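(* Let $(h_n(x,y))_{x,y\ge0}$ be a sequence of predictable positive-definite processes, let $W_n$ be a sequence of right-continuous $(\mathcal F_t)$-martingales with predictable and quadratic variation processes denoted by $\langle W_n\rangle$ and $[W_n]$, respectively, and suppose that $$\mathbb E\left(\int_0^t\int_0^t|h_n(x,y)|\,|dW_n(x)|\,|dW_n(y)|\right)<\infty$$ holds for all $n$ large enough and for all $t\in(0,\tau)$. Then, if $$\int_0^{\tau_n}h_n(x,x)\,d\langle W_n\rangle(x)=o_p(1),$$ we have $$\int_0^{\tau_n}\int_0^{\tau_n}h_n(x,y)\,dW_n(x)\,dW_n(y)=o_p(1),$$ and the same holds if $o_p(1)$ is replaced by $O_p(1)$ (in both the hypothesis and the conclusion).
   Context: Setting. For each $n$ there are mutually independent right-censored observations $(X_i,\Delta_i,c_i)$, $i\in[n]=\{1,\dots,n\}$, with $X_i=\min\{T_i,C_i\}$, $\Delta_i=\mathbf 1_{\{X_i=T_i\}}$, labels $c_i\in\{0,1\}$ deterministic; if $c_i=c$, then $T_i\sim F_c$ and $C_i\sim G_c$ are independent, with $F_c,G_c$ continuous distribution functions on $(0,\infty)$. With $n_c=\#\{i:c_i=c\}$, $n_0/n\to\eta\in(0,1)$. Put $1-H_c=(1-F_c)(1-G_c)$, $H=\eta H_0+(1-\eta)H_1$, $\tau=\sup\{x:1-H(x)>0\}$ and $\tau_n=\max_iX_i$. For sample size $n$, the filtration is $(\mathcal F_x)_{x\ge0}$, where $\mathcal F_x$ is generated by $\{\mathbf 1_{\{X_i\le s,\Delta_i=0\}},\mathbf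 1_{\{X_i\le s,\Delta_i=1\}}:0\le s\le x,\ i\in[n]\}$ and the $\mathbb P$-null sets. Let $C=\{(x,y):0<x<y<\infty\}$, and let $\mathcal P$ be the $\sigma$-algebra on $C\times\Omega$ generated by the sets $(a_1,b_1]\times(a_2,b_2]\times X$ with $0\le a_1\le b_1<a_2\le b_2$ and $X\in\mathcal F_{a_2}$. A process $(h(x,y))_{x,y\ge0}$ is a predictable positive-definite process if: (i) $h(x,y)=h(y,x)$; (ii) every realisation of $h$ is a positive-definite function, i.e. $\sum_{k,l}a_ka_lh(x_k,x_l)\ge0$ for all finite families of reals $a_k$ and points $x_k$; (iii) $(h(x,y))_{(x,y)\in C}$ is $\mathcal P$-measurable; (iv) $(h(x,x))_{x\ge0}$ is predictable with respect to $(\mathcal F_x)_{x\ge0}$. $\int_a^b$ denotes integration over $(a,b]$; integrals with respect to $W_n$ are pathwise Lebesgue–Stieltjes integrals, and $|dW_n|$ denotes the total variation measure (so the paths of $W_n$ have locally finite variation). $o_p,O_p$ are as $n\to\infty$. *)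

theory Defs
  imports "HOL-Probability.Probability"
begin

section \<open>Right-censored two-sample data\<close>

definition obs_time :: "(nat \<Rightarrow> 'a \<Rightarrow> real) \<Rightarrow> (nat \<Rightarrow> 'a \<Rightarrow> real) \<Rightarrow> nat \<Rightarrow> 'a \<Rightarrow> real" where
  "obs_time T C i \<omega> = min (T i \<omega>) (C i \<omega>)"

definition obs_status :: "(nat \<Rightarrow> 'a \<Rightarrow> real) \<Rightarrow> (nat \<Rightarrow> 'a \<Rightarrow> real) \<Rightarrow> nat \<Rightarrow> 'a \<Rightarrow> nat" where
  "obs_status T C i \<omega> = (if obs_time T C i \<omega> = T i \<omega> then 1 else 0)"

definition max_obs_time :: "nat \<Rightarrow> (nat \<Rightarrow> 'a \<Rightarrow> real) \<Rightarrow> (nat \<Rightarrow> 'a \<Rightarrow> real) \<Rightarrow> 'a \<Rightarrow> real" where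
  "max_obs_time n T C \<omega> = Max ((\<lambda>i. obs_time T C i \<omega>) ` {1..n})"

definition continuous_positive_cdf :: "(real \<Rightarrow> real) \<Rightarrow> bool" where
  "continuous_positive_cdf F \<longleftrightarrow>
     (\<exists>D. real_distribution D \<and> measure D {0<..} = 1 \<and> cdf D = F) \<and> continuous_on UNIV F"

text \<open>
  The observations are triangular: \<open>T n i\<close>, \<open>C n i\<close> and \<open>c n i\<close> belong to subject
  \<open>i \<in> {1..n}\<close> in the sample of size \<open>n \<ge> 1\<close>, which lives on its own probability space \<open>M n\<close>.
\<close>

locale censored_two_sample =
  fixes M :: "nat \<Rightarrow> 'a measure"
    and T C :: "nat \<Rightarrow> nat \<Rightarrow> 'a \<Rightarrow> real"
    and c :: "nat \<Rightarrow> nat \<Rightarrow> nat"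
    and F G :: "nat \<Rightarrow> real \<Rightarrow> real"
    and \<eta> :: real
  assumes prob: "\<And>n. n \<ge> 1 \<Longrightarrow> prob_space (M n)"
    and T_meas: "\<And>n i. i \<in> {1..n} \<Longrightarrow> T n i \<in> borel_measurable (M n)"
    and C_meas: "\<And>n i. i \<in> {1..n} \<Longrightarrow> C n i \<in> borel_measurable (M n)"
    and labels: "\<And>n i. i \<in> {1..n} \<Longrightarrow> c n i \<in> {0, 1}"
    and cdfs: "\<And>j. j \<in> {0, 1} \<Longrightarrow> continuous_positive_cdf (F j) \<and> continuous_positive_cdf (G j)"
    and T_dist: "\<And>n i. i \<in> {1..n} \<Longrightarrow> cdf (distr (M n) borel (T n i)) = F (c n i)"
    and C_dist: "\<And>n i. i \<in> {1..n} \<Longrightarrow> cdf (distr (M n) borel (C n i)) = G (c n i)"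
    and T_C_indep: "\<And>n i. i \<in> {1..n} \<Longrightarrow> prob_space.indep_var (M n) borel (T n i) borel (C n i)"
    and obs_indep: "\<And>n. n \<ge> 1 \<Longrightarrow> prob_space.indep_vars (M n) (\<lambda>_. borel \<Otimes>\<^sub>M count_space UNIV)
          (\<lambda>i \<omega>. (obs_time (T n) (C n) i \<omega>, obs_status (T n) (C n) i \<omega>)) {1..n}"
    and eta: "0 < \<eta>" "\<eta> < 1"
    and label_freq: "(\<lambda>n. real (card {i \<in> {1..n}. c n i = 0}) / real n) \<longlonglongrightarrow> \<eta>"

definition obs_cdf :: "(nat \<Rightarrow> real \<Rightarrow> real) \<Rightarrow> (nat \<Rightarrow> real \<Rightarrow> real) \<Rightarrow> nat \<Rightarrow> real \<Rightarrow> real" where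
  "obs_cdf F G j x = 1 - (1 - F j x) * (1 - G j x)"

definition mixed_obs_cdf ::
  "(nat \<Rightarrow> real \<Rightarrow> real) \<Rightarrow> (nat \<Rightarrow> real \<Rightarrow> real) \<Rightarrow> real \<Rightarrow> real \<Rightarrow> real" where
  "mixed_obs_cdf F G \<eta> x = \<eta> * obs_cdf F G 0 x + (1 - \<eta>) * obs_cdf F G 1 x"

definition obs_horizon ::
  "(nat \<Rightarrow> real \<Rightarrow> real) \<Rightarrow> (nat \<Rightarrow> real \<Rightarrow> real) \<Rightarrow> real \<Rightarrow> ereal" where
  "obs_horizon F G \<eta> = Sup {ereal x | x. 1 - mixed_obs_cdf F G \<eta> x > 0}"

definition obs_filtration ::
  "'a measure \<Rightarrow> nat \<Rightarrow> (nat \<Rightarrow> 'a \<Rightarrow> real) \<Rightarrow> (nat \<Rightarrow> 'a \<Rightarrow> real) \<Rightarrow> real \<Rightarrow> 'a measure" where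
  "obs_filtration M n T C x = sigma (space M)
     ({{\<omega> \<in> space M. obs_time T C i \<omega> \<le> s \<and> obs_status T C i \<omega> = d} | i s d.
         i \<in> {1..n} \<and> 0 \<le> s \<and> s \<le> x \<and> d \<in> {0, 1}} \<union> null_sets M)"


section \<open>Predictability\<close>

text \<open>
  Time runs through \<open>[0,\<infinity>)\<close>; values of processes at negative times play no role. All measures
  \<open>F t\<close> of a filtration have the same space.
\<close>

definition predictable_sigma :: "(real \<Rightarrow> 'a measure) \<Rightarrow> (real \<times> 'a) measure" where
  "predictable_sigma F = sigma ({0..} \<times> space (F 0))
     ({{0} \<times> B | B. B \<in> sets (F 0)} \<union>
      {{s<..t} \<times> B | s t B. 0 \<le> s \<and> s \<le> t \<and> B \<in> sets (F s)})"

definition predictable :: "(real \<Rightarrow> 'a measure) \<Rightarrow> (real \<Rightarrow> 'a \<Rightarrow> real) \<Rightarrow> bool" where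
  "predictable F Y \<longleftrightarrow> (\<lambda>(t, \<omega>). Y t \<omega>) \<in> borel_measurable (predictable_sigma F)"

definition bi_predictable_sigma :: "(real \<Rightarrow> 'a measure) \<Rightarrow> ((real \<times> real) \<times> 'a) measure" where
  "bi_predictable_sigma F = sigma ({(x, y). 0 < x \<and> x < y} \<times> space (F 0))
     {({a1<..b1} \<times> {a2<..b2}) \<times> B | a1 b1 a2 b2 B.
        0 \<le> a1 \<and> a1 \<le> b1 \<and> b1 < a2 \<and> a2 \<le> b2 \<and> B \<in> sets (F a2)}"

definition predictable_pos_def ::
  "(real \<Rightarrow> 'a measure) \<Rightarrow> (real \<Rightarrow> real \<Rightarrow> 'a \<Rightarrow> real) \<Rightarrow> bool" where
  "predictable_pos_def F h \<longleftrightarrow>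
     (\<forall>\<omega>\<in>space (F 0). \<forall>x\<ge>0. \<forall>y\<ge>0. h x y \<omega> = h y x \<omega>) \<and>
     (\<forall>\<omega>\<in>space (F 0). \<forall>(m::nat) (a::nat \<Rightarrow> real) (z::nat \<Rightarrow> real). (\<forall>k<m. 0 \<le> z k) \<longrightarrow>
        0 \<le> (\<Sum>k<m. \<Sum>l<m. a k * a l * h (z k) (z l) \<omega>)) \<and>
     (\<lambda>((x, y), \<omega>). h x y \<omega>) \<in> borel_measurable (bi_predictable_sigma F) \<and>
     predictable F (\<lambda>x. h x x)"


section \<open>Martingales and their variation processes\<close>

definition adapted :: "(real \<Rightarrow> 'a measure) \<Rightarrow> (real \<Rightarrow> 'a \<Rightarrow> real) \<Rightarrow> bool" where
  "adapted F Y \<longleftrightarrow> (\<forall>t\<ge>0. Y t \<in> borel_measurable (F t))"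

definition martingale :: "'a measure \<Rightarrow> (real \<Rightarrow> 'a measure) \<Rightarrow> (real \<Rightarrow> 'a \<Rightarrow> real) \<Rightarrow> bool" where
  "martingale M F Y \<longleftrightarrow> adapted F Y \<and> (\<forall>t\<ge>0. integrable M (Y t)) \<and>
     (\<forall>s t. 0 \<le> s \<and> s \<le> t \<longrightarrow> (AE \<omega> in M. real_cond_exp M (F s) (Y t) \<omega> = Y s \<omega>))"

text \<open>
  The localising stopping times are taken finite: a sequence \<open>S k\<close> with values in \<open>[0,\<infinity>]\<close> may be
  replaced by \<open>min (S k) k\<close>.
\<close>

definition local_martingale ::
  "'a measure \<Rightarrow> (real \<Rightarrow> 'a measure) \<Rightarrow> (real \<Rightarrow> 'a \<Rightarrow> real) \<Rightarrow> bool" where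
  "local_martingale M F Y \<longleftrightarrow> (\<exists>S :: nat \<Rightarrow> 'a \<Rightarrow> real.
     (\<forall>k. stopping_time F (S k)) \<and>
     (\<forall>k. \<forall>\<omega>\<in>space M. 0 \<le> S k \<omega> \<and> S k \<omega> \<le> S (Suc k) \<omega>) \<and>
     (AE \<omega> in M. filterlim (\<lambda>k. S k \<omega>) at_top sequentially) \<and>
     (\<forall>k. martingale M F (\<lambda>t \<omega>. Y (min t (S k \<omega>)) \<omega>)))"

definition right_continuous_path :: "(real \<Rightarrow> real) \<Rightarrow> bool" where
  "right_continuous_path w \<longleftrightarrow> (\<forall>t\<ge>0. continuous (at_right t) w)"

definition increasing_path :: "(real \<Rightarrow> real) \<Rightarrow> bool" where
  "increasing_path w \<longleftrightarrow> w 0 = 0 \<and> mono_on {0..} w \<and> right_continuous_path w"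

definition jump :: "(real \<Rightarrow> real) \<Rightarrow> real \<Rightarrow> real" where
  "jump w t = w t - Lim (at_left t) w"

definition predictable_variation ::
  "'a measure \<Rightarrow> (real \<Rightarrow> 'a measure) \<Rightarrow> (real \<Rightarrow> 'a \<Rightarrow> real) \<Rightarrow> (real \<Rightarrow> 'a \<Rightarrow> real) \<Rightarrow> bool" where
  "predictable_variation M F W A \<longleftrightarrow>
     (\<forall>\<omega>\<in>space M. increasing_path (\<lambda>t. A t \<omega>)) \<and> predictable F A \<and>
     local_martingale M F (\<lambda>t \<omega>. (W t \<omega>)\<^sup>2 - A t \<omega>)"

definition quadratic_variation ::
  "'a measure \<Rightarrow> (real \<Rightarrow> 'a measure) \<Rightarrow> (real \<Rightarrow> 'a \<Rightarrow> real) \<Rightarrow> (real \<Rightarrow> 'a \<Rightarrow> real) \<Rightarrow> bool" where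
  "quadratic_variation M F W Q \<longleftrightarrow>
     (\<forall>\<omega>\<in>space M. increasing_path (\<lambda>t. Q t \<omega>)) \<and> adapted F Q \<and>
     (\<forall>\<omega>\<in>space M. \<forall>t>0. jump (\<lambda>s. Q s \<omega>) t = (jump (\<lambda>s. W s \<omega>) t)\<^sup>2) \<and>
     local_martingale M F (\<lambda>t \<omega>. (W t \<omega>)\<^sup>2 - Q t \<omega>)"


section \<open>Pathwise Lebesgue--Stieltjes integrals\<close>

definition variation_sums :: "(real \<Rightarrow> real) \<Rightarrow> real \<Rightarrow> real set" where
  "variation_sums w t = {(\<Sum>i<m. \<bar>w (p (Suc i)) - w (p i)\<bar>) | (m::nat) (p::nat \<Rightarrow> real).
     mono p \<and> range p \<subseteq> {0..t}}"

definition locally_finite_variation :: "(real \<Rightarrow> real) \<Rightarrow> bool" where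
  "locally_finite_variation w \<longleftrightarrow> (\<forall>t\<ge>0. bdd_above (variation_sums w t))"

definition total_variation :: "(real \<Rightarrow> real) \<Rightarrow> real \<Rightarrow> real" where
  "total_variation w t = Sup (variation_sums w t)"

text \<open>
  For a right-continuous path \<open>w\<close> of locally finite variation, \<open>variation_measure w\<close> is \<open>|dw|\<close>, and
  \<open>dw = positive_measure w - negative_measure w\<close> is the Jordan decomposition, all on \<open>(0,\<infinity>)\<close>.
  Freezing the paths on the negative half line makes \<open>(-\<infinity>,0]\<close> a null set.
\<close>

definition variation_measure :: "(real \<Rightarrow> real) \<Rightarrow> real measure" where
  "variation_measure w = interval_measure (\<lambda>t. total_variation w (max 0 t))"

definition positive_measure :: "(real \<Rightarrow> real) \<Rightarrow> real measure" where
  "positive_measure w =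
     interval_measure (\<lambda>t. (total_variation w (max 0 t) + (w (max 0 t) - w 0)) / 2)"

definition negative_measure :: "(real \<Rightarrow> real) \<Rightarrow> real measure" where
  "negative_measure w =
     interval_measure (\<lambda>t. (total_variation w (max 0 t) - (w (max 0 t) - w 0)) / 2)"

text \<open>
  The integral of \<open>f\<close> with respect to \<open>w\<close> over \<open>(0,b]\<close>, for \<open>f\<close> integrable with respect to
  \<open>|dw|\<close> there.
\<close>

definition ls_integral :: "(real \<Rightarrow> real) \<Rightarrow> real \<Rightarrow> (real \<Rightarrow> real) \<Rightarrow> real" where
  "ls_integral w b f =
     (LINT x:{0<..b}|positive_measure w. f x) - (LINT x:{0<..b}|negative_measure w. f x)"


section \<open>Stochastic order symbols\<close>

text \<open>
  The measurability conjunct is needed because \<open>measure\<close> is \<open>0\<close> on non-measurable sets.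
\<close>

definition small_op_one :: "(nat \<Rightarrow> 'a measure) \<Rightarrow> (nat \<Rightarrow> 'a \<Rightarrow> real) \<Rightarrow> bool" where
  "small_op_one M Y \<longleftrightarrow>
     (\<forall>\<^sub>F n in sequentially. Y n \<in> borel_measurable (M n)) \<and>
     (\<forall>\<epsilon>>0. (\<lambda>n. measure (M n) {\<omega> \<in> space (M n). \<bar>Y n \<omega>\<bar> > \<epsilon>}) \<longlonglongrightarrow> 0)"

definition big_op_one :: "(nat \<Rightarrow> 'a measure) \<Rightarrow> (nat \<Rightarrow> 'a \<Rightarrow> real) \<Rightarrow> bool" where
  "big_op_one M Y \<longleftrightarrow>
     (\<forall>\<^sub>F n in sequentially. Y n \<in> borel_measurable (M n)) \<and>
     (\<forall>\<epsilon>>0. \<exists>K. \<forall>\<^sub>F n in sequentially.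
        measure (M n) {\<omega> \<in> space (M n). \<bar>Y n \<omega>\<bar> > K} \<le> \<epsilon>)"

end

theory Submission
  imports Defs
begin

text \<open>
  On a path of locally finite variation the double integral \<open>Z(t) = \<integral>\<integral> h(x,y) dW(x) dW(y)\<close> over
  \<open>(0,t]\<^sup>2\<close> splits into the off-diagonal part \<open>2 \<integral> (\<integral>\<^bsub>x<y\<^esub> h(x,y) dW(x)) dW(y)\<close>, whose integrand is
  predictable, and the diagonal part \<open>\<integral> h(y,y) \<Delta>W(y) dW(y)\<close>. The first has mean zero. By
  integration by parts, \<open>\<integral> \<Delta>W dW\<close> is \<open>W\<^sup>2\<close> up to a martingale, so the second has the same mean as
  \<open>Y(t) = \<integral> h(y,y) d\<langle>W\<rangle>(y)\<close>. Since \<open>Z\<close> is nonnegative by positive definiteness, it is dominated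
  by \<open>Y\<close> in the sense of Lenglart, and \<open>P(Z(\<tau>) > \<epsilon>) \<le> \<delta> / \<epsilon> + P(Y(\<tau>) > \<delta>)\<close> for the largest
  observation \<open>\<tau>\<close>, which is a stopping time and almost surely lies below the horizon. Choosing
  \<open>\<delta>\<close> small, respectively \<open>\<epsilon>\<close> large, gives the two claims.
\<close>


section \<open>Paths of locally finite variation\<close>

text \<open>Stopping when the compensator passes \<open>\<delta>\<close> would overshoot by a jump,
  so the cut-off is made on a predictable set: as the compensator is predictable, the times at which
  it is still at most \<open>\<delta>\<close>, its jump at that time included, form a predictable
  initial interval. The cut-off kernel is again positive definite, so the integral that replaces Z
  is nonnegative with mean at most \<open>\<delta>\<close>, and Markov's inequality gives the
  quotient. Facts about martingales are stated as equalities of means in [0,\<infinity>] for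
  nonnegative predictable integrands, with every negative term moved to the other side. They are
  checked on generators and extended by a monotone class argument; no stochastic integral is
  constructed. Equal terms can be cancelled only when finite, and the variation of W need not be
  integrable; hence the restriction to predictable sets on which the variation strictly before the
  present is bounded. Exit times from these sets satisfy {R < u} in F_u, which is enough for
  optional stopping. Expectations are finite only below the horizon, so the bound is proved up to a
  fixed t, which then increases for each fixed n.\<close>

lemma right_continuous_path_tendsto:
  assumes "right_continuous_path w" "0 \<le> t" "(X \<longlongrightarrow> t) G" "\<forall>\<^sub>F n in G. t \<le> X n"
  shows "((\<lambda>n. w (X n)) \<longlongrightarrow> w t) G"
proof (rule continuous_within_tendsto_compose[where S = "{t..}" and f = w and x = X and a = t])
  have "at t within {t..} = at_right t" 
    unfolding at_within_def by (rule arg_cong[where f = "\<lambda>S. inf (nhds t) (principal S)"]) auto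
  then show "continuous (at t within {t..}) w"
    using assms(1,2) by (simp add: continuous_within right_continuous_path_def)
qed (use assms in auto)

locale fv_path =
  fixes w :: "real \<Rightarrow> real"
  assumes finite_variation: "locally_finite_variation w"
    and right_cont: "right_continuous_path w"
begin

abbreviation V :: "real \<Rightarrow> real" where "V \<equiv> total_variation w"

lemma range_bounds:
  fixes p :: "nat \<Rightarrow> real"
  assumes "range p \<subseteq> {0..t}"
  shows "0 \<le> p i" "p i \<le> t"
  using assms by (auto simp: image_subset_iff)

lemma partition_sum_le:
  assumes "mono p" "range p \<subseteq> {0..t}"
  shows "(\<Sum>i<m. \<bar>w (p (Suc i)) - w (p i)\<bar>) \<le> V t"
proof -
  have "0 \<le> t" using range_bounds[OF assms(2), of 0] by linarith
  then have "bdd_above (variation_sums w t)"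
    using finite_variation by (auto simp: locally_finite_variation_def)
  then show ?thesis
    unfolding total_variation_def using assms
    by (intro cSup_upper) (auto simp: variation_sums_def)
qed

lemma total_variation_least:
  assumes "0 \<le> t"
    and "\<And>p m. mono p \<Longrightarrow> range p \<subseteq> {0..t} \<Longrightarrow> (\<Sum>i<m. \<bar>w (p (Suc i)) - w (p i)\<bar>) \<le> c"
  shows "V t \<le> c"
  unfolding total_variation_def
proof (rule cSup_least)
  have "(\<Sum>i<(0::nat). \<bar>w t - w t\<bar>) \<in> variation_sums w t"
    unfolding variation_sums_def using assms(1)
    by (intro CollectI exI[of _ 0] exI[of _ "\<lambda>_. t"]) (auto simp: mono_def)
  then show "variation_sums w t \<noteq> {}" by blast
qed (use assms(2) in \<open>auto simp: variation_sums_def\<close>)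

text \<open>A partition of \<open>{0..a}\<close> can be prolonged by the points \<open>a\<close> and
  \<open>b\<close>. This one inequality makes \<open>V\<close>, \<open>V + w\<close> and
  \<open>V - w\<close> increasing, hence also the two Jordan parts.\<close>

lemma V_increment:
  assumes "0 \<le> a" "a \<le> b"
  shows "V a + \<bar>w b - w a\<bar> \<le> V b"
proof -
  have "V a \<le> V b - \<bar>w b - w a\<bar>"
  proof (rule total_variation_least[OF assms(1)])
    fix p :: "nat \<Rightarrow> real" and m :: nat
    assume p: "mono p" "range p \<subseteq> {0..a}"
    define q where "q i = (if i \<le> m then p i else if i = Suc m then a else b)" for i
    have pa: "0 \<le> p i" "p i \<le> a" for i using range_bounds[OF p(2)] by auto
    have "mono q"
    proof (rule monoI)
      fix i j :: nat assume "i \<le> j"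
      then show "q i \<le> q j"
        using monoD[OF p(1), of i j] pa[of i] assms(2) by (auto simp: q_def)
    qed
    moreover have "range q \<subseteq> {0..b}"
      using pa assms order_trans[OF pa(2) assms(2)] by (auto simp: q_def)
    ultimately have "(\<Sum>i<Suc (Suc m). \<bar>w (q (Suc i)) - w (q i)\<bar>) \<le> V b"
      by (rule partition_sum_le)
    moreover have "(\<Sum>i<m. \<bar>w (q (Suc i)) - w (q i)\<bar>) = (\<Sum>i<m. \<bar>w (p (Suc i)) - w (p i)\<bar>)"
      by (intro sum.cong) (auto simp: q_def)
    ultimately show "(\<Sum>i<m. \<bar>w (p (Suc i)) - w (p i)\<bar>) \<le> V b - \<bar>w b - w a\<bar>"
      by (simp add: q_def)
  qed
  then show ?thesis by simp
qed

lemma V_mono: "0 \<le> a \<Longrightarrow> a \<le> b \<Longrightarrow> V a \<le> V b"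
  using V_increment[of a b] by linarith

lemma V_0 [simp]: "V 0 = 0"
proof (rule antisym)
  show "V 0 \<le> 0" by (rule total_variation_least) (auto simp: image_subset_iff)
  show "0 \<le> V 0" using partition_sum_le[of "\<lambda>_. 0" 0 0] by (auto simp: mono_def)
qed

lemma V_nonneg: "0 \<le> t \<Longrightarrow> 0 \<le> V t"
  using V_mono[of 0 t] by simp

lemma abs_diff_le_V: "0 \<le> t \<Longrightarrow> \<bar>w t - w 0\<bar> \<le> V t"
  using V_increment[of 0 t] by simp

lemma tendsto_w: "0 \<le> t \<Longrightarrow> (w \<longlongrightarrow> w t) (at_right t)"
  using right_cont by (auto simp: right_continuous_path_def continuous_within)

text \<open>A partition without points strictly between \<open>t\<close> and \<open>s\<close> sees
  only the single increment from \<open>t\<close> to \<open>s\<close> there, so the variation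
  \<open>V s - V t\<close> inside the gap can be traded for \<open>\<bar>w s - w t\<bar>\<close>.
  Both one-sided estimates for \<open>V\<close> below apply it to a gap that shrinks to a
  point.\<close>

lemma gap_bound:
  assumes p: "mono p" "range p \<subseteq> {0..u}" and ts: "0 \<le> t" "t \<le> s"
    and gap: "\<And>i. i \<le> m \<Longrightarrow> p i \<le> t \<or> s \<le> p i"
  shows "(\<Sum>i<m. \<bar>w (p (Suc i)) - w (p i)\<bar>) \<le>
    (if p m \<le> t then V (p m) else V t + \<bar>w s - w t\<bar> + V (p m) - V s)"
  using gap
proof (induction m)
  case 0
  have "0 \<le> p 0" using range_bounds[OF p(2)] by auto
  then show ?case using V_nonneg[of "p 0"] V_mono[of s "p 0"] V_nonneg[OF ts(1)] ts 0
    by auto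
next
  case (Suc m)
  have IH: "(\<Sum>i<m. \<bar>w (p (Suc i)) - w (p i)\<bar>) \<le>
    (if p m \<le> t then V (p m) else V t + \<bar>w s - w t\<bar> + V (p m) - V s)"
    using Suc by auto
  have pm: "0 \<le> p m" "p m \<le> p (Suc m)" using range_bounds[OF p(2)] monoD[OF p(1)] by auto
  have gaps: "p m \<le> t \<or> s \<le> p m" "p (Suc m) \<le> t \<or> s \<le> p (Suc m)"
    using Suc.prems[of m] Suc.prems[of "Suc m"] by auto
  have inc: "V (p m) + \<bar>w (p (Suc m)) - w (p m)\<bar> \<le> V (p (Suc m))"
    using V_increment pm by auto
  show ?case
  \<comment> \<open>Only the step that jumps over the gap is special; the triangle inequality
    inserts \<open>t\<close> and \<open>s\<close> into it.\<close>
  proof (cases "p m \<le> t \<and> \<not> p (Suc m) \<le> t")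
    case False
    then show ?thesis using IH inc pm by (auto split: if_splits)
  next
    case True
    have "V (p m) + \<bar>w t - w (p m)\<bar> \<le> V t" using V_increment pm True by auto
    moreover have "V s + \<bar>w (p (Suc m)) - w s\<bar> \<le> V (p (Suc m))"
      using V_increment[of s "p (Suc m)"] gaps True ts by auto
    ultimately show ?thesis using IH True by auto
  qed
qed

text \<open>If \<open>V\<close> jumped to the right of \<open>t\<close>, a nearly optimal partition
  of \<open>{0..t+1}\<close> would have to collect this jump. But it has no points close to
  \<open>t\<close> on the right, and the one increment of \<open>w\<close> across that gap tends to
  0.\<close>

lemma V_right_cont: 
  assumes t: "0 \<le> t"
  shows "(V \<longlongrightarrow> V t) (at_right t)"
proof (rule tendstoI)
  fix e :: real assume "0 < e"
  have "\<not> V (t + 1) \<le> V (t + 1) - e / 2" using \<open>0 < e\<close> by simp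
  then obtain p m where p: "mono p" "range p \<subseteq> {0..t+1}"
    and big: "V (t + 1) - e / 2 < (\<Sum>i<m. \<bar>w (p (Suc i)) - w (p i)\<bar>)"
    using total_variation_least[of "t+1" "V (t+1) - e/2"] t by (meson add_nonneg_nonneg not_le zero_le_one)
  have "\<forall>\<^sub>F s in at_right t. \<forall>i\<in>{..m}. p i \<le> t \<or> s \<le> p i"
  proof (rule eventually_ball_finite, simp, rule ballI)
    fix i assume "i \<in> {..m}"
    show "\<forall>\<^sub>F s in at_right t. p i \<le> t \<or> s \<le> p i"
    proof (cases "p i \<le> t")
      case False
      then have "\<forall>\<^sub>F s in at_right t. s < p i" by (intro eventually_at_right_real[THEN eventually_mono]) auto
      then show ?thesis by eventually_elim auto
    qed simp
  qed
  moreover have "\<forall>\<^sub>F s in at_right t. \<bar>w s - w t\<bar> < e / 2"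
    using tendstoD[OF tendsto_w[OF t], of "e/2"] \<open>0 < e\<close> by (simp add: dist_real_def)
  moreover have "\<forall>\<^sub>F s in at_right t. t < s \<and> s \<le> t + 1"
    using eventually_at_right_real[of t "t+1"] by (rule eventually_mono) auto
  ultimately show "\<forall>\<^sub>F s in at_right t. dist (V s) (V t) < e"
  proof eventually_elim
    case (elim s)
    have "(\<Sum>i<m. \<bar>w (p (Suc i)) - w (p i)\<bar>) \<le>
      (if p m \<le> t then V (p m) else V t + \<bar>w s - w t\<bar> + V (p m) - V s)"
      using elim by (intro gap_bound[OF p t]) auto
    moreover have "0 \<le> p m" "p m \<le> t + 1" using range_bounds[OF p(2)] by auto
    moreover have "V (p m) \<le> V (t+1)" by (rule V_mono) fact+
    moreover have "V (p m) \<le> V t" if "p m \<le> t" using that \<open>0 \<le> p m\<close> by (intro V_mono)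
    moreover have "V t \<le> V s" "V s \<le> V (t+1)" using elim t by (auto intro!: V_mono)
    ultimately show ?case using big elim by (auto simp: dist_real_def split: if_splits)
  qed
qed

text \<open>For \<open>s\<close> beyond all points of a partition other than \<open>r\<close>, its
  sum is at most \<open>V s\<close> plus one increment from \<open>s\<close> to \<open>r\<close>.
  Hence \<open>V\<close> jumps at \<open>r\<close> by no more than \<open>w\<close> does.\<close>

lemma V_left_bound:
  assumes r: "0 < r" and c: "\<forall>\<^sub>F s in at_left r. V s + \<bar>w r - w s\<bar> \<le> c"
  shows "V r \<le> c"
proof (rule total_variation_least)
  fix p :: "nat \<Rightarrow> real" and m :: nat
  assume p: "mono p" "range p \<subseteq> {0..r}"
  have pr: "0 \<le> p i" "p i \<le> r" for i using range_bounds[OF p(2)] by auto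
  have "\<forall>\<^sub>F s in at_left r. \<forall>i\<in>{..m}. r \<le> p i \<or> p i \<le> s"
  proof (rule eventually_ball_finite, simp, rule ballI)
    fix i assume "i \<in> {..m}"
    show "\<forall>\<^sub>F s in at_left r. r \<le> p i \<or> p i \<le> s"
    proof (cases "r \<le> p i")
      case False
      then have "\<forall>\<^sub>F s in at_left r. p i < s" by (intro eventually_at_left_real[THEN eventually_mono]) auto
      then show ?thesis by eventually_elim auto
    qed simp
  qed
  moreover have "\<forall>\<^sub>F s in at_left r. 0 < s \<and> s < r"
    using eventually_at_left_real[of 0 r] r by (rule_tac eventually_mono) auto
  ultimately have ev: "\<forall>\<^sub>F s in at_left r. (\<Sum>i<m. \<bar>w (p (Suc i)) - w (p i)\<bar>) \<le> c"
    using c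
  proof eventually_elim
    case (elim s)
    have "(\<Sum>i<m. \<bar>w (p (Suc i)) - w (p i)\<bar>) \<le>
      (if p m \<le> s then V (p m) else V s + \<bar>w r - w s\<bar> + V (p m) - V r)"
      using elim by (intro gap_bound[OF p]) auto
    also have "\<dots> \<le> V s + \<bar>w r - w s\<bar>"
      using V_mono[of "p m" s] V_mono[of "p m" r] pr[of m] elim by auto
    finally show ?case using elim by simp
  qed
  show "(\<Sum>i<m. \<bar>w (p (Suc i)) - w (p i)\<bar>) \<le> c"
    using eventually_happens[OF ev] by simp
qed (use r in simp)

definition grid_variation :: "nat \<Rightarrow> real \<Rightarrow> real" where
  "grid_variation m t = (\<Sum>j<m. \<bar>w (t * real (Suc j) / real m) - w (t * real j / real m)\<bar>)"

text \<open>Right continuity lets the points of any partition be replaced by nearby points of a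
  uniform grid. The supremum then runs over countably many sums at deterministic times, which will
  make the variation of an adapted process adapted.\<close>

lemma V_le_iff:
  assumes t: "0 < t"
  shows "V t \<le> c \<longleftrightarrow> (\<forall>m>0. grid_variation m t \<le> c)"
proof safe
  fix m :: nat assume V: "V t \<le> c" and m: "0 < m"
  define p where "p j = t * real (min j m) / real m" for j
  have "mono p" using t by (auto simp: p_def mono_def divide_right_mono mult_left_mono)
  moreover have "range p \<subseteq> {0..t}" using t m by (auto simp: p_def field_simps)
  ultimately have "(\<Sum>j<m. \<bar>w (p (Suc j)) - w (p j)\<bar>) \<le> V t" by (rule partition_sum_le)
  moreover have "(\<Sum>j<m. \<bar>w (p (Suc j)) - w (p j)\<bar>) = grid_variation m t"
    unfolding grid_variation_def by (intro sum.cong) (auto simp: p_def)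
  ultimately show "grid_variation m t \<le> c" using V by simp
next
  assume c: "\<forall>m>0. grid_variation m t \<le> c"
  show "V t \<le> c"
  proof (rule total_variation_least)
    fix p :: "nat \<Rightarrow> real" and k :: nat
    assume p: "mono p" "range p \<subseteq> {0..t}"
    have pt: "0 \<le> p i" "p i \<le> t" for i using range_bounds[OF p(2)] by auto
    \<comment> \<open>Rounding up to the grid: the grid points approach \<open>p i\<close> from the
      right, where \<open>w\<close> is continuous, and the order of the points is kept.\<close>
    define n where "n m i = nat \<lceil>real m * p i / t\<rceil>" for m i
    define x where "x m j = t * real j / real m" for m j
    have n_mono: "n m i \<le> n m j" if "i \<le> j" for m i j
      unfolding n_def using monoD[OF p(1) that] t
      by (intro nat_mono ceiling_mono divide_right_mono mult_left_mono) auto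
    have le: "(\<Sum>i<k. \<bar>w (x m (n m (Suc i))) - w (x m (n m i))\<bar>) \<le> c" if m: "0 < m" for m
    proof -
      have *: "\<bar>w (x m b) - w (x m a)\<bar> \<le> (\<Sum>j=a..<b. \<bar>w (x m (Suc j)) - w (x m j)\<bar>)" if "a \<le> b" for a b
        using that by (induction b rule: dec_induct) auto
      have "(\<Sum>i<l. \<bar>w (x m (n m (Suc i))) - w (x m (n m i))\<bar>) \<le>
          (\<Sum>j<n m l. \<bar>w (x m (Suc j)) - w (x m j)\<bar>)" for l
      proof (induction l)
        case (Suc l)
        have "(\<Sum>j<n m (Suc l). \<bar>w (x m (Suc j)) - w (x m j)\<bar>) =
          (\<Sum>j<n m l. \<bar>w (x m (Suc j)) - w (x m j)\<bar>) + (\<Sum>j=n m l..<n m (Suc l). \<bar>w (x m (Suc j)) - w (x m j)\<bar>)"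
          using n_mono[of l "Suc l" m] by (simp add: sum.atLeastLessThan_concat lessThan_atLeast0)
        then show ?case using Suc *[OF n_mono[of l "Suc l" m]] by simp
      qed (simp add: sum_nonneg)
      also have "(\<Sum>j<n m k. \<bar>w (x m (Suc j)) - w (x m j)\<bar>) \<le> (\<Sum>j<m. \<bar>w (x m (Suc j)) - w (x m j)\<bar>)"
      proof (rule sum_mono2)
        have "real m * p k / t \<le> real m" using pt[of k] t mult_left_mono[of "p k" t "real m"] by (simp add: field_simps)
        then have "n m k \<le> m" unfolding n_def by (simp add: ceiling_le nat_le_iff)
        then show "{..<n m k} \<subseteq> {..<m}" by auto
      qed auto
      also have "\<dots> \<le> c" using c m by (auto simp: grid_variation_def x_def)
      finally show ?thesis .
    qed
    have conv: "(\<lambda>m. w (x m (n m i))) \<longlonglongrightarrow> w (p i)" for i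
    proof -
      have bnd: "p i \<le> x m (n m i) \<and> x m (n m i) \<le> p i + t / real m" if "0 < m" for m
      proof -
        have "0 \<le> real m * p i / t" using pt t by simp
        then have "real (n m i) = of_int \<lceil>real m * p i / t\<rceil>" by (simp add: n_def)
        then have "real m * p i / t \<le> real (n m i)" "real (n m i) \<le> real m * p i / t + 1" by linarith+
        then show ?thesis using t that by (simp add: x_def field_simps)
      qed
      have "(\<lambda>m. x m (n m i)) \<longlonglongrightarrow> p i"
      proof (rule tendsto_sandwich)
        show "\<forall>\<^sub>F m in sequentially. p i \<le> x m (n m i)" "\<forall>\<^sub>F m in sequentially. x m (n m i) \<le> p i + t / real m"
          using bnd by (auto intro: eventually_sequentiallyI[of 1])
        show "(\<lambda>m. p i + t / real m) \<longlonglongrightarrow> p i"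
          using tendsto_add[OF tendsto_const lim_const_over_n[of t]] by simp
      qed simp
      then show ?thesis
        by (rule right_continuous_path_tendsto[OF right_cont pt(1)]) (use bnd in \<open>auto intro: eventually_sequentiallyI[of 1]\<close>)
    qed
    have "(\<lambda>m. \<Sum>i<k. \<bar>w (x m (n m (Suc i))) - w (x m (n m i))\<bar>) \<longlonglongrightarrow> (\<Sum>i<k. \<bar>w (p (Suc i)) - w (p i)\<bar>)"
      by (intro tendsto_intros conv)
    then show "(\<Sum>i<k. \<bar>w (p (Suc i)) - w (p i)\<bar>) \<le> c"
      by (rule LIMSEQ_le_const2) (use le in \<open>auto intro: exI[of _ 1]\<close>)
  qed (use t in simp)
qed

end

text \<open>The measures in question may have infinite total mass, so identities between signed
  measures are not written with differences: negative terms are moved to the other side and both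
  sides become sums of measures.\<close>

definition measure_add :: "'a measure \<Rightarrow> 'a measure \<Rightarrow> 'a measure" where
  "measure_add \<mu> \<nu> = measure_of (space \<mu>) (sets \<mu>) (\<lambda>E. emeasure \<mu> E + emeasure \<nu> E)"

lemma sets_measure_add [simp, measurable_cong]: "sets (measure_add \<mu> \<nu>) = sets \<mu>"
  by (simp add: measure_add_def)

lemma space_measure_add [simp]: "space (measure_add \<mu> \<nu>) = space \<mu>"
  by (simp add: measure_add_def)

lemma emeasure_measure_add:
  assumes "sets \<nu> = sets \<mu>" "E \<in> sets \<mu>"
  shows "emeasure (measure_add \<mu> \<nu>) E = emeasure \<mu> E + emeasure \<nu> E"
proof (rule emeasure_measure_of[OF measure_add_def])
  show "countably_additive (sets (measure_add \<mu> \<nu>)) (\<lambda>E. emeasure \<mu> E + emeasure \<nu> E)"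
  proof (rule countably_additiveI)
    fix A :: "nat \<Rightarrow> 'a set"
    assume A: "range A \<subseteq> sets (measure_add \<mu> \<nu>)" "disjoint_family A"
    then have "(\<Sum>i. emeasure \<mu> (A i)) = emeasure \<mu> (\<Union>i. A i)" "(\<Sum>i. emeasure \<nu> (A i)) = emeasure \<nu> (\<Union>i. A i)"
      using assms(1) by (auto intro!: suminf_emeasure)
    then show "(\<Sum>i. emeasure \<mu> (A i) + emeasure \<nu> (A i)) = emeasure \<mu> (\<Union>i. A i) + emeasure \<nu> (\<Union>i. A i)"
      by (simp flip: suminf_add)
  qed
qed (use assms sets.space_closed in \<open>auto simp: positive_def\<close>)

lemma nn_integral_measure_add:
  assumes sets: "sets \<nu> = sets \<mu>" and f: "f \<in> borel_measurable \<mu>"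
  shows "(\<integral>\<^sup>+x. f x \<partial>measure_add \<mu> \<nu>) = (\<integral>\<^sup>+x. f x \<partial>\<mu>) + (\<integral>\<^sup>+x. f x \<partial>\<nu>)"
  using f
proof (induction rule: borel_measurable_induct)
  case (cong f g)
  then show ?case 
    using nn_integral_cong[of \<mu> f g] nn_integral_cong[of \<nu> f g] nn_integral_cong[of "measure_add \<mu> \<nu>" f g]
    by (simp add: sets_eq_imp_space_eq[OF sets])
next
  case (set A)
  then show ?case by (simp add: emeasure_measure_add sets)
next
  case (mult u c)
  have [measurable_cong]: "sets \<nu> = sets \<mu>" by fact
  show ?case using mult(2,4) by (simp add: nn_integral_cmult distrib_left)
next
  case (add u v)
  have [measurable_cong]: "sets \<nu> = sets \<mu>" by fact
  show ?case using add(1,3,4,6,7) by (simp add: nn_integral_add algebra_simps)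
next
  case (seq U)
  have [measurable_cong]: "sets \<nu> = sets \<mu>" by fact
  have [measurable]: "U i \<in> borel_measurable \<mu>" for i by fact
  have *: "(\<integral>\<^sup>+x. (SUP i. U i) x \<partial>K) = (SUP i. \<integral>\<^sup>+x. U i x \<partial>K)" if [measurable_cong]: "sets K = sets \<mu>" for K
    unfolding SUP_apply by (rule nn_integral_monotone_convergence_SUP) (use \<open>incseq U\<close> in auto)
  have "incseq (\<lambda>i. \<integral>\<^sup>+x. U i x \<partial>K)" for K
    using \<open>incseq U\<close> by (auto simp: incseq_def le_fun_def intro!: nn_integral_mono)
  then show ?case
    using seq.IH *[of \<mu>] *[of \<nu>] *[of "measure_add \<mu> \<nu>"] by (simp add: sets ennreal_SUP_add)
qed

section \<open>Stieltjes measures of increasing paths\<close>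

lemma borel_measure_eqI:
  fixes \<mu> \<nu> :: "real measure"
  assumes "sets \<mu> = sets borel" "sets \<nu> = sets borel"
    and "\<And>a b. a \<le> b \<Longrightarrow> emeasure \<mu> {a<..b} = emeasure \<nu> {a<..b}"
    and "\<And>a b. emeasure \<mu> {a<..b} < \<infinity>"
  shows "\<mu> = \<nu>"
proof (rule measure_eqI_generator_eq[where \<Omega> = UNIV and E = "range (\<lambda>(a,b). {a<..b})" and A = "\<lambda>i. {- real i<..real i}"])
  show "Int_stable (range (\<lambda>(a, b). {a<..b::real}))"
    by (rule Int_stableI) (force simp: image_iff Ioc_inj)
  show "emeasure \<mu> X = emeasure \<nu> X" if X: "X \<in> range (\<lambda>(a, b). {a<..b})" for X
  proof -
    obtain a b where "X = {a<..b}" using X by auto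
    then show ?thesis using assms(3)[of a b] by (cases "a \<le> b") auto
  qed
  show "sets \<mu> = sigma_sets UNIV (range (\<lambda>(a, b). {a<..b}))" "sets \<nu> = sigma_sets UNIV (range (\<lambda>(a, b). {a<..b}))"
    using assms by (auto simp: borel_sigma_sets_Ioc)
  show "(\<Union>i. {- real i<..real i}) = UNIV"
  proof -
    have "x \<in> {- real (nat \<lceil>\<bar>x\<bar> + 1\<rceil>)<..real (nat \<lceil>\<bar>x\<bar> + 1\<rceil>)}" for x :: real
      by auto linarith+
    then show ?thesis by blast
  qed
  show "emeasure \<mu> {- real i<..real i} \<noteq> \<infinity>" for i using assms(4) by (simp add: less_top)
qed auto

definition path_measure :: "(real \<Rightarrow> real) \<Rightarrow> real measure" where
  "path_measure U = interval_measure (\<lambda>t. U (max 0 t))"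

locale inc_path =
  fixes U :: "real \<Rightarrow> real"
  assumes inc: "mono_on {0..} U" and inc_right_cont: "right_continuous_path U"
begin

lemma frozen: 
  shows "x \<le> y \<Longrightarrow> U (max 0 x) \<le> U (max 0 y)" and "continuous (at_right a) (\<lambda>t. U (max 0 t))"
proof -
  show "x \<le> y \<Longrightarrow> U (max 0 x) \<le> U (max 0 y)" by (intro mono_onD[OF inc]) auto
  show "continuous (at_right a) (\<lambda>t. U (max 0 t))"
  proof (cases "0 \<le> a")
    case True
    then have "((\<lambda>t. U t) \<longlongrightarrow> U a) (at_right a)"
      using inc_right_cont by (auto simp: right_continuous_path_def continuous_within)
    moreover have "\<forall>\<^sub>F t in at_right a. U t = U (max 0 t)"
      using True by (auto simp: eventually_at_filter)
    ultimately show ?thesis using True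
      by (auto simp: continuous_within elim: Lim_transform_eventually)
  next
    case False
    then have "\<forall>\<^sub>F t in at_right a. U 0 = U (max 0 t)"
      by (intro eventually_at_right_real[of a 0, THEN eventually_mono]) auto
    then show ?thesis using False
      by (auto simp: continuous_within intro: Lim_transform_eventually)
  qed
qed

lemma sets_path_measure: "sets (path_measure U) = sets borel"
  by (simp add: path_measure_def)

lemma emeasure_Ioc_max: "a \<le> b \<Longrightarrow> emeasure (path_measure U) {a<..b} = ennreal (U (max 0 b) - U (max 0 a))"
  unfolding path_measure_def by (intro emeasure_interval_measure_Ioc frozen)

lemma emeasure_Ioc: "0 \<le> a \<Longrightarrow> a \<le> b \<Longrightarrow> emeasure (path_measure U) {a<..b} = ennreal (U b - U a)"
  using emeasure_Ioc_max[of a b] by simp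

lemma emeasure_Ioc_finite: "emeasure (path_measure U) {a<..b} < \<infinity>"
  by (cases "a \<le> b") (auto simp: emeasure_Ioc_max)

lemma sigma_finite_path_measure: "sigma_finite_measure (path_measure U)"
  unfolding path_measure_def by (intro sigma_finite_interval_measure frozen)

lemma emeasure_bounded_finite: "A \<subseteq> {a<..b} \<Longrightarrow> emeasure (path_measure U) A < \<infinity>"
  using emeasure_mono[of A "{a<..b}" "path_measure U"] emeasure_Ioc_finite[of a b]
  by (auto simp: sets_path_measure)

lemma emeasure_atMost_0: "emeasure (path_measure U) {..0} = 0"
proof -
  have "emeasure (path_measure U) (\<Union>i::nat. {-real i<..0}) = 0"
    by (intro emeasure_UN_eq_0) (auto simp: emeasure_Ioc_max sets_path_measure)
  moreover have "(\<Union>i::nat. {-real i<..0}) = {..0}"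
    using reals_Archimedean2 by (auto simp: minus_less_iff)
  ultimately show ?thesis by simp
qed

lemma path_measure_eqI:
  assumes "sets \<mu> = sets borel" "emeasure \<mu> {..0} = 0"
    and "\<And>a b. 0 \<le> a \<Longrightarrow> a \<le> b \<Longrightarrow> emeasure \<mu> {a<..b} = ennreal (U b - U a)"
  shows "\<mu> = path_measure U"
proof (rule sym, rule borel_measure_eqI)
  fix a b :: real assume "a \<le> b"
  show "emeasure (path_measure U) {a<..b} = emeasure \<mu> {a<..b}"
  proof (cases "b \<le> 0")
    case True
    then have "emeasure \<mu> {a<..b} \<le> emeasure \<mu> {..0}" using assms(1) by (intro emeasure_mono) auto
    then show ?thesis using True \<open>a \<le> b\<close> assms(2) by (simp add: emeasure_Ioc_max)
  next
    case False
    have "emeasure \<mu> {max 0 a<..b} = emeasure \<mu> {a<..b}"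
    proof (rule emeasure_eq_AE)
      show "AE x in \<mu>. x \<in> {max 0 a<..b} \<longleftrightarrow> x \<in> {a<..b}"
        using assms(1,2) by (intro AE_I[of _ _ "{..0}"]) (auto simp: not_le)
    qed (use assms in auto)
    then show ?thesis using assms(3)[of "max 0 a" b] False \<open>a \<le> b\<close> by (simp add: emeasure_Ioc_max)
  qed
qed (use assms emeasure_Ioc_finite in \<open>auto simp: sets_path_measure\<close>)

lemma tendsto_atom:
  assumes y: "0 < y"
  shows "((\<lambda>n. emeasure (path_measure U) {y - 1 / Suc n<..y}) \<longlongrightarrow> emeasure (path_measure U) {y}) sequentially"
proof -
  have "1 / real (Suc n) \<le> 1 / real (Suc m)" if "m \<le> n" for m n
    using that by (intro frac_le) auto
  then have "decseq (\<lambda>n. {y - 1 / real (Suc n)<..y})"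
    by (fastforce simp: decseq_def simp del: of_nat_Suc)
  then have "(\<lambda>n. emeasure (path_measure U) {y - 1 / Suc n<..y}) \<longlonglongrightarrow> emeasure (path_measure U) (\<Inter>n. {y - 1 / Suc n<..y})"
    using emeasure_Ioc_finite
    by (intro Lim_emeasure_decseq) (auto simp: sets_path_measure less_top)
  also have "(\<Inter>n. {y - 1 / Suc n<..y}) = {y}"
  proof safe
    fix x assume x: "x \<in> (\<Inter>n. {y - 1 / real (Suc n)<..y})"
    have "(\<lambda>n. y - 1 / real (Suc n)) \<longlonglongrightarrow> y - 0"
      by (intro tendsto_intros LIMSEQ_Suc lim_1_over_n)
    then have "y \<le> x" by (intro LIMSEQ_le_const2[of _ y x]) (use x in \<open>auto intro!: exI[of _ 0] less_imp_le\<close>)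
    then show "x = y" using x by auto
  qed auto
  finally show ?thesis .
qed

text \<open>The mass of \<open>{0<..<y}\<close> is the left limit of \<open>U - U 0\<close> at
  \<open>y\<close>, and by monotonicity rational times before \<open>y\<close> determine it. So it
  depends on the strict past only, through countably many times.\<close>

lemma emeasure_Ioo: 
  assumes y: "0 < y"
  shows "emeasure (path_measure U) {0<..<y} \<le> ennreal c \<longleftrightarrow> (\<forall>q\<in>\<rat>. 0 \<le> q \<longrightarrow> q < y \<longrightarrow> ennreal (U q - U 0) \<le> ennreal c)"
proof safe
  fix q :: real assume "emeasure (path_measure U) {0<..<y} \<le> ennreal c" "0 \<le> q" "q < y"
  moreover have "emeasure (path_measure U) {0<..q} \<le> emeasure (path_measure U) {0<..<y}"
    using \<open>q < y\<close> by (intro emeasure_mono) (auto simp: sets_path_measure)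
  ultimately show "ennreal (U q - U 0) \<le> ennreal c" by (simp add: emeasure_Ioc)
next
  assume *: "\<forall>q\<in>\<rat>. 0 \<le> q \<longrightarrow> q < y \<longrightarrow> ennreal (U q - U 0) \<le> ennreal c"
  have "{0<..<y} = (\<Union>n. {0<..y - y / Suc (Suc n)})"
  proof safe
    fix x assume x: "x \<in> {0<..<y}"
    have "(\<lambda>n. y - y / real (Suc (Suc n))) \<longlonglongrightarrow> y - 0"
      by (intro tendsto_intros LIMSEQ_Suc lim_const_over_n)
    then have "\<forall>\<^sub>F n in sequentially. x < y - y / real (Suc (Suc n))"
      using x by (intro order_tendstoD(1)) auto
    then obtain n where "x < y - y / real (Suc (Suc n))" by (auto simp: eventually_sequentially)
    then show "x \<in> (\<Union>n. {0<..y - y / Suc (Suc n)})" using x by (auto intro!: exI[of _ n])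
  next
    fix x n assume x: "x \<in> {0<..y - y / real (Suc (Suc n))}"
    moreover have "0 < y / real (Suc (Suc n))" using y by simp
    ultimately show "x \<in> {0<..<y}" by (simp del: of_nat_Suc)
  qed
  moreover have "emeasure (path_measure U) (\<Union>n. {0<..y - y / Suc (Suc n)}) = (SUP n. emeasure (path_measure U) {0<..y - y / Suc (Suc n)})"
  proof (rule SUP_emeasure_incseq[symmetric])
    show "incseq (\<lambda>n. {0<..y - y / real (Suc (Suc n))})"
      using y by (auto simp: incseq_def intro!: divide_left_mono elim!: order_trans)
  qed (auto simp: sets_path_measure)
  moreover have "emeasure (path_measure U) {0<..y - y / Suc (Suc n)} \<le> ennreal c" for n
  proof -
    have y': "0 < y / Suc (Suc n)" "y / Suc (Suc n) \<le> y" using y by (auto simp: field_simps)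
    obtain q where q: "q \<in> \<rat>" "y - y / Suc (Suc n) < q" "q < y" using Rats_dense_in_real[of "y - y / Suc (Suc n)" y] y' by auto
    have "emeasure (path_measure U) {0<..y - y / Suc (Suc n)} \<le> emeasure (path_measure U) {0<..q}"
      using q by (intro emeasure_mono) (auto simp: sets_path_measure)
    also have "\<dots> \<le> ennreal c" using * q y' by (subst emeasure_Ioc) auto
    finally show ?thesis .
  qed
  ultimately show "emeasure (path_measure U) {0<..<y} \<le> ennreal c" by (auto intro: SUP_least)
qed

end

section \<open>The Jordan decomposition of a path\<close>

context fv_path begin

abbreviation "U_pos t \<equiv> (V t + (w t - w 0)) / 2"
abbreviation "U_neg t \<equiv> (V t - (w t - w 0)) / 2"

sublocale V: inc_path V
  by standard (auto simp: mono_on_def right_continuous_path_def continuous_within V_mono V_right_cont)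

sublocale pos: inc_path U_pos
proof
  have "V a + (w a - w 0) \<le> V b + (w b - w 0)" if "0 \<le> a" "a \<le> b" for a b
    using V_increment[OF that] by linarith
  then show "mono_on {0..} U_pos" by (fastforce simp: mono_on_def intro!: divide_right_mono)
  show "right_continuous_path U_pos"
    by (auto simp: right_continuous_path_def continuous_within intro!: tendsto_intros tendsto_w V_right_cont)
qed

sublocale neg: inc_path U_neg
proof
  have "V a - (w a - w 0) \<le> V b - (w b - w 0)" if "0 \<le> a" "a \<le> b" for a b
    using V_increment[OF that] by linarith
  then show "mono_on {0..} U_neg" by (fastforce simp: mono_on_def intro!: divide_right_mono)
  show "right_continuous_path U_neg"
    by (auto simp: right_continuous_path_def continuous_within intro!: tendsto_intros tendsto_w V_right_cont)
qed

lemma path_measures: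
  "path_measure V = variation_measure w" "path_measure U_pos = positive_measure w" "path_measure U_neg = negative_measure w"
  by (simp_all add: path_measure_def variation_measure_def positive_measure_def negative_measure_def)

lemma sets_path_measures [measurable_cong, simp]:
  "sets (variation_measure w) = sets borel" "sets (positive_measure w) = sets borel" "sets (negative_measure w) = sets borel"
  by (simp_all add: variation_measure_def positive_measure_def negative_measure_def)

lemmas emeasure_pos = pos.emeasure_Ioc[unfolded path_measures]
lemmas emeasure_neg = neg.emeasure_Ioc[unfolded path_measures]

lemma variation_measure_eq: "variation_measure w = measure_add (positive_measure w) (negative_measure w)"
  unfolding path_measures(1)[symmetric]
proof (rule V.path_measure_eqI[symmetric])
  show "emeasure (measure_add (positive_measure w) (negative_measure w)) {..0} = 0"
    using pos.emeasure_atMost_0 neg.emeasure_atMost_0 by (simp add: emeasure_measure_add path_measures)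
  fix a b :: real assume ab: "0 \<le> a" "a \<le> b"
  have "0 \<le> U_pos b - U_pos a" "0 \<le> U_neg b - U_neg a"
    using V_increment[OF ab] by (simp_all add: field_simps)
  then show "emeasure (measure_add (positive_measure w) (negative_measure w)) {a<..b} = ennreal (V b - V a)"
    using ab by (simp add: emeasure_measure_add emeasure_pos emeasure_neg ennreal_plus[symmetric] del: ennreal_plus)
      (simp add: field_simps)
qed simp

lemma nn_integral_variation:
  "f \<in> borel_measurable borel \<Longrightarrow>
    (\<integral>\<^sup>+x. f x \<partial>variation_measure w) = (\<integral>\<^sup>+x. f x \<partial>positive_measure w) + (\<integral>\<^sup>+x. f x \<partial>negative_measure w)"
  by (simp add: variation_measure_eq nn_integral_measure_add)

text \<open>Masses \<open>a\<close> and \<open>b\<close> of the two parts at the same point would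
  make the total variation jump by \<open>a + b\<close> while \<open>w\<close> jumps only by
  \<open>\<bar>a - b\<bar>\<close>, against \<open>V_left_bound\<close>. It follows that the jump of
  \<open>w\<close> has the size of the atom of |dw|.\<close>

lemma atoms_disjoint:
  assumes y: "0 < y"
  shows "emeasure (positive_measure w) {y} = 0 \<or> emeasure (negative_measure w) {y} = 0"
proof -
  have "emeasure (positive_measure w) {y} < \<infinity>" "emeasure (negative_measure w) {y} < \<infinity>"
    using pos.emeasure_bounded_finite[of "{y}" "y-1" y] neg.emeasure_bounded_finite[of "{y}" "y-1" y]
    by (auto simp: path_measures)
  then obtain a b where a: "0 \<le> a" "emeasure (positive_measure w) {y} = ennreal a"
    and b: "0 \<le> b" "emeasure (negative_measure w) {y} = ennreal b"
    by (metis ennreal_cases infinity_ennreal_def less_irrefl)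
  \<comment> \<open>Close to \<open>y\<close> each part puts its atom plus at most
    \<open>e / 2\<close> on \<open>{s<..y}\<close>. There \<open>V s\<close> is at most
    \<open>V y - (a + b)\<close>, and \<open>w\<close> moves by at most
    \<open>\<bar>a - b\<bar> + e\<close>.\<close>
  have "V y \<le> V y - (a + b) + \<bar>a - b\<bar> + e" if "0 < e" for e
  proof (rule V_left_bound[OF y])
    have "\<forall>\<^sub>F n in sequentially. emeasure (positive_measure w) {y - 1 / Suc n<..y} < ennreal (a + e / 2)"
      using pos.tendsto_atom[OF y] a \<open>0 < e\<close> by (intro order_tendstoD(2)) (auto simp: path_measures ennreal_less_iff)
    moreover have "\<forall>\<^sub>F n in sequentially. emeasure (negative_measure w) {y - 1 / Suc n<..y} < ennreal (b + e / 2)"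
      using neg.tendsto_atom[OF y] b \<open>0 < e\<close> by (intro order_tendstoD(2)) (auto simp: path_measures ennreal_less_iff)
    ultimately obtain n where n: "emeasure (positive_measure w) {y - 1 / Suc n<..y} < ennreal (a + e / 2)"
      "emeasure (negative_measure w) {y - 1 / Suc n<..y} < ennreal (b + e / 2)"
      using eventually_happens'[OF _ eventually_conj] by (metis (mono_tags, lifting) sequentially_bot)
    have "\<forall>\<^sub>F s in at_left y. s \<in> {max 0 (y - 1 / Suc n)<..<y}"
      using y by (intro eventually_at_left_real) auto
    then show "\<forall>\<^sub>F s in at_left y. V s + \<bar>w y - w s\<bar> \<le> V y - (a + b) + \<bar>a - b\<bar> + e"
    proof eventually_elim
      case (elim s)
      have "emeasure (positive_measure w) {s<..y} \<le> emeasure (positive_measure w) {y - 1 / Suc n<..y}"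
        "emeasure (negative_measure w) {s<..y} \<le> emeasure (negative_measure w) {y - 1 / Suc n<..y}"
        "emeasure (positive_measure w) {y} \<le> emeasure (positive_measure w) {s<..y}"
        "emeasure (negative_measure w) {y} \<le> emeasure (negative_measure w) {s<..y}"
        using elim by (auto intro!: emeasure_mono)
      then have "ennreal (U_pos y - U_pos s) < ennreal (a + e / 2)" "ennreal (U_neg y - U_neg s) < ennreal (b + e / 2)"
        "ennreal a \<le> ennreal (U_pos y - U_pos s)" "ennreal b \<le> ennreal (U_neg y - U_neg s)"
        using n elim a b by (auto simp: emeasure_pos emeasure_neg)
      moreover have "0 \<le> U_pos y - U_pos s" "0 \<le> U_neg y - U_neg s"
        using V_increment[of s y] elim by (simp_all add: field_simps)
      ultimately have "U_pos y - U_pos s < a + e / 2" "U_neg y - U_neg s < b + e / 2"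
        "a \<le> U_pos y - U_pos s" "b \<le> U_neg y - U_neg s"
        using a b that by (auto simp: ennreal_less_iff simp del: ennreal_plus)
      then show ?case by (simp add: field_simps)
    qed
  qed
  then have "a + b \<le> \<bar>a - b\<bar>" using field_le_epsilon[of "a + b" "\<bar>a - b\<bar>"] by force
  then show ?thesis using a b by auto
qed

end


section \<open>Positive definite kernels and double integrals\<close>

text \<open>This supplies the mean of an off-diagonal term in the sampling argument below: two
  different coordinates are independent with law \<open>\<nu>\<close>.\<close>

lemma distr_PiM_pair:
  assumes "prob_space \<nu>" and "k \<in> I" "l \<in> I" "k \<noteq> l"
  shows "distr (PiM I (\<lambda>_. \<nu>)) (\<nu> \<Otimes>\<^sub>M \<nu>) (\<lambda>x. (x k, x l)) = \<nu> \<Otimes>\<^sub>M \<nu>"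
proof -
  interpret \<nu>: prob_space \<nu> by fact
  interpret product_prob_space "\<lambda>_. \<nu>" I by standard
  interpret P: prob_space "PiM I (\<lambda>_. \<nu>)" by (rule prob_space_PiM) (rule assms)
  have "distr (PiM I (\<lambda>_. \<nu>)) (PiM I (\<lambda>_. \<nu>)) (\<lambda>x. \<lambda>i\<in>I. x i) = distr (PiM I (\<lambda>_. \<nu>)) (PiM I (\<lambda>_. \<nu>)) (\<lambda>x. x)"
    by (rule distr_cong) (auto simp: space_PiM)
  also have "\<dots> = PiM I (\<lambda>i. distr (PiM I (\<lambda>_. \<nu>)) \<nu> (\<lambda>x. x i))"
    using PiM_component by (auto intro!: PiM_cong)
  finally have "P.indep_vars (\<lambda>_. \<nu>) (\<lambda>i x. x i) I"
    using assms by (subst P.indep_vars_iff_distr_eq_PiM') auto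
  then have "P.indep_var (PiM {k} (\<lambda>_. \<nu>)) (\<lambda>x. restrict x {k}) (PiM {l} (\<lambda>_. \<nu>)) (\<lambda>x. restrict x {l})"
    by (rule P.indep_var_restrict) (use assms in auto)
  then have "P.indep_var \<nu> ((\<lambda>x. x k) \<circ> (\<lambda>x. restrict x {k})) \<nu> ((\<lambda>x. x l) \<circ> (\<lambda>x. restrict x {l}))"
    by (rule P.indep_var_compose) auto
  then have "P.indep_var \<nu> (\<lambda>x. x k) \<nu> (\<lambda>x. x l)"
    by (simp add: comp_def)
  then have "distr (PiM I (\<lambda>_. \<nu>)) (\<nu> \<Otimes>\<^sub>M \<nu>) (\<lambda>x. (x k, x l)) =
     distr (PiM I (\<lambda>_. \<nu>)) \<nu> (\<lambda>x. x k) \<Otimes>\<^sub>M distr (PiM I (\<lambda>_. \<nu>)) \<nu> (\<lambda>x. x l)"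
    by (simp add: P.indep_var_distribution_eq)
  then show ?thesis using PiM_component assms by simp
qed

text \<open>
  Sampling: the mean of the nonnegative random variable \<open>\<Sum>k l. g (X k, X l)\<close> for independent
  \<open>X 0, \<dots>, X n\<close> is dominated for large \<open>n\<close> by the off-diagonal terms.
\<close>

lemma integral_pos_def_prob:
  fixes g :: "'a \<times> 'a \<Rightarrow> real"
  assumes "prob_space \<nu>" and g [measurable]: "g \<in> borel_measurable (\<nu> \<Otimes>\<^sub>M \<nu>)" and bound: "\<And>z. \<bar>g z\<bar> \<le> c"
    and pos: "\<And>(n::nat) x. (\<And>k. k < n \<Longrightarrow> x k \<in> space \<nu>) \<Longrightarrow> 0 \<le> (\<Sum>k<n. \<Sum>l<n. g (x k, x l))"
  shows "0 \<le> integral\<^sup>L (\<nu> \<Otimes>\<^sub>M \<nu>) g"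
proof -
  interpret \<nu>: prob_space \<nu> by fact
  interpret \<nu>\<nu>: pair_prob_space \<nu> \<nu> ..
  define m where "m = integral\<^sup>L (\<nu> \<Otimes>\<^sub>M \<nu>) g"
  have "c \<ge> 0" using bound[of undefined] by linarith
  \<comment> \<open>\<open>Suc n\<close> samples have n(n+1) ordered pairs of distinct indices, each
    of mean \<open>m\<close>, and n+1 diagonal terms of mean at most \<open>c\<close>. Dividing by
    n+1 leaves \<open>n * m + c\<close> nonnegative for all \<open>n\<close>.\<close>
  have ineq: "0 \<le> real n * (real n + 1) * m + (real n + 1) * c" for n
  proof -
    let ?I = "{..<Suc n}"
    let ?P = "PiM ?I (\<lambda>_. \<nu>)"
    interpret P: prob_space ?P by (rule prob_space_PiM) (rule assms)
    have meas: "(\<lambda>x. g (x k, x l)) \<in> borel_measurable ?P" if "k \<in> ?I" "l \<in> ?I" for k l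
      using that by measurable
    have int: "integrable ?P (\<lambda>x. g (x k, x l))" if "k \<in> ?I" "l \<in> ?I" for k l
      by (rule P.integrable_const_bound[where B = c]) (use meas[OF that] bound in auto)
    have off: "integral\<^sup>L ?P (\<lambda>x. g (x k, x l)) = m" if "k \<in> ?I" "l \<in> ?I" "k \<noteq> l" for k l
    proof -
      have "m = integral\<^sup>L (distr ?P (\<nu> \<Otimes>\<^sub>M \<nu>) (\<lambda>x. (x k, x l))) g"
        unfolding m_def using distr_PiM_pair[OF assms(1) that] by simp
      also have "\<dots> = integral\<^sup>L ?P (\<lambda>x. g (x k, x l))"
        by (rule integral_distr) (use that in measurable)
      finally show ?thesis ..
    qed
    have diag: "integral\<^sup>L ?P (\<lambda>x. g (x k, x k)) \<le> c" if "k \<in> ?I" for k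
    proof -
      have "integral\<^sup>L ?P (\<lambda>x. g (x k, x k)) \<le> integral\<^sup>L ?P (\<lambda>x. c)"
        by (rule integral_mono) (use int that bound in \<open>auto simp: abs_le_iff\<close>)
      then show ?thesis by (simp add: P.prob_space)
    qed
    have "0 \<le> integral\<^sup>L ?P (\<lambda>x. \<Sum>k\<in>?I. \<Sum>l\<in>?I. g (x k, x l))"
      by (rule Bochner_Integration.integral_nonneg, rule pos) (auto simp: space_PiM)
    also have "\<dots> = (\<Sum>k\<in>?I. \<Sum>l\<in>?I. integral\<^sup>L ?P (\<lambda>x. g (x k, x l)))"
    proof (subst Bochner_Integration.integral_sum)
      show "integrable ?P (\<lambda>x. \<Sum>l\<in>?I. g (x k, x l))" if "k \<in> ?I" for k
        using int[OF that] by (rule Bochner_Integration.integrable_sum)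
      show "(\<Sum>k\<in>?I. integral\<^sup>L ?P (\<lambda>x. \<Sum>l\<in>?I. g (x k, x l))) = (\<Sum>k\<in>?I. \<Sum>l\<in>?I. integral\<^sup>L ?P (\<lambda>x. g (x k, x l)))"
        by (intro sum.cong Bochner_Integration.integral_sum int) auto
    qed
    also have "\<dots> = (\<Sum>k\<in>?I. integral\<^sup>L ?P (\<lambda>x. g (x k, x k)) + (\<Sum>l\<in>?I - {k}. integral\<^sup>L ?P (\<lambda>x. g (x k, x l))))"
      by (intro sum.cong sum.remove) auto
    also have "\<dots> \<le> (\<Sum>k\<in>?I. c + (\<Sum>l\<in>?I - {k}. m))"
      by (intro sum_mono add_mono diag sum_mono eq_refl off) auto
    also have "\<dots> = real n * (real n + 1) * m + (real n + 1) * c"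
      by (simp add: card_Diff_singleton algebra_simps)
    finally show ?thesis .
  qed
  have "0 \<le> m"
  proof (rule ccontr)
    assume "\<not> 0 \<le> m"
    then obtain n :: nat where "c / (-m) < real n" using reals_Archimedean2 by blast
    then have "c < real n * (-m)" using \<open>\<not> 0 \<le> m\<close> by (subst (asm) divide_less_eq) auto
    then have "real n * m + c < 0" by simp
    then have "(real n + 1) * (real n * m + c) < 0" by (intro mult_pos_neg) auto
    then show False using ineq[of n] by (simp add: algebra_simps)
  qed
  then show ?thesis by (simp add: m_def)
qed

text \<open>Normalising the measure multiplies the double integral by the positive factor
  \<open>(1 / r)\<^sup>2\<close>; the null measure, which cannot be normalised, is treated
  apart.\<close>

lemma integral_pos_def_finite:
  fixes g :: "'a \<times> 'a \<Rightarrow> real"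
  assumes "finite_measure \<nu>" and g [measurable]: "g \<in> borel_measurable (\<nu> \<Otimes>\<^sub>M \<nu>)" and bound: "\<And>z. \<bar>g z\<bar> \<le> c"
    and pos: "\<And>(n::nat) x. (\<And>k. k < n \<Longrightarrow> x k \<in> space \<nu>) \<Longrightarrow> 0 \<le> (\<Sum>k<n. \<Sum>l<n. g (x k, x l))"
  shows "0 \<le> (\<integral>x. \<integral>y. g (x, y) \<partial>\<nu> \<partial>\<nu>)"
proof (cases "emeasure \<nu> (space \<nu>) = 0")
  case True
  then have "AE x in \<nu>. (\<integral>y. g (x, y) \<partial>\<nu>) = 0" by (intro AE_I[of _ _ "space \<nu>"]) auto
  then have "(\<integral>x. \<integral>y. g (x, y) \<partial>\<nu> \<partial>\<nu>) = 0" by (rule integral_eq_zero_AE)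
  then show ?thesis by simp
next
  case False
  interpret \<nu>: finite_measure \<nu> by fact
  define r where "r = measure \<nu> (space \<nu>)"
  have r: "0 < r" using False by (simp add: r_def \<nu>.emeasure_eq_measure zero_less_measure_iff)
  define \<nu>' where "\<nu>' = density \<nu> (\<lambda>_. ennreal (1 / r))"
  have [measurable_cong, simp]: "sets \<nu>' = sets \<nu>" by (simp add: \<nu>'_def)
  have "prob_space \<nu>'"
    by (rule prob_spaceI) (use r in \<open>simp add: \<nu>'_def emeasure_density \<nu>.emeasure_eq_measure r_def[symmetric] ennreal_mult[symmetric]\<close>)
  then interpret \<nu>': prob_space \<nu>' .
  interpret pair_prob_space \<nu>' \<nu>' ..
  have "0 \<le> integral\<^sup>L (\<nu>' \<Otimes>\<^sub>M \<nu>') g"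
    by (rule integral_pos_def_prob[where c = c]) (use \<open>prob_space \<nu>'\<close> bound pos in \<open>auto simp: \<nu>'_def\<close>)
  also have "integral\<^sup>L (\<nu>' \<Otimes>\<^sub>M \<nu>') g = (\<integral>x. \<integral>y. g (x, y) \<partial>\<nu>' \<partial>\<nu>')"
    by (rule integral_fst'[symmetric]) (rule integrable_const_bound[where B = c], use bound in auto)
  also have "\<dots> = (1 / r)\<^sup>2 * (\<integral>x. \<integral>y. g (x, y) \<partial>\<nu> \<partial>\<nu>)"
  proof -
    have scale: "integral\<^sup>L \<nu>' f = (1 / r) * integral\<^sup>L \<nu> f" if "f \<in> borel_measurable \<nu>" for f :: "'a \<Rightarrow> real"
      unfolding \<nu>'_def using r that by (subst integral_density) auto
    have "(\<integral>x. \<integral>y. g (x, y) \<partial>\<nu>' \<partial>\<nu>') = (\<integral>x. (1 / r) * (\<integral>y. g (x, y) \<partial>\<nu>) \<partial>\<nu>')"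
      by (intro Bochner_Integration.integral_cong scale measurable_compose[OF measurable_Pair1' g])
        (auto simp: sets_eq_imp_space_eq[of \<nu>' \<nu>])
    also have "\<dots> = (1 / r) * (\<integral>x. (1 / r) * (\<integral>y. g (x, y) \<partial>\<nu>) \<partial>\<nu>)"
      by (rule scale) measurable
    finally show ?thesis by (simp add: power2_eq_square)
  qed
  finally show ?thesis using r by (smt (verit) mult_pos_neg zero_less_power zero_less_divide_1_iff)
qed

section \<open>The density of dw with respect to |dw|\<close>

context fv_path begin

lemma sigma_finite_variation: "sigma_finite_measure (variation_measure w)"
  using V.sigma_finite_path_measure by (simp add: path_measures)

lemma sigma_finite_pos: "sigma_finite_measure (positive_measure w)"
  using pos.sigma_finite_path_measure by (simp add: path_measures)

lemma sigma_finite_neg: "sigma_finite_measure (negative_measure w)"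
  using neg.sigma_finite_path_measure by (simp add: path_measures)

lemma emeasure_variation_eq: "A \<in> sets borel \<Longrightarrow>
    emeasure (variation_measure w) A = emeasure (positive_measure w) A + emeasure (negative_measure w) A"
  by (simp add: variation_measure_eq emeasure_measure_add)

lemma space_path_measures [simp]: "space (variation_measure w) = UNIV" "space (positive_measure w) = UNIV"
    "space (negative_measure w) = UNIV"
  by (simp_all add: variation_measure_def positive_measure_def negative_measure_def)

lemma integrable_variation:
  fixes f :: "real \<Rightarrow> real"
  assumes "integrable (variation_measure w) f"
  shows "integrable (positive_measure w) f" "integrable (negative_measure w) f"
proof -
  have [measurable]: "f \<in> borel_measurable borel" using borel_measurable_integrable[OF assms] by simp
  have "(\<integral>\<^sup>+x. norm (f x) \<partial>variation_measure w) < \<infinity>" using assms by (simp add: integrable_iff_bounded)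
  then show "integrable (positive_measure w) f" "integrable (negative_measure w) f"
    by (auto simp: integrable_iff_bounded nn_integral_variation)
qed

text \<open>A version of the density dw/d|dw|. With it a double integral against dw becomes one
  integral over the product of |dw| with itself, instead of four products of the Jordan parts, and
  the coefficients of a quadratic form can carry the sign.\<close>

definition jordan_density :: "(real \<Rightarrow> real) \<Rightarrow> bool" where
  "jordan_density \<phi> \<longleftrightarrow> \<phi> \<in> borel_measurable borel \<and> (\<forall>x. \<bar>\<phi> x\<bar> \<le> 1) \<and>
     (\<forall>f. integrable (variation_measure w) f \<longrightarrow>
        (LINT x|positive_measure w. f x) - (LINT x|negative_measure w. f x) = (LINT x|variation_measure w. \<phi> x * f x))"

lemma ex_jordan_density: "\<exists>\<phi>. jordan_density \<phi>"
proof -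
  interpret V: sigma_finite_measure "variation_measure w" by (rule sigma_finite_variation)
  have "absolutely_continuous (variation_measure w) (positive_measure w)"
    "absolutely_continuous (variation_measure w) (negative_measure w)"
    by (auto simp: absolutely_continuous_def null_sets_def emeasure_variation_eq)
  then obtain p q where p0: "p \<in> borel_measurable (variation_measure w)" "density (variation_measure w) p = positive_measure w"
    and q0: "q \<in> borel_measurable (variation_measure w)" "density (variation_measure w) q = negative_measure w"
    using V.Radon_Nikodym[of "positive_measure w"] V.Radon_Nikodym[of "negative_measure w"] by auto
  have p: "p \<in> borel_measurable borel" "density (variation_measure w) p = positive_measure w"
    and q: "q \<in> borel_measurable borel" "density (variation_measure w) q = negative_measure w"
    using p0 q0 by simp_all
  note [measurable] = p(1) q(1)
  have "density (variation_measure w) (\<lambda>x. p x + q x) = variation_measure w"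
  proof (rule measure_eqI)
    fix A assume "A \<in> sets (density (variation_measure w) (\<lambda>x. p x + q x))"
    then have [measurable]: "A \<in> sets borel" by simp
    have "emeasure (density (variation_measure w) (\<lambda>x. p x + q x)) A =
        emeasure (density (variation_measure w) p) A + emeasure (density (variation_measure w) q) A"
      by (simp add: emeasure_density distrib_right nn_integral_add)
    then show "emeasure (density (variation_measure w) (\<lambda>x. p x + q x)) A = emeasure (variation_measure w) A"
      by (simp add: p(2) q(2) emeasure_variation_eq)
  qed simp
  then have "density (variation_measure w) (\<lambda>x. p x + q x) = density (variation_measure w) (\<lambda>_. 1)"
    by (simp add: density_1)
  then have AE1: "AE x in variation_measure w. p x + q x = 1"
    by (subst (asm) V.density_unique_iff) auto
  \<comment> \<open>On the exceptional null set both densities are reset to 0, so that the bound by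
    1 on their difference holds at every point.\<close>
  define p' where "p' x = (if p x + q x = 1 then enn2real (p x) else 0)" for x
  define q' where "q' x = (if p x + q x = 1 then enn2real (q x) else 0)" for x
  have [measurable]: "p' \<in> borel_measurable borel" "q' \<in> borel_measurable borel"
    unfolding p'_def q'_def by measurable
  have fin: "p x < \<infinity> \<and> q x < \<infinity>" if "p x + q x = 1" for x
    using that by (metis ennreal_add_eq_top ennreal_one_neq_top infinity_ennreal_def top.not_eq_extremum)
  have sum1: "0 \<le> p' x" "0 \<le> q' x" "p' x + q' x \<le> 1" for x
    using fin[of x] by (auto simp: p'_def q'_def enn2real_plus[symmetric])
  have dens: "density (variation_measure w) (\<lambda>x. ennreal (p' x)) = positive_measure w"
    "density (variation_measure w) (\<lambda>x. ennreal (q' x)) = negative_measure w"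
    unfolding p(2)[symmetric] q(2)[symmetric]
    by (rule density_cong; use AE1 fin in \<open>auto simp: p'_def q'_def\<close>)+
  have "jordan_density (\<lambda>x. p' x - q' x)"
    unfolding jordan_density_def
  proof (intro conjI allI impI)
    show "\<bar>p' x - q' x\<bar> \<le> 1" for x using sum1[of x] by linarith
    fix f :: "real \<Rightarrow> real" assume f: "integrable (variation_measure w) f"
    then have [measurable]: "f \<in> borel_measurable borel" using borel_measurable_integrable by fastforce
    have "(LINT x|positive_measure w. f x) = (LINT x|variation_measure w. p' x * f x)"
      "(LINT x|negative_measure w. f x) = (LINT x|variation_measure w. q' x * f x)"
      unfolding dens[symmetric] using sum1 by (subst integral_density; simp)+
    moreover have "integrable (variation_measure w) (\<lambda>x. p' x * f x)" "integrable (variation_measure w) (\<lambda>x. q' x * f x)"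
      using integrable_variation[OF f] unfolding dens[symmetric] using sum1
      by (auto simp: integrable_density)
    ultimately show "(LINT x|positive_measure w. f x) - (LINT x|negative_measure w. f x) = (LINT x|variation_measure w. (p' x - q' x) * f x)"
      by (simp add: left_diff_distrib)
  qed simp
  then show ?thesis by blast
qed

text \<open>An atom belongs to just one Jordan part, so the density is 1 or -1 there. The factor
  \<open>measure (variation_measure w) {y}\<close> on both sides covers the points without mass, at
  which the density is undetermined.\<close>

lemma jordan_density_atom:
  assumes \<phi>: "jordan_density \<phi>" and y: "0 < y"
  shows "(\<phi> y)\<^sup>2 * measure (variation_measure w) {y} = measure (variation_measure w) {y}"
proof -
  have fin: "emeasure (variation_measure w) {y} < \<infinity>" "emeasure (positive_measure w) {y} < \<infinity>" "emeasure (negative_measure w) {y} < \<infinity>"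
    using V.emeasure_bounded_finite[of "{y}" "y-1" y] pos.emeasure_bounded_finite[of "{y}" "y-1" y] neg.emeasure_bounded_finite[of "{y}" "y-1" y]
    by (auto simp: path_measures)
  then have "integrable (variation_measure w) (indicator {y} :: real \<Rightarrow> real)" by simp
  then have "(LINT x|positive_measure w. indicator {y} x) - (LINT x|negative_measure w. indicator {y} x) =
     (LINT x|variation_measure w. \<phi> x * indicator {y} x)"
    using \<phi> unfolding jordan_density_def by blast
  also have "(\<lambda>x. \<phi> x * indicator {y} x) = (\<lambda>x. \<phi> y * indicator {y} x)"
    by (auto simp: fun_eq_iff split: split_indicator)
  finally have eq: "measure (positive_measure w) {y} - measure (negative_measure w) {y} = \<phi> y * measure (variation_measure w) {y}"
    using fin by simp
  have sum: "measure (variation_measure w) {y} = measure (positive_measure w) {y} + measure (negative_measure w) {y}"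
    using fin by (simp add: measure_def emeasure_variation_eq enn2real_plus)
  have "measure (positive_measure w) {y} = 0 \<or> measure (negative_measure w) {y} = 0"
    using atoms_disjoint[OF y] by (auto simp: measure_def)
  then have "(\<phi> y * measure (variation_measure w) {y})\<^sup>2 = (measure (variation_measure w) {y})\<^sup>2"
    unfolding eq[symmetric] unfolding sum by (auto simp: power2_eq_square)
  then have "((\<phi> y)\<^sup>2 * measure (variation_measure w) {y}) * measure (variation_measure w) {y} =
      measure (variation_measure w) {y} * measure (variation_measure w) {y}"
    by (simp add: power_mult_distrib power2_eq_square mult_ac)
  then show ?thesis by (metis mult_cancel_right mult_zero_right)
qed

lemma measurable_atom [measurable]:
  "(\<lambda>y. emeasure (variation_measure w) {y}) \<in> borel_measurable borel"
proof -
  interpret V: sigma_finite_measure "variation_measure w" by (rule sigma_finite_variation)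
  have "{p \<in> space (borel \<Otimes>\<^sub>M borel). fst p = (snd p :: real)} \<in> sets (borel \<Otimes>\<^sub>M borel)"
    by measurable
  then have "{p :: real \<times> real. fst p = snd p} \<in> sets (borel \<Otimes>\<^sub>M variation_measure w)"
    by (simp add: space_pair_measure)
  then have "(\<lambda>x. emeasure (variation_measure w) (Pair x -` {p :: real \<times> real. fst p = snd p})) \<in> borel_measurable borel"
    by (rule V.measurable_emeasure_Pair)
  then show ?thesis by (simp add: vimage_def)
qed

end

section \<open>The double integral of a positive-definite kernel\<close>

lemma pos_def_bound:
  fixes h :: "real \<Rightarrow> real \<Rightarrow> real"
  assumes sym: "\<And>x y. h x y = h y x"
    and pos: "\<And>(m::nat) a z. (\<And>k. k < m \<Longrightarrow> 0 < z k) \<Longrightarrow> 0 \<le> (\<Sum>k<m. \<Sum>l<m. a k * a l * h (z k) (z l))"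
    and xy: "0 < x" "0 < y"
  shows "\<bar>h x y\<bar> \<le> (h x x + h y y) / 2"
proof -
  \<comment> \<open>The form is tested at \<open>x\<close> and \<open>y\<close> with coefficients
    (1, s); s = 1 bounds \<open>h x y\<close> from below and s = -1 from above.\<close>
  have "0 \<le> (\<Sum>k<2::nat. \<Sum>l<2::nat. (if k = 0 then 1 else s) * (if l = 0 then 1 else s) * h (if k = 0 then x else y) (if l = 0 then x else y))" for s
    by (rule pos) (use xy in auto)
  from this[of 1] this[of "-1"] show "\<bar>h x y\<bar> \<le> (h x x + h y y) / 2"
    using sym[of x y] by (simp add: numeral_2_eq_2)
qed

text \<open>Through the density, dw(x) dw(y) is a signed measure on \<open>I \<times> I\<close>. The
  regions x < y and x > y contribute equally by the symmetry of \<open>h\<close>; on the diagonal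
  only atoms count and the squared density is 1 there, which leaves h(y,y) times the squared jumps.
  \<open>I\<close> may lack its right end point, since it will be a section of a predictable set;
  for \<open>I = {0<..b}\<close> the value \<open>S\<close> is the iterated path integral.\<close>

lemma (in fv_path) double_integral_decomposition:
  fixes h :: "real \<Rightarrow> real \<Rightarrow> real"
  assumes h [measurable]: "(\<lambda>(x, y). h x y) \<in> borel_measurable (borel \<Otimes>\<^sub>M borel)"
    and sym: "\<And>x y. h x y = h y x"
    and pos_def: "\<And>(m::nat) a z. (\<And>k. k < m \<Longrightarrow> 0 < z k) \<Longrightarrow> 0 \<le> (\<Sum>k<m. \<Sum>l<m. a k * a l * h (z k) (z l))"
    and I [measurable]: "I \<in> sets borel" and I_bounded: "I \<subseteq> {0<..t}"
    and I_initial: "\<And>x y. y \<in> I \<Longrightarrow> 0 < x \<Longrightarrow> x < y \<Longrightarrow> x \<in> I"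
    and fin: "(\<integral>\<^sup>+y\<in>I. (\<integral>\<^sup>+x\<in>I. ennreal \<bar>h x y\<bar> \<partial>variation_measure w) \<partial>variation_measure w) < \<infinity>"
  defines "g \<equiv> \<lambda>y. indicator I y * ((LINT x:{0<..<y}|positive_measure w. h x y) - (LINT x:{0<..<y}|negative_measure w. h x y))"
  shows "\<exists>S\<ge>0. 2 * ((LINT y|positive_measure w. g y) - (LINT y|negative_measure w. g y))
      + enn2real (\<integral>\<^sup>+y\<in>I. ennreal (h y y) * emeasure (variation_measure w) {y} \<partial>variation_measure w) = S \<and>
    (\<forall>b. I = {0<..b} \<longrightarrow> ls_integral w b (\<lambda>y. ls_integral w b (\<lambda>x. h x y)) = S)"
proof -
  interpret V: sigma_finite_measure "variation_measure w" by (rule sigma_finite_variation)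
  interpret P: sigma_finite_measure "positive_measure w" by (rule sigma_finite_pos)
  interpret N: sigma_finite_measure "negative_measure w" by (rule sigma_finite_neg)
  interpret VV: pair_sigma_finite "variation_measure w" "variation_measure w" ..
  let ?V = "variation_measure w" and ?P = "positive_measure w" and ?N = "negative_measure w"
  obtain \<phi> where \<phi>: "jordan_density \<phi>" using ex_jordan_density by blast
  then have \<phi>_meas [measurable]: "\<phi> \<in> borel_measurable borel" and \<phi>_le: "\<And>x. \<bar>\<phi> x\<bar> \<le> 1"
    and \<phi>_int: "\<And>f. integrable ?V f \<Longrightarrow> (LINT x|?P. f x) - (LINT x|?N. f x) = (LINT x|?V. \<phi> x * f x)"
    by (auto simp: jordan_density_def)
  have h_diag: "0 \<le> h y y" if "0 < y" for y
    using pos_def[of 1 "\<lambda>_. y" "\<lambda>_. 1"] that by simp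
  have h_bound: "\<bar>h x y\<bar> \<le> (h x x + h y y) / 2" if "0 < x" "0 < y" for x y
    using sym pos_def that by (rule pos_def_bound)
  define H where "H = (\<lambda>(y, x). indicator I y * indicator I x * h x y :: real)"
  define G where "G = (\<lambda>(y, x). \<phi> y * \<phi> x * H (y, x) :: real)"
  have H_meas [measurable]: "H \<in> borel_measurable (borel \<Otimes>\<^sub>M borel)" unfolding H_def by measurable
  have G_meas [measurable]: "G \<in> borel_measurable (borel \<Otimes>\<^sub>M borel)" unfolding G_def by measurable
  have [measurable_cong]: "sets (?V \<Otimes>\<^sub>M ?V) = sets (borel \<Otimes>\<^sub>M borel)" by (intro sets_pair_measure_cong) auto
  have H_int: "integrable (?V \<Otimes>\<^sub>M ?V) H"
  proof (rule integrableI_bounded)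
    have "(\<integral>\<^sup>+z. norm (H z) \<partial>(?V \<Otimes>\<^sub>M ?V)) = (\<integral>\<^sup>+y. \<integral>\<^sup>+x. norm (H (y, x)) \<partial>?V \<partial>?V)"
      by (rule V.nn_integral_fst[symmetric]) measurable
    also have "\<dots> = (\<integral>\<^sup>+y\<in>I. (\<integral>\<^sup>+x\<in>I. ennreal \<bar>h x y\<bar> \<partial>?V) \<partial>?V)"
      by (intro nn_integral_cong) (auto simp: H_def abs_mult split: split_indicator intro!: nn_integral_cong)
    finally show "(\<integral>\<^sup>+z. norm (H z) \<partial>(?V \<Otimes>\<^sub>M ?V)) < \<infinity>" using fin by simp
  qed measurable
  have part: "integrable (?V \<Otimes>\<^sub>M ?V) (\<lambda>z. r z * H z)" "integrable (?V \<Otimes>\<^sub>M ?V) (\<lambda>z. r z * G z)"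
    if [measurable]: "r \<in> borel_measurable (borel \<Otimes>\<^sub>M borel)" and r: "\<And>z. \<bar>r z\<bar> \<le> 1" for r :: "real \<times> real \<Rightarrow> real"
  proof -
    show "integrable (?V \<Otimes>\<^sub>M ?V) (\<lambda>z. r z * H z)"
      by (rule Bochner_Integration.integrable_bound[OF H_int])
        (use r in \<open>auto simp: abs_mult intro!: mult_left_le_one_le\<close>)
    have "\<bar>r z * \<phi> (fst z) * \<phi> (snd z)\<bar> \<le> 1" for z
      using r[of z] \<phi>_le[of "fst z"] \<phi>_le[of "snd z"] by (auto simp: abs_mult intro!: mult_le_one)
    then have "\<bar>r z * \<phi> (fst z) * \<phi> (snd z)\<bar> * \<bar>H z\<bar> \<le> \<bar>H z\<bar>" for z
      by (intro mult_left_le_one_le) auto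
    then show "integrable (?V \<Otimes>\<^sub>M ?V) (\<lambda>z. r z * G z)"
      by (intro Bochner_Integration.integrable_bound[OF H_int])
        (auto simp: G_def abs_mult split_beta mult_ac)
  qed
  \<comment> \<open>The weight \<open>r\<close> selects a region of the square. The inner integrals
    \<open>k\<close> and \<open>k'\<close> are identified only almost everywhere: where the section
    is not integrable, the difference of the two integrals need not be the integral against the
    density.\<close>
  have key: "(LINT y|?P. k y) - (LINT y|?N. k y) = (LINT z|(?V \<Otimes>\<^sub>M ?V). r z * G z)"
    if [measurable]: "r \<in> borel_measurable (borel \<Otimes>\<^sub>M borel)" and r: "\<And>z. \<bar>r z\<bar> \<le> 1"
      and k: "k = (\<lambda>y. (LINT x|?P. r (y, x) * H (y, x)) - (LINT x|?N. r (y, x) * H (y, x)))"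
    for r :: "real \<times> real \<Rightarrow> real" and k
  proof -
    have [measurable]: "k \<in> borel_measurable borel" unfolding k by measurable
    define k' where "k' y = (LINT x|?V. r (y, x) * \<phi> x * H (y, x))" for y
    have [measurable]: "k' \<in> borel_measurable borel" unfolding k'_def by measurable
    have rH: "integrable (?V \<Otimes>\<^sub>M ?V) (\<lambda>z. (r z * \<phi> (snd z)) * H z)"
      using r \<phi>_le by (intro part(1)) (auto simp: abs_mult intro!: mult_le_one)
    have "AE y in ?V. k y = k' y"
      using VV.AE_integrable_fst'[OF part(1)[OF that(1) r]]
    proof eventually_elim
      case (elim y)
      then show ?case unfolding k k'_def by (subst \<phi>_int) (auto simp: mult_ac)
    qed
    moreover have "integrable ?V k'"
      using VV.integrable_fst'[OF rH] by (simp add: k'_def[abs_def])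
    ultimately have "integrable ?V k" by (subst integrable_cong_AE[where g = k']) auto
    then have "(LINT y|?P. k y) - (LINT y|?N. k y) = (LINT y|?V. \<phi> y * k y)" by (rule \<phi>_int)
    also have "\<dots> = (LINT y|?V. \<phi> y * k' y)"
      using \<open>AE y in ?V. k y = k' y\<close> by (intro integral_cong_AE) auto
    also have "\<dots> = (LINT y|?V. LINT x|?V. r (y, x) * G (y, x))"
      by (simp add: k'_def G_def mult_ac flip: integral_mult_right_zero)
    also have "\<dots> = (LINT z|(?V \<Otimes>\<^sub>M ?V). r z * G z)"
      by (rule VV.integral_fst'[OF part(2)[OF that(1) r]])
    finally show ?thesis .
  qed
  define S where "S = (LINT z|(?V \<Otimes>\<^sub>M ?V). G z)"
  define L where "L = (\<lambda>(y::real, x::real). of_bool (x < y) :: real)"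
  define R where "R = (\<lambda>(y::real, x::real). of_bool (y < x) :: real)"
  define D where "D = (\<lambda>(y::real, x::real). of_bool (y = x) :: real)"
  have [measurable]: "L \<in> borel_measurable (borel \<Otimes>\<^sub>M borel)" "R \<in> borel_measurable (borel \<Otimes>\<^sub>M borel)"
    "D \<in> borel_measurable (borel \<Otimes>\<^sub>M borel)"
    unfolding L_def R_def D_def by measurable
  have le1: "\<bar>L z\<bar> \<le> 1" "\<bar>R z\<bar> \<le> 1" "\<bar>D z\<bar> \<le> 1" for z
    by (auto simp: L_def R_def D_def split_beta)
  have "G z = L z * G z + R z * G z + D z * G z" for z
    by (cases z) (auto simp: L_def R_def D_def)
  then have "S = (LINT z|(?V \<Otimes>\<^sub>M ?V). L z * G z + R z * G z + D z * G z)"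
    unfolding S_def by presburger
  also have "\<dots> = (LINT z|(?V \<Otimes>\<^sub>M ?V). L z * G z) + (LINT z|(?V \<Otimes>\<^sub>M ?V). R z * G z) + (LINT z|(?V \<Otimes>\<^sub>M ?V). D z * G z)"
    using part(2)[of L] part(2)[of R] part(2)[of D] le1 by simp
  also have "(LINT z|(?V \<Otimes>\<^sub>M ?V). R z * G z) = (LINT z|(?V \<Otimes>\<^sub>M ?V). L z * G z)"
  proof -
    have "(LINT z|(?V \<Otimes>\<^sub>M ?V). R z * G z) = (\<integral>(x, y). R (y, x) * G (y, x) \<partial>(?V \<Otimes>\<^sub>M ?V))"
      by (rule VV.integral_product_swap[symmetric]) measurable
    also have "\<dots> = (LINT z|(?V \<Otimes>\<^sub>M ?V). L z * G z)"
      using sym by (intro Bochner_Integration.integral_cong) (auto simp: L_def R_def G_def H_def mult_ac)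
    finally show ?thesis .
  qed
  also have "(LINT z|(?V \<Otimes>\<^sub>M ?V). L z * G z) = (LINT y|?P. g y) - (LINT y|?N. g y)"
  proof (rule key[symmetric])
    \<comment> \<open>As \<open>I\<close> is initial, 0 < x < y with y in \<open>I\<close> already
      puts x in \<open>I\<close>.\<close>
    show "g = (\<lambda>y. (LINT x|?P. L (y, x) * H (y, x)) - (LINT x|?N. L (y, x) * H (y, x)))"
    proof
      fix y
      have "indicator I y * (LINT x:{0<..<y}|K. h x y) = (LINT x|K. L (y, x) * H (y, x))" for K
        unfolding set_lebesgue_integral_def
        using I_initial I_bounded
        by (subst integral_mult_right_zero[symmetric], intro Bochner_Integration.integral_cong)
          (auto simp: L_def H_def split: split_indicator)
      then show "g y = (LINT x|?P. L (y, x) * H (y, x)) - (LINT x|?N. L (y, x) * H (y, x))"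
        by (simp add: g_def right_diff_distrib)
    qed
  qed (use le1 in auto)
  also have "(LINT z|(?V \<Otimes>\<^sub>M ?V). D z * G z) = enn2real (\<integral>\<^sup>+y\<in>I. ennreal (h y y) * emeasure ?V {y} \<partial>?V)"
  proof -
    have fin_atom: "emeasure ?V {y} < \<infinity>" for y
      using V.emeasure_bounded_finite[of "{y}" "y-1" y] by (auto simp: path_measures)
    have "(LINT z|(?V \<Otimes>\<^sub>M ?V). D z * G z) = (LINT y|?V. LINT x|?V. D (y, x) * G (y, x))"
      using le1 by (intro VV.integral_fst'[symmetric] part(2)) auto
    also have "\<dots> = (LINT y|?V. indicator I y * h y y * measure ?V {y})"
    proof (intro Bochner_Integration.integral_cong refl)
      fix y
      have "(LINT x|?V. D (y, x) * G (y, x)) = (LINT x|?V. ((\<phi> y)\<^sup>2 * indicator I y * h y y) * indicator {y} x)"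
        by (intro Bochner_Integration.integral_cong)
          (auto simp: D_def G_def H_def power2_eq_square split: split_indicator)
      also have "\<dots> = ((\<phi> y)\<^sup>2 * indicator I y * h y y) * measure ?V {y}"
        using fin_atom[of y] by simp
      also have "\<dots> = indicator I y * h y y * ((\<phi> y)\<^sup>2 * measure ?V {y})" by simp
      also have "\<dots> = indicator I y * h y y * measure ?V {y}"
        using jordan_density_atom[OF \<phi>, of y] I_bounded by (auto split: split_indicator)
      finally show "(LINT x|?V. D (y, x) * G (y, x)) = indicator I y * h y y * measure ?V {y}" .
    qed
    also have "\<dots> = enn2real (\<integral>\<^sup>+y. ennreal (indicator I y * h y y * measure ?V {y}) \<partial>?V)"
    proof (rule integral_eq_nn_integral)
      show "(\<lambda>y. indicator I y * h y y * measure ?V {y}) \<in> borel_measurable ?V"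
        unfolding measure_def by measurable
      show "AE y in ?V. 0 \<le> indicator I y * h y y * measure ?V {y}"
        using h_diag I_bounded by (intro AE_I2) (auto split: split_indicator)
    qed
    also have "(\<integral>\<^sup>+y. ennreal (indicator I y * h y y * measure ?V {y}) \<partial>?V) = (\<integral>\<^sup>+y\<in>I. ennreal (h y y) * emeasure ?V {y} \<partial>?V)"
      using h_diag I_bounded fin_atom
      by (intro nn_integral_cong) (auto simp: ennreal_mult' emeasure_eq_ennreal_measure less_top split: split_indicator)
    finally show ?thesis .
  qed
  finally have S_eq: "2 * ((LINT y|?P. g y) - (LINT y|?N. g y))
      + enn2real (\<integral>\<^sup>+y\<in>I. ennreal (h y y) * emeasure ?V {y} \<partial>?V) = S" by simp
  have ls: "ls_integral w b (\<lambda>y. ls_integral w b (\<lambda>x. h x y)) = S" if "I = {0<..b}" for b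
  proof -
    have *: "indicator I y * ls_integral w b (\<lambda>x. h x y) = (LINT x|?P. 1 * H (y, x)) - (LINT x|?N. 1 * H (y, x))" for y
      unfolding ls_integral_def set_lebesgue_integral_def that[symmetric] H_def
      by (simp add: right_diff_distrib mult.assoc flip: integral_mult_right_zero)
    have "ls_integral w b (\<lambda>y. ls_integral w b (\<lambda>x. h x y)) =
      (LINT y|?P. indicator I y * ls_integral w b (\<lambda>x. h x y)) - (LINT y|?N. indicator I y * ls_integral w b (\<lambda>x. h x y))"
      unfolding that by (subst ls_integral_def) (simp add: set_lebesgue_integral_def)
    also have "\<dots> = (LINT z|(?V \<Otimes>\<^sub>M ?V). 1 * G z)"
      unfolding * by (rule key) auto
    finally show ?thesis by (simp add: S_def)
  qed
  have "0 \<le> S"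
  proof (rule LIMSEQ_le_const)
    \<comment> \<open>The kernel is cut off where its diagonal exceeds \<open>c\<close>:
      \<open>pos_def_bound\<close> then bounds it by \<open>c\<close>, and the form stays positive
      because the cut-off is an indicator in x times the same indicator in y.\<close>
    define B where "B c = (\<lambda>(y, x). of_bool (h y y \<le> real c \<and> h x x \<le> real c) :: real)" for c
    have B_meas [measurable]: "B c \<in> borel_measurable (borel \<Otimes>\<^sub>M borel)" for c
      unfolding B_def by measurable
    have B_le: "\<bar>B c z\<bar> \<le> 1" for c z by (auto simp: B_def split_beta)
    show "(\<lambda>c. LINT z|(?V \<Otimes>\<^sub>M ?V). B c z * G z) \<longlonglongrightarrow> S"
      unfolding S_def
    proof (rule integral_dominated_convergence[where w = "\<lambda>z. \<bar>G z\<bar>"])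
      show "integrable (?V \<Otimes>\<^sub>M ?V) (\<lambda>z. \<bar>G z\<bar>)" using part(2)[of "\<lambda>_. 1"] by simp
      show "AE z in ?V \<Otimes>\<^sub>M ?V. (\<lambda>c. B c z * G z) \<longlonglongrightarrow> G z"
      proof (intro AE_I2)
        fix z :: "real \<times> real"
        obtain c0 where "max (h (fst z) (fst z)) (h (snd z) (snd z)) \<le> real c0" using real_arch_simple by blast
        then have "\<forall>\<^sub>F c in sequentially. B c z * G z = G z"
          by (intro eventually_sequentiallyI[of c0]) (auto simp: B_def split_beta)
        then show "(\<lambda>c. B c z * G z) \<longlonglongrightarrow> G z" by (rule tendsto_eventually)
      qed
      show "AE z in ?V \<Otimes>\<^sub>M ?V. norm (B c z * G z) \<le> \<bar>G z\<bar>" for c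
        using B_le by (auto simp: abs_mult intro!: mult_left_le_one_le)
    qed measurable
    have "0 \<le> (LINT z|(?V \<Otimes>\<^sub>M ?V). B c z * G z)" for c
    proof -
      define \<nu> where "\<nu> = density ?V (indicator I)"
      have [measurable_cong, simp]: "sets \<nu> = sets borel" "space \<nu> = UNIV" by (simp_all add: \<nu>_def)
      have "finite_measure \<nu>"
        using V.emeasure_bounded_finite[OF I_bounded]
        by (intro finite_measureI) (simp add: \<nu>_def emeasure_density path_measures less_top)
      have "0 \<le> (LINT y|\<nu>. LINT x|\<nu>. B c (y, x) * G (y, x))"
      proof (rule integral_pos_def_finite[OF \<open>finite_measure \<nu>\<close>])
        have bd: "\<bar>B c (y, x) * G (y, x)\<bar> \<le> real c" for y x
        proof (cases "h y y \<le> real c \<and> h x x \<le> real c \<and> y \<in> I \<and> x \<in> I")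
          case True
          then have "\<bar>h x y\<bar> \<le> (h x x + h y y) / 2"
            using I_bounded by (intro h_bound) auto
          moreover have "\<bar>\<phi> y * \<phi> x * h x y\<bar> \<le> \<bar>h x y\<bar>"
            using \<phi>_le[of x] \<phi>_le[of y] by (auto simp: abs_mult intro!: mult_left_le_one_le mult_le_one)
          ultimately show ?thesis using True by (simp add: B_def G_def H_def)
        qed (auto simp: B_def G_def H_def)
        then show "\<bar>B c z * G z\<bar> \<le> real c" for z by (cases z) auto
        fix n :: nat and x :: "nat \<Rightarrow> real"
        \<comment> \<open>The density and the cut-off become coefficients of the quadratic form.
          Points outside \<open>I\<close> are moved to 1, because positivity is available at
          positive points only, and they get the coefficient 0.\<close>
        define a where "a k = (if x k \<in> I \<and> h (x k) (x k) \<le> real c then \<phi> (x k) else 0)" for k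
        define z where "z k = (if x k \<in> I then x k else 1)" for k
        have "0 \<le> (\<Sum>k<n. \<Sum>l<n. a k * a l * h (z k) (z l))"
          by (rule pos_def) (use I_bounded in \<open>auto simp: z_def\<close>)
        also have "\<dots> = (\<Sum>k<n. \<Sum>l<n. B c (x k, x l) * G (x k, x l))"
          using sym by (intro sum.cong refl) (auto simp: a_def z_def B_def G_def H_def)
        finally show "0 \<le> (\<Sum>k<n. \<Sum>l<n. B c (x k, x l) * G (x k, x l))" .
      qed measurable
      also have "\<dots> = (LINT y|?V. LINT x|?V. B c (y, x) * G (y, x))"
      proof -
        have [measurable]: "(\<lambda>y. LINT x|\<nu>. B c (y, x) * G (y, x)) \<in> borel_measurable borel"
        proof -
          interpret \<nu>: finite_measure \<nu> by fact
          show ?thesis by measurable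
        qed
        have 1: "integral\<^sup>L \<nu> f = (LINT x|?V. indicator I x * f x)" if "f \<in> borel_measurable borel" for f :: "real \<Rightarrow> real"
          unfolding \<nu>_def ennreal_indicator[symmetric] using that by (subst integral_density) auto
        have "(LINT y|\<nu>. LINT x|\<nu>. B c (y, x) * G (y, x)) = (LINT y|?V. indicator I y * (LINT x|\<nu>. B c (y, x) * G (y, x)))"
          by (rule 1) measurable
        also have "\<dots> = (LINT y|?V. indicator I y * (LINT x|?V. indicator I x * (B c (y, x) * G (y, x))))"
          by (subst 1) auto
        also have "\<dots> = (LINT y|?V. LINT x|?V. B c (y, x) * G (y, x))"
          unfolding integral_mult_right_zero[symmetric]
          by (intro Bochner_Integration.integral_cong) (auto simp: G_def H_def split: split_indicator)
        finally show ?thesis .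
      qed
      also have "\<dots> = (LINT z|(?V \<Otimes>\<^sub>M ?V). B c z * G z)"
        using B_le by (intro VV.integral_fst' part(2)) auto
      finally show ?thesis .
    qed
    then show "\<exists>N. \<forall>c\<ge>N. 0 \<le> (LINT z|(?V \<Otimes>\<^sub>M ?V). B c z * G z)" by blast
  qed
  then show ?thesis using S_eq ls by blast
qed

section \<open>Integration by parts for the square of a path\<close>

lemma borel_measure_eqI_Ioc_0:
  fixes \<mu> \<nu> :: "real measure"
  assumes sets: "sets \<mu> = sets borel" "sets \<nu> = sets borel"
    and null: "emeasure \<mu> {..0} = 0" "emeasure \<nu> {..0} = 0"
    and eq: "\<And>d. 0 \<le> d \<Longrightarrow> emeasure \<mu> {0<..d} = emeasure \<nu> {0<..d}"
    and fin: "\<And>d. 0 \<le> d \<Longrightarrow> emeasure \<mu> {0<..d} < \<infinity>"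
  shows "\<mu> = \<nu>"
proof (rule borel_measure_eqI[OF sets])
  have Ioc: "emeasure K {a<..b} = emeasure K {0<..max 0 b} - emeasure K {0<..max 0 a}"
    if K: "sets K = sets borel" "emeasure K {..0} = 0" "\<And>d. 0 \<le> d \<Longrightarrow> emeasure K {0<..d} < \<infinity>" and "a \<le> b" for K and a b :: real
  proof -
    have "AE x in K. x \<in> {a<..b} \<longleftrightarrow> x \<in> {0<..max 0 b} - {0<..max 0 a}"
      using K(1,2) \<open>a \<le> b\<close> by (intro AE_I[of _ _ "{..0}"]) auto
    then have *: "emeasure K {a<..b} = emeasure K ({0<..max 0 b} - {0<..max 0 a})"
      by (rule emeasure_eq_AE) (use K in auto)
    have "emeasure K {0<..max 0 a} < \<infinity>" by (rule K(3)) simp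
    then have "emeasure K ({0<..max 0 b} - {0<..max 0 a}) = emeasure K {0<..max 0 b} - emeasure K {0<..max 0 a}"
      using K(1) \<open>a \<le> b\<close> by (intro emeasure_Diff) (auto simp: less_top)
    with * show ?thesis by simp
  qed
  have fin': "0 \<le> d \<Longrightarrow> emeasure \<nu> {0<..d} < \<infinity>" for d using eq fin by simp
  show "emeasure \<mu> {a<..b} = emeasure \<nu> {a<..b}" if "a \<le> b" for a b
    using Ioc[OF sets(1) null(1) fin that] Ioc[OF sets(2) null(2) fin' that] eq by simp
  show "emeasure \<mu> {a<..b} < \<infinity>" for a b
  proof (cases "a \<le> b")
    case True
    then show ?thesis using Ioc[OF sets(1) null(1) fin, of a b] fin[of "max 0 b"]
        order.strict_trans1[OF diff_le_self_ennreal, of "emeasure \<mu> {0<..max 0 b}" \<infinity>]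
      by simp
  qed auto
qed

context fv_path begin

text \<open>The left limit of the path is split into two nonnegative functions, initial value
  included, so that integrals against it can be taken in [0,\<infinity>].\<close>

definition left_pos :: "real \<Rightarrow> ennreal" where
  "left_pos y = ennreal (max 0 (w 0)) + emeasure (positive_measure w) {0<..<y}"

definition left_neg :: "real \<Rightarrow> ennreal" where
  "left_neg y = ennreal (max 0 (- w 0)) + emeasure (negative_measure w) {0<..<y}"

lemma measurable_Ioo:
  fixes K :: "real measure"
  assumes [measurable_cong]: "sets K = sets borel" and "sigma_finite_measure K"
  shows "(\<lambda>y. emeasure K {0<..<y}) \<in> borel_measurable borel"
proof -
  interpret K: sigma_finite_measure K by fact
  have "{p \<in> space (borel \<Otimes>\<^sub>M borel). 0 < snd p \<and> snd p < (fst p :: real)} \<in> sets (borel \<Otimes>\<^sub>M borel)"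
    by measurable
  then have "{p :: real \<times> real. 0 < snd p \<and> snd p < fst p} \<in> sets (borel \<Otimes>\<^sub>M K)"
    by (simp add: space_pair_measure sets_pair_measure_cong[OF refl assms(1)])
  then have "(\<lambda>x. emeasure K (Pair x -` {p :: real \<times> real. 0 < snd p \<and> snd p < fst p})) \<in> borel_measurable borel"
    by (rule K.measurable_emeasure_Pair)
  moreover have "Pair x -` {p :: real \<times> real. 0 < snd p \<and> snd p < fst p} = {0<..<x}" for x by auto
  ultimately show ?thesis by simp
qed

lemma left_measurable [measurable]: "left_pos \<in> borel_measurable borel" "left_neg \<in> borel_measurable borel"
  unfolding left_pos_def left_neg_def
  using measurable_Ioo[OF sets_path_measures(2) sigma_finite_pos] measurable_Ioo[OF sets_path_measures(3) sigma_finite_neg]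
  by auto

text \<open>
  Integration by parts, \<open>d(w\<^sup>2) = 2 w(y-) dw + \<Delta>w dw\<close>, with \<open>w(y-) = left_pos y - left_neg y\<close>; it
  is the case \<open>h = 1\<close> of the decomposition of a double integral.
\<close>

lemma square_decomposition:
  assumes e: "0 \<le> e"
  shows "\<exists>\<alpha> aP aN bP bN. 0 \<le> \<alpha> \<and> 0 \<le> aP \<and> 0 \<le> aN \<and> 0 \<le> bP \<and> 0 \<le> bN \<and>
    (\<integral>\<^sup>+y\<in>{0<..e}. emeasure (variation_measure w) {y} \<partial>variation_measure w) = ennreal \<alpha> \<and>
    (\<integral>\<^sup>+y\<in>{0<..e}. left_pos y \<partial>positive_measure w) = ennreal aP \<and>
    (\<integral>\<^sup>+y\<in>{0<..e}. left_pos y \<partial>negative_measure w) = ennreal aN \<and>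
    (\<integral>\<^sup>+y\<in>{0<..e}. left_neg y \<partial>positive_measure w) = ennreal bP \<and>
    (\<integral>\<^sup>+y\<in>{0<..e}. left_neg y \<partial>negative_measure w) = ennreal bN \<and>
    (w e)\<^sup>2 - (w 0)\<^sup>2 = \<alpha> + 2 * (aP - bP) - 2 * (aN - bN)"
proof -
  let ?V = "variation_measure w" and ?P = "positive_measure w" and ?N = "negative_measure w"
  let ?I = "{0<..e}"
  interpret P: sigma_finite_measure ?P by (rule sigma_finite_pos)
  interpret N: sigma_finite_measure ?N by (rule sigma_finite_neg)
  note [measurable] = measurable_Ioo[OF sets_path_measures(2) sigma_finite_pos] measurable_Ioo[OF sets_path_measures(3) sigma_finite_neg]
  have finV: "A \<subseteq> {0<..e} \<Longrightarrow> emeasure ?V A < \<infinity>" for A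
    using V.emeasure_bounded_finite[of A 0 e] by (simp add: path_measures)
  have fin: "A \<subseteq> {0<..u} \<Longrightarrow> emeasure ?P A < \<infinity>" "A \<subseteq> {0<..u} \<Longrightarrow> emeasure ?N A < \<infinity>" for A u
    using pos.emeasure_bounded_finite[of A 0 u] neg.emeasure_bounded_finite[of A 0 u] by (simp_all add: path_measures)
  define p where "p y = measure ?P {0<..<y}" for y
  define n where "n y = measure ?N {0<..<y}" for y
  have p_nn: "emeasure ?P {0<..<y} = ennreal (p y)" "emeasure ?N {0<..<y} = ennreal (n y)" for y
  proof -
    have "{0<..<y} \<subseteq> {0<..y}" by auto
    from fin[OF this] show "emeasure ?P {0<..<y} = ennreal (p y)" "emeasure ?N {0<..<y} = ennreal (n y)"
      by (auto simp: p_def n_def less_top intro!: emeasure_eq_ennreal_measure)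
  qed
  have [measurable]: "p \<in> borel_measurable borel" "n \<in> borel_measurable borel"
    unfolding p_def[abs_def] n_def[abs_def] measure_def by measurable
  have p0: "0 \<le> p y" "0 \<le> n y" for y by (auto simp: p_def n_def)
  have pe: "p y \<le> measure ?P ?I" "n y \<le> measure ?N ?I" if "y \<in> ?I" for y
    using that fin[of ?I e] unfolding p_def n_def by (auto intro!: measure_mono_fmeasurable simp: fmeasurable_def)
  define g :: "real \<Rightarrow> real" where "g y = indicator ?I y * ((LINT x:{0<..<y}|?P. 1) - (LINT x:{0<..<y}|?N. 1))" for y
  have g: "g y = indicator ?I y * (p y - n y)" for y
    unfolding g_def p_def n_def by (simp add: set_lebesgue_integral_def)
  have finVV: "(\<integral>\<^sup>+y\<in>?I. (\<integral>\<^sup>+x\<in>?I. ennreal \<bar>1\<bar> \<partial>?V) \<partial>?V) < \<infinity>"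
  proof -
    have "(\<integral>\<^sup>+y\<in>?I. (\<integral>\<^sup>+x\<in>?I. ennreal \<bar>1\<bar> \<partial>?V) \<partial>?V) = emeasure ?V ?I * emeasure ?V ?I"
      by (simp add: nn_integral_cmult)
    then show ?thesis using finV[of ?I] by (simp add: ennreal_mult_less_top)
  qed
  have sum_sq: "0 \<le> (\<Sum>k<m. \<Sum>l<m. a k * a l * 1)" for m :: nat and a :: "nat \<Rightarrow> real"
    by (simp add: sum_product[symmetric])
  have "\<exists>S\<ge>0. 2 * ((LINT y|?P. g y) - (LINT y|?N. g y)) + enn2real (\<integral>\<^sup>+y\<in>?I. ennreal 1 * emeasure ?V {y} \<partial>?V) = S \<and>
    (\<forall>b. ?I = {0<..b} \<longrightarrow> ls_integral w b (\<lambda>y. ls_integral w b (\<lambda>x. 1)) = S)"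
    unfolding g_def by (rule double_integral_decomposition[where t = e and h = "\<lambda>_ _. 1"]) (use finVV sum_sq in auto)
  then have S: "2 * ((LINT y|?P. g y) - (LINT y|?N. g y)) + enn2real (\<integral>\<^sup>+y\<in>?I. emeasure ?V {y} \<partial>?V)
      = ls_integral w e (\<lambda>y. ls_integral w e (\<lambda>x. 1))" by auto
  have U: "0 \<le> U_pos e - U_pos 0" "0 \<le> U_neg e - U_neg 0"
    using V_increment[of 0 e] e by (simp_all add: field_simps)
  have PN: "measure ?P ?I = U_pos e - U_pos 0" "measure ?N ?I = U_neg e - U_neg 0"
    using e U by (simp_all add: measure_def emeasure_pos emeasure_neg)
  have ls1: "ls_integral w e (\<lambda>x. c) = c * (w e - w 0)" for c
  proof -
    have "ls_integral w e (\<lambda>x. c) = c * (measure ?P ?I - measure ?N ?I)"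
      using fin[of ?I e] by (simp add: ls_integral_def set_lebesgue_integral_def right_diff_distrib)
    then show ?thesis unfolding PN by (simp add: field_simps)
  qed
  have intb: "integrable K (\<lambda>y. indicator ?I y * f y)" 
    if "K = ?P \<or> K = ?N" and f: "f \<in> borel_measurable borel" "\<And>y. y \<in> ?I \<Longrightarrow> \<bar>f y\<bar> \<le> c" for K c and f :: "real \<Rightarrow> real"
  proof (rule Bochner_Integration.integrable_bound)
    show "integrable K (\<lambda>y. indicator ?I y * c)" using that fin[of ?I e] by auto
    have "norm (indicator ?I y * f y) \<le> norm (indicator ?I y * c)" for y
      using f(2)[of y] by (auto split: split_indicator)
    then show "AE y in K. norm (indicator ?I y * f y) \<le> norm (indicator ?I y * c)" by simp
  qed (use that in auto)
  have P: "(LINT y|K. indicator ?I y * (p y - n y)) = (LINT y|K. indicator ?I y * p y) - (LINT y|K. indicator ?I y * n y)"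
    if K: "K = ?P \<or> K = ?N" for K
    using intb[OF K, of p "measure ?P ?I"] intb[OF K, of n "measure ?N ?I"] p0 pe
    by (simp add: right_diff_distrib)
  have L: "(\<integral>\<^sup>+y\<in>?I. (ennreal c + ennreal (f y)) \<partial>K) = ennreal (c * measure K ?I + (LINT y|K. indicator ?I y * f y))"
    if K: "K = ?P \<or> K = ?N" and f [measurable]: "f \<in> borel_measurable borel" and f': "\<And>y. y \<in> ?I \<Longrightarrow> 0 \<le> f y \<and> f y \<le> d" and c: "0 \<le> c"
    for K c d f
  proof -
    have int: "integrable K (\<lambda>y. indicator ?I y * c)" "integrable K (\<lambda>y. indicator ?I y * f y)"
    proof -
      show "integrable K (\<lambda>y. indicator ?I y * c)" by (rule intb[OF K, of _ c]) (use c in auto)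
      show "integrable K (\<lambda>y. indicator ?I y * f y)" by (rule intb[OF K f, of d]) (use f' in auto)
    qed
    have "(\<integral>\<^sup>+y\<in>?I. (ennreal c + ennreal (f y)) \<partial>K) = (\<integral>\<^sup>+y. ennreal (indicator ?I y * c + indicator ?I y * f y) \<partial>K)"
      using f' c by (intro nn_integral_cong) (auto split: split_indicator)
    also have "\<dots> = ennreal (LINT y|K. indicator ?I y * c + indicator ?I y * f y)"
      using int f' c by (intro nn_integral_eq_integral) (auto split: split_indicator)
    also have "(LINT y|K. indicator ?I y * c + indicator ?I y * f y) = c * measure K ?I + (LINT y|K. indicator ?I y * f y)"
      using int fin[of ?I e] K by (auto simp: mult.commute)
    finally show ?thesis .
  qed
  define aP where "aP = max 0 (w 0) * measure ?P ?I + (LINT y|?P. indicator ?I y * p y)"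
  define aN where "aN = max 0 (w 0) * measure ?N ?I + (LINT y|?N. indicator ?I y * p y)"
  define bP where "bP = max 0 (- w 0) * measure ?P ?I + (LINT y|?P. indicator ?I y * n y)"
  define bN where "bN = max 0 (- w 0) * measure ?N ?I + (LINT y|?N. indicator ?I y * n y)"
  define \<alpha> where "\<alpha> = enn2real (\<integral>\<^sup>+y\<in>?I. emeasure ?V {y} \<partial>?V)"
  have "0 \<le> aP" "0 \<le> aN" "0 \<le> bP" "0 \<le> bN"
    using p0 by (auto simp: aP_def aN_def bP_def bN_def intro!: add_nonneg_nonneg mult_nonneg_nonneg Bochner_Integration.integral_nonneg)
  moreover have "(\<integral>\<^sup>+y\<in>?I. emeasure ?V {y} \<partial>?V) = ennreal \<alpha>"
  proof -
    have "(\<integral>\<^sup>+y\<in>?I. emeasure ?V {y} \<partial>?V) \<le> (\<integral>\<^sup>+y. emeasure ?V ?I * indicator ?I y \<partial>?V)"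
      by (intro nn_integral_mono) (auto split: split_indicator intro!: emeasure_mono)
    also have "\<dots> < \<infinity>" using finV[of ?I] by (simp add: nn_integral_cmult ennreal_mult_less_top)
    finally show ?thesis by (simp add: \<alpha>_def less_top)
  qed
  moreover have "(\<integral>\<^sup>+y\<in>?I. left_pos y \<partial>?P) = ennreal aP" "(\<integral>\<^sup>+y\<in>?I. left_pos y \<partial>?N) = ennreal aN"
    unfolding left_pos_def p_nn aP_def aN_def
    by (rule L[where d = "measure ?P ?I"]; use p0 pe in auto)+
  moreover have "(\<integral>\<^sup>+y\<in>?I. left_neg y \<partial>?P) = ennreal bP" "(\<integral>\<^sup>+y\<in>?I. left_neg y \<partial>?N) = ennreal bN"
    unfolding left_neg_def p_nn bP_def bN_def
    by (rule L[where d = "measure ?N ?I"]; use p0 pe in auto)+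
  \<comment> \<open>The kernel 1 gives the square of \<open>w e - w 0\<close>. The remaining 2 w(0)
    (w(e) - w(0)) comes from the constants \<open>max 0 (w 0)\<close> and
    \<open>max 0 (- w 0)\<close> in the left limits.\<close>
  moreover have "(w e)\<^sup>2 - (w 0)\<^sup>2 = \<alpha> + 2 * (aP - bP) - 2 * (aN - bN)"
  proof -
    have w0: "max 0 (w 0) - max 0 (- w 0) = w 0" by simp
    have "aP - bP = (max 0 (w 0) - max 0 (- w 0)) * measure ?P ?I + (LINT y|?P. g y)"
      by (simp add: aP_def bP_def g P left_diff_distrib)
    moreover have "aN - bN = (max 0 (w 0) - max 0 (- w 0)) * measure ?N ?I + (LINT y|?N. g y)"
      by (simp add: aN_def bN_def g P left_diff_distrib)
    moreover have "measure ?P ?I - measure ?N ?I = w e - w 0"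
      unfolding PN by (simp add: field_simps)
    then have "w 0 * measure ?P ?I - w 0 * measure ?N ?I = w 0 * (w e - w 0)"
      by (simp flip: right_diff_distrib)
    moreover have "2 * ((LINT y|?P. g y) - (LINT y|?N. g y)) + \<alpha> = (w e - w 0)\<^sup>2"
      using S unfolding ls1 \<alpha>_def by (simp add: power2_eq_square)
    ultimately show ?thesis unfolding w0 by (simp add: power2_eq_square algebra_simps)
  qed
  moreover have "0 \<le> \<alpha>" by (simp add: \<alpha>_def)
  ultimately show ?thesis
    by (intro exI[of _ \<alpha>] exI[of _ aP] exI[of _ aN] exI[of _ bP] exI[of _ bN] conjI)
qed

text \<open>The local martingale \<open>W\<^sup>2 - A\<close>, stopped at a localising time, has
  paths of this kind. So the results on martingales of finite variation will apply to it as well as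
  to \<open>W\<close>.\<close>

lemma fv_path_stopped_square:
  assumes A: "inc_path A" and s: "0 \<le> s"
  shows "fv_path (\<lambda>y. (w (min y s))\<^sup>2 - A (min y s))"
proof
  interpret A: inc_path A by fact
  have A_mono: "0 \<le> x \<Longrightarrow> x \<le> y \<Longrightarrow> A x \<le> A y" for x y
    using mono_onD[OF A.inc, of x y] by auto
  show "locally_finite_variation (\<lambda>y. (w (min y s))\<^sup>2 - A (min y s))"
    unfolding locally_finite_variation_def
  proof (intro allI impI)
    fix t :: real assume t: "0 \<le> t"
    \<comment> \<open>\<open>C\<close> bounds the factor a + b in a^2 - b^2 = (a + b)(a - b) for two
      values of \<open>w\<close> on \<open>{0..t}\<close>.\<close>
    define C where "C = 2 * (\<bar>w 0\<bar> + V t)"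
    have C: "0 \<le> C" using V_nonneg[OF t] by (simp add: C_def)
    have w_le: "\<bar>w x\<bar> \<le> C / 2" if "0 \<le> x" "x \<le> t" for x
      using abs_diff_le_V[OF that(1)] V_mono[OF that] by (simp add: C_def)
    have "(\<Sum>i<m. \<bar>((w (min (p (Suc i)) s))\<^sup>2 - A (min (p (Suc i)) s)) - ((w (min (p i) s))\<^sup>2 - A (min (p i) s))\<bar>)
      \<le> C * V t + (A t - A 0)" if p: "mono p" "range p \<subseteq> {0..t}" for p :: "nat \<Rightarrow> real" and m :: nat
    proof -
      define q where "q i = min (p i) s" for i
      have q: "mono q" "range q \<subseteq> {0..t}" 
        using p range_bounds[OF p(2)] s unfolding q_def mono_def by (auto simp: image_subset_iff min_le_iff_disj intro: min.mono)
      have qt: "0 \<le> q i" "q i \<le> t" "q i \<le> q (Suc i)" for i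
        using range_bounds[OF q(2)] monoD[OF q(1)] by auto
      have "\<bar>((w (q (Suc i)))\<^sup>2 - A (q (Suc i))) - ((w (q i))\<^sup>2 - A (q i))\<bar>
          \<le> C * \<bar>w (q (Suc i)) - w (q i)\<bar> + (A (q (Suc i)) - A (q i))" for i
      proof -
        have "(w (q (Suc i)))\<^sup>2 - (w (q i))\<^sup>2 = (w (q (Suc i)) + w (q i)) * (w (q (Suc i)) - w (q i))"
          by (simp add: power2_eq_square algebra_simps)
        moreover have "\<bar>(w (q (Suc i)) + w (q i)) * (w (q (Suc i)) - w (q i))\<bar> \<le> C * \<bar>w (q (Suc i)) - w (q i)\<bar>"
          unfolding abs_mult using w_le[OF qt(1,2), of i] w_le[OF qt(1,2), of "Suc i"] by (intro mult_right_mono) auto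
        ultimately show ?thesis using A_mono[of "q i" "q (Suc i)"] qt[of i] by linarith
      qed
      then have "(\<Sum>i<m. \<bar>((w (q (Suc i)))\<^sup>2 - A (q (Suc i))) - ((w (q i))\<^sup>2 - A (q i))\<bar>)
          \<le> (\<Sum>i<m. C * \<bar>w (q (Suc i)) - w (q i)\<bar> + (A (q (Suc i)) - A (q i)))"
        by (rule sum_mono)
      also have "\<dots> = C * (\<Sum>i<m. \<bar>w (q (Suc i)) - w (q i)\<bar>) + (A (q m) - A (q 0))"
        by (simp add: sum.distrib sum_distrib_left sum_lessThan_telescope[of "\<lambda>i. A (q i)"])
      also have "\<dots> \<le> C * V t + (A t - A 0)"
        using partition_sum_le[OF q, of m] C A_mono[of "q m" t] A_mono[of 0 "q 0"] qt[of m] qt[of 0]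
        by (intro add_mono mult_left_mono diff_mono) auto
      finally show ?thesis by (simp add: q_def)
    qed
    then show "bdd_above (variation_sums (\<lambda>y. (w (min y s))\<^sup>2 - A (min y s)) t)"
      by (intro bdd_aboveI) (auto simp: variation_sums_def)
  qed
  show "right_continuous_path (\<lambda>y. (w (min y s))\<^sup>2 - A (min y s))"
    unfolding right_continuous_path_def continuous_within
  proof (intro allI impI)
    fix t :: real assume t: "0 \<le> t"
    have lim: "((\<lambda>y. min y s) \<longlongrightarrow> min t s) (at_right t)" by (intro tendsto_intros)
    have ev: "\<forall>\<^sub>F y in at_right t. min t s \<le> min y s"
      by (auto simp: eventually_at_filter min_le_iff_disj intro!: always_eventually)
    show "((\<lambda>y. (w (min y s))\<^sup>2 - A (min y s)) \<longlongrightarrow> (w (min t s))\<^sup>2 - A (min t s)) (at_right t)"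
      using t s by (intro tendsto_intros right_continuous_path_tendsto[OF right_cont _ lim ev]
          right_continuous_path_tendsto[OF A.inc_right_cont _ lim ev]) auto
  qed
qed

text \<open>Up to \<open>s\<close> the measure of \<open>v\<close> is d(w^2) - dA; inserting
  integration by parts for d(w^2) gives \<Delta>w dw + 2 w(y-) dw = dA + dv. Every signed term is
  split into its positive and negative parts and put on the side where it enters with a plus sign.
  The two sides define measures that agree on all intervals \<open>{0<..d}\<close>.\<close>

lemma square_measure_identity:
  fixes f :: "real \<Rightarrow> ennreal"
  assumes A: "inc_path A" and s: "0 \<le> s" and f [measurable]: "f \<in> borel_measurable borel"
  defines "v \<equiv> \<lambda>y. (w (min y s))\<^sup>2 - A (min y s)"
  shows "(\<integral>\<^sup>+y\<in>{0<..s}. f y * emeasure (variation_measure w) {y} \<partial>variation_measure w)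
      + (2 * (\<integral>\<^sup>+y\<in>{0<..s}. f y * left_pos y \<partial>positive_measure w)
      + (2 * (\<integral>\<^sup>+y\<in>{0<..s}. f y * left_neg y \<partial>negative_measure w) + (\<integral>\<^sup>+y\<in>{0<..s}. f y \<partial>negative_measure v)))
    = (\<integral>\<^sup>+y\<in>{0<..s}. f y \<partial>path_measure A)
      + (2 * (\<integral>\<^sup>+y\<in>{0<..s}. f y * left_pos y \<partial>negative_measure w)
      + (2 * (\<integral>\<^sup>+y\<in>{0<..s}. f y * left_neg y \<partial>positive_measure w) + (\<integral>\<^sup>+y\<in>{0<..s}. f y \<partial>positive_measure v)))"
proof -
  interpret A: inc_path A by fact
  interpret v: fv_path v unfolding v_def by (rule fv_path_stopped_square[OF A s])
  let ?V = "variation_measure w" and ?P = "positive_measure w" and ?N = "negative_measure w"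
  have [measurable_cong, simp]: "sets (path_measure A) = sets borel" by (rule A.sets_path_measure)
  define \<kappa>1 where "\<kappa>1 = measure_add (density ?V (\<lambda>y. emeasure ?V {y} * indicator {0<..s} y))
    (measure_add (density ?P (\<lambda>y. 2 * left_pos y * indicator {0<..s} y))
    (measure_add (density ?N (\<lambda>y. 2 * left_neg y * indicator {0<..s} y)) (density (negative_measure v) (indicator {0<..s}))))"
  define \<kappa>2 where "\<kappa>2 = measure_add (density (path_measure A) (indicator {0<..s}))
    (measure_add (density ?N (\<lambda>y. 2 * left_pos y * indicator {0<..s} y))
    (measure_add (density ?P (\<lambda>y. 2 * left_neg y * indicator {0<..s} y)) (density (positive_measure v) (indicator {0<..s}))))"
  have [measurable_cong, simp]: "sets \<kappa>1 = sets borel" "sets \<kappa>2 = sets borel" by (simp_all add: \<kappa>1_def \<kappa>2_def)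
  have \<kappa>1: "(\<integral>\<^sup>+y. k y \<partial>\<kappa>1) = (\<integral>\<^sup>+y\<in>{0<..s}. k y * emeasure ?V {y} \<partial>?V)
      + (2 * (\<integral>\<^sup>+y\<in>{0<..s}. k y * left_pos y \<partial>?P)
      + (2 * (\<integral>\<^sup>+y\<in>{0<..s}. k y * left_neg y \<partial>?N) + (\<integral>\<^sup>+y\<in>{0<..s}. k y \<partial>negative_measure v)))"
    if [measurable]: "k \<in> borel_measurable borel" for k
    unfolding \<kappa>1_def
    by (simp add: nn_integral_measure_add nn_integral_density mult_ac nn_integral_cmult[symmetric])
  have \<kappa>2: "(\<integral>\<^sup>+y. k y \<partial>\<kappa>2) = (\<integral>\<^sup>+y\<in>{0<..s}. k y \<partial>path_measure A)
      + (2 * (\<integral>\<^sup>+y\<in>{0<..s}. k y * left_pos y \<partial>?N)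
      + (2 * (\<integral>\<^sup>+y\<in>{0<..s}. k y * left_neg y \<partial>?P) + (\<integral>\<^sup>+y\<in>{0<..s}. k y \<partial>positive_measure v)))"
    if [measurable]: "k \<in> borel_measurable borel" for k
    unfolding \<kappa>2_def
    by (simp add: nn_integral_measure_add nn_integral_density mult_ac nn_integral_cmult[symmetric])
  have on_Ioc: "emeasure \<kappa>1 {0<..d} = emeasure \<kappa>2 {0<..d} \<and> emeasure \<kappa>1 {0<..d} < \<infinity>" if d: "0 \<le> d" for d
  proof -
    define e where "e = min d s"
    have e: "0 \<le> e" "e \<le> s" using d s by (auto simp: e_def)
    have ind: "(\<integral>\<^sup>+y\<in>{0<..s}. indicator {0<..d} y * k y \<partial>K) = (\<integral>\<^sup>+y\<in>{0<..e}. k y \<partial>K)" for k :: "real \<Rightarrow> ennreal" and K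
      by (intro nn_integral_cong) (auto simp: e_def split: split_indicator)
    have ind1: "(\<integral>\<^sup>+y\<in>{0<..s}. indicator {0<..d} y \<partial>K) = emeasure K {0<..e}" if "sets K = sets borel" for K
      using ind[where k = "\<lambda>_. 1" and K = K] that by simp
    obtain \<alpha> aP aN bP bN where nn: "0 \<le> \<alpha>" "0 \<le> aP" "0 \<le> aN" "0 \<le> bP" "0 \<le> bN"
      and eqs: "(\<integral>\<^sup>+y\<in>{0<..e}. emeasure ?V {y} \<partial>?V) = ennreal \<alpha>"
        "(\<integral>\<^sup>+y\<in>{0<..e}. left_pos y \<partial>?P) = ennreal aP" "(\<integral>\<^sup>+y\<in>{0<..e}. left_pos y \<partial>?N) = ennreal aN"
        "(\<integral>\<^sup>+y\<in>{0<..e}. left_neg y \<partial>?P) = ennreal bP" "(\<integral>\<^sup>+y\<in>{0<..e}. left_neg y \<partial>?N) = ennreal bN"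
      and sq: "(w e)\<^sup>2 - (w 0)\<^sup>2 = \<alpha> + 2 * (aP - bP) - 2 * (aN - bN)"
      using square_decomposition[OF e(1)] by (elim exE conjE) (rule that)
    define vp where "vp = v.U_pos e - v.U_pos 0"
    define vn where "vn = v.U_neg e - v.U_neg 0"
    have v0: "0 \<le> vp" "0 \<le> vn" "vp - vn = v e - v 0"
      using v.V_increment[of 0 e] e by (simp_all add: vp_def vn_def field_simps)
    have em: "emeasure (negative_measure v) {0<..e} = ennreal vn" "emeasure (positive_measure v) {0<..e} = ennreal vp"
      unfolding vn_def vp_def by (rule v.emeasure_neg[OF order_refl e(1)], rule v.emeasure_pos[OF order_refl e(1)])
    have Ae: "0 \<le> A e - A 0" using mono_onD[OF A.inc, of 0 e] e by simp
    have ve: "v e - v 0 = (w e)\<^sup>2 - (w 0)\<^sup>2 - (A e - A 0)"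
      using e s by (simp add: v_def min_absorb1)
    have l1: "emeasure \<kappa>1 {0<..d} = ennreal (\<alpha> + (2 * aP + (2 * bN + vn)))"
      using \<kappa>1[of "indicator {0<..d}"] nn v0
      by (simp add: ind ind1 eqs em ennreal_mult')
    have l2: "emeasure \<kappa>2 {0<..d} = ennreal ((A e - A 0) + (2 * aN + (2 * bP + vp)))"
      using \<kappa>2[of "indicator {0<..d}"] nn v0 Ae A.emeasure_Ioc[of 0 e] e
      by (simp add: ind ind1 eqs em ennreal_mult')
    have "\<alpha> + (2 * aP + (2 * bN + vn)) = (A e - A 0) + (2 * aN + (2 * bP + vp))"
      using sq ve v0(3) by (simp only: diff_eq_eq) (simp add: algebra_simps)
    then show ?thesis unfolding l1 l2 by simp
  qed
  have null: "emeasure \<kappa>1 {..0} = 0" "emeasure \<kappa>2 {..0} = 0"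
  proof -
    have *: "(\<integral>\<^sup>+y\<in>{0<..s}. indicator {..0} y * k y \<partial>K) = 0" for k :: "real \<Rightarrow> ennreal" and K
      by (rule trans[OF nn_integral_cong[where v = "\<lambda>_. 0"]]) (auto split: split_indicator)
    have **: "(\<integral>\<^sup>+y\<in>{0<..s}. indicator {..0} y \<partial>K) = 0" for K
      using *[where k = "\<lambda>_. 1" and K = K] by simp
    show "emeasure \<kappa>1 {..0} = 0" using \<kappa>1[of "indicator {..0}"] by (simp add: * **)
    show "emeasure \<kappa>2 {..0} = 0" using \<kappa>2[of "indicator {..0}"] by (simp add: * **)
  qed
  have "\<kappa>1 = \<kappa>2"
    by (rule borel_measure_eqI_Ioc_0)
      (use on_Ioc[THEN conjunct1] on_Ioc[THEN conjunct2] null in \<open>simp_all del: infinity_ennreal_def\<close>)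
  then show ?thesis using \<kappa>1[OF f] \<kappa>2[OF f] by simp
qed

end

section \<open>Measurability of pathwise integrals in a parameter\<close>

lemma measurable_nn_integral_path_measure:
  fixes U :: "'b \<Rightarrow> real \<Rightarrow> real"
  assumes U: "\<And>b. b \<in> space N \<Longrightarrow> inc_path (U b)"
    and U_meas: "\<And>t. 0 \<le> t \<Longrightarrow> (\<lambda>b. U b t) \<in> borel_measurable N"
    and f [measurable]: "f \<in> borel_measurable (N \<Otimes>\<^sub>M borel)"
  shows "(\<lambda>b. \<integral>\<^sup>+y. f (b, y) \<partial>path_measure (U b)) \<in> borel_measurable N"
proof -
  define I where "I m = {0<..real m}" for m
  \<comment> \<open>One more than the mass of \<open>I m\<close>: never zero as a divisor, and
    dividing by it always leaves a subprobability measure.\<close>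
  define r where "r m b = 1 + U b (real m) - U b 0" for m b
  have r_meas [measurable]: "r m \<in> borel_measurable N" for m
    unfolding r_def[abs_def] by (intro borel_measurable_add borel_measurable_diff U_meas) auto
  have r_pos: "1 \<le> r m b" if "b \<in> space N" for m b
    using mono_onD[OF inc_path.inc[OF U[OF that]], of 0 "real m"] by (simp add: r_def)
  \<comment> \<open>The path measures are only locally finite. Cut down to \<open>I m\<close> and
    rescaled they form a subprobability kernel, whose measurability can be checked on half-open
    intervals; afterwards the scaling is undone and \<open>m\<close> increases.\<close>
  define L where "L m b = density (path_measure (U b)) (\<lambda>y. indicator (I m) y * ennreal (1 / r m b))" for m b
  have sets_L: "sets (L m b) = sets borel" for m b by (simp add: L_def path_measure_def)
  have em_L: "emeasure (L m b) A = emeasure (path_measure (U b)) (A \<inter> I m) * ennreal (1 / r m b)" if "A \<in> sets borel" for m b A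
  proof -
    have [measurable_cong]: "sets (path_measure (U b)) = sets borel" by (simp add: path_measure_def)
    have "emeasure (L m b) A = (\<integral>\<^sup>+y. indicator (A \<inter> I m) y * ennreal (1 / r m b) \<partial>path_measure (U b))"
      unfolding L_def using that by (subst emeasure_density) (auto simp: I_def split: split_indicator intro!: nn_integral_cong)
    then show ?thesis using that by (simp add: nn_integral_multc I_def)
  qed
  have L_meas: "L m \<in> measurable N (subprob_algebra borel)" for m
  proof (rule measurable_subprob_algebra_generated[where G = "range (\<lambda>(a, b). {a<..b})" and \<Omega> = UNIV])
    show "sets borel = sigma_sets UNIV (range (\<lambda>(a, b). {a<..b::real}))" by (simp add: borel_sigma_sets_Ioc)
    show "Int_stable (range (\<lambda>(a, b). {a<..b::real}))"
      by (rule Int_stableI) (force simp: image_iff Ioc_inj)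
    have Ioc: "(\<lambda>b. emeasure (path_measure (U b)) ({u<..v} \<inter> I m)) \<in> borel_measurable N" for u v
    proof (cases "max 0 u \<le> min v (real m)")
      case True
      have "emeasure (path_measure (U b)) ({u<..v} \<inter> I m) = ennreal (U b (min v (real m)) - U b (max 0 u))" if "b \<in> space N" for b
      proof -
        have "{u<..v} \<inter> I m = {max 0 u<..min v (real m)}" by (auto simp: I_def)
        then show ?thesis using inc_path.emeasure_Ioc[OF U[OF that], of "max 0 u"] True by simp
      qed
      then show ?thesis using True
        by (subst measurable_cong) (auto intro!: measurable_compose[OF _ measurable_ennreal] borel_measurable_diff U_meas)
    next
      case False
      then have "{u<..v} \<inter> I m = {}" by (auto simp: I_def)
      then show ?thesis by simp
    qed
    show "(\<lambda>a. emeasure (L m a) A) \<in> borel_measurable N" if range: "A \<in> range (\<lambda>(a, b). {a<..b})" for A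
    proof -
      obtain u v where A: "A = {u<..v}" using range by auto
      show ?thesis unfolding A by (subst em_L) (auto intro!: borel_measurable_times_ennreal Ioc)
    qed
    show "(\<lambda>a. emeasure (L m a) UNIV) \<in> borel_measurable N"
    proof -
      have "UNIV \<inter> I m = {0<..real m} \<inter> I m" by (auto simp: I_def)
      then show ?thesis using Ioc[of 0 "real m"] by (subst em_L) (auto intro!: borel_measurable_times_ennreal)
    qed
    fix b assume b: "b \<in> space N"
    have "emeasure (L m b) UNIV = ennreal ((r m b - 1) / r m b)"
      using r_pos[OF b, of m] inc_path.emeasure_Ioc[OF U[OF b], of 0 "real m"]
      by (simp add: em_L I_def r_def ennreal_mult'[symmetric])
    also have "\<dots> \<le> 1" using r_pos[OF b, of m] by (simp add: field_simps flip: ennreal_1)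
    finally show "subprob_space (L m b)"
      by (intro subprob_spaceI) (auto simp: L_def path_measure_def)
  qed (simp_all add: sets_L)
  have "(\<lambda>b. SUP m. ennreal (r m b) * (\<integral>\<^sup>+y. f (b, y) \<partial>L m b)) \<in> borel_measurable N"
  proof (intro borel_measurable_SUP borel_measurable_times_ennreal)
    show "(\<lambda>b. \<integral>\<^sup>+y. f (b, y) \<partial>L m b) \<in> borel_measurable N" for m
      by (rule nn_integral_measurable_subprob_algebra2[OF _ L_meas]) measurable
  qed auto
  also have "(\<lambda>b. SUP m. ennreal (r m b) * (\<integral>\<^sup>+y. f (b, y) \<partial>L m b)) \<in> borel_measurable N \<longleftrightarrow> ?thesis"
  proof (rule measurable_cong)
    fix b assume b: "b \<in> space N"
    interpret inc_path "U b" by (rule U[OF b])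
    have [measurable_cong]: "sets (path_measure (U b)) = sets borel" by (simp add: path_measure_def)
    have fb [measurable]: "(\<lambda>y. f (b, y)) \<in> borel_measurable borel" using b by measurable
    have "ennreal (r m b) * (\<integral>\<^sup>+y. f (b, y) \<partial>L m b) = (\<integral>\<^sup>+y. f (b, y) * indicator (I m) y \<partial>path_measure (U b))" for m
    proof -
      have "(\<integral>\<^sup>+y. f (b, y) \<partial>L m b) = (\<integral>\<^sup>+y. ennreal (1 / r m b) * (f (b, y) * indicator (I m) y) \<partial>path_measure (U b))"
        unfolding L_def by (subst nn_integral_density) (auto simp: I_def mult_ac)
      also have "\<dots> = ennreal (1 / r m b) * (\<integral>\<^sup>+y. f (b, y) * indicator (I m) y \<partial>path_measure (U b))"
        by (rule nn_integral_cmult) (simp add: I_def)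
      finally have "ennreal (r m b) * (\<integral>\<^sup>+y. f (b, y) \<partial>L m b) = 
          ennreal (r m b * (1 / r m b)) * (\<integral>\<^sup>+y. f (b, y) * indicator (I m) y \<partial>path_measure (U b))"
        using r_pos[OF b, of m] by (subst ennreal_mult) (auto simp: mult_ac)
      then show ?thesis using r_pos[OF b, of m] by simp
    qed
    then have "(SUP m. ennreal (r m b) * (\<integral>\<^sup>+y. f (b, y) \<partial>L m b)) = (SUP m. \<integral>\<^sup>+y. f (b, y) * indicator (I m) y \<partial>path_measure (U b))"
      by simp
    also have "\<dots> = (\<integral>\<^sup>+y. (SUP m. f (b, y) * indicator (I m) y) \<partial>path_measure (U b))"
      by (rule nn_integral_monotone_convergence_SUP[symmetric])
        (auto simp: incseq_def le_fun_def I_def split: split_indicator)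
    also have "\<dots> = (\<integral>\<^sup>+y. f (b, y) \<partial>path_measure (U b))"
    proof (rule nn_integral_cong_AE)
      have "AE y in path_measure (U b). 0 < y"
        using emeasure_atMost_0 by (intro AE_I[of _ _ "{..0}"]) (auto simp: sets_path_measure)
      then show "AE y in path_measure (U b). (SUP m. f (b, y) * indicator (I m) y) = f (b, y)"
      proof eventually_elim
        case (elim y)
        obtain m0 :: nat where "y \<le> real m0" using real_arch_simple by blast
        then have "f (b, y) \<le> (SUP m. f (b, y) * indicator (I m) y)"
          using elim by (intro SUP_upper2[of m0]) (auto simp: I_def)
        moreover have "(SUP m. f (b, y) * indicator (I m) y) \<le> f (b, y)"
          by (intro SUP_least) (auto split: split_indicator)
        ultimately show ?case by simp
      qed
    qed
    finally show "(SUP m. ennreal (r m b) * (\<integral>\<^sup>+y. f (b, y) \<partial>L m b)) = (\<integral>\<^sup>+y. f (b, y) \<partial>path_measure (U b))" .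
  qed
  finally show ?thesis .
qed

lemma measurable_integral_path_measure:
  fixes U :: "'b \<Rightarrow> real \<Rightarrow> real" and f :: "'b \<times> real \<Rightarrow> real"
  assumes U: "\<And>b. b \<in> space N \<Longrightarrow> inc_path (U b)"
    and U_meas: "\<And>t. 0 \<le> t \<Longrightarrow> (\<lambda>b. U b t) \<in> borel_measurable N"
    and f [measurable]: "f \<in> borel_measurable (N \<Otimes>\<^sub>M borel)"
  shows "(\<lambda>b. \<integral>y. f (b, y) \<partial>path_measure (U b)) \<in> borel_measurable N"
proof -
  note [measurable] = measurable_nn_integral_path_measure[OF U U_meas]
  \<comment> \<open>The \<open>else\<close> branch reproduces the value 0 that the integral has at a
    non-integrable section, so that the equality holds for every \<open>b\<close>.\<close>
  have "(\<lambda>b. if (\<integral>\<^sup>+y. ennreal \<bar>f (b, y)\<bar> \<partial>path_measure (U b)) < \<infinity> then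
      enn2real (\<integral>\<^sup>+y. ennreal (f (b, y)) \<partial>path_measure (U b)) - enn2real (\<integral>\<^sup>+y. ennreal (- f (b, y)) \<partial>path_measure (U b)) else 0)
     \<in> borel_measurable N"
    by measurable
  also have "?this \<longleftrightarrow> ?thesis"
  proof (rule measurable_cong)
    fix b assume b: "b \<in> space N"
    have [measurable_cong]: "sets (path_measure (U b)) = sets borel" by (simp add: path_measure_def)
    have [measurable]: "(\<lambda>y. f (b, y)) \<in> borel_measurable borel" using b by measurable
    show "(if (\<integral>\<^sup>+y. ennreal \<bar>f (b, y)\<bar> \<partial>path_measure (U b)) < \<infinity> then
      enn2real (\<integral>\<^sup>+y. ennreal (f (b, y)) \<partial>path_measure (U b)) - enn2real (\<integral>\<^sup>+y. ennreal (- f (b, y)) \<partial>path_measure (U b)) else 0)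
      = (\<integral>y. f (b, y) \<partial>path_measure (U b))"
      by (auto simp: integrable_iff_bounded real_lebesgue_integral_def not_integrable_integral_eq)
  qed
  finally show ?thesis .
qed


section \<open>Filtrations and predictable processes\<close>

locale filtered_space = prob_space M for M :: "'a measure" +
  fixes F :: "real \<Rightarrow> 'a measure"
  assumes space_F: "\<And>t. space (F t) = space M"
    and sets_F: "\<And>t. sets (F t) \<subseteq> sets M"
    and F_mono: "\<And>s t. s \<le> t \<Longrightarrow> sets (F s) \<subseteq> sets (F t)"
begin

lemma measurable_F_mono: "f \<in> measurable (F s) N \<Longrightarrow> s \<le> t \<Longrightarrow> f \<in> measurable (F t) N"
  using F_mono[of s t] by (auto simp: measurable_def space_F)

lemma measurable_F_M: "f \<in> measurable (F s) N \<Longrightarrow> f \<in> measurable M N"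
  using sets_F[of s] by (auto simp: measurable_def space_F)

definition "pred_gen = {{0} \<times> B | B. B \<in> sets (F 0)} \<union> {{s<..t} \<times> B | s t B. 0 \<le> s \<and> s \<le> t \<and> B \<in> sets (F s)}"

lemma pred_genI:
  "X = {0} \<times> B \<Longrightarrow> B \<in> sets (F 0) \<Longrightarrow> X \<in> pred_gen"
  "X = {s<..t} \<times> B \<Longrightarrow> 0 \<le> s \<Longrightarrow> s \<le> t \<Longrightarrow> B \<in> sets (F s) \<Longrightarrow> X \<in> pred_gen"
  unfolding pred_gen_def by blast+

lemma pred_gen_cases:
  assumes "X \<in> pred_gen"
  obtains B where "X = {0} \<times> B" "B \<in> sets (F 0)"
  | s t B where "X = {s<..t} \<times> B" "0 \<le> s" "s \<le> t" "B \<in> sets (F s)"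
  using assms unfolding pred_gen_def by (elim UnE CollectE exE conjE) blast+

lemma pred_gen_closed: "pred_gen \<subseteq> Pow ({0..} \<times> space M)"
proof -
  have "B \<subseteq> space M" if "B \<in> sets (F s)" for B s using that sets.sets_into_space[of B "F s"] by (simp add: space_F)
  note sub = this
  show ?thesis
  proof
    fix X assume "X \<in> pred_gen"
    then obtain I B s where "X = I \<times> B" "I \<subseteq> {0..}" "B \<in> sets (F s)"
      unfolding pred_gen_def
    proof (elim UnE CollectE exE conjE)
      fix B assume "X = {0} \<times> B" "B \<in> sets (F 0)"
      then show ?thesis by (intro that[of "{0}" B 0]) auto
    next
      fix s t B assume "X = {s<..t} \<times> B" "0 \<le> s" "B \<in> sets (F s)"
      then show ?thesis by (intro that[of "{s<..t}" B s]) auto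
    qed
    then show "X \<in> Pow ({0..} \<times> space M)" using sub by blast
  qed
qed

lemma space_predictable: "space (predictable_sigma F) = {0..} \<times> space M"
  unfolding predictable_sigma_def pred_gen_def[symmetric] space_F
  using pred_gen_closed by (rule space_measure_of)

lemma sets_predictable: "sets (predictable_sigma F) = sigma_sets ({0..} \<times> space M) pred_gen"
  unfolding predictable_sigma_def pred_gen_def[symmetric] space_F
  using pred_gen_closed by (rule sets_measure_of)

lemma Int_stable_pred_gen: "Int_stable pred_gen"
proof (rule Int_stableI)
  have Ioc: "({s<..t} \<times> B) \<inter> ({s'<..t'} \<times> B') \<in> pred_gen"
    if "0 \<le> s" "0 \<le> s'" "B \<in> sets (F s)" "B' \<in> sets (F s')" for s t s' t' B B'
  proof (cases "max s s' \<le> min t t'")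
    case True
    have "B \<in> sets (F (max s s'))" "B' \<in> sets (F (max s s'))" using that F_mono[of s "max s s'"] F_mono[of s' "max s s'"] by auto
    then have "B \<inter> B' \<in> sets (F (max s s'))" by auto
    moreover have eq: "({s<..t} \<times> B) \<inter> ({s'<..t'} \<times> B') = {max s s'<..min t t'} \<times> (B \<inter> B')" by auto
    ultimately show ?thesis using True that
      by (intro pred_genI(2)[of _ "max s s'" "min t t'" "B \<inter> B'"]) auto
  next
    case False
    then have *: "({s<..t} \<times> B) \<inter> ({s'<..t'} \<times> B') = {0} \<times> {}" by auto
    show ?thesis unfolding * by (rule pred_genI(1)) auto
  qed
  have zero: "({0} \<times> B) \<inter> ({s<..t} \<times> B') = {0} \<times> {}" if "0 \<le> s" for s t :: real and B B' :: "'a set"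
    using that by auto
  have empty: "{0} \<times> {} \<in> pred_gen" by (rule pred_genI(1)) auto
  have zz: "({0} \<times> B) \<inter> ({0} \<times> B') \<in> pred_gen" if "B \<in> sets (F 0)" "B' \<in> sets (F 0)" for B B'
    using that by (intro pred_genI(1)[of _ "B \<inter> B'"]) auto
  fix X Y assume XY: "X \<in> pred_gen" "Y \<in> pred_gen"
  show "X \<inter> Y \<in> pred_gen"
    using XY(1)
  proof (cases rule: pred_gen_cases)
    case X: (1 B)
    show ?thesis using XY(2)
    proof (cases rule: pred_gen_cases)
      case (1 B')
      then show ?thesis using X zz by simp
    next
      case (2 s t B')
      then show ?thesis using X zero[of s B t B'] empty by simp
    qed
  next
    case X: (2 s t B)
    show ?thesis using XY(2)
    proof (cases rule: pred_gen_cases)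
      case (1 B')
      then show ?thesis using X zero[of s B' t B] empty by (simp add: Int_commute)
    next
      case (2 s' t' B')
      then show ?thesis using X Ioc by simp
    qed
  qed
qed

lemma predictable_Ioc: "0 \<le> s \<Longrightarrow> B \<in> sets (F s) \<Longrightarrow> {s<..t} \<times> B \<in> sets (predictable_sigma F)"
proof (cases "s \<le> t")
  case True
  then show "0 \<le> s \<Longrightarrow> B \<in> sets (F s) \<Longrightarrow> {s<..t} \<times> B \<in> sets (predictable_sigma F)"
    unfolding sets_predictable by (intro sigma_sets.Basic pred_genI(2)[of _ s t B]) auto
qed auto

lemma predictable_after: 
  assumes "0 \<le> s" "B \<in> sets (F s)"
  shows "{s<..} \<times> B \<in> sets (predictable_sigma F)"
proof -
  have "(\<Union>n::nat. {s<..s + real n} \<times> B) \<in> sets (predictable_sigma F)"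
    using predictable_Ioc[OF assms] by (intro sets.countable_UN) auto
  also have "(\<Union>n::nat. {s<..s + real n} \<times> B) = {s<..} \<times> B"
  proof -
    have "\<exists>n::nat. x \<le> s + real n" for x using real_arch_simple[of "x - s"] by (auto simp: algebra_simps)
    then show ?thesis by auto
  qed
  finally show ?thesis .
qed

lemma measurable_flip: 
  "(\<lambda>(\<omega>, y). (y, \<omega>)) \<in> measurable (restrict_space (M \<Otimes>\<^sub>M borel) (space M \<times> {0<..})) (predictable_sigma F)"
proof (rule measurable_sigma_sets[OF sets_predictable pred_gen_closed])
  show "(\<lambda>(\<omega>, y :: real). (y, \<omega>)) \<in> space (restrict_space (M \<Otimes>\<^sub>M borel) (space M \<times> {0<..})) \<rightarrow> {0..} \<times> space M"
    by (auto simp: space_restrict_space space_pair_measure)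
  fix X assume "X \<in> pred_gen"
  then obtain I B where X: "X = I \<times> B" "I \<in> sets borel" "B \<in> sets M"
    unfolding pred_gen_def
  proof (elim UnE CollectE exE conjE)
    fix B assume "X = {0} \<times> B" "B \<in> sets (F 0)"
    then show ?thesis using sets_F[of 0] by (intro that[of "{0}" B]) auto
  next
    fix s t B assume "X = {s<..t} \<times> B" "0 \<le> s" "B \<in> sets (F s)"
    then show ?thesis using sets_F[of s] by (intro that[of "{s<..t}" B]) auto
  qed
  have "B \<subseteq> space M" using X sets.sets_into_space by auto
  then have "(\<lambda>(\<omega>, y). (y, \<omega>)) -` X \<inter> space (restrict_space (M \<Otimes>\<^sub>M borel) (space M \<times> {0<..})) = (space M \<times> {0<..}) \<inter> (B \<times> I)"
    by (auto simp: space_restrict_space space_pair_measure X)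
  then show "(\<lambda>(\<omega>, y). (y, \<omega>)) -` X \<inter> space (restrict_space (M \<Otimes>\<^sub>M borel) (space M \<times> {0<..})) \<in> sets (restrict_space (M \<Otimes>\<^sub>M borel) (space M \<times> {0<..}))"
    using X by (auto simp: sets_restrict_space)
qed

text \<open>The product has the whole Borel line as second factor, while the process lives on
  nonnegative times. It is set to 0 for times up to 0, which no path measure charges.\<close>

lemma predictable_imp_product:
  fixes f :: "real \<times> 'a \<Rightarrow> 'b :: {zero, topological_space}"
  assumes "f \<in> borel_measurable (predictable_sigma F)"
  shows "(\<lambda>(\<omega>, y). if 0 < y then f (y, \<omega>) else 0) \<in> borel_measurable (M \<Otimes>\<^sub>M borel)"
proof -
  have "(\<lambda>z. f ((\<lambda>(\<omega>, y). (y, \<omega>)) z)) \<in> borel_measurable (restrict_space (M \<Otimes>\<^sub>M borel) (space M \<times> {0<..}))"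
    using measurable_flip assms by (rule measurable_compose)
  moreover have "{z \<in> space (M \<Otimes>\<^sub>M borel). z \<in> space M \<times> {0::real<..}} = space M \<times> {0<..}"
    by (auto simp: space_pair_measure)
  then have "{z \<in> space (M \<Otimes>\<^sub>M borel). z \<in> space M \<times> {0::real<..}} \<in> sets (M \<Otimes>\<^sub>M borel)"
    by simp
  ultimately have "(\<lambda>z. if z \<in> space M \<times> {0<..} then f ((\<lambda>(\<omega>, y). (y, \<omega>)) z) else 0) \<in> borel_measurable (M \<Otimes>\<^sub>M borel)"
    by (subst measurable_If_restrict_space_iff) (simp_all add: Collect_mem_eq)
  also have "?this \<longleftrightarrow> ?thesis"
    by (rule measurable_cong) (auto simp: space_pair_measure split: if_splits)
  finally show ?thesis .
qed

lemma predictable_section: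
  assumes f: "f \<in> measurable (predictable_sigma F) N" and u: "0 \<le> u"
  shows "(\<lambda>\<omega>. f (u, \<omega>)) \<in> measurable (F u) N"
proof -
  have "Pair u \<in> measurable (F u) (predictable_sigma F)"
  proof (rule measurable_sigma_sets[OF sets_predictable pred_gen_closed])
    show "Pair u \<in> space (F u) \<rightarrow> {0..} \<times> space M" using u by (auto simp: space_F)
    fix X assume "X \<in> pred_gen"
    then show "Pair u -` X \<inter> space (F u) \<in> sets (F u)"
      unfolding pred_gen_def
    proof (elim UnE CollectE exE conjE)
      fix B assume "X = {0} \<times> B" "B \<in> sets (F 0)"
      moreover have "Pair u -` ({0} \<times> B) = (if u = 0 then B else {})" by auto
      ultimately show ?thesis by auto
    next
      fix s t B assume X: "X = {s<..t} \<times> B" "0 \<le> s" "B \<in> sets (F s)"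
      have "Pair u -` ({s<..t} \<times> B) = (if s < u \<and> u \<le> t then B else {})" by auto
      moreover have "B \<in> sets (F u)" if "s < u" using X F_mono[of s u] that by auto
      ultimately show ?thesis using X by auto
    qed
  qed
  then show ?thesis using f by (rule measurable_compose)
qed

lemma predictable_const_after:
  fixes \<xi> :: "'a \<Rightarrow> 'b :: {zero, topological_space}"
  assumes q: "0 \<le> q" and \<xi>: "\<xi> \<in> borel_measurable (F q)"
  shows "(\<lambda>(y, \<omega>). if q < y then \<xi> \<omega> else 0) \<in> borel_measurable (predictable_sigma F)"
proof (rule measurableI)
  fix A :: "'b set" assume A: "A \<in> sets borel"
  let ?f = "\<lambda>(y, \<omega>). if q < y then \<xi> \<omega> else 0"
  have B: "\<xi> -` A \<inter> space (F q) \<in> sets (F q)" using \<xi> A by (rule measurable_sets)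
  have "{q<..} \<times> space (F q) \<in> sets (predictable_sigma F)" using q by (intro predictable_after) auto
  moreover have "?f -` A \<inter> space (predictable_sigma F) = {q<..} \<times> (\<xi> -` A \<inter> space (F q)) \<union>
     (if 0 \<in> A then space (predictable_sigma F) - {q<..} \<times> space (F q) else {})"
    using q by (auto simp: space_predictable space_F split: if_splits)
  ultimately show "?f -` A \<inter> space (predictable_sigma F) \<in> sets (predictable_sigma F)"
    using predictable_after[OF q B] by auto
qed auto

definition inc_process :: "(real \<Rightarrow> 'a \<Rightarrow> real) \<Rightarrow> bool" where
  "inc_process U \<longleftrightarrow> adapted F U \<and> (\<forall>\<omega>\<in>space M. inc_path (\<lambda>t. U t \<omega>))"

text \<open>The mass of \<open>{0<..<y}\<close> exceeds a level exactly if \<open>U q - U 0\<close>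
  does at some rational q < y. This event is known at q and counts from q on, which gives a
  countable union of predictable rectangles.\<close>

lemma predictable_Ioo:
  assumes U: "inc_process U"
  shows "(\<lambda>(y, \<omega>). emeasure (path_measure (\<lambda>t. U t \<omega>)) {0<..<y}) \<in> borel_measurable (predictable_sigma F)"
proof (rule borel_measurableI_greater)
  fix c :: ennreal
  show "{z \<in> space (predictable_sigma F). c < (case z of (y, \<omega>) \<Rightarrow> emeasure (path_measure (\<lambda>t. U t \<omega>)) {0<..<y})} \<in> sets (predictable_sigma F)"
  proof (cases c)
    case (real r)
    define B where "B q = {\<omega> \<in> space (F q). ennreal r < ennreal (U q \<omega> - U 0 \<omega>)}" for q
    have B: "B q \<in> sets (F q)" if "0 \<le> q" for q
    proof -
      have [measurable]: "U q \<in> borel_measurable (F q)" "U 0 \<in> borel_measurable (F q)"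
        using U that by (auto simp: inc_process_def adapted_def intro: measurable_F_mono)
      show ?thesis unfolding B_def by measurable
    qed
    have "(\<Union>q\<in>{q\<in>\<rat>. 0 \<le> q}. {q<..} \<times> B q) \<in> sets (predictable_sigma F)"
      using predictable_after B by (intro sets.countable_UN') (auto intro: countable_subset[OF _ countable_rat])
    also have "(\<Union>q\<in>{q\<in>\<rat>. 0 \<le> q}. {q<..} \<times> B q) =
      {z \<in> space (predictable_sigma F). c < (case z of (y, \<omega>) \<Rightarrow> emeasure (path_measure (\<lambda>t. U t \<omega>)) {0<..<y})}"
    proof -
      have "(\<exists>q\<in>\<rat>. 0 \<le> q \<and> q < y \<and> ennreal r < ennreal (U q \<omega> - U 0 \<omega>)) \<longleftrightarrow> 
        0 \<le> y \<and> ennreal r < emeasure (path_measure (\<lambda>t. U t \<omega>)) {0<..<y}" if "\<omega> \<in> space M" for y \<omega>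
      proof (cases "0 < y")
        case True
        interpret inc_path "\<lambda>t. U t \<omega>" using U that by (simp add: inc_process_def)
        show ?thesis using emeasure_Ioo[OF True, of r] True by (auto simp: not_le[symmetric])
      qed auto
      then show ?thesis using real by (auto simp: space_predictable space_F B_def)
    qed
    finally show ?thesis .
  qed simp
qed

end


section \<open>Optional stopping\<close>

text \<open>Vitali's convergence theorem. Uniform integrability is measured by the mean of (|Y| -
  L)^+, a continuous and convex function: it passes to the limit by Fatou, and along a martingale it
  increases in time, which is how the bound \<open>e\<close> will be obtained.\<close>

lemma (in finite_measure) integral_tendsto_uniformly_integrable:
  fixes Y :: "nat \<Rightarrow> 'a \<Rightarrow> real" and X :: "'a \<Rightarrow> real" and e :: "nat \<Rightarrow> real"
  assumes Y: "\<And>m. integrable M (Y m)" and X [measurable]: "X \<in> borel_measurable M"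
    and lim: "\<And>\<omega>. \<omega> \<in> space M \<Longrightarrow> (\<lambda>m. Y m \<omega>) \<longlonglongrightarrow> X \<omega>"
    and tail: "\<And>m L. (\<integral>\<omega>. max 0 (\<bar>Y m \<omega>\<bar> - real L) \<partial>M) \<le> e L"
    and e: "e \<longlonglongrightarrow> 0"
  shows "integrable M X" "(\<integral>\<omega>. \<bar>X \<omega>\<bar> \<partial>M) \<le> e 0" "(\<lambda>m. \<integral>\<omega>. Y m \<omega> \<partial>M) \<longlonglongrightarrow> (\<integral>\<omega>. X \<omega> \<partial>M)"
proof -
  have [measurable]: "Y m \<in> borel_measurable M" for m using Y by auto
  have Y_tail_int: "integrable M (\<lambda>\<omega>. max 0 (\<bar>Y m \<omega>\<bar> - real L))" for m L
    by (rule Bochner_Integration.integrable_bound[OF Y[of m]]) auto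
  have e_nonneg: "0 \<le> e L" for L
    by (rule order_trans[OF Bochner_Integration.integral_nonneg tail[of 0 L]]) simp
  have X_tail: "(\<integral>\<^sup>+\<omega>. ennreal (max 0 (\<bar>X \<omega>\<bar> - real L)) \<partial>M) \<le> ennreal (e L)" for L
  proof -
    have "(\<integral>\<^sup>+\<omega>. ennreal (max 0 (\<bar>X \<omega>\<bar> - real L)) \<partial>M) = (\<integral>\<^sup>+\<omega>. liminf (\<lambda>m. ennreal (max 0 (\<bar>Y m \<omega>\<bar> - real L))) \<partial>M)"
    proof (rule nn_integral_cong)
      fix \<omega> assume "\<omega> \<in> space M"
      then have "(\<lambda>m. ennreal (max 0 (\<bar>Y m \<omega>\<bar> - real L))) \<longlonglongrightarrow> ennreal (max 0 (\<bar>X \<omega>\<bar> - real L))"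
        by (intro tendsto_intros lim)
      then show "ennreal (max 0 (\<bar>X \<omega>\<bar> - real L)) = liminf (\<lambda>m. ennreal (max 0 (\<bar>Y m \<omega>\<bar> - real L)))"
        by (intro lim_imp_Liminf[symmetric]) auto
    qed
    also have "\<dots> \<le> liminf (\<lambda>m. \<integral>\<^sup>+\<omega>. ennreal (max 0 (\<bar>Y m \<omega>\<bar> - real L)) \<partial>M)"
      by (rule nn_integral_liminf) measurable
    also have "\<dots> \<le> ennreal (e L)"
    proof (intro Liminf_le always_eventually allI)
      show "(\<integral>\<^sup>+\<omega>. ennreal (max 0 (\<bar>Y m \<omega>\<bar> - real L)) \<partial>M) \<le> ennreal (e L)" for m
        by (subst nn_integral_eq_integral[OF Y_tail_int]) (use tail in \<open>auto intro: ennreal_leI\<close>)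
    qed simp
    finally show ?thesis .
  qed
  show X_int: "integrable M X"
    using X_tail[of 0] by (intro integrableI_bounded) (auto simp: top.not_eq_extremum[symmetric] top_unique)
  have X_tail_int: "integrable M (\<lambda>\<omega>. max 0 (\<bar>X \<omega>\<bar> - real L))" for L
    by (rule Bochner_Integration.integrable_bound[OF X_int]) auto
  have X_tail': "(\<integral>\<omega>. max 0 (\<bar>X \<omega>\<bar> - real L) \<partial>M) \<le> e L" for L
    using X_tail[of L] unfolding nn_integral_eq_integral[OF X_tail_int[of L] AE_I2[OF max.cobounded1]]
    using e_nonneg[of L] by (simp only: ennreal_le_iff)
  then show "(\<integral>\<omega>. \<bar>X \<omega>\<bar> \<partial>M) \<le> e 0" using X_tail'[of 0] by simp
  show "(\<lambda>m. \<integral>\<omega>. Y m \<omega> \<partial>M) \<longlonglongrightarrow> (\<integral>\<omega>. X \<omega> \<partial>M)"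
  proof (rule LIMSEQ_I)
    fix r :: real assume r: "0 < r"
    then have "\<forall>\<^sub>F L in sequentially. e L < r / 3" using e by (intro order_tendstoD) auto
    then obtain L where L: "e L < r / 3" by (auto simp: eventually_sequentially)
    \<comment> \<open>Clipping at \<open>L\<close> costs exactly (|x| - L)^+, so bounded convergence
      for the clipped variables leaves an error of at most twice \<open>e L\<close>.\<close>
    define c where "c x = max (- real L) (min (real L) x)" for x
    have c: "\<bar>x - c x\<bar> = max 0 (\<bar>x\<bar> - real L)" for x by (auto simp: c_def max_def min_def)
    have [measurable]: "c \<in> borel_measurable borel" unfolding c_def[abs_def] by measurable
    have c_le: "\<bar>c x\<bar> \<le> real L" for x by (auto simp: c_def)
    have c_int: "integrable M (\<lambda>\<omega>. c (Z \<omega>))" if [measurable]: "Z \<in> borel_measurable M" for Z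
      by (rule integrable_const_bound[where B = "real L"]) (use c_le in auto)
    have "(\<lambda>m. \<integral>\<omega>. c (Y m \<omega>) \<partial>M) \<longlonglongrightarrow> (\<integral>\<omega>. c (X \<omega>) \<partial>M)"
    proof (rule integral_dominated_convergence[where w = "\<lambda>_. real L"])
      show "AE \<omega> in M. (\<lambda>m. c (Y m \<omega>)) \<longlonglongrightarrow> c (X \<omega>)"
        unfolding c_def by (intro AE_I2 tendsto_intros lim)
    qed (use c_le in auto)
    then obtain m0 where m0: "\<bar>(\<integral>\<omega>. c (Y m \<omega>) \<partial>M) - (\<integral>\<omega>. c (X \<omega>) \<partial>M)\<bar> < r / 3" if "m \<ge> m0" for m
      using LIMSEQ_D[of _ _ "r/3"] r by (metis divide_pos_pos real_norm_def zero_less_numeral)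
    have "norm ((\<integral>\<omega>. Y m \<omega> \<partial>M) - (\<integral>\<omega>. X \<omega> \<partial>M)) < r" if "m \<ge> m0" for m
    proof -
      have "\<bar>(\<integral>\<omega>. Z \<omega> \<partial>M) - (\<integral>\<omega>. c (Z \<omega>) \<partial>M)\<bar> \<le> e L"
        if Z: "integrable M Z" "(\<integral>\<omega>. max 0 (\<bar>Z \<omega>\<bar> - real L) \<partial>M) \<le> e L" for Z
      proof -
        have "(\<integral>\<omega>. Z \<omega> \<partial>M) - (\<integral>\<omega>. c (Z \<omega>) \<partial>M) = (\<integral>\<omega>. Z \<omega> - c (Z \<omega>) \<partial>M)"
          using Z(1) c_int by simp
        also have "\<bar>\<dots>\<bar> \<le> (\<integral>\<omega>. \<bar>Z \<omega> - c (Z \<omega>)\<bar> \<partial>M)" by (rule integral_abs_bound)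
        finally show ?thesis using Z(2) by (simp add: c)
      qed
      from this[OF Y[of m] tail] this[OF X_int X_tail'] m0[OF that] L show ?thesis
        by (simp only: real_norm_def)
    qed
    then show "\<exists>no. \<forall>m\<ge>no. norm ((\<integral>\<omega>. Y m \<omega> \<partial>M) - (\<integral>\<omega>. X \<omega> \<partial>M)) < r" by blast
  qed
qed

lemma (in finite_measure) integral_tail_tendsto_0:
  fixes X :: "'a \<Rightarrow> real"
  assumes X: "integrable M X"
  shows "(\<lambda>L. \<integral>\<omega>. max 0 (\<bar>X \<omega>\<bar> - real L) \<partial>M) \<longlonglongrightarrow> 0"
proof -
  have [measurable]: "X \<in> borel_measurable M" using X by auto
  have "(\<lambda>L. \<integral>\<omega>. max 0 (\<bar>X \<omega>\<bar> - real L) \<partial>M) \<longlonglongrightarrow> (\<integral>\<omega>. 0 \<partial>M)"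
  proof (rule integral_dominated_convergence[where w = "\<lambda>\<omega>. \<bar>X \<omega>\<bar>"])
    show "AE \<omega> in M. (\<lambda>L. max 0 (\<bar>X \<omega>\<bar> - real L)) \<longlonglongrightarrow> 0"
    proof (intro AE_I2)
      fix \<omega>
      obtain L0 where "\<bar>X \<omega>\<bar> \<le> real L0" using real_arch_simple by blast
      then have "\<forall>\<^sub>F L in sequentially. max 0 (\<bar>X \<omega>\<bar> - real L) = 0"
        by (intro eventually_sequentiallyI[of L0]) auto
      then show "(\<lambda>L. max 0 (\<bar>X \<omega>\<bar> - real L)) \<longlonglongrightarrow> 0" by (rule tendsto_eventually)
    qed
  qed (use X in auto)
  then show ?thesis by simp
qed

context filtered_space begin

lemma martingale_integral_indicator:
  assumes G: "martingale M F G" and "0 \<le> s" "s \<le> u" and D: "D \<in> sets (F s)"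
  shows "(\<integral>\<omega>. indicator D \<omega> * G s \<omega> \<partial>M) = (\<integral>\<omega>. indicator D \<omega> * G u \<omega> \<partial>M)"
proof -
  interpret S: finite_measure_subalgebra M "F s"
    by unfold_locales (use space_F sets_F in \<open>auto simp: subalgebra_def\<close>)
  have int: "integrable M (G u)" and ae: "AE \<omega> in M. real_cond_exp M (F s) (G u) \<omega> = G s \<omega>"
    and meas: "G s \<in> borel_measurable (F s)"
    using G assms(2,3) by (auto simp: martingale_def adapted_def)
  have [measurable]: "G s \<in> borel_measurable M" using meas by (rule measurable_F_M)
  have [measurable]: "D \<in> sets M" using D sets_F by auto
  have [measurable]: "real_cond_exp M (F s) (G u) \<in> borel_measurable M"
    using borel_measurable_cond_exp2 by blast
  have "(\<integral>\<omega>. indicator D \<omega> * G u \<omega> \<partial>M) = (\<integral>\<omega>. indicator D \<omega> * real_cond_exp M (F s) (G u) \<omega> \<partial>M)"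
    using S.real_cond_exp_intA[OF int D] by (simp add: set_lebesgue_integral_def)
  also have "\<dots> = (\<integral>\<omega>. indicator D \<omega> * G s \<omega> \<partial>M)"
    using ae by (intro integral_cong_AE) auto
  finally show ?thesis ..
qed

text \<open>Conditional Jensen for the convex function (|x| - L)^+. Where it is nonzero at time
  \<open>s\<close> it is the linear function x - L or -x - L, selected by an event known at
  \<open>s\<close>. There \<open>G s\<close> may be replaced by \<open>G u\<close>, and a linear
  piece never exceeds the convex function.\<close>

lemma martingale_tail_mono:
  assumes G: "martingale M F G" and "0 \<le> s" "s \<le> u" and D: "D \<in> sets (F s)" and L: "0 \<le> L"
  shows "(\<integral>\<omega>. indicator D \<omega> * max 0 (\<bar>G s \<omega>\<bar> - L) \<partial>M) \<le> (\<integral>\<omega>. indicator D \<omega> * max 0 (\<bar>G u \<omega>\<bar> - L) \<partial>M)"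
proof -
  have int [simp]: "integrable M (G u)" "integrable M (G s)" and meas [measurable]: "G s \<in> borel_measurable (F s)"
    using G assms(2,3) by (auto simp: martingale_def adapted_def)
  note [measurable] = borel_measurable_integrable[OF int(1)] borel_measurable_integrable[OF int(2)]
  define D1 where "D1 = D \<inter> {\<omega> \<in> space (F s). L < G s \<omega>}"
  define D2 where "D2 = D \<inter> {\<omega> \<in> space (F s). G s \<omega> < - L}"
  have D12: "D1 \<in> sets (F s)" "D2 \<in> sets (F s)" unfolding D1_def D2_def using D by auto
  have [measurable]: "D \<in> sets M" "D1 \<in> sets M" "D2 \<in> sets M" using D D12 sets_F by auto
  have i: "integrable M (\<lambda>\<omega>. indicator E \<omega> * f \<omega>)" if "integrable M f" "E \<in> sets M" for E and f :: "'a \<Rightarrow> real"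
    using integrable_mult_indicator[OF that(2,1)] by simp
  have iL: "integrable M (\<lambda>\<omega>. L * (indicator D1 \<omega> + indicator D2 \<omega>))"
    by (rule integrable_const_bound[where B = "2 * L"]) (use L in \<open>auto split: split_indicator\<close>)
  have split: "(\<integral>\<omega>. indicator D1 \<omega> * f \<omega> - indicator D2 \<omega> * f \<omega> - L * (indicator D1 \<omega> + indicator D2 \<omega>) \<partial>M) =
      (\<integral>\<omega>. indicator D1 \<omega> * f \<omega> \<partial>M) - (\<integral>\<omega>. indicator D2 \<omega> * f \<omega> \<partial>M) - (\<integral>\<omega>. L * (indicator D1 \<omega> + indicator D2 \<omega>) \<partial>M)"
    if f: "integrable M f" for f :: "'a \<Rightarrow> real"
  proof -
    have D1: "integrable M (\<lambda>\<omega>. indicator D1 \<omega> * f \<omega>)" and D2: "integrable M (\<lambda>\<omega>. indicator D2 \<omega> * f \<omega>)"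
      using i[OF f] by auto
    show ?thesis
      unfolding Bochner_Integration.integral_diff[OF Bochner_Integration.integrable_diff[OF D1 D2] iL]
        Bochner_Integration.integral_diff[OF D1 D2] ..
  qed
  have "(\<integral>\<omega>. indicator D \<omega> * max 0 (\<bar>G s \<omega>\<bar> - L) \<partial>M) = (\<integral>\<omega>. indicator D1 \<omega> * G s \<omega> - indicator D2 \<omega> * G s \<omega> - L * (indicator D1 \<omega> + indicator D2 \<omega>) \<partial>M)"
    using L by (intro Bochner_Integration.integral_cong) (auto simp: D1_def D2_def space_F split: split_indicator)
  also have "\<dots> = (\<integral>\<omega>. indicator D1 \<omega> * G s \<omega> \<partial>M) - (\<integral>\<omega>. indicator D2 \<omega> * G s \<omega> \<partial>M) - (\<integral>\<omega>. L * (indicator D1 \<omega> + indicator D2 \<omega>) \<partial>M)"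
    by (rule split[OF int(2)])
  also have "\<dots> = (\<integral>\<omega>. indicator D1 \<omega> * G u \<omega> \<partial>M) - (\<integral>\<omega>. indicator D2 \<omega> * G u \<omega> \<partial>M) - (\<integral>\<omega>. L * (indicator D1 \<omega> + indicator D2 \<omega>) \<partial>M)"
    using martingale_integral_indicator[OF G assms(2,3)] D12 by simp
  also have "\<dots> = (\<integral>\<omega>. indicator D1 \<omega> * G u \<omega> - indicator D2 \<omega> * G u \<omega> - L * (indicator D1 \<omega> + indicator D2 \<omega>) \<partial>M)"
    by (rule split[OF int(1), symmetric])
  also have "\<dots> \<le> (\<integral>\<omega>. indicator D \<omega> * max 0 (\<bar>G u \<omega>\<bar> - L) \<partial>M)"
  proof (rule integral_mono)
    show "integrable M (\<lambda>\<omega>. indicator D \<omega> * max 0 (\<bar>G u \<omega>\<bar> - L))"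
      by (rule i[OF Bochner_Integration.integrable_bound[OF int(1)]]) (use L in auto)
    show "integrable M (\<lambda>\<omega>. indicator D1 \<omega> * G u \<omega> - indicator D2 \<omega> * G u \<omega> - L * (indicator D1 \<omega> + indicator D2 \<omega>))"
      by (intro Bochner_Integration.integrable_diff i iL) auto
  qed (use L in \<open>auto simp: D1_def D2_def split: split_indicator\<close>)
  finally show ?thesis .
qed

text \<open>
  Optional stopping at an optional time \<open>R\<close>: \<open>R\<close> is approximated from above on the grid
  \<open>s + (u - s) k / m\<close>, and the stopped values are uniformly integrable.
\<close>

lemma optional_stopping_aux:
  assumes G: "martingale M F G" and rc: "\<And>\<omega>. \<omega> \<in> space M \<Longrightarrow> right_continuous_path (\<lambda>t. G t \<omega>)"
    and R: "\<And>u. 0 \<le> u \<Longrightarrow> {\<omega> \<in> space M. R \<omega> < u} \<in> sets (F u)"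
    and su: "0 \<le> s" "s < u" and B: "B \<in> sets (F s)"
  defines "B' \<equiv> B \<inter> {\<omega> \<in> space M. s \<le> R \<omega>}"
  shows "integrable M (\<lambda>\<omega>. indicator B' \<omega> * G (min u (R \<omega>)) \<omega>)"
    "(\<integral>\<omega>. \<bar>indicator B' \<omega> * G (min u (R \<omega>)) \<omega>\<bar> \<partial>M) \<le> (\<integral>\<omega>. \<bar>G u \<omega>\<bar> \<partial>M)"
    "(\<integral>\<omega>. indicator B' \<omega> * G (min u (R \<omega>)) \<omega> \<partial>M) = (\<integral>\<omega>. indicator B' \<omega> * G u \<omega> \<partial>M)"
    "B' \<in> sets (F s)"
proof -
  have Gint: "integrable M (G v)" if "0 \<le> v" for v using G that by (auto simp: martingale_def)
  have u: "0 \<le> u" using su by simp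
  have ge: "{\<omega> \<in> space M. v \<le> R \<omega>} \<in> sets (F v)" if "0 \<le> v" for v
  proof -
    have "space (F v) - {\<omega> \<in> space M. R \<omega> < v} \<in> sets (F v)" using R[OF that] by auto
    also have "space (F v) - {\<omega> \<in> space M. R \<omega> < v} = {\<omega> \<in> space M. v \<le> R \<omega>}" by (auto simp: space_F)
    finally show ?thesis .
  qed
  show B': "B' \<in> sets (F s)" unfolding B'_def using B ge[OF su(1)] by auto
  have B's: "B' \<in> sets (F v)" if "s \<le> v" for v using F_mono[OF that] B' by auto
  have B'M [measurable]: "B' \<in> sets M" using B' sets_F by auto
  define x where "x m k = s + (u - s) * real k / real (Suc m)" for m k
  \<comment> \<open>The index of the grid cell that contains \<open>R\<close>. The cap at
    \<open>m\<close> sends every \<open>R\<close> beyond \<open>x m m\<close> to the last cell,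
    whose right end is \<open>x m (Suc m) = u\<close>.\<close>
  define \<kappa> where "\<kappa> m \<omega> = min m (nat \<lfloor>real (Suc m) * (R \<omega> - s) / (u - s)\<rfloor>)" for m \<omega>
  define E where "E m k = {\<omega> \<in> B'. \<kappa> m \<omega> = k}" for m k
  have x_le: "s \<le> x m k" "0 \<le> x m k" "k \<le> Suc m \<Longrightarrow> x m k \<le> u" "x m k \<le> x m (Suc k)" for m k
  proof -
    show "s \<le> x m k" "0 \<le> x m k" using su by (auto simp: x_def)
    show "x m k \<le> x m (Suc k)" using su by (auto simp: x_def divide_right_mono)
    assume "k \<le> Suc m"
    then have "(u - s) * (real k / real (Suc m)) \<le> (u - s) * 1" using su by (intro mult_left_mono) auto
    then show "x m k \<le> u" by (simp add: x_def)
  qed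
  have le_iff: "x m k \<le> v \<longleftrightarrow> real k \<le> real (Suc m) * (v - s) / (u - s)" for m k v
    using su by (simp add: x_def field_simps)
  have \<kappa>_le: "\<kappa> m \<omega> \<le> m" for m \<omega> by (simp add: \<kappa>_def)
  have E_eq: "E m k = B' \<inter> {\<omega> \<in> space M. x m k \<le> R \<omega>} \<inter> (if k < m then {\<omega> \<in> space M. R \<omega> < x m (Suc k)} else space M)"
    if "k \<le> m" for m k
  proof -
    have "\<kappa> m \<omega> = k \<longleftrightarrow> x m k \<le> R \<omega> \<and> (k < m \<longrightarrow> R \<omega> < x m (Suc k))" if "s \<le> R \<omega>" for \<omega>
    proof -
      define z where "z = real (Suc m) * (R \<omega> - s) / (u - s)"
      have z: "0 \<le> z" using that su by (simp add: z_def)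
      have 1: "x m k \<le> R \<omega> \<longleftrightarrow> k \<le> nat \<lfloor>z\<rfloor>"
        unfolding le_iff z_def[symmetric] using z by (simp add: le_nat_iff le_floor_iff)
      have 2: "R \<omega> < x m (Suc k) \<longleftrightarrow> nat \<lfloor>z\<rfloor> < Suc k"
        unfolding not_le[symmetric] le_iff z_def[symmetric] using z by (simp add: le_nat_iff le_floor_iff)
      have "\<kappa> m \<omega> = min m (nat \<lfloor>z\<rfloor>)" by (simp add: \<kappa>_def z_def)
      then show ?thesis unfolding 1 2 using \<open>k \<le> m\<close> by linarith
    qed
    then have "\<omega> \<in> E m k \<longleftrightarrow> \<omega> \<in> B' \<and> x m k \<le> R \<omega> \<and> (k < m \<longrightarrow> R \<omega> < x m (Suc k))" for \<omega>
      by (auto simp: E_def B'_def)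
    moreover have "\<omega> \<in> space M" if "\<omega> \<in> B'" for \<omega> using that sets.sets_into_space[OF B'M] by blast
    ultimately show ?thesis by (intro set_eqI) (simp, blast)
  qed
  \<comment> \<open>Only events \<open>R < v\<close> are known at time \<open>v\<close>, so
    membership of a cell is decided at its right end point.\<close>
  have E_meas: "E m k \<in> sets (F (x m (Suc k)))" if "k \<le> m" for m k
  proof -
    have "{\<omega> \<in> space M. x m k \<le> R \<omega>} \<in> sets (F (x m (Suc k)))"
      using ge[OF x_le(2)] F_mono[OF x_le(4)] by blast
    moreover have "space M \<in> sets (F (x m (Suc k)))" using space_F[of "x m (Suc k)"] by (metis sets.top)
    ultimately show ?thesis
      unfolding E_eq[OF that] using B's[OF x_le(1)[of m "Suc k"]] R[OF x_le(2)[of m "Suc k"]] by auto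
  qed
  have E_M [measurable]: "E m k \<in> sets M" if "k \<le> m" for m k using E_meas[OF that] sets_F by auto
  \<comment> \<open>\<open>G\<close> is evaluated at the right end of the cell: there the cell is
    known, and the right end converges to \<open>min u (R \<omega>)\<close> from above.\<close>
  define Y where "Y m \<omega> = (\<Sum>k\<le>m. indicator (E m k) \<omega> * G (x m (Suc k)) \<omega>)" for m \<omega>
  have Y_eq: "(\<Sum>k\<le>m. indicator (E m k) \<omega> * f k) = (if \<omega> \<in> B' then f (\<kappa> m \<omega>) else 0)" for m \<omega> and f :: "nat \<Rightarrow> real"
  proof -
    have "(\<Sum>k\<le>m. indicator (E m k) \<omega> * f k) = (\<Sum>k\<le>m. if k = \<kappa> m \<omega> then (if \<omega> \<in> B' then f (\<kappa> m \<omega>) else 0) else 0)"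
      by (intro sum.cong) (auto simp: E_def split: split_indicator)
    then show ?thesis using \<kappa>_le by simp
  qed
  have iE: "integrable M (\<lambda>\<omega>. indicator (E m k) \<omega> * f \<omega>)" if "integrable M f" "k \<le> m" for m k and f :: "'a \<Rightarrow> real"
    using integrable_mult_indicator[OF E_M[OF that(2)] that(1)] by simp
  have tail_int: "integrable M (\<lambda>\<omega>. max 0 (\<bar>G v \<omega>\<bar> - real L))" if "0 \<le> v" for v L
    by (rule Bochner_Integration.integrable_bound[OF Gint[OF that]]) (use Gint[OF that] in auto)
  have Y_int: "integrable M (Y m)" for m
    unfolding Y_def by (intro Bochner_Integration.integrable_sum iE Gint x_le) auto
  define e where "e L = (\<integral>\<omega>. max 0 (\<bar>G u \<omega>\<bar> - real L) \<partial>M)" for L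
  \<comment> \<open>On each cell the tail at its right end is dominated by the tail at
    \<open>u\<close>; summing over the disjoint cells gives a bound that does not depend on
    \<open>m\<close>.\<close>
  have Y_tail: "(\<integral>\<omega>. max 0 (\<bar>Y m \<omega>\<bar> - real L) \<partial>M) \<le> e L" for m L
  proof -
    have "(\<integral>\<omega>. max 0 (\<bar>Y m \<omega>\<bar> - real L) \<partial>M) = (\<integral>\<omega>. (\<Sum>k\<le>m. indicator (E m k) \<omega> * max 0 (\<bar>G (x m (Suc k)) \<omega>\<bar> - real L)) \<partial>M)"
      unfolding Y_def Y_eq by (intro Bochner_Integration.integral_cong) auto
    also have "\<dots> = (\<Sum>k\<le>m. \<integral>\<omega>. indicator (E m k) \<omega> * max 0 (\<bar>G (x m (Suc k)) \<omega>\<bar> - real L) \<partial>M)"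
      by (intro Bochner_Integration.integral_sum iE tail_int x_le) auto
    also have "\<dots> \<le> (\<Sum>k\<le>m. \<integral>\<omega>. indicator (E m k) \<omega> * max 0 (\<bar>G u \<omega>\<bar> - real L) \<partial>M)"
      by (intro sum_mono martingale_tail_mono[OF G] E_meas x_le) auto
    also have "\<dots> = (\<integral>\<omega>. (\<Sum>k\<le>m. indicator (E m k) \<omega> * max 0 (\<bar>G u \<omega>\<bar> - real L)) \<partial>M)"
      by (intro Bochner_Integration.integral_sum[symmetric] iE tail_int u) auto
    also have "\<dots> \<le> e L"
      unfolding e_def
    proof (rule integral_mono)
      show "integrable M (\<lambda>\<omega>. \<Sum>k\<le>m. indicator (E m k) \<omega> * max 0 (\<bar>G u \<omega>\<bar> - real L))"
        by (intro Bochner_Integration.integrable_sum iE tail_int u) auto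
    qed (use tail_int[OF u] in \<open>auto simp: Y_eq\<close>)
    finally show ?thesis .
  qed
  have Y_lim: "(\<lambda>m. Y m \<omega>) \<longlonglongrightarrow> indicator B' \<omega> * G (min u (R \<omega>)) \<omega>" if "\<omega> \<in> space M" for \<omega>
  proof (cases "\<omega> \<in> B'")
    case True
    then have sR: "s \<le> R \<omega>" by (simp add: B'_def)
    have bounds: "min u (R \<omega>) \<le> x m (Suc (\<kappa> m \<omega>)) \<and> x m (Suc (\<kappa> m \<omega>)) \<le> min u (R \<omega>) + (u - s) / real (Suc m)" for m
    proof -
      have "\<omega> \<in> E m (\<kappa> m \<omega>)" using True by (simp add: E_def)
      then have *: "x m (\<kappa> m \<omega>) \<le> R \<omega>" "\<kappa> m \<omega> < m \<Longrightarrow> R \<omega> < x m (Suc (\<kappa> m \<omega>))"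
        using E_eq[OF \<kappa>_le[of m \<omega>]] by (auto split: if_splits)
      have step: "x m (Suc k) = x m k + (u - s) / real (Suc m)" for k
        unfolding x_def by (simp add: add_divide_distrib distrib_left)
      have top: "x m (Suc m) = u" by (simp add: x_def)
      show ?thesis
      proof (cases "\<kappa> m \<omega> < m")
        case True
        then show ?thesis using * step[of "\<kappa> m \<omega>"] x_le(3)[of "\<kappa> m \<omega>" m] by auto
      next
        case False
        then have "\<kappa> m \<omega> = m" using \<kappa>_le[of m \<omega>] by simp
        then show ?thesis using * step[of m] top x_le(3)[of m m] by auto
      qed
    qed
    have "(\<lambda>m. x m (Suc (\<kappa> m \<omega>))) \<longlonglongrightarrow> min u (R \<omega>)"
    proof (rule tendsto_sandwich)
      show "\<forall>\<^sub>F m in sequentially. min u (R \<omega>) \<le> x m (Suc (\<kappa> m \<omega>))"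
        "\<forall>\<^sub>F m in sequentially. x m (Suc (\<kappa> m \<omega>)) \<le> min u (R \<omega>) + (u - s) / real (Suc m)"
        using bounds by auto
      show "(\<lambda>m. min u (R \<omega>) + (u - s) / real (Suc m)) \<longlonglongrightarrow> min u (R \<omega>)"
        using tendsto_add[OF tendsto_const LIMSEQ_Suc[OF lim_const_over_n[of "u - s"]]] by simp
    qed simp
    then have "(\<lambda>m. G (x m (Suc (\<kappa> m \<omega>))) \<omega>) \<longlonglongrightarrow> G (min u (R \<omega>)) \<omega>"
      by (rule right_continuous_path_tendsto[OF rc[OF that], rotated]) (use u su sR bounds in auto)
    then show ?thesis using True by (simp add: Y_def Y_eq)
  qed (simp add: Y_def Y_eq)
  have X_meas: "(\<lambda>\<omega>. indicator B' \<omega> * G (min u (R \<omega>)) \<omega>) \<in> borel_measurable M"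
    using Y_lim Y_int by (rule_tac borel_measurable_LIMSEQ_real[where u = Y]) auto
  have e0: "e \<longlonglongrightarrow> 0"
    unfolding e_def[abs_def] by (rule integral_tail_tendsto_0[OF Gint[OF u]])
  note UI = integral_tendsto_uniformly_integrable[OF Y_int X_meas Y_lim Y_tail e0]
  show "integrable M (\<lambda>\<omega>. indicator B' \<omega> * G (min u (R \<omega>)) \<omega>)" by (rule UI(1))
  show "(\<integral>\<omega>. \<bar>indicator B' \<omega> * G (min u (R \<omega>)) \<omega>\<bar> \<partial>M) \<le> (\<integral>\<omega>. \<bar>G u \<omega>\<bar> \<partial>M)"
    using UI(2) by (simp add: e_def)
  have "(\<integral>\<omega>. Y m \<omega> \<partial>M) = (\<integral>\<omega>. indicator B' \<omega> * G u \<omega> \<partial>M)" for m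
  proof -
    have "(\<integral>\<omega>. Y m \<omega> \<partial>M) = (\<Sum>k\<le>m. \<integral>\<omega>. indicator (E m k) \<omega> * G (x m (Suc k)) \<omega> \<partial>M)"
      unfolding Y_def by (intro Bochner_Integration.integral_sum iE Gint x_le) auto
    also have "\<dots> = (\<Sum>k\<le>m. \<integral>\<omega>. indicator (E m k) \<omega> * G u \<omega> \<partial>M)"
      by (intro sum.cong martingale_integral_indicator[OF G] E_meas x_le) auto
    also have "\<dots> = (\<integral>\<omega>. (\<Sum>k\<le>m. indicator (E m k) \<omega> * G u \<omega>) \<partial>M)"
      by (intro Bochner_Integration.integral_sum[symmetric] iE Gint u) auto
    also have "\<dots> = (\<integral>\<omega>. indicator B' \<omega> * G u \<omega> \<partial>M)"
      unfolding Y_eq by (intro Bochner_Integration.integral_cong) auto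
    finally show ?thesis .
  qed
  then have "(\<lambda>m. \<integral>\<omega>. Y m \<omega> \<partial>M) \<longlonglongrightarrow> (\<integral>\<omega>. indicator B' \<omega> * G u \<omega> \<partial>M)" by simp
  then show "(\<integral>\<omega>. indicator B' \<omega> * G (min u (R \<omega>)) \<omega> \<partial>M) = (\<integral>\<omega>. indicator B' \<omega> * G u \<omega> \<partial>M)"
    using UI(3) by (rule LIMSEQ_unique[rotated])
qed

lemma optional_stopping:
  assumes G: "martingale M F G" and rc: "\<And>\<omega>. \<omega> \<in> space M \<Longrightarrow> right_continuous_path (\<lambda>t. G t \<omega>)"
    and R: "\<And>u. 0 \<le> u \<Longrightarrow> {\<omega> \<in> space M. R \<omega> < u} \<in> sets (F u)" and R_nonneg: "\<And>\<omega>. \<omega> \<in> space M \<Longrightarrow> 0 \<le> R \<omega>"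
    and su: "0 \<le> s" "s \<le> u" and B: "B \<in> sets (F s)"
  shows "integrable M (\<lambda>\<omega>. G (min u (R \<omega>)) \<omega>)"
    "(\<integral>\<omega>. indicator B \<omega> * (G (min u (R \<omega>)) \<omega> - G (min s (R \<omega>)) \<omega>) \<partial>M) = 0"
proof -
  have Gint: "integrable M (G v)" if "0 \<le> v" for v using G that by (auto simp: martingale_def)
  show "integrable M (\<lambda>\<omega>. G (min u (R \<omega>)) \<omega>)"
  proof (cases "u = 0")
    case True
    have "integrable M (\<lambda>\<omega>. G (min u (R \<omega>)) \<omega>) \<longleftrightarrow> integrable M (G 0)"
      using True R_nonneg by (intro Bochner_Integration.integrable_cong) (auto simp: min_absorb1)
    then show ?thesis using Gint by simp
  next
    case False
    then have "0 < u" using su by simp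
    have "integrable M (\<lambda>\<omega>. G (min u (R \<omega>)) \<omega>) \<longleftrightarrow>
        integrable M (\<lambda>\<omega>. indicator (space (F 0) \<inter> {\<omega> \<in> space M. 0 \<le> R \<omega>}) \<omega> * G (min u (R \<omega>)) \<omega>)"
      using R_nonneg by (intro Bochner_Integration.integrable_cong) (auto simp: space_F)
    then show ?thesis
      using optional_stopping_aux(1)[OF G rc R order_refl \<open>0 < u\<close> sets.top] by simp
  qed
  show "(\<integral>\<omega>. indicator B \<omega> * (G (min u (R \<omega>)) \<omega> - G (min s (R \<omega>)) \<omega>) \<partial>M) = 0"
  proof (cases "s = u")
    case False
    then have "s < u" using su by simp
    define B' where "B' = B \<inter> {\<omega> \<in> space M. s \<le> R \<omega>}"
    note * = optional_stopping_aux[OF G rc R su(1) \<open>s < u\<close> B, folded B'_def]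
    have [measurable]: "B' \<in> sets M" using *(4) sets_F by auto
    \<comment> \<open>Where \<open>R < s\<close> both stopped values equal \<open>G\<close> at
      \<open>R\<close> and the difference vanishes, so \<open>B\<close> may be replaced by
      \<open>B'\<close>.\<close>
    have "(\<integral>\<omega>. indicator B \<omega> * (G (min u (R \<omega>)) \<omega> - G (min s (R \<omega>)) \<omega>) \<partial>M) =
        (\<integral>\<omega>. indicator B' \<omega> * G (min u (R \<omega>)) \<omega> - indicator B' \<omega> * G s \<omega> \<partial>M)"
      using su by (intro Bochner_Integration.integral_cong) (auto simp: B'_def min_absorb1 min_absorb2 split: split_indicator)
    also have "\<dots> = (\<integral>\<omega>. indicator B' \<omega> * G (min u (R \<omega>)) \<omega> \<partial>M) - (\<integral>\<omega>. indicator B' \<omega> * G s \<omega> \<partial>M)"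
      using integrable_mult_indicator[of B' M "G s"] Gint[OF su(1)] *(1)
      by (intro Bochner_Integration.integral_diff) auto
    also have "\<dots> = 0"
      using *(3) martingale_integral_indicator[OF G su *(4)] by simp
    finally show ?thesis .
  qed simp
qed



section \<open>Integrals of predictable processes\<close>

definition path_integral :: "(real \<Rightarrow> 'a \<Rightarrow> real) \<Rightarrow> real \<Rightarrow> (real \<times> 'a \<Rightarrow> ennreal) \<Rightarrow> 'a \<Rightarrow> ennreal" where
  "path_integral U t f \<omega> = (\<integral>\<^sup>+y\<in>{0<..t}. f (y, \<omega>) \<partial>path_measure (\<lambda>s. U s \<omega>))"

text \<open>For indicators \<open>f\<close> this is the Doleans measure of \<open>U\<close> on
  \<open>{0<..t}\<close>. Comparing two such measures on generators takes the place of constructing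
  a stochastic integral.\<close>

definition mean_integral :: "(real \<Rightarrow> 'a \<Rightarrow> real) \<Rightarrow> real \<Rightarrow> (real \<times> 'a \<Rightarrow> ennreal) \<Rightarrow> ennreal" where
  "mean_integral U t f = (\<integral>\<^sup>+\<omega>. path_integral U t f \<omega> \<partial>M)"

lemma inc_process_measurable: "inc_process U \<Longrightarrow> 0 \<le> t \<Longrightarrow> U t \<in> borel_measurable M"
  by (auto simp: inc_process_def adapted_def intro: measurable_F_M)

lemma inc_process_path: "inc_process U \<Longrightarrow> \<omega> \<in> space M \<Longrightarrow> inc_path (\<lambda>t. U t \<omega>)"
  by (simp add: inc_process_def)

lemma predictable_path_section:
  fixes f :: "real \<times> 'a \<Rightarrow> 'b :: {zero, topological_space}"
  assumes "f \<in> borel_measurable (predictable_sigma F)" "\<omega> \<in> space M"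
  shows "(\<lambda>y. if 0 < y then f (y, \<omega>) else 0) \<in> borel_measurable borel"
  using measurable_compose[OF measurable_Pair1'[OF assms(2)] predictable_imp_product[OF assms(1)]] by simp

lemma predictable_path_section_indicator:
  fixes f :: "real \<times> 'a \<Rightarrow> ennreal"
  assumes "f \<in> borel_measurable (predictable_sigma F)" "\<omega> \<in> space M"
  shows "(\<lambda>y. f (y, \<omega>) * indicator {0<..t} y) \<in> borel_measurable borel"
proof -
  have "(\<lambda>y. (if 0 < y then f (y, \<omega>) else 0) * indicator {0<..t} y) \<in> borel_measurable borel"
    using predictable_path_section[OF assms] by measurable
  also have "(\<lambda>y. (if 0 < y then f (y, \<omega>) else 0) * indicator {0<..t} y) = (\<lambda>y. f (y, \<omega>) * indicator {0<..t} y)"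
    by (auto simp: fun_eq_iff split: split_indicator)
  finally show ?thesis .
qed

lemma path_integral_measurable:
  assumes U: "inc_process U" and f: "f \<in> borel_measurable (predictable_sigma F)"
  shows "path_integral U t f \<in> borel_measurable M"
proof -
  have [measurable]: "(\<lambda>(\<omega>, y). if 0 < y then f (y, \<omega>) else 0) \<in> borel_measurable (M \<Otimes>\<^sub>M borel)"
    by (rule predictable_imp_product[OF f])
  have "(\<lambda>\<omega>. \<integral>\<^sup>+y. (\<lambda>(\<omega>, y). (if 0 < y then f (y, \<omega>) else 0) * indicator {0<..t} y) (\<omega>, y) \<partial>path_measure (\<lambda>s. U s \<omega>)) \<in> borel_measurable M"
    by (rule measurable_nn_integral_path_measure)
      (use inc_process_path[OF U] inc_process_measurable[OF U] in \<open>simp_all add: split_beta'\<close>)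
  also have "?this \<longleftrightarrow> ?thesis"
    by (rule measurable_cong) (auto simp: path_integral_def intro!: nn_integral_cong split: split_indicator)
  finally show ?thesis .
qed

lemma path_integral_add:
  assumes "f \<in> borel_measurable (predictable_sigma F)" "g \<in> borel_measurable (predictable_sigma F)" "\<omega> \<in> space M"
  shows "path_integral U t (\<lambda>z. f z + g z) \<omega> = path_integral U t f \<omega> + path_integral U t g \<omega>"
proof -
  have [measurable_cong]: "sets (path_measure (\<lambda>s. U s \<omega>)) = sets borel" by (simp add: path_measure_def)
  note [measurable] = predictable_path_section_indicator[OF assms(1,3), of t] predictable_path_section_indicator[OF assms(2,3), of t]
  show ?thesis unfolding path_integral_def distrib_right by (rule nn_integral_add) measurable
qed

lemma path_integral_cmult:
  assumes "f \<in> borel_measurable (predictable_sigma F)" "\<omega> \<in> space M"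
  shows "path_integral U t (\<lambda>z. c * f z) \<omega> = c * path_integral U t f \<omega>"
proof -
  have [measurable_cong]: "sets (path_measure (\<lambda>s. U s \<omega>)) = sets borel" by (simp add: path_measure_def)
  note [measurable] = predictable_path_section_indicator[OF assms, of t]
  show ?thesis unfolding path_integral_def mult.assoc by (rule nn_integral_cmult) measurable
qed

lemma path_integral_SUP:
  assumes "\<And>i. f i \<in> borel_measurable (predictable_sigma F)" "\<omega> \<in> space M"
    and inc: "\<And>y i. 0 < y \<Longrightarrow> y \<le> t \<Longrightarrow> f i (y, \<omega>) \<le> f (Suc i) (y, \<omega>)"
  shows "path_integral U t (\<lambda>z. SUP i. f i z) \<omega> = (SUP i. path_integral U t (f i) \<omega>)"
proof -
  have [measurable_cong]: "sets (path_measure (\<lambda>s. U s \<omega>)) = sets borel" by (simp add: path_measure_def)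
  note [measurable] = predictable_path_section_indicator[OF assms(1,2), of _ t]
  have "path_integral U t (\<lambda>z. SUP i. f i z) \<omega> = (\<integral>\<^sup>+y. (SUP i. f i (y, \<omega>) * indicator {0<..t} y) \<partial>path_measure (\<lambda>s. U s \<omega>))"
    unfolding path_integral_def by (intro nn_integral_cong) (auto split: split_indicator)
  also have "\<dots> = (SUP i. path_integral U t (f i) \<omega>)"
    unfolding path_integral_def
    by (rule nn_integral_monotone_convergence_SUP)
      (use inc in \<open>auto intro!: incseq_SucI le_funI split: split_indicator\<close>)
  finally show ?thesis .
qed

lemma path_integral_mono:
  assumes "\<And>y. 0 < y \<Longrightarrow> y \<le> t \<Longrightarrow> f (y, \<omega>) \<le> g (y, \<omega>)"
  shows "path_integral U t f \<omega> \<le> path_integral U t g \<omega>"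
  unfolding path_integral_def using assms by (intro nn_integral_mono) (auto split: split_indicator)

lemma path_integral_cong:
  assumes "\<And>y. 0 < y \<Longrightarrow> y \<le> t \<Longrightarrow> f (y, \<omega>) = g (y, \<omega>)"
  shows "path_integral U t f \<omega> = path_integral U t g \<omega>"
  unfolding path_integral_def using assms by (intro nn_integral_cong) (auto split: split_indicator)

lemma mean_integral_mono:
  assumes "\<And>y \<omega>. 0 < y \<Longrightarrow> y \<le> t \<Longrightarrow> \<omega> \<in> space M \<Longrightarrow> f (y, \<omega>) \<le> g (y, \<omega>)"
  shows "mean_integral U t f \<le> mean_integral U t g"
  unfolding mean_integral_def using assms by (intro nn_integral_mono path_integral_mono) auto

lemma mean_integral_cong:
  assumes "\<And>y \<omega>. 0 < y \<Longrightarrow> y \<le> t \<Longrightarrow> \<omega> \<in> space M \<Longrightarrow> f (y, \<omega>) = g (y, \<omega>)"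
  shows "mean_integral U t f = mean_integral U t g"
  unfolding mean_integral_def using assms by (intro nn_integral_cong path_integral_cong) auto

lemma mean_integral_add:
  assumes U: "inc_process U" and f: "f \<in> borel_measurable (predictable_sigma F)" and g: "g \<in> borel_measurable (predictable_sigma F)"
  shows "mean_integral U t (\<lambda>z. f z + g z) = mean_integral U t f + mean_integral U t g"
proof -
  note [measurable] = path_integral_measurable[OF U f] path_integral_measurable[OF U g]
  have "mean_integral U t (\<lambda>z. f z + g z) = (\<integral>\<^sup>+\<omega>. path_integral U t f \<omega> + path_integral U t g \<omega> \<partial>M)"
    unfolding mean_integral_def by (intro nn_integral_cong path_integral_add f g)
  then show ?thesis by (simp add: nn_integral_add mean_integral_def)
qed

lemma mean_integral_cmult:
  assumes U: "inc_process U" and f: "f \<in> borel_measurable (predictable_sigma F)"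
  shows "mean_integral U t (\<lambda>z. c * f z) = c * mean_integral U t f"
proof -
  note [measurable] = path_integral_measurable[OF U f]
  have "mean_integral U t (\<lambda>z. c * f z) = (\<integral>\<^sup>+\<omega>. c * path_integral U t f \<omega> \<partial>M)"
    unfolding mean_integral_def by (intro nn_integral_cong path_integral_cmult f)
  then show ?thesis by (simp add: nn_integral_cmult mean_integral_def)
qed

lemma mean_integral_SUP:
  assumes U: "inc_process U" and f: "\<And>i. f i \<in> borel_measurable (predictable_sigma F)"
    and inc: "\<And>y i \<omega>. 0 < y \<Longrightarrow> y \<le> t \<Longrightarrow> \<omega> \<in> space M \<Longrightarrow> f i (y, \<omega>) \<le> f (Suc i) (y, \<omega>)"
  shows "mean_integral U t (\<lambda>z. SUP i. f i z) = (SUP i. mean_integral U t (f i))"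
proof -
  note [measurable] = path_integral_measurable[OF U f]
  have "mean_integral U t (\<lambda>z. SUP i. f i z) = (\<integral>\<^sup>+\<omega>. (SUP i. path_integral U t (f i) \<omega>) \<partial>M)"
    unfolding mean_integral_def by (intro nn_integral_cong path_integral_SUP f inc)
  also have "\<dots> = (SUP i. mean_integral U t (f i))"
    unfolding mean_integral_def
  proof (rule nn_integral_monotone_convergence_SUP_AE)
    show "AE \<omega> in M. path_integral U t (f i) \<omega> \<le> path_integral U t (f (Suc i)) \<omega>" for i
      using inc by (intro AE_I2 path_integral_mono) auto
  qed simp
  finally show ?thesis .
qed

text \<open>A monotone class argument for two Doleans measures restricted to the predictable set
  \<open>J\<close>. The restriction provides the finite total mass from which complements can be
  subtracted.\<close>

lemma mean_integral_eqI:
  assumes t: "0 \<le> t" and U: "inc_process U" and U': "inc_process U'" and J: "J \<in> sets (predictable_sigma F)"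
    and fin: "mean_integral U t (indicator J) < \<infinity>"
    and gen: "\<And>X. X \<in> pred_gen \<Longrightarrow> mean_integral U t (\<lambda>z. indicator X z * indicator J z) = mean_integral U' t (\<lambda>z. indicator X z * indicator J z)"
    and f: "f \<in> borel_measurable (predictable_sigma F)"
  shows "mean_integral U t (\<lambda>z. f z * indicator J z) = mean_integral U' t (\<lambda>z. f z * indicator J z)"
proof -
  note [measurable] = J
  have total: "mean_integral K t (indicator J) = mean_integral K t (\<lambda>z. indicator ({0<..t} \<times> space (F 0)) z * indicator J z)" for K
    by (rule mean_integral_cong) (auto simp: space_F split: split_indicator)
  have "{0<..t} \<times> space (F 0) \<in> pred_gen" using t by (intro pred_genI(2)[of _ 0 t "space (F 0)"]) auto
  then have totals: "mean_integral U t (indicator J) = mean_integral U' t (indicator J)" unfolding total by (rule gen)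
  have sets: "mean_integral U t (\<lambda>z. indicator X z * indicator J z) = mean_integral U' t (\<lambda>z. indicator X z * indicator J z)"
    if "X \<in> sigma_sets ({0..} \<times> space M) pred_gen" for X
    using Int_stable_pred_gen pred_gen_closed that
  proof (induction rule: sigma_sets_induct_disjoint)
    case (basic A)
    then show ?case by (rule gen)
  next
    case empty
    then show ?case by (simp add: mean_integral_def path_integral_def)
  next
    case (compl A)
    have A [measurable]: "A \<in> sets (predictable_sigma F)" using compl(1) by (simp add: sets_predictable)
    have A' [measurable]: "{0..} \<times> space M - A \<in> sets (predictable_sigma F)"
      using sets.compl_sets[OF A] by (simp add: space_predictable)
    have split: "mean_integral K t (indicator J) = mean_integral K t (\<lambda>z. indicator ({0..} \<times> space M - A) z * indicator J z) + mean_integral K t (\<lambda>z. indicator A z * indicator J z)"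
      if "inc_process K" for K
    proof -
      have "mean_integral K t (indicator J) = mean_integral K t (\<lambda>z. indicator ({0..} \<times> space M - A) z * indicator J z + indicator A z * indicator J z)"
        by (rule mean_integral_cong) (auto split: split_indicator)
      also have "\<dots> = mean_integral K t (\<lambda>z. indicator ({0..} \<times> space M - A) z * indicator J z) + mean_integral K t (\<lambda>z. indicator A z * indicator J z)"
        by (rule mean_integral_add[OF that]) measurable
      finally show ?thesis .
    qed
    have "mean_integral U t (\<lambda>z. indicator A z * indicator J z) \<le> mean_integral U t (indicator J)"
      by (rule mean_integral_mono) (auto split: split_indicator)
    then have "mean_integral U t (\<lambda>z. indicator A z * indicator J z) \<noteq> \<top>" using fin by (auto simp: top_unique)
    then show ?case
      using split[OF U] split[OF U'] totals compl(2) by (simp add: ennreal_add_left_cancel add.commute[of "mean_integral _ _ (\<lambda>z. indicator ({0..} \<times> space M - A) z * _ z)"])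
  next
    case (union A)
    have A [measurable]: "A i \<in> sets (predictable_sigma F)" for i using union(2) by (auto simp: sets_predictable)
    define B where "B n z = (\<Sum>i<n. indicator (A i) z :: ennreal) * indicator J z" for n z
    have Bm [measurable]: "B n \<in> borel_measurable (predictable_sigma F)" for n unfolding B_def by measurable
    have B_eq: "mean_integral K t (B n) = (\<Sum>i<n. mean_integral K t (\<lambda>z. indicator (A i) z * indicator J z))" if K: "inc_process K" for K n
    proof (induction n)
      case 0
      have "mean_integral K t (B 0) = mean_integral K t (\<lambda>z. 0 * indicator J z)"
        by (rule mean_integral_cong) (simp add: B_def)
      also have "\<dots> = 0" by (subst mean_integral_cmult[OF K]) auto
      finally show ?case by simp
    next
      case (Suc n)
      have "mean_integral K t (B (Suc n)) = mean_integral K t (\<lambda>z. B n z + indicator (A n) z * indicator J z)"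
        by (rule mean_integral_cong) (simp add: B_def distrib_right)
      also have "\<dots> = mean_integral K t (B n) + mean_integral K t (\<lambda>z. indicator (A n) z * indicator J z)"
        by (rule mean_integral_add[OF K]) measurable
      finally show ?case using Suc by simp
    qed
    have "mean_integral K t (\<lambda>z. indicator (\<Union>i. A i) z * indicator J z) = (SUP n. mean_integral K t (B n))" if K: "inc_process K" for K
    proof -
      have "mean_integral K t (\<lambda>z. indicator (\<Union>i. A i) z * indicator J z) = mean_integral K t (\<lambda>z. SUP n. B n z)"
      proof (rule mean_integral_cong)
        fix y \<omega>
        have "indicator (\<Union>i. A i) (y, \<omega>) = (\<Sum>i. indicator (A i) (y, \<omega>) :: ennreal)"
          by (rule suminf_indicator[OF union(1), symmetric])
        then show "indicator (\<Union>i. A i) (y, \<omega>) * indicator J (y, \<omega>) = (SUP n. B n (y, \<omega>))"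
          unfolding B_def by (simp add: suminf_eq_SUP SUP_mult_right_ennreal)
      qed
      also have "\<dots> = (SUP n. mean_integral K t (B n))"
        by (rule mean_integral_SUP[OF K Bm]) (auto simp: B_def distrib_right)
      finally show ?thesis .
    qed
    then show ?case using B_eq U U' union(3) by simp
  qed
  show ?thesis using f
  proof (induction rule: borel_measurable_induct)
    case (cong f g)
    then have "mean_integral K t (\<lambda>z. f z * indicator J z) = mean_integral K t (\<lambda>z. g z * indicator J z)" for K
      by (intro mean_integral_cong) (auto simp: space_predictable)
    then show ?case using cong by simp
  next
    case (set A)
    then show ?case using sets by (simp add: sets_predictable)
  next
    case (mult u c)
    then show ?case using mean_integral_cmult[OF U, of "\<lambda>z. u z * indicator J z" t c] mean_integral_cmult[OF U', of "\<lambda>z. u z * indicator J z" t c]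
      by (simp add: mult.assoc)
  next
    case (add u v)
    note [measurable] = add.hyps(1) add.hyps(3)
    have m: "(\<lambda>z. v z * indicator J z) \<in> borel_measurable (predictable_sigma F)" "(\<lambda>z. u z * indicator J z) \<in> borel_measurable (predictable_sigma F)"
      by measurable
    show ?case using add.IH mean_integral_add[OF U m] mean_integral_add[OF U' m]
      by (simp add: distrib_right)
  next
    case (seq W)
    note [measurable] = seq.hyps(1)
    have "mean_integral K t (\<lambda>z. (SUP i. W i) z * indicator J z) = (SUP i. mean_integral K t (\<lambda>z. W i z * indicator J z))" if "inc_process K" for K
    proof -
      have "mean_integral K t (\<lambda>z. (SUP i. W i) z * indicator J z) = mean_integral K t (\<lambda>z. SUP i. W i z * indicator J z)"
        by (rule mean_integral_cong) (simp add: SUP_mult_right_ennreal image_comp)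
      also have "\<dots> = (SUP i. mean_integral K t (\<lambda>z. W i z * indicator J z))"
      proof (rule mean_integral_SUP[OF that])
        show "W i (y, \<omega>) * indicator J (y, \<omega>) \<le> W (Suc i) (y, \<omega>) * indicator J (y, \<omega>)" for i y \<omega>
          using incseq_SucD[OF \<open>incseq W\<close>, of i] by (intro mult_right_mono) (auto simp: le_fun_def)
      qed measurable
      finally show ?thesis .
    qed
    then show ?case using U U' seq.IH by simp
  qed
qed



section \<open>Martingales of locally finite variation\<close>

definition fv_martingale :: "(real \<Rightarrow> 'a \<Rightarrow> real) \<Rightarrow> bool" where
  "fv_martingale W \<longleftrightarrow> martingale M F W \<and> (\<forall>\<omega>\<in>space M. fv_path (\<lambda>t. W t \<omega>))"

definition var_process :: "(real \<Rightarrow> 'a \<Rightarrow> real) \<Rightarrow> real \<Rightarrow> 'a \<Rightarrow> real" where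
  "var_process W t \<omega> = total_variation (\<lambda>s. W s \<omega>) t"

definition pos_process :: "(real \<Rightarrow> 'a \<Rightarrow> real) \<Rightarrow> real \<Rightarrow> 'a \<Rightarrow> real" where
  "pos_process W t \<omega> = (var_process W t \<omega> + (W t \<omega> - W 0 \<omega>)) / 2"

definition neg_process :: "(real \<Rightarrow> 'a \<Rightarrow> real) \<Rightarrow> real \<Rightarrow> 'a \<Rightarrow> real" where
  "neg_process W t \<omega> = (var_process W t \<omega> - (W t \<omega> - W 0 \<omega>)) / 2"

context
  fixes W assumes W: "fv_martingale W"
begin

lemma W_path: "\<omega> \<in> space M \<Longrightarrow> fv_path (\<lambda>t. W t \<omega>)"
  using W by (simp add: fv_martingale_def)

lemma W_martingale: "martingale M F W"
  using W by (simp add: fv_martingale_def)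

lemma W_adapted: "0 \<le> s \<Longrightarrow> s \<le> t \<Longrightarrow> W s \<in> borel_measurable (F t)"
  using W_martingale by (auto simp: martingale_def adapted_def intro: measurable_F_mono)

lemma W_integrable: "0 \<le> t \<Longrightarrow> integrable M (W t)"
  using W_martingale by (auto simp: martingale_def)

lemma var_process_adapted: "0 \<le> t \<Longrightarrow> var_process W t \<in> borel_measurable (F t)"
proof (cases "t = 0")
  case True
  have "var_process W 0 \<in> borel_measurable (F 0) \<longleftrightarrow> (\<lambda>_. 0 :: real) \<in> borel_measurable (F 0)"
    by (rule measurable_cong) (auto simp: var_process_def space_F intro!: fv_path.V_0 W_path)
  then show ?thesis using True by simp
next
  case False
  assume "0 \<le> t"
  then have t: "0 < t" using False by simp
  show ?thesis
  proof (rule borel_measurableI_le)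
    fix c :: real
    define g where "g m \<omega> = (\<Sum>j<m. \<bar>W (t * real (Suc j) / real m) \<omega> - W (t * real j / real m) \<omega>\<bar>)" for m \<omega>
    have g: "g m \<in> borel_measurable (F t)" for m
      unfolding g_def[abs_def]
    proof (rule borel_measurable_sum)
      fix j assume j: "j \<in> {..<m}"
      have "t * real (Suc j) \<le> t * real m" "t * real j \<le> t * real m" using j t by (auto intro!: mult_left_mono simp del: of_nat_Suc)
      then have "t * real (Suc j) / real m \<le> t" "t * real j / real m \<le> t" using j by (simp_all add: divide_le_eq)
      then have "W (t * real (Suc j) / real m) \<in> borel_measurable (F t)" "W (t * real j / real m) \<in> borel_measurable (F t)"
        using t by (auto intro!: W_adapted simp del: of_nat_Suc)
      then show "(\<lambda>x. \<bar>W (t * real (Suc j) / real m) x - W (t * real j / real m) x\<bar>) \<in> borel_measurable (F t)"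
        by measurable
    qed
    have "{\<omega> \<in> space (F t). \<forall>m\<in>{0<..}. g m \<omega> \<le> c} \<in> sets (F t)"
      using g by measurable
    also have "{\<omega> \<in> space (F t). \<forall>m\<in>{0<..}. g m \<omega> \<le> c} = {\<omega> \<in> space (F t). var_process W t \<omega> \<le> c}"
      using fv_path.V_le_iff[OF W_path t] fv_path.grid_variation_def[OF W_path]
      by (auto simp: var_process_def space_F g_def)
    finally show "{\<omega> \<in> space (F t). var_process W t \<omega> \<le> c} \<in> sets (F t)" .
  qed
qed

lemma inc_var: "inc_process (var_process W)"
  unfolding inc_process_def adapted_def
proof safe
  fix \<omega> assume "\<omega> \<in> space M"
  then interpret fv_path "\<lambda>t. W t \<omega>" by (rule W_path)
  show "inc_path (\<lambda>t. var_process W t \<omega>)" unfolding var_process_def by unfold_locales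
qed (rule var_process_adapted)

lemma inc_pos: "inc_process (pos_process W)"
  unfolding inc_process_def adapted_def
proof safe
  fix \<omega> assume "\<omega> \<in> space M"
  then interpret fv_path "\<lambda>t. W t \<omega>" by (rule W_path)
  show "inc_path (\<lambda>t. pos_process W t \<omega>)" unfolding var_process_def pos_process_def by unfold_locales
next
  fix t :: real assume "0 \<le> t"
  note [measurable] = var_process_adapted[OF this] W_adapted[OF this order_refl] W_adapted[OF order_refl this]
  show "pos_process W t \<in> borel_measurable (F t)" unfolding pos_process_def[abs_def] by measurable
qed

lemma inc_neg: "inc_process (neg_process W)"
  unfolding inc_process_def adapted_def
proof safe
  fix \<omega> assume "\<omega> \<in> space M"
  then interpret fv_path "\<lambda>t. W t \<omega>" by (rule W_path)
  show "inc_path (\<lambda>t. neg_process W t \<omega>)" unfolding var_process_def neg_process_def by unfold_locales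
next
  fix t :: real assume "0 \<le> t"
  note [measurable] = var_process_adapted[OF this] W_adapted[OF this order_refl] W_adapted[OF order_refl this]
  show "neg_process W t \<in> borel_measurable (F t)" unfolding neg_process_def[abs_def] by measurable
qed

lemma process_measures:
  assumes "\<omega> \<in> space M"
  shows "path_measure (\<lambda>t. var_process W t \<omega>) = variation_measure (\<lambda>t. W t \<omega>)"
    "path_measure (\<lambda>t. pos_process W t \<omega>) = positive_measure (\<lambda>t. W t \<omega>)"
    "path_measure (\<lambda>t. neg_process W t \<omega>) = negative_measure (\<lambda>t. W t \<omega>)"
  using fv_path.path_measures[OF W_path[OF assms]] by (simp_all add: var_process_def pos_process_def neg_process_def)

lemma path_integral_variation:
  assumes f: "f \<in> borel_measurable (predictable_sigma F)" and \<omega>: "\<omega> \<in> space M"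
  shows "path_integral (var_process W) t f \<omega> = path_integral (pos_process W) t f \<omega> + path_integral (neg_process W) t f \<omega>"
proof -
  interpret fv_path "\<lambda>t. W t \<omega>" using W_path \<omega> .
  show ?thesis
    unfolding path_integral_def process_measures[OF \<omega>]
    by (rule nn_integral_variation) (rule predictable_path_section_indicator[OF f \<omega>])
qed

lemma mean_integral_variation:
  assumes f: "f \<in> borel_measurable (predictable_sigma F)"
  shows "mean_integral (var_process W) t f = mean_integral (pos_process W) t f + mean_integral (neg_process W) t f"
proof -
  note [measurable] = path_integral_measurable[OF inc_pos f] path_integral_measurable[OF inc_neg f]
  have "mean_integral (var_process W) t f = (\<integral>\<^sup>+\<omega>. path_integral (pos_process W) t f \<omega> + path_integral (neg_process W) t f \<omega> \<partial>M)"
    unfolding mean_integral_def by (intro nn_integral_cong path_integral_variation f)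
  then show ?thesis by (simp add: nn_integral_add mean_integral_def)
qed

text \<open>The stochastic interval up to the time at which the variation passes \<open>k\<close>.
  The variation is required to be small strictly before \<open>y\<close> only: this makes the set
  predictable and its sections closed on the right, but lets the variation jump beyond
  \<open>k\<close> at the end point.\<close>

definition localizing :: "nat \<Rightarrow> (real \<times> 'a) set" where
  "localizing k = {(y, \<omega>). 0 \<le> y \<and> \<omega> \<in> space M \<and> (\<forall>q. 0 \<le> q \<longrightarrow> q < y \<longrightarrow> var_process W q \<omega> \<le> real k)}"

lemma V_mono: "\<omega> \<in> space M \<Longrightarrow> 0 \<le> s \<Longrightarrow> s \<le> t \<Longrightarrow> var_process W s \<omega> \<le> var_process W t \<omega>"
  using fv_path.V_mono[OF W_path] by (simp add: var_process_def)

lemma rational_exit: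
  assumes "\<omega> \<in> space M"
  shows "(\<forall>q. 0 \<le> q \<longrightarrow> q < y \<longrightarrow> var_process W q \<omega> \<le> c) \<longleftrightarrow> (\<forall>q\<in>{q\<in>\<rat>. 0 \<le> q \<and> q < y}. var_process W q \<omega> \<le> c)"
proof safe
  fix q assume *: "\<forall>q\<in>{q\<in>\<rat>. 0 \<le> q \<and> q < y}. var_process W q \<omega> \<le> c" and q: "0 \<le> q" "q < y"
  obtain r where "r \<in> \<rat>" "q < r" "r < y" using Rats_dense_in_real[OF q(2)] by blast
  then have "var_process W r \<omega> \<le> c" using * q by auto
  then show "var_process W q \<omega> \<le> c" using V_mono[OF assms q(1), of r] \<open>q < r\<close> by linarith
qed auto

lemma exit_sets: "0 \<le> q \<Longrightarrow> {\<omega> \<in> space M. c < var_process W q \<omega>} \<in> sets (F q)"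
proof -
  assume "0 \<le> q"
  then have [measurable]: "var_process W q \<in> borel_measurable (F q)" by (rule var_process_adapted)
  have "{\<omega> \<in> space (F q). c < var_process W q \<omega>} \<in> sets (F q)" by measurable
  then show ?thesis by (simp add: space_F)
qed

lemma localizing_sets: "localizing k \<in> sets (predictable_sigma F)"
proof -
  have "(\<Union>q\<in>{q\<in>\<rat>. 0 \<le> q}. {q<..} \<times> {\<omega> \<in> space M. real k < var_process W q \<omega>}) \<in> sets (predictable_sigma F)"
    using predictable_after exit_sets by (intro sets.countable_UN') (auto intro: countable_subset[OF _ countable_rat])
  then have "space (predictable_sigma F) - (\<Union>q\<in>{q\<in>\<rat>. 0 \<le> q}. {q<..} \<times> {\<omega> \<in> space M. real k < var_process W q \<omega>}) \<in> sets (predictable_sigma F)"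
    by auto
  also have "space (predictable_sigma F) - (\<Union>q\<in>{q\<in>\<rat>. 0 \<le> q}. {q<..} \<times> {\<omega> \<in> space M. real k < var_process W q \<omega>}) = localizing k"
  proof (rule set_eqI)
    fix z :: "real \<times> 'a"
    obtain y \<omega> where z: "z = (y, \<omega>)" by (cases z)
    show "z \<in> space (predictable_sigma F) - (\<Union>q\<in>{q\<in>\<rat>. 0 \<le> q}. {q<..} \<times> {\<omega> \<in> space M. real k < var_process W q \<omega>}) \<longleftrightarrow> z \<in> localizing k"
    proof (cases "\<omega> \<in> space M")
      case True
      show ?thesis using True unfolding z localizing_def mem_Collect_eq prod.case rational_exit[OF True]
        by (auto simp: space_predictable not_less)
    qed (auto simp: z localizing_def space_predictable)
  qed
  finally show ?thesis .
qed

lemma localizing_mono: "localizing k \<subseteq> localizing (Suc k)"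
  by (fastforce simp: localizing_def)

lemma localizing_UN: "\<omega> \<in> space M \<Longrightarrow> 0 \<le> y \<Longrightarrow> \<exists>k. (y, \<omega>) \<in> localizing k"
proof -
  assume *: "\<omega> \<in> space M" "0 \<le> y"
  obtain k where "var_process W y \<omega> \<le> real k" using real_arch_simple by blast
  then have "var_process W q \<omega> \<le> real k" if "0 \<le> q" "q < y" for q
    using V_mono[OF *(1), of q y] that by linarith
  then show ?thesis using * by (intro exI[of _ k]) (simp add: localizing_def)
qed

lemma SUP_localizing:
  assumes "\<omega> \<in> space M" "0 \<le> y"
  shows "(SUP k. c * indicator (localizing k) (y, \<omega>)) = (c :: ennreal)"
proof (rule antisym)
  show "(SUP k. c * indicator (localizing k) (y, \<omega>)) \<le> c"
    by (intro SUP_least) (auto split: split_indicator)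
  obtain k where "(y, \<omega>) \<in> localizing k" using localizing_UN[OF assms] by blast
  then show "c \<le> (SUP k. c * indicator (localizing k) (y, \<omega>))" by (intro SUP_upper2[of k]) auto
qed

definition exit_time :: "real \<Rightarrow> nat \<Rightarrow> 'a \<Rightarrow> real" where
  "exit_time t k \<omega> = Sup {y \<in> {0..t}. (y, \<omega>) \<in> localizing k}"

context
  fixes t :: real and k :: nat
  assumes t: "0 \<le> t"
begin

lemma exit_time_bounds:
  assumes "\<omega> \<in> space M"
  shows "0 \<le> exit_time t k \<omega>" "exit_time t k \<omega> \<le> t"
proof -
  have "0 \<in> {y \<in> {0..t}. (y, \<omega>) \<in> localizing k}" using assms t by (auto simp: localizing_def)
  moreover have "bdd_above {y \<in> {0..t}. (y, \<omega>) \<in> localizing k}" by (intro bdd_aboveI[of _ t]) auto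
  ultimately show "0 \<le> exit_time t k \<omega>" "exit_time t k \<omega> \<le> t"
    unfolding exit_time_def by (auto intro!: cSup_upper cSup_least)
qed

lemma localizing_iff:
  assumes \<omega>: "\<omega> \<in> space M" and y: "0 \<le> y" "y \<le> t"
  shows "(y, \<omega>) \<in> localizing k \<longleftrightarrow> y \<le> exit_time t k \<omega>"
proof
  have bdd: "bdd_above {y \<in> {0..t}. (y, \<omega>) \<in> localizing k}" by (intro bdd_aboveI[of _ t]) auto
  show "(y, \<omega>) \<in> localizing k \<Longrightarrow> y \<le> exit_time t k \<omega>"
    unfolding exit_time_def using y bdd by (intro cSup_upper) auto
  assume *: "y \<le> exit_time t k \<omega>"
  show "(y, \<omega>) \<in> localizing k"
  proof -
    have "var_process W q \<omega> \<le> real k" if q: "0 \<le> q" "q < y" for q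
    proof -
      have "q < Sup {y \<in> {0..t}. (y, \<omega>) \<in> localizing k}" using q * by (simp add: exit_time_def)
      moreover have "{y \<in> {0..t}. (y, \<omega>) \<in> localizing k} \<noteq> {}" using \<omega> t by (auto simp: localizing_def intro!: exI[of _ 0])
      ultimately obtain z where "q < z" "(z, \<omega>) \<in> localizing k"
        using less_cSup_iff[OF _ bdd] by auto
      then show ?thesis using q by (auto simp: localizing_def)
    qed
    then show ?thesis using \<omega> y by (simp add: localizing_def)
  qed
qed

text \<open>An exit before \<open>u\<close> shows at a rational time q < u with variation above
  \<open>k\<close>, hence is known at \<open>u\<close>. At the exit time itself nothing may be
  visible yet, which is why the event carries a strict inequality.\<close>

lemma exit_time_optional:
  assumes u: "0 \<le> u"
  shows "{\<omega> \<in> space M. exit_time t k \<omega> < u} \<in> sets (F u)"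
proof (cases "u \<le> t")
  case True
  have "(\<Union>q\<in>{q\<in>\<rat>. 0 \<le> q \<and> q < u}. {\<omega> \<in> space M. real k < var_process W q \<omega>}) \<in> sets (F u)"
  proof (rule sets.countable_UN')
    show "countable {q\<in>\<rat>. 0 \<le> q \<and> q < u}" by (rule countable_subset[OF _ countable_rat]) auto
    show "(\<lambda>q. {\<omega> \<in> space M. real k < var_process W q \<omega>}) ` {q\<in>\<rat>. 0 \<le> q \<and> q < u} \<subseteq> sets (F u)"
    proof safe
      fix q assume "0 \<le> q" "q < u"
      then show "{\<omega> \<in> space M. real k < var_process W q \<omega>} \<in> sets (F u)"
        using exit_sets[of q "real k"] F_mono[of q u] by auto
    qed
  qed
  also have "(\<Union>q\<in>{q\<in>\<rat>. 0 \<le> q \<and> q < u}. {\<omega> \<in> space M. real k < var_process W q \<omega>}) = {\<omega> \<in> space M. exit_time t k \<omega> < u}"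
  proof -
    have "exit_time t k \<omega> < u \<longleftrightarrow> (\<exists>q\<in>{q\<in>\<rat>. 0 \<le> q \<and> q < u}. real k < var_process W q \<omega>)" if "\<omega> \<in> space M" for \<omega>
      using localizing_iff[OF that u True] rational_exit[OF that, of u "real k"] that u
      by (auto simp: localizing_def not_le[symmetric])
    then show ?thesis by auto
  qed
  finally show ?thesis .
next
  case False
  then have "{\<omega> \<in> space M. exit_time t k \<omega> < u} = space M" using exit_time_bounds(2) by force
  then show ?thesis using space_F[of u] by (metis sets.top)
qed

text \<open>Before the exit time r the variation is at most \<open>k\<close>, and the jump at r is
  at most |W(s)| + |W(r)| with |W(s)| \<le> |W(0)| + k for s just before r; hence
  \<open>2 * real k\<close>. The stopped value on the right is integrable by optional
  stopping.\<close>

lemma var_exit_le: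
  assumes \<omega>: "\<omega> \<in> space M"
  shows "var_process W (exit_time t k \<omega>) \<omega> \<le> 2 * real k + \<bar>W 0 \<omega>\<bar> + \<bar>W (min t (exit_time t k \<omega>)) \<omega>\<bar>"
proof -
  interpret fv_path "\<lambda>t. W t \<omega>" using W_path[OF \<omega>] .
  define r where "r = exit_time t k \<omega>"
  have r: "0 \<le> r" "min t r = r" using exit_time_bounds[OF \<omega>] by (auto simp: r_def)
  have "V r \<le> 2 * real k + \<bar>W 0 \<omega>\<bar> + \<bar>W r \<omega>\<bar>"
  proof (cases "r = 0")
    case False
    have "(r, \<omega>) \<in> localizing k" using localizing_iff[OF \<omega>, of r] exit_time_bounds[OF \<omega>] by (auto simp: r_def)
    then have less: "V s \<le> real k" if "0 \<le> s" "s < r" for s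
      using that by (auto simp: localizing_def var_process_def)
    show ?thesis
    proof (rule V_left_bound)
      show "0 < r" using r False by simp
      then have "\<forall>\<^sub>F s in at_left r. s \<in> {0<..<r}" by (rule eventually_at_left_real)
      then show "\<forall>\<^sub>F s in at_left r. V s + \<bar>W r \<omega> - W s \<omega>\<bar> \<le> 2 * real k + \<bar>W 0 \<omega>\<bar> + \<bar>W r \<omega>\<bar>"
      proof eventually_elim
        case (elim s)
        then show ?case using less[of s] abs_diff_le_V[of s] by auto
      qed
    qed
  qed simp
  then show ?thesis using r by (simp add: r_def[symmetric] var_process_def)
qed

lemma stopped_integrable: "integrable M (\<lambda>\<omega>. W (min t (exit_time t k \<omega>)) \<omega>)"
  by (rule optional_stopping(1)[OF W_martingale fv_path.right_cont[OF W_path] exit_time_optional exit_time_bounds(1) order_refl t sets.top])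

lemma path_integral_localizing:
  assumes U: "inc_process U" and s: "0 \<le> s" "s \<le> u" "u \<le> t" and \<omega>: "\<omega> \<in> space M"
  shows "path_integral U t (\<lambda>z. indicator ({s<..u} \<times> B) z * indicator (localizing k) z) \<omega> =
    indicator B \<omega> * ennreal (U (min u (exit_time t k \<omega>)) \<omega> - U (min s (exit_time t k \<omega>)) \<omega>)"
proof -
  interpret inc_path "\<lambda>s. U s \<omega>" using U \<omega> by (rule inc_process_path)
  let ?R = "exit_time t k \<omega>"
  have R: "0 \<le> ?R" "?R \<le> t" using exit_time_bounds[OF \<omega>] by auto
  have "path_integral U t (\<lambda>z. indicator ({s<..u} \<times> B) z * indicator (localizing k) z) \<omega> =
    (\<integral>\<^sup>+y. indicator B \<omega> * indicator {min s ?R<..min u ?R} y \<partial>path_measure (\<lambda>s. U s \<omega>))"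
    unfolding path_integral_def
    using localizing_iff[OF \<omega>] s by (intro nn_integral_cong) (auto split: split_indicator)
  also have "\<dots> = indicator B \<omega> * emeasure (path_measure (\<lambda>s. U s \<omega>)) {min s ?R<..min u ?R}"
    by (rule nn_integral_cmult_indicator) (simp add: sets_path_measure)
  finally show ?thesis using s R by (subst (asm) emeasure_Ioc) auto
qed

lemma mean_localizing_finite: "mean_integral (var_process W) t (indicator (localizing k)) < \<infinity>"
proof -
  have "mean_integral (var_process W) t (indicator (localizing k)) =
      mean_integral (var_process W) t (\<lambda>z. indicator ({0<..t} \<times> space M) z * indicator (localizing k) z)"
    by (rule mean_integral_cong) (auto split: split_indicator)
  also have "\<dots> \<le> (\<integral>\<^sup>+\<omega>. ennreal (2 * real k + \<bar>W 0 \<omega>\<bar> + \<bar>W (min t (exit_time t k \<omega>)) \<omega>\<bar>) \<partial>M)"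
    unfolding mean_integral_def
  proof (rule nn_integral_mono)
    fix \<omega> assume \<omega>: "\<omega> \<in> space M"
    have "var_process W 0 \<omega> = 0" using fv_path.V_0[OF W_path[OF \<omega>]] by (simp add: var_process_def)
    then show "path_integral (var_process W) t (\<lambda>z. indicator ({0<..t} \<times> space M) z * indicator (localizing k) z) \<omega>
        \<le> ennreal (2 * real k + \<bar>W 0 \<omega>\<bar> + \<bar>W (min t (exit_time t k \<omega>)) \<omega>\<bar>)"
      using \<omega> t exit_time_bounds[OF \<omega>] var_exit_le[OF \<omega>]
      by (subst path_integral_localizing[OF inc_var]) (auto intro!: ennreal_leI simp: min_absorb1 min_absorb2 simp del: ennreal_plus)
  qed
  also have "\<dots> < \<infinity>"
  proof -
    have "integrable M (\<lambda>\<omega>. 2 * real k + \<bar>W 0 \<omega>\<bar> + \<bar>W (min t (exit_time t k \<omega>)) \<omega>\<bar>)"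
      using W_integrable[of 0] stopped_integrable by simp
    then show ?thesis by (subst nn_integral_eq_integral) auto
  qed
  finally show ?thesis .
qed

text \<open>On a rectangle of positive times the two sides are means of increments of the stopped
  Jordan parts. Their difference is the mean of an increment of the stopped martingale on an event
  known at its start, which is 0.\<close>

lemma mean_localizing_gen:
  assumes X: "X \<in> pred_gen"
  shows "mean_integral (pos_process W) t (\<lambda>z. indicator X z * indicator (localizing k) z)
    = mean_integral (neg_process W) t (\<lambda>z. indicator X z * indicator (localizing k) z)"
  using X
proof (cases rule: pred_gen_cases)
  case (1 B)
  have "mean_integral U t (\<lambda>z. indicator X z * indicator (localizing k) z) = 0" for U
  proof -
    have "mean_integral U t (\<lambda>z. indicator X z * indicator (localizing k) z) = mean_integral U t (\<lambda>z. 0)"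
      using 1 by (intro mean_integral_cong) auto
    then show ?thesis by (simp add: mean_integral_def path_integral_def)
  qed
  then show ?thesis by simp
next
  case (2 s u' B)
  \<comment> \<open>Times beyond \<open>t\<close> do not enter \<open>mean_integral\<close>, and the
    comparison with the exit time, itself capped at \<open>t\<close>, is made for times up to
    \<open>t\<close>.\<close>
  define u where "u = min u' t"
  have restrict: "mean_integral U t (\<lambda>z. indicator X z * indicator (localizing k) z) = mean_integral U t (\<lambda>z. indicator ({s<..u} \<times> B) z * indicator (localizing k) z)" for U
    using 2 by (intro mean_integral_cong) (auto simp: u_def split: split_indicator)
  show ?thesis
  proof (cases "s \<le> u")
    case False
    then have "{s<..u} = {}" by simp
    then have "{s<..u} \<times> B = {}" by simp
    then show ?thesis unfolding restrict by (simp add: mean_integral_def path_integral_def)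
  next
    case True
    have s: "0 \<le> s" "s \<le> u" "u \<le> t" using 2 True by (auto simp: u_def)
    have B [measurable]: "B \<in> sets M" using 2 sets_F by auto
    let ?R = "exit_time t k"
    define p where "p \<omega> = pos_process W (min u (?R \<omega>)) \<omega> - pos_process W (min s (?R \<omega>)) \<omega>" for \<omega>
    define n where "n \<omega> = neg_process W (min u (?R \<omega>)) \<omega> - neg_process W (min s (?R \<omega>)) \<omega>" for \<omega>
    have pn: "0 \<le> p \<omega>" "0 \<le> n \<omega>" "p \<omega> - n \<omega> = W (min u (?R \<omega>)) \<omega> - W (min s (?R \<omega>)) \<omega>" if "\<omega> \<in> space M" for \<omega>
    proof -
      have "0 \<le> min s (?R \<omega>)" "min s (?R \<omega>) \<le> min u (?R \<omega>)" using exit_time_bounds[OF that] s by auto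
      then show "0 \<le> p \<omega>" "0 \<le> n \<omega>"
        using mono_onD[OF inc_path.inc[OF inc_process_path[OF inc_pos that]], of "min s (?R \<omega>)" "min u (?R \<omega>)"]
          mono_onD[OF inc_path.inc[OF inc_process_path[OF inc_neg that]], of "min s (?R \<omega>)" "min u (?R \<omega>)"]
        by (auto simp: p_def n_def)
      show "p \<omega> - n \<omega> = W (min u (?R \<omega>)) \<omega> - W (min s (?R \<omega>)) \<omega>"
        by (simp add: p_def n_def pos_process_def neg_process_def field_simps)
    qed
    have eq: "mean_integral (pos_process W) t (\<lambda>z. indicator ({s<..u} \<times> B) z * indicator (localizing k) z) = (\<integral>\<^sup>+\<omega>. ennreal (indicator B \<omega> * p \<omega>) \<partial>M)"
      "mean_integral (neg_process W) t (\<lambda>z. indicator ({s<..u} \<times> B) z * indicator (localizing k) z) = (\<integral>\<^sup>+\<omega>. ennreal (indicator B \<omega> * n \<omega>) \<partial>M)"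
      unfolding mean_integral_def p_def n_def using path_integral_localizing[OF inc_pos s] path_integral_localizing[OF inc_neg s]
      by (auto intro!: nn_integral_cong split: split_indicator)
    have [measurable]: "{s<..u} \<times> B \<in> sets (predictable_sigma F)" using 2 by (intro predictable_Ioc) auto
    note [measurable] = localizing_sets
    \<comment> \<open>Both means must be finite before their difference may be formed; they are
      dominated by the mean of the localised variation.\<close>
    have fin: "mean_integral U t (\<lambda>z. indicator ({s<..u} \<times> B) z * indicator (localizing k) z) < \<infinity>" if "U = pos_process W \<or> U = neg_process W" for U
    proof -
      have "mean_integral U t (\<lambda>z. indicator ({s<..u} \<times> B) z * indicator (localizing k) z) \<le> mean_integral U t (indicator (localizing k))"
        by (rule mean_integral_mono) (auto split: split_indicator)
      also have "\<dots> \<le> mean_integral (var_process W) t (indicator (localizing k))"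
        using that mean_integral_variation[of "indicator (localizing k)" t] by auto
      finally show ?thesis using mean_localizing_finite by (rule le_less_trans)
    qed
    have meas: "(\<lambda>\<omega>. indicator B \<omega> * p \<omega>) \<in> borel_measurable M" "(\<lambda>\<omega>. indicator B \<omega> * n \<omega>) \<in> borel_measurable M"
    proof -
      have *: "(\<lambda>\<omega>. indicator B \<omega> * (U (min u (?R \<omega>)) \<omega> - U (min s (?R \<omega>)) \<omega>)) \<in> borel_measurable M" if U: "inc_process U" for U
      proof -
        have "(\<lambda>z. indicator ({s<..u} \<times> B) z * indicator (localizing k) z :: ennreal) \<in> borel_measurable (predictable_sigma F)" by measurable
        from path_integral_measurable[OF U this, of t]
        have "(\<lambda>\<omega>. enn2real (path_integral U t (\<lambda>z. indicator ({s<..u} \<times> B) z * indicator (localizing k) z) \<omega>)) \<in> borel_measurable M"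
          by measurable
        also have "?this \<longleftrightarrow> ?thesis"
        proof (rule measurable_cong)
          fix \<omega> assume \<omega>: "\<omega> \<in> space M"
          have "0 \<le> U (min u (?R \<omega>)) \<omega> - U (min s (?R \<omega>)) \<omega>"
            using mono_onD[OF inc_path.inc[OF inc_process_path[OF U \<omega>]], of "min s (?R \<omega>)" "min u (?R \<omega>)"] exit_time_bounds[OF \<omega>] s by auto
          then show "enn2real (path_integral U t (\<lambda>z. indicator ({s<..u} \<times> B) z * indicator (localizing k) z) \<omega>) =
              indicator B \<omega> * (U (min u (?R \<omega>)) \<omega> - U (min s (?R \<omega>)) \<omega>)"
            using path_integral_localizing[OF U s \<omega>] by (auto split: split_indicator)
        qed
        finally show ?thesis .
      qed
      show "(\<lambda>\<omega>. indicator B \<omega> * p \<omega>) \<in> borel_measurable M" "(\<lambda>\<omega>. indicator B \<omega> * n \<omega>) \<in> borel_measurable M"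
        unfolding p_def n_def using *[OF inc_pos] *[OF inc_neg] .
    qed
    have int: "integrable M (\<lambda>\<omega>. indicator B \<omega> * p \<omega>)" "integrable M (\<lambda>\<omega>. indicator B \<omega> * n \<omega>)"
      using fin[of "pos_process W"] fin[of "neg_process W"] pn meas by (auto intro!: integrableI_nonneg simp: eq)
    have "(\<integral>\<omega>. indicator B \<omega> * p \<omega> \<partial>M) - (\<integral>\<omega>. indicator B \<omega> * n \<omega> \<partial>M) = (\<integral>\<omega>. indicator B \<omega> * (W (min u (?R \<omega>)) \<omega> - W (min s (?R \<omega>)) \<omega>) \<partial>M)"
      using pn by (subst Bochner_Integration.integral_diff[OF int, symmetric], intro Bochner_Integration.integral_cong)
        (auto simp: right_diff_distrib[symmetric])
    also have "\<dots> = 0"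
      by (rule optional_stopping(2)[OF W_martingale fv_path.right_cont[OF W_path] exit_time_optional exit_time_bounds(1) s(1,2)])
        (use 2 in auto)
    finally have "(\<integral>\<omega>. indicator B \<omega> * p \<omega> \<partial>M) = (\<integral>\<omega>. indicator B \<omega> * n \<omega> \<partial>M)" by simp
    then show ?thesis unfolding restrict eq using int pn by (simp add: nn_integral_eq_integral)
  qed
qed

lemma mean_localizing_eq:
  assumes f: "f \<in> borel_measurable (predictable_sigma F)"
  shows "mean_integral (pos_process W) t (\<lambda>z. f z * indicator (localizing k) z) = mean_integral (neg_process W) t (\<lambda>z. f z * indicator (localizing k) z)"
proof (rule mean_integral_eqI[OF t inc_pos inc_neg localizing_sets _ mean_localizing_gen f])
  show "mean_integral (pos_process W) t (indicator (localizing k)) < \<infinity>"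
    using mean_localizing_finite mean_integral_variation[of "indicator (localizing k)" t] localizing_sets
    by (simp add: borel_measurable_indicator)
qed

end

text \<open>The integral of \<open>f\<close> against \<open>W\<close> has mean zero, written without
  a difference so that both sides may be infinite. The localising sets exhaust all positive times,
  and monotone convergence carries the equality over.\<close>

theorem mean_integral_fv_martingale:
  assumes t: "0 \<le> t" and f: "f \<in> borel_measurable (predictable_sigma F)"
  shows "mean_integral (pos_process W) t f = mean_integral (neg_process W) t f"
proof -
  note [measurable] = localizing_sets f
  have "mean_integral U t f = (SUP k. mean_integral U t (\<lambda>z. f z * indicator (localizing k) z))" if U: "inc_process U" for U
  proof -
    have "mean_integral U t f = mean_integral U t (\<lambda>z. SUP k. f z * indicator (localizing k) z)"
      by (rule mean_integral_cong) (simp add: SUP_localizing)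
    also have "\<dots> = (SUP k. mean_integral U t (\<lambda>z. f z * indicator (localizing k) z))"
      by (rule mean_integral_SUP[OF U]) (use localizing_mono in \<open>auto split: split_indicator\<close>)
    finally show ?thesis .
  qed
  then show ?thesis using inc_pos inc_neg mean_localizing_eq[OF t f] by simp
qed

end



section \<open>The predictable variation as a compensator\<close>

text \<open>The complement is a countable union, over rationals q, of the event
  \<open>S \<le> q\<close> switched on after q. The \<open>max 0\<close> keeps time 0 in the set at
  outcomes where \<open>S\<close> is negative.\<close>

lemma predictable_until:
  assumes "\<And>q. 0 \<le> q \<Longrightarrow> {\<omega> \<in> space M. S \<omega> \<le> q} \<in> sets (F q)"
  shows "{(y, \<omega>). 0 \<le> y \<and> \<omega> \<in> space M \<and> y \<le> max 0 (S \<omega>)} \<in> sets (predictable_sigma F)"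
proof -
  have "(\<Union>q\<in>{q\<in>\<rat>. 0 \<le> q}. {q<..} \<times> {\<omega> \<in> space M. S \<omega> \<le> q}) \<in> sets (predictable_sigma F)"
    using predictable_after assms by (intro sets.countable_UN') (auto intro: countable_subset[OF _ countable_rat])
  then have "space (predictable_sigma F) - (\<Union>q\<in>{q\<in>\<rat>. 0 \<le> q}. {q<..} \<times> {\<omega> \<in> space M. S \<omega> \<le> q}) \<in> sets (predictable_sigma F)"
    by auto
  also have "space (predictable_sigma F) - (\<Union>q\<in>{q\<in>\<rat>. 0 \<le> q}. {q<..} \<times> {\<omega> \<in> space M. S \<omega> \<le> q}) =
    {(y, \<omega>). 0 \<le> y \<and> \<omega> \<in> space M \<and> y \<le> max 0 (S \<omega>)}"
  proof -
    have "(\<exists>q\<in>\<rat>. 0 \<le> q \<and> q < y \<and> S \<omega> \<le> q) \<longleftrightarrow> max 0 (S \<omega>) < y" for y \<omega>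
    proof
      assume "max 0 (S \<omega>) < y"
      then obtain q where "q \<in> \<rat>" "max 0 (S \<omega>) < q" "q < y" using Rats_dense_in_real by blast
      then show "\<exists>q\<in>\<rat>. 0 \<le> q \<and> q < y \<and> S \<omega> \<le> q" by (intro bexI[of _ q]) auto
    qed auto
    then have *: "(y, \<omega>) \<in> (\<Union>q\<in>{q\<in>\<rat>. 0 \<le> q}. {q<..} \<times> {\<omega> \<in> space M. S \<omega> \<le> q}) \<longleftrightarrow> \<omega> \<in> space M \<and> max 0 (S \<omega>) < y" for y \<omega>
      by blast
    show ?thesis
    proof (rule set_eqI)
      fix z :: "real \<times> 'a"
      show "z \<in> space (predictable_sigma F) - (\<Union>q\<in>{q\<in>\<rat>. 0 \<le> q}. {q<..} \<times> {\<omega> \<in> space M. S \<omega> \<le> q}) \<longleftrightarrow>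
        z \<in> {(y, \<omega>). 0 \<le> y \<and> \<omega> \<in> space M \<and> y \<le> max 0 (S \<omega>)}"
        using *[of "fst z" "snd z"] by (cases z) (auto simp: space_predictable not_less simp del: UN_iff)
    qed
  qed
  finally show ?thesis .
qed

lemma fv_martingale_integral_zero:
  fixes g :: "real \<times> 'a \<Rightarrow> real"
  assumes W: "fv_martingale W" and t: "0 \<le> t" and g [measurable]: "g \<in> borel_measurable (predictable_sigma F)"
    and fin: "mean_integral (var_process W) t (\<lambda>z. ennreal \<bar>g z\<bar>) < \<infinity>"
  defines "X \<equiv> \<lambda>\<omega>. (LINT y:{0<..t}|positive_measure (\<lambda>s. W s \<omega>). g (y, \<omega>)) - (LINT y:{0<..t}|negative_measure (\<lambda>s. W s \<omega>). g (y, \<omega>))"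
  shows "integrable M X" "(\<integral>\<omega>. X \<omega> \<partial>M) = 0"
proof -
  let ?P = "pos_process W" and ?N = "neg_process W" and ?V = "var_process W"
  let ?p = "\<lambda>z. ennreal (g z)" and ?n = "\<lambda>z. ennreal (- g z)"
  have gm: "?p \<in> borel_measurable (predictable_sigma F)" "?n \<in> borel_measurable (predictable_sigma F)"
    "(\<lambda>z. ennreal \<bar>g z\<bar>) \<in> borel_measurable (predictable_sigma F)" by measurable
  note PN = inc_pos[OF W] inc_neg[OF W] inc_var[OF W]
  note [measurable] = path_integral_measurable[OF PN(1) gm(1)] path_integral_measurable[OF PN(1) gm(2)]
    path_integral_measurable[OF PN(2) gm(1)] path_integral_measurable[OF PN(2) gm(2)] path_integral_measurable[OF PN(3) gm(3)]
  \<comment> \<open>\<open>X'\<close> is assembled from the four nonnegative integrals for which the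
    equality of means is available. It agrees with \<open>X\<close> where the path integral of |g|
    is finite; elsewhere default values of integrals may enter, so the two are identified almost
    everywhere.\<close>
  define X' where "X' \<omega> = (enn2real (path_integral ?P t ?p \<omega>) - enn2real (path_integral ?P t ?n \<omega>)) -
    (enn2real (path_integral ?N t ?p \<omega>) - enn2real (path_integral ?N t ?n \<omega>))" for \<omega>
  have "mean_integral ?V t ?p \<le> mean_integral ?V t (\<lambda>z. ennreal \<bar>g z\<bar>)" "mean_integral ?V t ?n \<le> mean_integral ?V t (\<lambda>z. ennreal \<bar>g z\<bar>)"
    by (intro mean_integral_mono; auto intro!: ennreal_leI)+
  then have finV: "mean_integral ?V t ?p < \<infinity>" "mean_integral ?V t ?n < \<infinity>" using fin by (auto intro: le_less_trans)
  then have fins: "mean_integral ?P t ?p < \<infinity>" "mean_integral ?P t ?n < \<infinity>" "mean_integral ?N t ?p < \<infinity>" "mean_integral ?N t ?n < \<infinity>"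
    using mean_integral_variation[OF W gm(1), of t] mean_integral_variation[OF W gm(2), of t] by auto
  have conv: "integrable M (\<lambda>\<omega>. enn2real (path_integral U t f \<omega>)) \<and> ennreal (\<integral>\<omega>. enn2real (path_integral U t f \<omega>) \<partial>M) = mean_integral U t f"
    if [measurable]: "path_integral U t f \<in> borel_measurable M" and f: "mean_integral U t f < \<infinity>" for U f
  proof -
    have "AE \<omega> in M. path_integral U t f \<omega> \<noteq> \<infinity>"
      using f unfolding mean_integral_def by (intro nn_integral_PInf_AE) auto
    then have "(\<integral>\<^sup>+\<omega>. ennreal (enn2real (path_integral U t f \<omega>)) \<partial>M) = mean_integral U t f"
      unfolding mean_integral_def by (intro nn_integral_cong_AE) (auto simp: less_top)
    moreover from this have "integrable M (\<lambda>\<omega>. enn2real (path_integral U t f \<omega>))"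
      using f by (intro integrableI_nonneg) auto
    ultimately show ?thesis by (simp add: nn_integral_eq_integral)
  qed
  have mo: "mean_integral ?P t ?p = mean_integral ?N t ?p" "mean_integral ?P t ?n = mean_integral ?N t ?n"
    using mean_integral_fv_martingale[OF W t] gm by auto
  have Pp: "integrable M (\<lambda>\<omega>. enn2real (path_integral ?P t ?p \<omega>))" and Pn: "integrable M (\<lambda>\<omega>. enn2real (path_integral ?P t ?n \<omega>))"
    and Np: "integrable M (\<lambda>\<omega>. enn2real (path_integral ?N t ?p \<omega>))" and Nn: "integrable M (\<lambda>\<omega>. enn2real (path_integral ?N t ?n \<omega>))"
    using conv[OF _ fins(1)] conv[OF _ fins(2)] conv[OF _ fins(3)] conv[OF _ fins(4)] by auto
  have eqs: "(\<integral>\<omega>. enn2real (path_integral ?P t ?p \<omega>) \<partial>M) = (\<integral>\<omega>. enn2real (path_integral ?N t ?p \<omega>) \<partial>M)"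
    "(\<integral>\<omega>. enn2real (path_integral ?P t ?n \<omega>) \<partial>M) = (\<integral>\<omega>. enn2real (path_integral ?N t ?n \<omega>) \<partial>M)"
    using conv[OF _ fins(1)] conv[OF _ fins(2)] conv[OF _ fins(3)] conv[OF _ fins(4)] mo
    by (auto simp: Bochner_Integration.integral_nonneg ennreal_inj[symmetric])
  have X'_int: "integrable M X'" "(\<integral>\<omega>. X' \<omega> \<partial>M) = 0"
    unfolding X'_def
    using Pp Pn Np Nn eqs by simp_all
  have AE_eq: "AE \<omega> in M. X \<omega> = X' \<omega>"
  proof -
    have "AE \<omega> in M. path_integral ?V t (\<lambda>z. ennreal \<bar>g z\<bar>) \<omega> \<noteq> \<infinity>"
      using fin unfolding mean_integral_def by (intro nn_integral_PInf_AE) auto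
    then show ?thesis
      using AE_space
    proof eventually_elim
      case (elim \<omega>)
      then interpret fv_path "\<lambda>s. W s \<omega>" using W_path[OF W] by simp
      define k where "k y = indicator {0<..t} y * g (y, \<omega>)" for y
      have k: "k \<in> borel_measurable borel"
      proof -
        have "(\<lambda>y. indicator {0<..t} y * (if 0 < y then g (y, \<omega>) else 0)) \<in> borel_measurable borel"
          using predictable_path_section[OF g elim(2)] by measurable
        also have "(\<lambda>y. indicator {0<..t} y * (if 0 < y then g (y, \<omega>) else 0)) = k"
          by (auto simp: fun_eq_iff k_def split: split_indicator)
        finally show ?thesis .
      qed
      have nn: "path_integral U t (\<lambda>z. ennreal (c * g z)) \<omega> = (\<integral>\<^sup>+y. ennreal (c * k y) \<partial>path_measure (\<lambda>s. U s \<omega>))" for U c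
        unfolding path_integral_def by (intro nn_integral_cong) (auto simp: k_def split: split_indicator)
      have "path_integral ?V t (\<lambda>z. ennreal \<bar>g z\<bar>) \<omega> = (\<integral>\<^sup>+y. ennreal (norm (k y)) \<partial>variation_measure (\<lambda>s. W s \<omega>))"
        unfolding path_integral_def process_measures(1)[OF W elim(2)]
        by (intro nn_integral_cong) (auto simp: k_def split: split_indicator)
      then have "integrable (variation_measure (\<lambda>s. W s \<omega>)) k"
        using elim(1) k by (intro integrableI_bounded) (auto simp: less_top)
      then have kint: "integrable (positive_measure (\<lambda>s. W s \<omega>)) k" "integrable (negative_measure (\<lambda>s. W s \<omega>)) k"
        by (rule integrable_variation)+
      show "X \<omega> = X' \<omega>"
        unfolding X_def X'_def set_lebesgue_integral_def
        using real_lebesgue_integral_def[OF kint(1)] real_lebesgue_integral_def[OF kint(2)]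
          nn[of _ 1] nn[of _ "-1"] process_measures[OF W elim(2)]
        by (simp add: k_def[symmetric])
    qed
  qed
  have X_meas: "X \<in> borel_measurable M"
  proof -
    have gg [measurable]: "(\<lambda>(\<omega>, y). if 0 < y then g (y, \<omega>) else 0) \<in> borel_measurable (M \<Otimes>\<^sub>M borel)"
      by (rule predictable_imp_product[OF g])
    have *: "(\<lambda>\<omega>. LINT y:{0<..t}|path_measure (\<lambda>s. U s \<omega>). g (y, \<omega>)) \<in> borel_measurable M" if U: "inc_process U" for U
    proof -
      have "(\<lambda>\<omega>. LINT y|path_measure (\<lambda>s. U s \<omega>). (\<lambda>(\<omega>, y). indicator {0<..t} y * (if 0 < y then g (y, \<omega>) else 0)) (\<omega>, y)) \<in> borel_measurable M"
        by (rule measurable_integral_path_measure)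
          (use inc_process_path[OF U] inc_process_measurable[OF U] in \<open>simp_all add: split_beta'\<close>)
      also have "?this \<longleftrightarrow> ?thesis"
        unfolding set_lebesgue_integral_def
        by (intro measurable_cong Bochner_Integration.integral_cong) (auto split: split_indicator)
      finally show ?thesis .
    qed
    have "(\<lambda>\<omega>. (LINT y:{0<..t}|path_measure (\<lambda>s. ?P s \<omega>). g (y, \<omega>)) - (LINT y:{0<..t}|path_measure (\<lambda>s. ?N s \<omega>). g (y, \<omega>))) \<in> borel_measurable M"
      by (intro borel_measurable_diff * PN)
    also have "?this \<longleftrightarrow> ?thesis"
      by (rule measurable_cong) (simp add: X_def process_measures[OF W])
    finally show ?thesis .
  qed
  have X'_meas: "X' \<in> borel_measurable M" using X'_int(1) by auto
  show "integrable M X" using X'_int(1) integrable_cong_AE[OF X_meas X'_meas AE_eq] by simp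
  show "(\<integral>\<omega>. X \<omega> \<partial>M) = 0" using X'_int(2) integral_cong_AE[OF X_meas X'_meas AE_eq] by simp
qed

text \<open>The mass of a single point under |dW| is the size of the jump there. So this is the sum
  of f(y) times the squared jump at y, the integral against the quadratic variation of a path of
  finite variation.\<close>

definition bracket_integral :: "(real \<Rightarrow> 'a \<Rightarrow> real) \<Rightarrow> real \<Rightarrow> (real \<times> 'a \<Rightarrow> ennreal) \<Rightarrow> 'a \<Rightarrow> ennreal" where
  "bracket_integral W t f \<omega> = (\<integral>\<^sup>+y\<in>{0<..t}. f (y, \<omega>) * emeasure (variation_measure (\<lambda>s. W s \<omega>)) {y} \<partial>variation_measure (\<lambda>s. W s \<omega>))"

text \<open>The mass of the point y is an integral of the indicator of the diagonal with (\<omega>,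
  y) as parameter. Measurability in a parameter is used twice, for this mass and for the integral
  over y.\<close>

lemma bracket_integral_measurable:
  assumes W: "fv_martingale W" and f: "f \<in> borel_measurable (predictable_sigma F)"
  shows "bracket_integral W t f \<in> borel_measurable M"
proof -
  let ?V = "\<lambda>\<omega>. path_measure (\<lambda>s. var_process W s \<omega>)"
  note V = inc_var[OF W]
  have [measurable]: "(\<lambda>(\<omega>, y). if 0 < y then f (y, \<omega>) else 0) \<in> borel_measurable (M \<Otimes>\<^sub>M borel)"
    by (rule predictable_imp_product[OF f])
  have "(\<lambda>b. \<integral>\<^sup>+y. (\<lambda>(b, x). indicator {snd b} x :: ennreal) (b, y) \<partial>path_measure (\<lambda>s. var_process W s (fst b))) \<in> borel_measurable (M \<Otimes>\<^sub>M borel)"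
  proof (rule measurable_nn_integral_path_measure)
    let ?E = "{z \<in> space ((M \<Otimes>\<^sub>M borel) \<Otimes>\<^sub>M borel). snd z = (snd (fst z) :: real)}"
    have "(indicator ?E :: _ \<Rightarrow> ennreal) \<in> borel_measurable ((M \<Otimes>\<^sub>M borel) \<Otimes>\<^sub>M borel)"
      by measurable
    then show "(\<lambda>(b :: 'a \<times> real, x). indicator {snd b} x :: ennreal) \<in> borel_measurable ((M \<Otimes>\<^sub>M borel) \<Otimes>\<^sub>M borel)"
      by (rule measurable_cong[THEN iffD1, rotated]) (auto split: split_indicator)
  qed (use inc_process_path[OF V] inc_process_measurable[OF V] in \<open>auto simp: space_pair_measure intro: measurable_compose[OF measurable_fst]\<close>)
  also have "(\<lambda>b. \<integral>\<^sup>+y. (\<lambda>(b, x). indicator {snd b} x :: ennreal) (b, y) \<partial>path_measure (\<lambda>s. var_process W s (fst b))) =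
    (\<lambda>b. emeasure (?V (fst b)) {snd b})"
    by (simp add: fun_eq_iff path_measure_def)
  finally have [measurable]: "(\<lambda>b. emeasure (?V (fst b)) {snd b}) \<in> borel_measurable (M \<Otimes>\<^sub>M borel)" .
  have "(\<lambda>\<omega>. \<integral>\<^sup>+y. (\<lambda>z. (\<lambda>(\<omega>, y). if 0 < y then f (y, \<omega>) else 0) z * emeasure (?V (fst z)) {snd z} * indicator {0<..t} (snd z)) (\<omega>, y) \<partial>?V \<omega>) \<in> borel_measurable M"
    by (rule measurable_nn_integral_path_measure)
      (use inc_process_path[OF V] inc_process_measurable[OF V] in simp_all)
  also have "?this \<longleftrightarrow> ?thesis"
    by (rule measurable_cong) 
      (auto simp: bracket_integral_def process_measures[OF W] intro!: nn_integral_cong split: split_indicator)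
  finally show ?thesis .
qed

lemma bracket_integral_SUP:
  assumes W: "fv_martingale W" and f: "\<And>i. f i \<in> borel_measurable (predictable_sigma F)" and \<omega>: "\<omega> \<in> space M"
    and inc: "\<And>y i. 0 < y \<Longrightarrow> y \<le> t \<Longrightarrow> f i (y, \<omega>) \<le> f (Suc i) (y, \<omega>)"
  shows "bracket_integral W t (\<lambda>z. SUP i. f i z) \<omega> = (SUP i. bracket_integral W t (f i) \<omega>)"
proof -
  interpret fv_path "\<lambda>s. W s \<omega>" using W_path[OF W \<omega>] .
  let ?\<kappa> = "\<lambda>y. emeasure (variation_measure (\<lambda>s. W s \<omega>)) {y}"
  note [measurable] = predictable_path_section_indicator[OF f \<omega>, of _ t]
  have "bracket_integral W t (\<lambda>z. SUP i. f i z) \<omega> = (\<integral>\<^sup>+y. (SUP i. f i (y, \<omega>) * indicator {0<..t} y * ?\<kappa> y) \<partial>variation_measure (\<lambda>s. W s \<omega>))"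
    unfolding bracket_integral_def by (intro nn_integral_cong) (auto simp: SUP_mult_right_ennreal split: split_indicator)
  also have "\<dots> = (SUP i. \<integral>\<^sup>+y. f i (y, \<omega>) * indicator {0<..t} y * ?\<kappa> y \<partial>variation_measure (\<lambda>s. W s \<omega>))"
  proof (rule nn_integral_monotone_convergence_SUP)
    show "incseq (\<lambda>i y. f i (y, \<omega>) * indicator {0<..t} y * ?\<kappa> y)"
    proof (intro incseq_SucI le_funI)
      fix i y
      show "f i (y, \<omega>) * indicator {0<..t} y * ?\<kappa> y \<le> f (Suc i) (y, \<omega>) * indicator {0<..t} y * ?\<kappa> y"
        using inc[of y i] by (cases "y \<in> {0<..t}") (auto intro!: mult_right_mono)
    qed
  qed measurable
  finally show ?thesis by (simp add: bracket_integral_def mult_ac)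
qed

definition left_pos_process :: "(real \<Rightarrow> 'a \<Rightarrow> real) \<Rightarrow> real \<times> 'a \<Rightarrow> ennreal" where
  "left_pos_process W = (\<lambda>(y, \<omega>). if 0 < y then fv_path.left_pos (\<lambda>t. W t \<omega>) y else 0)"

definition left_neg_process :: "(real \<Rightarrow> 'a \<Rightarrow> real) \<Rightarrow> real \<times> 'a \<Rightarrow> ennreal" where
  "left_neg_process W = (\<lambda>(y, \<omega>). if 0 < y then fv_path.left_neg (\<lambda>t. W t \<omega>) y else 0)"

lemma left_process_predictable:
  assumes W: "fv_martingale W"
  shows "left_pos_process W \<in> borel_measurable (predictable_sigma F)" "left_neg_process W \<in> borel_measurable (predictable_sigma F)"
proof -
  have [measurable]: "W 0 \<in> borel_measurable (F 0)" using W_adapted[OF W] by simp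
  have "(\<lambda>(y, \<omega>). if 0 < y then ennreal (max 0 (W 0 \<omega>)) else 0) \<in> borel_measurable (predictable_sigma F)"
    "(\<lambda>(y, \<omega>). if 0 < y then ennreal (max 0 (- W 0 \<omega>)) else 0) \<in> borel_measurable (predictable_sigma F)"
    by (rule predictable_const_after; measurable)+
  then have *: "(\<lambda>z. (\<lambda>(y, \<omega>). if 0 < y then ennreal (max 0 (W 0 \<omega>)) else 0) z + (\<lambda>(y, \<omega>). emeasure (path_measure (\<lambda>t. pos_process W t \<omega>)) {0<..<y}) z) \<in> borel_measurable (predictable_sigma F)"
    "(\<lambda>z. (\<lambda>(y, \<omega>). if 0 < y then ennreal (max 0 (- W 0 \<omega>)) else 0) z + (\<lambda>(y, \<omega>). emeasure (path_measure (\<lambda>t. neg_process W t \<omega>)) {0<..<y}) z) \<in> borel_measurable (predictable_sigma F)"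
    using predictable_Ioo[OF inc_pos[OF W]] predictable_Ioo[OF inc_neg[OF W]] by (auto intro: borel_measurable_add)
  show "left_pos_process W \<in> borel_measurable (predictable_sigma F)"
    by (rule measurable_cong[THEN iffD1, OF _ *(1)])
      (auto simp: left_pos_process_def space_predictable fv_path.left_pos_def[OF W_path[OF W]] process_measures[OF W])
  show "left_neg_process W \<in> borel_measurable (predictable_sigma F)"
    by (rule measurable_cong[THEN iffD1, OF _ *(2)])
      (auto simp: left_neg_process_def space_predictable fv_path.left_neg_def[OF W_path[OF W]] process_measures[OF W])
qed

text \<open>One half of the bound \<open>2 * real n\<close> is for the initial value, the other for
  the variation strictly before \<open>y\<close>. It will make the terms to be cancelled
  finite.\<close>

lemma left_process_bound:
  assumes W: "fv_martingale W" and "(y, \<omega>) \<in> localizing W n" "\<bar>W 0 \<omega>\<bar> \<le> real n"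
  shows "left_pos_process W (y, \<omega>) \<le> ennreal (2 * real n)" "left_neg_process W (y, \<omega>) \<le> ennreal (2 * real n)"
proof -
  have \<omega>: "\<omega> \<in> space M" and V_le: "\<And>q. 0 \<le> q \<Longrightarrow> q < y \<Longrightarrow> var_process W q \<omega> \<le> real n"
    using assms(2) by (auto simp: localizing_def[OF W])
  interpret fv_path "\<lambda>t. W t \<omega>" using W_path[OF W \<omega>] .
  have nn: "ennreal x + e \<le> ennreal (2 * real n)" if "e \<le> ennreal (real n)" "x \<le> real n" for x e
  proof -
    have "ennreal x + e \<le> ennreal (real n) + ennreal (real n)"
      using that by (intro add_mono ennreal_leI) auto
    then show ?thesis by (simp add: ennreal_plus[symmetric] del: ennreal_plus)
  qed
  have "emeasure (path_measure U_pos) {0<..<y} \<le> ennreal (real n)" "emeasure (path_measure U_neg) {0<..<y} \<le> ennreal (real n)" if y: "0 < y"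
    unfolding pos.emeasure_Ioo[OF y] neg.emeasure_Ioo[OF y]
    using V_le abs_diff_le_V by (auto simp: var_process_def field_simps abs_le_iff intro!: ennreal_leI; smt (verit))+
  then show "left_pos_process W (y, \<omega>) \<le> ennreal (2 * real n)" "left_neg_process W (y, \<omega>) \<le> ennreal (2 * real n)"
    using assms(3) unfolding left_pos_process_def left_neg_process_def path_measures
    by (auto simp: left_pos_def left_neg_def intro!: nn)
qed

lemma SUP_min_of_nat: "(SUP n. min c (of_nat n)) = (c :: ennreal)"
proof -
  have "(SUP n. min c (of_nat n)) = min c (SUP n. of_nat n)"
    unfolding inf_min[symmetric] by (rule inf_SUP[symmetric])
  then show ?thesis by (simp add: ennreal_SUP_of_nat_eq_top)
qed

text \<open>Take means in \<open>square_measure_identity\<close>. The stopped process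
  \<open>N\<close> is itself a martingale of finite variation, so for \<open>W\<close> and for
  \<open>N\<close> the positive and negative parts integrate to the same mean; the two sides then
  share all terms except the bracket and the integral against \<open>A\<close>.\<close>

lemma mean_bracket_stopped:
  assumes W: "fv_martingale W" and A: "inc_process A" and t: "0 \<le> t"
    and S: "\<And>\<omega>. \<omega> \<in> space M \<Longrightarrow> 0 \<le> S \<omega>" "\<And>q. 0 \<le> q \<Longrightarrow> {\<omega> \<in> space M. S \<omega> \<le> q} \<in> sets (F q)"
    and N: "martingale M F (\<lambda>t \<omega>. (W (min t (S \<omega>)) \<omega>)\<^sup>2 - A (min t (S \<omega>)) \<omega>)"
    and f [measurable]: "f \<in> borel_measurable (predictable_sigma F)"
  defines "D \<equiv> {(y, \<omega>). 0 \<le> y \<and> \<omega> \<in> space M \<and> y \<le> max 0 (S \<omega>)}"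
  shows "(\<integral>\<^sup>+\<omega>. bracket_integral W t (\<lambda>z. f z * indicator D z) \<omega> \<partial>M) = mean_integral A t (\<lambda>z. f z * indicator D z)"
proof -
  define N where "N t \<omega> = (W (min t (S \<omega>)) \<omega>)\<^sup>2 - A (min t (S \<omega>)) \<omega>" for t \<omega>
  have N_fv: "fv_martingale N"
    unfolding fv_martingale_def
  proof
    show "martingale M F N" using N by (simp add: N_def[abs_def])
    show "\<forall>\<omega>\<in>space M. fv_path (\<lambda>t. N t \<omega>)"
      using fv_path.fv_path_stopped_square[OF W_path[OF W] inc_process_path[OF A] S(1)] by (simp add: N_def)
  qed
  have [measurable]: "D \<in> sets (predictable_sigma F)" unfolding D_def using S(2) by (rule predictable_until)
  have B: "{\<omega> \<in> space M. \<bar>W 0 \<omega>\<bar> \<le> real n} \<in> sets (F 0)" for n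
  proof -
    have [measurable]: "W 0 \<in> borel_measurable (F 0)" using W_adapted[OF W] by simp
    have "{\<omega> \<in> space (F 0). \<bar>W 0 \<omega>\<bar> \<le> real n} \<in> sets (F 0)" by measurable
    then show ?thesis by (simp add: space_F)
  qed
  \<comment> \<open>On \<open>J n\<close> the variations of \<open>W\<close> and \<open>N\<close>
    before the present time and the initial value of \<open>W\<close> are at most \<open>n\<close>.
    Together with the truncation of \<open>f\<close> at \<open>n\<close> this makes the shared terms
    finite, hence cancellable. The last factor is predictable because the initial value is known at
    time 0.\<close>
  define J where "J n = localizing W n \<inter> localizing N n \<inter> ({0<..} \<times> {\<omega> \<in> space M. \<bar>W 0 \<omega>\<bar> \<le> real n})" for n
  have J [measurable]: "J n \<in> sets (predictable_sigma F)" for n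
    unfolding J_def using localizing_sets[OF W] localizing_sets[OF N_fv] predictable_after[OF _ B] by (intro sets.Int) auto
  define g where "g n z = min (f z) (of_nat n) * indicator (D \<inter> J n) z" for n z
  have g [measurable]: "g n \<in> borel_measurable (predictable_sigma F)" for n unfolding g_def[abs_def] by measurable
  note [measurable] = left_process_predictable[OF W]
  have J_mono: "J n \<subseteq> J (Suc n)" for n
    using localizing_mono[OF W, of n] localizing_mono[OF N_fv, of n] by (auto simp: J_def)
  have g_mono: "g n z \<le> g (Suc n) z" for n z
    unfolding g_def using J_mono[of n] by (intro mult_mono min.mono) (auto split: split_indicator)
  have g_SUP: "(SUP n. g n (y, \<omega>)) = f (y, \<omega>) * indicator D (y, \<omega>)" if "0 < y" "\<omega> \<in> space M" for y \<omega>
  proof (rule LIMSEQ_unique)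
    show "(\<lambda>n. g n (y, \<omega>)) \<longlonglongrightarrow> (SUP n. g n (y, \<omega>))" using g_mono by (intro LIMSEQ_SUP incseq_SucI)
    have ev1: "\<forall>\<^sub>F n in sequentially. (y, \<omega>) \<in> localizing K n" if K: "fv_martingale K" for K
    proof -
      obtain k where k: "(y, \<omega>) \<in> localizing K k" using localizing_UN[OF K, of \<omega> y] \<open>0 < y\<close> \<open>\<omega> \<in> space M\<close> by auto
      have "(y, \<omega>) \<in> localizing K n" if "k \<le> n" for n
        using that k localizing_mono[OF K] by (induction n rule: dec_induct) auto
      then show ?thesis by (intro eventually_sequentiallyI[of k])
    qed
    obtain k where "\<bar>W 0 \<omega>\<bar> \<le> real k" using real_arch_simple by blast
    then have "\<forall>\<^sub>F n in sequentially. \<bar>W 0 \<omega>\<bar> \<le> real n" by (intro eventually_sequentiallyI[of k]) auto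
    then have "\<forall>\<^sub>F n in sequentially. min (f (y, \<omega>)) (of_nat n) * indicator D (y, \<omega>) = g n (y, \<omega>)"
      using ev1[OF W] ev1[OF N_fv]
      by eventually_elim (use that in \<open>auto simp: g_def J_def split: split_indicator\<close>)
    moreover have "(\<lambda>n. min (f (y, \<omega>)) (of_nat n)) \<longlonglongrightarrow> (SUP n. min (f (y, \<omega>)) (of_nat n))"
      by (intro LIMSEQ_SUP monoI min.mono order_refl) simp
    then have "(\<lambda>n. min (f (y, \<omega>)) (of_nat n) * indicator D (y, \<omega>)) \<longlonglongrightarrow> f (y, \<omega>) * indicator D (y, \<omega>)"
      unfolding SUP_min_of_nat by (auto split: split_indicator)
    ultimately show "(\<lambda>n. g n (y, \<omega>)) \<longlonglongrightarrow> f (y, \<omega>) * indicator D (y, \<omega>)" by (rule Lim_transform_eventually[rotated])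
  qed
  have step: "(\<integral>\<^sup>+\<omega>. bracket_integral W t (g n) \<omega> \<partial>M) = mean_integral A t (g n)" for n
  proof -
    let ?a = "\<lambda>z. g n z * left_pos_process W z" and ?b = "\<lambda>z. g n z * left_neg_process W z"
    have ab: "?a \<in> borel_measurable (predictable_sigma F)" "?b \<in> borel_measurable (predictable_sigma F)" by measurable
    note PN = inc_pos[OF W] inc_neg[OF W] inc_pos[OF N_fv] inc_neg[OF N_fv]
    note [measurable] = path_integral_measurable[OF PN(1) ab(1)] path_integral_measurable[OF PN(1) ab(2)]
      path_integral_measurable[OF PN(2) ab(1)] path_integral_measurable[OF PN(2) ab(2)] path_integral_measurable[OF PN(3) g]
      path_integral_measurable[OF PN(4) g] path_integral_measurable[OF A g] bracket_integral_measurable[OF W g]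
    have "bracket_integral W t (g n) \<omega> + (2 * path_integral (pos_process W) t ?a \<omega> + (2 * path_integral (neg_process W) t ?b \<omega> + path_integral (neg_process N) t (g n) \<omega>))
      = path_integral A t (g n) \<omega> + (2 * path_integral (neg_process W) t ?a \<omega> + (2 * path_integral (pos_process W) t ?b \<omega> + path_integral (pos_process N) t (g n) \<omega>))"
      if \<omega>: "\<omega> \<in> space M" for \<omega>
    proof -
      interpret fv_path "\<lambda>s. W s \<omega>" using W_path[OF W \<omega>] .
      define k where "k y = g n (y, \<omega>) * indicator {0<..t} y" for y
      have k: "k \<in> borel_measurable borel" unfolding k_def[abs_def] by (rule predictable_path_section_indicator[OF g \<omega>])
      \<comment> \<open>Beyond \<open>S\<close> the integrand vanishes, so the identity over
        \<open>{0<..S \<omega>}\<close> becomes one over \<open>{0<..t}\<close>.\<close>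
      have zero: "g n (y, \<omega>) = 0" if "S \<omega> < y" for y
        using that S(1)[OF \<omega>] by (auto simp: g_def D_def)
      have c: "(\<integral>\<^sup>+y\<in>{0<..S \<omega>}. k y * q y \<partial>K) = (\<integral>\<^sup>+y\<in>{0<..t}. g n (y, \<omega>) * q y \<partial>K)" for q K
        using zero by (intro nn_integral_cong) (auto simp: k_def not_le split: split_indicator)
      have c1: "(\<integral>\<^sup>+y\<in>{0<..S \<omega>}. k y \<partial>K) = (\<integral>\<^sup>+y\<in>{0<..t}. g n (y, \<omega>) \<partial>K)" for K
        using c[of K "\<lambda>_. 1"] by simp
      have l: "(\<integral>\<^sup>+y\<in>{0<..t}. g n (y, \<omega>) * left_pos y \<partial>K) = (\<integral>\<^sup>+y\<in>{0<..t}. g n (y, \<omega>) * left_pos_process W (y, \<omega>) \<partial>K)"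
        "(\<integral>\<^sup>+y\<in>{0<..t}. g n (y, \<omega>) * left_neg y \<partial>K) = (\<integral>\<^sup>+y\<in>{0<..t}. g n (y, \<omega>) * left_neg_process W (y, \<omega>) \<partial>K)" for K
        by (auto intro!: nn_integral_cong simp: left_pos_process_def left_neg_process_def split: split_indicator)
      show ?thesis
        using square_measure_identity[OF inc_process_path[OF A \<omega>] S(1)[OF \<omega>] k]
        unfolding c c1 l bracket_integral_def path_integral_def process_measures[OF W \<omega>] process_measures[OF N_fv \<omega>]
        by (simp add: N_def)
    qed
    then have "(\<integral>\<^sup>+\<omega>. bracket_integral W t (g n) \<omega> + (2 * path_integral (pos_process W) t ?a \<omega> + (2 * path_integral (neg_process W) t ?b \<omega> + path_integral (neg_process N) t (g n) \<omega>)) \<partial>M)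
      = (\<integral>\<^sup>+\<omega>. path_integral A t (g n) \<omega> + (2 * path_integral (neg_process W) t ?a \<omega> + (2 * path_integral (pos_process W) t ?b \<omega> + path_integral (pos_process N) t (g n) \<omega>)) \<partial>M)"
      by (rule nn_integral_cong)
    then have eq: "(\<integral>\<^sup>+\<omega>. bracket_integral W t (g n) \<omega> \<partial>M) + (2 * mean_integral (pos_process W) t ?a + (2 * mean_integral (neg_process W) t ?b + mean_integral (neg_process N) t (g n)))
      = mean_integral A t (g n) + (2 * mean_integral (neg_process W) t ?a + (2 * mean_integral (pos_process W) t ?b + mean_integral (pos_process N) t (g n)))"
      by (simp add: nn_integral_add nn_integral_cmult mean_integral_def)
    have swap: "mean_integral (pos_process W) t ?a = mean_integral (neg_process W) t ?a" "mean_integral (pos_process W) t ?b = mean_integral (neg_process W) t ?b"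
      "mean_integral (pos_process N) t (g n) = mean_integral (neg_process N) t (g n)"
      using mean_integral_fv_martingale[OF W t] mean_integral_fv_martingale[OF N_fv t] ab g by auto
    have finite: "mean_integral U t q < \<infinity>"
      if U: "inc_process U" "mean_integral U t (indicator (localizing K n)) \<le> mean_integral (var_process K) t (indicator (localizing K n))"
        and K: "fv_martingale K" and q: "\<And>y \<omega>. q (y, \<omega>) \<le> ennreal c * indicator (localizing K n) (y, \<omega>)" for U K q c
    proof -
      have "mean_integral U t q \<le> mean_integral U t (\<lambda>z. ennreal c * indicator (localizing K n) z)"
        using q by (intro mean_integral_mono) auto
      also have "\<dots> = ennreal c * mean_integral U t (indicator (localizing K n))"
        by (rule mean_integral_cmult[OF U(1)]) (rule borel_measurable_indicator[OF localizing_sets[OF K]])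
      also have "\<dots> < \<infinity>"
        using le_less_trans[OF U(2) mean_localizing_finite[OF K t]] by (simp add: ennreal_mult_less_top)
      finally show ?thesis .
    qed
    have le_var: "mean_integral (pos_process K) t (indicator (localizing K n)) \<le> mean_integral (var_process K) t (indicator (localizing K n))"
      if K: "fv_martingale K" for K
      using mean_integral_variation[OF K, of "indicator (localizing K n)" t] localizing_sets[OF K] by simp
    have g_le: "g n z \<le> ennreal (real n) * indicator (J n) z" for z
      by (auto simp: g_def ennreal_of_nat_eq_real_of_nat split: split_indicator)
    have bnd: "g n (y, \<omega>) * left_pos_process W (y, \<omega>) \<le> ennreal (real n * (2 * real n)) * indicator (localizing W n) (y, \<omega>)"
      "g n (y, \<omega>) * left_neg_process W (y, \<omega>) \<le> ennreal (real n * (2 * real n)) * indicator (localizing W n) (y, \<omega>)" for y \<omega>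
    proof -
      have "g n (y, \<omega>) * e \<le> ennreal (real n * (2 * real n)) * indicator (localizing W n) (y, \<omega>)"
        if "(y, \<omega>) \<in> J n \<Longrightarrow> e \<le> ennreal (2 * real n)" for e
      proof (cases "(y, \<omega>) \<in> J n")
        case True
        then have "g n (y, \<omega>) * e \<le> ennreal (real n) * ennreal (2 * real n)"
          using that g_le[of "(y, \<omega>)"] by (intro mult_mono) auto
        then show ?thesis using True by (simp add: J_def ennreal_mult)
      qed (use g_le[of "(y, \<omega>)"] in auto)
      then show "g n (y, \<omega>) * left_pos_process W (y, \<omega>) \<le> ennreal (real n * (2 * real n)) * indicator (localizing W n) (y, \<omega>)"
        "g n (y, \<omega>) * left_neg_process W (y, \<omega>) \<le> ennreal (real n * (2 * real n)) * indicator (localizing W n) (y, \<omega>)"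
        using left_process_bound[OF W, of y \<omega> n] by (auto simp: J_def)
    qed
    have fin1: "mean_integral (pos_process W) t ?a < \<infinity>" "mean_integral (pos_process W) t ?b < \<infinity>"
      by (rule finite[OF PN(1) le_var[OF W] W bnd(1)], rule finite[OF PN(1) le_var[OF W] W bnd(2)])
    have fin2: "mean_integral (pos_process N) t (g n) < \<infinity>"
    proof (rule finite[OF PN(3) le_var[OF N_fv] N_fv])
      show "g n (y, \<omega>) \<le> ennreal (real n) * indicator (localizing N n) (y, \<omega>)" for y \<omega>
        using g_le[of "(y, \<omega>)"] by (rule order_trans) (auto simp: J_def split: split_indicator)
    qed
    define c where "c = 2 * mean_integral (neg_process W) t ?a + (2 * mean_integral (neg_process W) t ?b + mean_integral (neg_process N) t (g n))"
    have "c < \<infinity>" using fin1 fin2 unfolding c_def swap by (simp add: ennreal_mult_less_top)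
    moreover have "(\<integral>\<^sup>+\<omega>. bracket_integral W t (g n) \<omega> \<partial>M) + c = mean_integral A t (g n) + c"
      using eq unfolding swap c_def .
    ultimately show ?thesis by (auto simp: add.commute[of _ c] ennreal_add_left_cancel)
  qed
  have "(\<integral>\<^sup>+\<omega>. bracket_integral W t (\<lambda>z. f z * indicator D z) \<omega> \<partial>M) = (\<integral>\<^sup>+\<omega>. bracket_integral W t (\<lambda>z. SUP n. g n z) \<omega> \<partial>M)"
    unfolding bracket_integral_def using g_SUP by (intro nn_integral_cong) (auto split: split_indicator)
  also have "\<dots> = (\<integral>\<^sup>+\<omega>. (SUP n. bracket_integral W t (g n) \<omega>) \<partial>M)"
    by (intro nn_integral_cong bracket_integral_SUP[OF W g] g_mono)
  also have "\<dots> = (SUP n. \<integral>\<^sup>+\<omega>. bracket_integral W t (g n) \<omega> \<partial>M)"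
  proof (rule nn_integral_monotone_convergence_SUP_AE)
    show "AE \<omega> in M. bracket_integral W t (g n) \<omega> \<le> bracket_integral W t (g (Suc n)) \<omega>" for n
      unfolding bracket_integral_def using g_mono by (intro AE_I2 nn_integral_mono mult_right_mono) auto
  qed (rule bracket_integral_measurable[OF W g])
  also have "\<dots> = (SUP n. mean_integral A t (g n))" using step by simp
  also have "\<dots> = mean_integral A t (\<lambda>z. SUP n. g n z)"
    by (rule mean_integral_SUP[OF A g, symmetric]) (rule g_mono)
  also have "\<dots> = mean_integral A t (\<lambda>z. f z * indicator D z)"
    using g_SUP by (intro mean_integral_cong) auto
  finally show ?thesis .
qed

text \<open>\<open>A\<close> is the compensator of the sum of squared jumps. The localising times
  tend to infinity almost surely, so cutting \<open>f\<close> off at them and letting them grow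
  recovers both sides by monotone convergence.\<close>

theorem mean_bracket:
  assumes W: "fv_martingale W" and A: "inc_process A" and t: "0 \<le> t"
    and local: "local_martingale M F (\<lambda>t \<omega>. (W t \<omega>)\<^sup>2 - A t \<omega>)"
    and f [measurable]: "f \<in> borel_measurable (predictable_sigma F)"
  shows "(\<integral>\<^sup>+\<omega>. bracket_integral W t f \<omega> \<partial>M) = mean_integral A t f"
proof -
  obtain S where S: "\<And>k. stopping_time F (S k)" "\<And>k \<omega>. \<omega> \<in> space M \<Longrightarrow> 0 \<le> S k \<omega> \<and> S k \<omega> \<le> S (Suc k) \<omega>"
    "AE \<omega> in M. filterlim (\<lambda>k. S k \<omega>) at_top sequentially"
    "\<And>k. martingale M F (\<lambda>t \<omega>. (W (min t (S k \<omega>)) \<omega>)\<^sup>2 - A (min t (S k \<omega>)) \<omega>)"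
    using local unfolding local_martingale_def by blast
  have S_sets: "{\<omega> \<in> space M. S k \<omega> \<le> q} \<in> sets (F q)" for k q
    using stopping_timeD[OF S(1)[of k], of q] by (simp add: pred_def space_F)
  define D where "D k = {(y, \<omega>). 0 \<le> y \<and> \<omega> \<in> space M \<and> y \<le> max 0 (S k \<omega>)}" for k
  have [measurable]: "D k \<in> sets (predictable_sigma F)" for k unfolding D_def using S_sets by (rule predictable_until)
  define g where "g k z = f z * indicator (D k) z" for k z
  have g [measurable]: "g k \<in> borel_measurable (predictable_sigma F)" for k unfolding g_def[abs_def] by measurable
  have D_mono: "(y, \<omega>) \<in> D k \<Longrightarrow> (y, \<omega>) \<in> D (Suc k)" for y \<omega> k
    using S(2)[of \<omega> k] by (auto simp: D_def)
  have g_mono: "g k (y, \<omega>) \<le> g (Suc k) (y, \<omega>)" for k y \<omega>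
    using D_mono[of y \<omega> k] by (auto simp: g_def split: split_indicator)
  have AE_SUP: "AE \<omega> in M. \<forall>y>0. (SUP k. g k (y, \<omega>)) = f (y, \<omega>)"
    using S(3) AE_space
  proof eventually_elim
    case (elim \<omega>)
    show ?case
    proof safe
      fix y :: real assume y: "0 < y"
      obtain k where "y \<le> S k \<omega>" using filterlim_at_top[THEN iffD1, OF elim(1)] by (meson eventually_sequentially le_refl)
      then have "f (y, \<omega>) \<le> (SUP k. g k (y, \<omega>))"
        using y elim(2) by (intro SUP_upper2[of k]) (auto simp: g_def D_def)
      moreover have "(SUP k. g k (y, \<omega>)) \<le> f (y, \<omega>)"
        by (intro SUP_least) (auto simp: g_def split: split_indicator)
      ultimately show "(SUP k. g k (y, \<omega>)) = f (y, \<omega>)" by simp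
    qed
  qed
  have "(\<integral>\<^sup>+\<omega>. bracket_integral W t f \<omega> \<partial>M) = (\<integral>\<^sup>+\<omega>. bracket_integral W t (\<lambda>z. SUP k. g k z) \<omega> \<partial>M)"
    using AE_SUP by (intro nn_integral_cong_AE, eventually_elim)
      (auto simp: bracket_integral_def intro!: nn_integral_cong split: split_indicator)
  also have "\<dots> = (\<integral>\<^sup>+\<omega>. (SUP k. bracket_integral W t (g k) \<omega>) \<partial>M)"
    by (intro nn_integral_cong bracket_integral_SUP[OF W g] g_mono)
  also have "\<dots> = (SUP k. \<integral>\<^sup>+\<omega>. bracket_integral W t (g k) \<omega> \<partial>M)"
  proof (rule nn_integral_monotone_convergence_SUP_AE)
    show "AE \<omega> in M. bracket_integral W t (g n) \<omega> \<le> bracket_integral W t (g (Suc n)) \<omega>" for n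
      unfolding bracket_integral_def using g_mono by (intro AE_I2 nn_integral_mono mult_right_mono) auto
  qed (rule bracket_integral_measurable[OF W g])
  also have "\<dots> = (SUP k. mean_integral A t (g k))"
    unfolding g_def D_def using S(2) S_sets S(4)
    by (intro SUP_cong refl mean_bracket_stopped[OF W A t _ _ _ f]) auto
  also have "\<dots> = mean_integral A t (\<lambda>z. SUP k. g k z)"
    by (rule mean_integral_SUP[OF A g, symmetric]) (rule g_mono)
  also have "\<dots> = mean_integral A t f"
    unfolding mean_integral_def using AE_SUP
    by (intro nn_integral_cong_AE, eventually_elim) (auto intro!: path_integral_cong)
  finally show ?thesis .
qed



section \<open>Predictable kernels of two time variables\<close>

lemma borel_measurable_predictable_before:
  "{z \<in> space (predictable_sigma F). s < fst z} \<in> sets (predictable_sigma F)" if "0 \<le> s"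
proof -
  have "{s<..} \<times> space (F s) \<in> sets (predictable_sigma F)" using that by (intro predictable_after) auto
  also have "{s<..} \<times> space (F s) = {z \<in> space (predictable_sigma F). s < fst z}"
    using that by (auto simp: space_predictable space_F)
  finally show ?thesis .
qed

text \<open>The integral includes its upper end point, which is why \<open>U\<close> is taken
  predictable and not merely adapted: on a rectangle after time \<open>s\<close> the integral is the
  increment \<open>U (min u y) - U s\<close>, evaluated at the current time
  \<open>y\<close>.\<close>

lemma predictable_running_integral:
  assumes U: "inc_process U" and pred: "predictable F U" and f: "f \<in> borel_measurable (predictable_sigma F)"
  shows "(\<lambda>(y, \<omega>). path_integral U y f \<omega>) \<in> borel_measurable (predictable_sigma F)"
proof -
  have U_meas [measurable]: "(\<lambda>z. U (fst z) (snd z)) \<in> borel_measurable (predictable_sigma F)"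
    using pred by (simp add: predictable_def split_beta')
  have U_F: "U s \<in> borel_measurable (F s)" if "0 \<le> s" for s using U that by (auto simp: inc_process_def adapted_def)
  have sets: "(\<lambda>z. path_integral U (fst z) (indicator X) (snd z)) \<in> borel_measurable (predictable_sigma F)"
    if "X \<in> sigma_sets ({0..} \<times> space M) pred_gen" for X
    using Int_stable_pred_gen pred_gen_closed that
  proof (induction rule: sigma_sets_induct_disjoint)
    case (basic A)
    then show ?case
    proof (cases rule: pred_gen_cases)
      case (1 B)
      have "path_integral U y (indicator A) \<omega> = 0" for y \<omega>
      proof -
        have "path_integral U y (indicator A) \<omega> = path_integral U y (\<lambda>_. 0) \<omega>" using 1 by (intro path_integral_cong) auto
        then show ?thesis by (simp add: path_integral_def)
      qed
      then show ?thesis by simp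
    next
      case (2 s u B)
      have val: "path_integral U y (indicator A) \<omega> = (if s < y then indicator B \<omega> * ennreal (U (min u y) \<omega> - U s \<omega>) else 0)"
        if "0 \<le> y" and \<omega>: "\<omega> \<in> space M" for y \<omega>
      proof -
        interpret inc_path "\<lambda>s. U s \<omega>" using U \<omega> by (rule inc_process_path)
        have "path_integral U y (indicator A) \<omega> = (\<integral>\<^sup>+x. indicator B \<omega> * indicator {s<..min u y} x \<partial>path_measure (\<lambda>s. U s \<omega>))"
          unfolding path_integral_def 2(1) using \<open>0 \<le> s\<close> by (intro nn_integral_cong) (auto split: split_indicator)
        also have "\<dots> = indicator B \<omega> * emeasure (path_measure (\<lambda>s. U s \<omega>)) {s<..min u y}"
          by (rule nn_integral_cmult_indicator) (simp add: sets_path_measure)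
        also have "\<dots> = (if s < y then indicator B \<omega> * ennreal (U (min u y) \<omega> - U s \<omega>) else 0)"
        proof (cases "s < y")
          case True
          then show ?thesis using 2 by (subst emeasure_Ioc) auto
        next
          case False
          then have "{s<..min u y} = {}" by auto
          then show ?thesis using False by simp
        qed
        finally show ?thesis .
      qed
      have [measurable]: "(\<lambda>(y, \<omega>). if s < y then indicator B \<omega> :: real else 0) \<in> borel_measurable (predictable_sigma F)"
        using 2 by (intro predictable_const_after) auto
      have [measurable]: "(\<lambda>(y, \<omega>). if s < y then U s \<omega> else 0) \<in> borel_measurable (predictable_sigma F)"
        using 2 U_F by (intro predictable_const_after) auto
      have [measurable]: "(\<lambda>(y, \<omega>). if u < y then U u \<omega> else 0) \<in> borel_measurable (predictable_sigma F)"
        using 2 U_F by (intro predictable_const_after) auto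
      have [measurable]: "{z \<in> space (predictable_sigma F). s < fst z} \<in> sets (predictable_sigma F)"
        "{z \<in> space (predictable_sigma F). u < fst z} \<in> sets (predictable_sigma F)"
        using 2 by (auto intro!: borel_measurable_predictable_before)
      have [measurable]: "Measurable.pred (predictable_sigma F) (\<lambda>z. u < fst z)" "Measurable.pred (predictable_sigma F) (\<lambda>z. s < fst z)"
        by (auto simp: pred_def)
      have "(\<lambda>z. ennreal (if s < fst z then (\<lambda>(y, \<omega>). if s < y then indicator B \<omega> else 0) z *
          ((if u < fst z then (\<lambda>(y, \<omega>). if u < y then U u \<omega> else 0) z else U (fst z) (snd z)) -
            (\<lambda>(y, \<omega>). if s < y then U s \<omega> else 0) z) else 0)) \<in> borel_measurable (predictable_sigma F)"
        by measurable
      also have "?this \<longleftrightarrow> ?thesis"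
        by (rule measurable_cong) (auto simp: val space_predictable min_def split: split_indicator)
      finally show ?thesis .
    qed
  next
    case empty
    then show ?case by (simp add: path_integral_def)
  next
    case (compl A)
    have A [measurable]: "A \<in> sets (predictable_sigma F)" using compl(1) by (simp add: sets_predictable)
    have A' [measurable]: "{0..} \<times> space M - A \<in> sets (predictable_sigma F)"
      using sets.compl_sets[OF A] by (simp add: space_predictable)
    have diff: "path_integral U y (indicator ({0..} \<times> space M - A)) \<omega> = ennreal (U y \<omega> - U 0 \<omega>) - path_integral U y (indicator A) \<omega>"
      if y: "0 \<le> y" and \<omega>: "\<omega> \<in> space M" for y \<omega>
    proof -
      interpret inc_path "\<lambda>s. U s \<omega>" using U \<omega> by (rule inc_process_path)
      have total: "path_integral U y (\<lambda>_. 1) \<omega> = ennreal (U y \<omega> - U 0 \<omega>)"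
        unfolding path_integral_def using y by (simp add: sets_path_measure emeasure_Ioc)
      have le: "path_integral U y (indicator A) \<omega> \<le> path_integral U y (\<lambda>_. 1) \<omega>"
        by (rule path_integral_mono) (auto split: split_indicator)
      have "path_integral U y (\<lambda>_. 1) \<omega> = path_integral U y (\<lambda>z. indicator ({0..} \<times> space M - A) z + indicator A z) \<omega>"
        using \<omega> by (intro path_integral_cong) (auto split: split_indicator)
      also have "\<dots> = path_integral U y (indicator ({0..} \<times> space M - A)) \<omega> + path_integral U y (indicator A) \<omega>"
        by (rule path_integral_add[OF _ _ \<omega>]) measurable
      finally show ?thesis
        using le unfolding total by (metis ennreal_add_diff_cancel_right ennreal_less_top infinity_ennreal_def leD)
    qed
    have [measurable]: "U 0 \<in> borel_measurable (F 0)" using U_F by simp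
    have U0 [measurable]: "(\<lambda>(y, \<omega>). if 0 < y then U 0 \<omega> else 0) \<in> borel_measurable (predictable_sigma F)"
      by (rule predictable_const_after) auto
    have [measurable]: "Measurable.pred (predictable_sigma F) (\<lambda>z. 0 < fst z)"
      using borel_measurable_predictable_before[of 0] by (simp add: pred_def)
    have "(\<lambda>z. ennreal (if 0 < fst z then U (fst z) (snd z) - (\<lambda>(y, \<omega>). if 0 < y then U 0 \<omega> else 0) z else 0) - path_integral U (fst z) (indicator A) (snd z)) \<in> borel_measurable (predictable_sigma F)"
      using compl(2) by measurable
    also have "?this \<longleftrightarrow> ?case"
    proof (rule measurable_cong)
      fix z assume "z \<in> space (predictable_sigma F)"
      then show "ennreal (if 0 < fst z then U (fst z) (snd z) - (\<lambda>(y, \<omega>). if 0 < y then U 0 \<omega> else 0) z else 0) - path_integral U (fst z) (indicator A) (snd z) = 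
        path_integral U (fst z) (indicator ({0..} \<times> space M - A)) (snd z)"
        by (cases "fst z = 0") (auto simp: space_predictable diff)
    qed
    finally show ?case .
  next
    case (union A)
    have A [measurable]: "A i \<in> sets (predictable_sigma F)" for i using union(2) by (auto simp: sets_predictable)
    have "(\<lambda>z. \<Sum>i. path_integral U (fst z) (indicator (A i)) (snd z)) \<in> borel_measurable (predictable_sigma F)"
      using union(3) by measurable
    also have "?this \<longleftrightarrow> ?case"
    proof (rule measurable_cong, safe)
      fix y \<omega> assume "(y, \<omega>) \<in> space (predictable_sigma F)"
      then have \<omega>: "\<omega> \<in> space M" by (auto simp: space_predictable)
      have [measurable_cong]: "sets (path_measure (\<lambda>s. U s \<omega>)) = sets borel" by (simp add: path_measure_def)
      have [measurable]: "(\<lambda>x. indicator (A i) (x, \<omega>) * indicator {0<..y} x :: ennreal) \<in> borel_measurable borel" for i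
        by (rule predictable_path_section_indicator[OF _ \<omega>]) measurable
      have "(\<Sum>i. path_integral U y (indicator (A i)) \<omega>) = (\<integral>\<^sup>+x. (\<Sum>i. indicator (A i) (x, \<omega>) * indicator {0<..y} x) \<partial>path_measure (\<lambda>s. U s \<omega>))"
        unfolding path_integral_def by (rule nn_integral_suminf[symmetric]) measurable
      also have "\<dots> = path_integral U y (indicator (\<Union>i. A i)) \<omega>"
        unfolding path_integral_def by (intro nn_integral_cong) (simp add: suminf_indicator[OF union(1)] ennreal_suminf_multc)
      finally show "(\<Sum>i. path_integral U (fst (y, \<omega>)) (indicator (A i)) (snd (y, \<omega>))) = path_integral U (fst (y, \<omega>)) (indicator (\<Union>i. A i)) (snd (y, \<omega>))"
        by simp
    qed
    finally show ?case .
  qed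
  have "(\<lambda>z. path_integral U (fst z) f (snd z)) \<in> borel_measurable (predictable_sigma F)"
    using f
  proof (induction rule: borel_measurable_induct)
    case (cong f g)
    have "path_integral U (fst z) f (snd z) = path_integral U (fst z) g (snd z)" if "z \<in> space (predictable_sigma F)" for z
      using that cong.hyps by (intro path_integral_cong) (auto simp: space_predictable)
    then show ?case using cong.IH by (subst measurable_cong) auto
  next
    case (set A)
    then show ?case using sets by (simp add: sets_predictable)
  next
    case (mult u c)
    have "path_integral U (fst z) (\<lambda>x. c * u x) (snd z) = c * path_integral U (fst z) u (snd z)" if "z \<in> space (predictable_sigma F)" for z
      using that mult.hyps by (intro path_integral_cmult) (auto simp: space_predictable)
    moreover have "(\<lambda>z. c * path_integral U (fst z) u (snd z)) \<in> borel_measurable (predictable_sigma F)"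
      using mult.IH mult.hyps by measurable
    ultimately show ?case by (subst measurable_cong) auto
  next
    case (add u v)
    have "path_integral U (fst z) (\<lambda>x. v x + u x) (snd z) = path_integral U (fst z) v (snd z) + path_integral U (fst z) u (snd z)" if "z \<in> space (predictable_sigma F)" for z
      using that add.hyps by (intro path_integral_add) (auto simp: space_predictable)
    moreover have "(\<lambda>z. path_integral U (fst z) v (snd z) + path_integral U (fst z) u (snd z)) \<in> borel_measurable (predictable_sigma F)"
      using add.IH add.hyps by measurable
    ultimately show ?case by (subst measurable_cong) auto
  next
    case (seq V)
    have "path_integral U (fst z) (SUP i. V i) (snd z) = (SUP i. path_integral U (fst z) (V i) (snd z))" if "z \<in> space (predictable_sigma F)" for z
    proof -
      have "path_integral U (fst z) (SUP i. V i) (snd z) = path_integral U (fst z) (\<lambda>x. SUP i. V i x) (snd z)"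
        by (rule path_integral_cong) (simp add: image_comp)
      also have "\<dots> = (SUP i. path_integral U (fst z) (V i) (snd z))"
        using that seq.hyps incseq_SucD[OF \<open>incseq V\<close>] by (intro path_integral_SUP) (auto simp: space_predictable le_fun_def)
      finally show ?thesis .
    qed
    moreover have "(\<lambda>z. SUP i. path_integral U (fst z) (V i) (snd z)) \<in> borel_measurable (predictable_sigma F)"
      using seq.IH by measurable
    ultimately show ?case by (subst measurable_cong) auto
  qed
  then show ?thesis by (simp add: split_beta')
qed

definition "bi_gen = {({a1<..b1} \<times> {a2<..b2}) \<times> B | a1 b1 a2 b2 B. 0 \<le> a1 \<and> a1 \<le> b1 \<and> b1 < a2 \<and> a2 \<le> b2 \<and> B \<in> sets (F a2)}"

definition bi_space :: "((real \<times> real) \<times> 'a) set" where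
  "bi_space = {(x, y). 0 < x \<and> x < y} \<times> space M"

lemma bi_genI:
  "X = ({a1<..b1} \<times> {a2<..b2}) \<times> B \<Longrightarrow> 0 \<le> a1 \<Longrightarrow> a1 \<le> b1 \<Longrightarrow> b1 < a2 \<Longrightarrow> a2 \<le> b2 \<Longrightarrow> B \<in> sets (F a2) \<Longrightarrow> X \<in> bi_gen"
  unfolding bi_gen_def by blast

lemma bi_gen_cases:
  assumes "X \<in> bi_gen"
  obtains a1 b1 a2 b2 B where "X = ({a1<..b1} \<times> {a2<..b2}) \<times> B" "0 \<le> a1" "a1 \<le> b1" "b1 < a2" "a2 \<le> b2" "B \<in> sets (F a2)"
  using assms unfolding bi_gen_def by (elim CollectE exE conjE) blast

lemma bi_gen_closed: "bi_gen \<subseteq> Pow bi_space"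
proof
  fix X assume "X \<in> bi_gen"
  then show "X \<in> Pow bi_space"
  proof (cases rule: bi_gen_cases)
    case (1 a1 b1 a2 b2 B)
    have "B \<subseteq> space M" using sets.sets_into_space[OF 1(6)] by (simp add: space_F)
    then show ?thesis using 1 by (auto simp: bi_space_def)
  qed
qed

lemma space_bi: "space (bi_predictable_sigma F) = bi_space"
  unfolding bi_predictable_sigma_def bi_gen_def[symmetric] space_F bi_space_def[symmetric]
  using bi_gen_closed by (rule space_measure_of)

lemma sets_bi: "sets (bi_predictable_sigma F) = sigma_sets bi_space bi_gen"
  unfolding bi_predictable_sigma_def bi_gen_def[symmetric] space_F bi_space_def[symmetric]
  using bi_gen_closed by (rule sets_measure_of)

lemma Int_stable_bi_gen: "Int_stable bi_gen"
proof (rule Int_stableI)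
  fix X Y assume XY: "X \<in> bi_gen" "Y \<in> bi_gen"
  show "X \<inter> Y \<in> bi_gen" using XY(1)
  proof (cases rule: bi_gen_cases)
    case X: (1 a1 b1 a2 b2 B)
    show ?thesis using XY(2)
    proof (cases rule: bi_gen_cases)
      case Y: (1 a1' b1' a2' b2' B')
      have eq: "X \<inter> Y = ({max a1 a1'<..min b1 b1'} \<times> {max a2 a2'<..min b2 b2'}) \<times> (B \<inter> B')"
        unfolding X(1) Y(1) by auto
      show ?thesis
      proof (cases "max a1 a1' \<le> min b1 b1' \<and> max a2 a2' \<le> min b2 b2'")
        case True
        have "B \<in> sets (F (max a2 a2'))" "B' \<in> sets (F (max a2 a2'))"
          using X Y F_mono[of a2 "max a2 a2'"] F_mono[of a2' "max a2 a2'"] by auto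
        then show ?thesis using X Y True by (intro bi_genI[OF eq]) auto
      next
        case False
        then have "X \<inter> Y = ({0<..0} \<times> {1<..1}) \<times> {}" unfolding eq by auto
        then show ?thesis by (rule bi_genI) auto
      qed
    qed
  qed
qed

text \<open>The arguments are ordered for iterated integration: the outcome and the outer time y
  form the parameter of the inner integral over x.\<close>

lemma bi_predictable_imp_product:
  fixes f :: "(real \<times> real) \<times> 'a \<Rightarrow> 'b :: {zero, topological_space}"
  assumes f: "f \<in> borel_measurable (bi_predictable_sigma F)"
  shows "(\<lambda>((\<omega>, y), x). if 0 < x \<and> x < y then f ((x, y), \<omega>) else 0) \<in> borel_measurable ((M \<Otimes>\<^sub>M borel) \<Otimes>\<^sub>M borel)"
proof -
  let ?MM = "(M \<Otimes>\<^sub>M (borel :: real measure)) \<Otimes>\<^sub>M (borel :: real measure)"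
  let ?E = "{z \<in> space ?MM. 0 < snd z \<and> snd z < snd (fst z)}"
  have E: "?E \<in> sets ?MM" by measurable
  let ?r = "\<lambda>z. ((snd z, snd (fst z)), fst (fst z))"
  have r: "?r \<in> measurable (restrict_space ?MM ?E) (bi_predictable_sigma F)"
  proof (rule measurable_sigma_sets[OF sets_bi bi_gen_closed])
    show "?r \<in> space (restrict_space ?MM ?E) \<rightarrow> bi_space"
      by (auto simp: space_restrict_space space_pair_measure bi_space_def)
    fix X assume "X \<in> bi_gen"
    then show "?r -` X \<inter> space (restrict_space ?MM ?E) \<in> sets (restrict_space ?MM ?E)"
    proof (cases rule: bi_gen_cases)
      case (1 a1 b1 a2 b2 B)
      have [measurable]: "B \<in> sets M" using 1 sets_F by auto
      have "?r -` X \<inter> space (restrict_space ?MM ?E) = ?E \<inter> ((B \<times> {a2<..b2}) \<times> {a1<..b1})"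
        unfolding 1(1) using sets.sets_into_space[OF \<open>B \<in> sets M\<close>] by (auto simp: space_restrict_space space_pair_measure)
      then show ?thesis using E by (auto simp: sets_restrict_space)
    qed
  qed
  have "(\<lambda>z. f (?r z)) \<in> borel_measurable (restrict_space ?MM ?E)" using r f by (rule measurable_compose)
  then have "(\<lambda>z. if z \<in> ?E then f (?r z) else 0) \<in> borel_measurable ?MM"
    using E by (subst measurable_If_restrict_space_iff) (simp_all add: Collect_mem_eq)
  also have "?this \<longleftrightarrow> ?thesis"
    by (rule measurable_cong) auto
  finally show ?thesis .
qed

lemma bi_section:
  fixes f :: "(real \<times> real) \<times> 'a \<Rightarrow> ennreal"
  assumes f: "f \<in> borel_measurable (bi_predictable_sigma F)" and \<omega>: "\<omega> \<in> space M"
  shows "(\<lambda>x. f ((x, y), \<omega>) * indicator {0<..<y} x) \<in> borel_measurable borel"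
proof -
  have "(\<omega>, y) \<in> space (M \<Otimes>\<^sub>M borel)" using \<omega> by (simp add: space_pair_measure)
  from measurable_compose[OF measurable_Pair1'[OF this] bi_predictable_imp_product[OF f]]
  have [measurable]: "(\<lambda>x. if 0 < x \<and> x < y then f ((x, y), \<omega>) else 0) \<in> borel_measurable borel" by simp
  have "(\<lambda>x. (if 0 < x \<and> x < y then f ((x, y), \<omega>) else 0) * indicator {0<..<y} x) \<in> borel_measurable borel"
    by measurable
  also have "(\<lambda>x. (if 0 < x \<and> x < y then f ((x, y), \<omega>) else 0) * indicator {0<..<y} x) = (\<lambda>x. f ((x, y), \<omega>) * indicator {0<..<y} x)"
    by (auto simp: fun_eq_iff split: split_indicator)
  finally show ?thesis .
qed

definition inner_integral :: "(real \<Rightarrow> 'a \<Rightarrow> real) \<Rightarrow> ((real \<times> real) \<times> 'a \<Rightarrow> ennreal) \<Rightarrow> real \<times> 'a \<Rightarrow> ennreal" where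
  "inner_integral U f = (\<lambda>(y, \<omega>). \<integral>\<^sup>+x\<in>{0<..<y}. f ((x, y), \<omega>) \<partial>path_measure (\<lambda>s. U s \<omega>))"

text \<open>In a generating rectangle the first interval ends before the second begins. So the
  increment of \<open>U\<close> over the first and the event \<open>B\<close> are both known at
  \<open>a2\<close>, and the integral is this known quantity for \<open>a2 < y \<le> b2\<close>.
  Complements are subtracted from the finite mass of \<open>{0<..<y}\<close>, itself
  predictable.\<close>

lemma predictable_inner_integral:
  assumes U: "inc_process U" and f: "f \<in> borel_measurable (bi_predictable_sigma F)"
  shows "inner_integral U f \<in> borel_measurable (predictable_sigma F)"
proof -
  have pc [measurable_cong]: "sets (path_measure (\<lambda>s. U s \<omega>)) = sets borel" for \<omega> by (simp add: path_measure_def)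
  note Ioo = predictable_Ioo[OF U]
  have sets: "inner_integral U (indicator X) \<in> borel_measurable (predictable_sigma F)"
    if "X \<in> sigma_sets bi_space bi_gen" for X
    using Int_stable_bi_gen bi_gen_closed that
  proof (induction rule: sigma_sets_induct_disjoint)
    case (basic A)
    then show ?case
    proof (cases rule: bi_gen_cases)
      case (1 a1 b1 a2 b2 B)
      have val: "inner_integral U (indicator A) (y, \<omega>) = (indicator {a2<..b2} y * indicator B \<omega>) * ennreal (U b1 \<omega> - U a1 \<omega>)"
        if \<omega>: "\<omega> \<in> space M" for y \<omega>
      proof -
        interpret inc_path "\<lambda>s. U s \<omega>" using U \<omega> by (rule inc_process_path)
        have "inner_integral U (indicator A) (y, \<omega>) = (\<integral>\<^sup>+x. (indicator {a2<..b2} y * indicator B \<omega>) * indicator {a1<..b1} x \<partial>path_measure (\<lambda>s. U s \<omega>))"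
          unfolding inner_integral_def 1(1) prod.case using 1 by (intro nn_integral_cong) (auto split: split_indicator)
        also have "\<dots> = (indicator {a2<..b2} y * indicator B \<omega>) * ennreal (U b1 \<omega> - U a1 \<omega>)"
          using 1 by (subst nn_integral_cmult_indicator) (auto simp: emeasure_Ioc)
        finally show ?thesis .
      qed
      have [measurable]: "B \<in> sets (F a2)" by fact
      have "U a1 \<in> borel_measurable (F a1)" "U b1 \<in> borel_measurable (F b1)" using U 1 by (auto simp: inc_process_def adapted_def)
      then have [measurable]: "U a1 \<in> borel_measurable (F a2)" "U b1 \<in> borel_measurable (F a2)"
        using 1 by (auto intro: measurable_F_mono)
      have [measurable]: "(\<lambda>(y, \<omega>). if a2 < y then indicator B \<omega> * ennreal (U b1 \<omega> - U a1 \<omega>) else 0) \<in> borel_measurable (predictable_sigma F)"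
        using 1 by (intro predictable_const_after) auto
      have [measurable]: "Measurable.pred (predictable_sigma F) (\<lambda>z. b2 < fst z)"
        using borel_measurable_predictable_before[of b2] 1 by (simp add: pred_def)
      have "(\<lambda>z. if b2 < fst z then 0 else (\<lambda>(y, \<omega>). if a2 < y then indicator B \<omega> * ennreal (U b1 \<omega> - U a1 \<omega>) else 0) z) \<in> borel_measurable (predictable_sigma F)"
        by measurable
      also have "?this \<longleftrightarrow> ?thesis"
        by (rule measurable_cong) (auto simp: val space_predictable split: split_indicator)
      finally show ?thesis .
    qed
  next
    case empty
    then show ?case by (simp add: inner_integral_def split_beta')
  next
    case (compl A)
    have A [measurable]: "A \<in> sets (bi_predictable_sigma F)" using compl(1) by (simp add: sets_bi)
    have A' [measurable]: "bi_space - A \<in> sets (bi_predictable_sigma F)"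
      using sets.compl_sets[OF A] by (simp add: space_bi)
    have diff: "inner_integral U (indicator (bi_space - A)) (y, \<omega>) = emeasure (path_measure (\<lambda>t. U t \<omega>)) {0<..<y} - inner_integral U (indicator A) (y, \<omega>)"
      if \<omega>: "\<omega> \<in> space M" for y \<omega>
    proof -
      interpret inc_path "\<lambda>s. U s \<omega>" using U \<omega> by (rule inc_process_path)
      have fin: "emeasure (path_measure (\<lambda>t. U t \<omega>)) {0<..<y} < \<infinity>" by (rule emeasure_bounded_finite[of _ 0 y]) auto
      have [measurable]: "(\<lambda>x. indicator A ((x, y), \<omega>) * indicator {0<..<y} x :: ennreal) \<in> borel_measurable borel"
        "(\<lambda>x. indicator (bi_space - A) ((x, y), \<omega>) * indicator {0<..<y} x :: ennreal) \<in> borel_measurable borel"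
        by (rule bi_section[OF _ \<omega>]; measurable)+
      have le: "inner_integral U (indicator A) (y, \<omega>) \<le> emeasure (path_measure (\<lambda>t. U t \<omega>)) {0<..<y}"
      proof -
        have "inner_integral U (indicator A) (y, \<omega>) \<le> (\<integral>\<^sup>+x. indicator {0<..<y} x \<partial>path_measure (\<lambda>t. U t \<omega>))"
          unfolding inner_integral_def prod.case by (intro nn_integral_mono) (auto split: split_indicator)
        then show ?thesis by simp
      qed
      have "emeasure (path_measure (\<lambda>t. U t \<omega>)) {0<..<y} = (\<integral>\<^sup>+x. indicator {0<..<y} x \<partial>path_measure (\<lambda>t. U t \<omega>))" by simp
      also have "\<dots> = (\<integral>\<^sup>+x. indicator (bi_space - A) ((x, y), \<omega>) * indicator {0<..<y} x + indicator A ((x, y), \<omega>) * indicator {0<..<y} x \<partial>path_measure (\<lambda>t. U t \<omega>))"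
        using \<omega> by (intro nn_integral_cong) (auto simp: bi_space_def split: split_indicator)
      also have "\<dots> = inner_integral U (indicator (bi_space - A)) (y, \<omega>) + inner_integral U (indicator A) (y, \<omega>)"
        unfolding inner_integral_def prod.case by (rule nn_integral_add) measurable
      finally have "emeasure (path_measure (\<lambda>t. U t \<omega>)) {0<..<y} - inner_integral U (indicator A) (y, \<omega>) = inner_integral U (indicator (bi_space - A)) (y, \<omega>)"
        using le fin by (metis ennreal_add_diff_cancel_right infinity_ennreal_def leD)
      then show ?thesis by simp
    qed
    have "(\<lambda>z. (\<lambda>(y, \<omega>). emeasure (path_measure (\<lambda>t. U t \<omega>)) {0<..<y}) z - inner_integral U (indicator A) z) \<in> borel_measurable (predictable_sigma F)"
      using compl(2) Ioo by measurable
    also have "?this \<longleftrightarrow> ?case"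
      by (rule measurable_cong) (auto simp: diff space_predictable)
    finally show ?case .
  next
    case (union A)
    have A [measurable]: "A i \<in> sets (bi_predictable_sigma F)" for i using union(2) by (auto simp: sets_bi)
    have "(\<lambda>z. \<Sum>i. inner_integral U (indicator (A i)) z) \<in> borel_measurable (predictable_sigma F)"
      using union(3) by measurable
    also have "?this \<longleftrightarrow> ?case"
    proof (rule measurable_cong, safe)
      fix y \<omega> assume "(y, \<omega>) \<in> space (predictable_sigma F)"
      then have \<omega>: "\<omega> \<in> space M" by (auto simp: space_predictable)
      have [measurable]: "(\<lambda>x. indicator (A i) ((x, y), \<omega>) * indicator {0<..<y} x :: ennreal) \<in> borel_measurable borel" for i
        by (rule bi_section[OF _ \<omega>]) measurable
      have "(\<Sum>i. inner_integral U (indicator (A i)) (y, \<omega>)) = (\<integral>\<^sup>+x. (\<Sum>i. indicator (A i) ((x, y), \<omega>) * indicator {0<..<y} x) \<partial>path_measure (\<lambda>s. U s \<omega>))"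
        unfolding inner_integral_def prod.case by (rule nn_integral_suminf[symmetric]) measurable
      also have "\<dots> = inner_integral U (indicator (\<Union>i. A i)) (y, \<omega>)"
        unfolding inner_integral_def prod.case by (intro nn_integral_cong) (simp add: suminf_indicator[OF union(1)] ennreal_suminf_multc)
      finally show "(\<Sum>i. inner_integral U (indicator (A i)) (y, \<omega>)) = inner_integral U (indicator (\<Union>i. A i)) (y, \<omega>)" .
    qed
    finally show ?case .
  qed
  show ?thesis
    using f
  proof (induction rule: borel_measurable_induct)
    case (cong f g)
    have "inner_integral U f z = inner_integral U g z" if "z \<in> space (predictable_sigma F)" for z
      using that cong.hyps(3) by (auto simp: inner_integral_def space_predictable space_bi bi_space_def intro!: nn_integral_cong split: split_indicator)
    then show ?case using cong.IH by (subst measurable_cong) auto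
  next
    case (set A)
    then show ?case using sets by (simp add: sets_bi)
  next
    case (mult u c)
    have "inner_integral U (\<lambda>x. c * u x) z = c * inner_integral U u z" if zs: "z \<in> space (predictable_sigma F)" for z
    proof -
      obtain y \<omega> where z: "z = (y, \<omega>)" "\<omega> \<in> space M" using zs by (auto simp: space_predictable)
      note [measurable] = bi_section[OF mult.hyps(2) z(2), of y]
      show ?thesis unfolding z inner_integral_def prod.case mult.assoc by (rule nn_integral_cmult) measurable
    qed
    moreover have "(\<lambda>z. c * inner_integral U u z) \<in> borel_measurable (predictable_sigma F)"
      using mult.IH by measurable
    ultimately show ?case by (subst measurable_cong) auto
  next
    case (add u v)
    have "inner_integral U (\<lambda>x. v x + u x) z = inner_integral U v z + inner_integral U u z" if zs: "z \<in> space (predictable_sigma F)" for z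
    proof -
      obtain y \<omega> where z: "z = (y, \<omega>)" "\<omega> \<in> space M" using zs by (auto simp: space_predictable)
      note [measurable] = bi_section[OF add.hyps(1) z(2), of y] bi_section[OF add.hyps(3) z(2), of y]
      show ?thesis unfolding z inner_integral_def prod.case distrib_right by (rule nn_integral_add) measurable
    qed
    moreover have "(\<lambda>z. inner_integral U v z + inner_integral U u z) \<in> borel_measurable (predictable_sigma F)"
      using add.IH by measurable
    ultimately show ?case by (subst measurable_cong) auto
  next
    case (seq V)
    have "inner_integral U (SUP i. V i) z = (SUP i. inner_integral U (V i) z)" if zs: "z \<in> space (predictable_sigma F)" for z
    proof -
      obtain y \<omega> where z: "z = (y, \<omega>)" "\<omega> \<in> space M" using zs by (auto simp: space_predictable)
      note [measurable] = bi_section[OF seq.hyps(1) z(2), of _ y]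
      have "inner_integral U (SUP i. V i) z = (\<integral>\<^sup>+x. (SUP i. V i ((x, y), \<omega>) * indicator {0<..<y} x) \<partial>path_measure (\<lambda>s. U s \<omega>))"
        unfolding z inner_integral_def prod.case by (intro nn_integral_cong) (simp add: SUP_mult_right_ennreal image_comp)
      also have "\<dots> = (SUP i. inner_integral U (V i) z)"
        unfolding z inner_integral_def prod.case
      proof (rule nn_integral_monotone_convergence_SUP)
        show "incseq (\<lambda>i x. V i ((x, y), \<omega>) * indicator {0<..<y} x)"
          using incseq_SucD[OF \<open>incseq V\<close>] by (intro incseq_SucI le_funI mult_right_mono) (auto simp: le_fun_def)
      qed measurable
      finally show ?thesis .
    qed
    moreover have "(\<lambda>z. SUP i. inner_integral U (V i) z) \<in> borel_measurable (predictable_sigma F)"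
      using seq.IH by measurable
    ultimately show ?case by (subst measurable_cong) auto
  qed
qed

end

text \<open>A nonempty initial segment is \<open>{0<..s}\<close> or \<open>{0<..<s}\<close> with
  \<open>s\<close> its supremum. In the second case it is exhausted by segments
  \<open>{0<..y}\<close> with y in \<open>I\<close>, so the bound holds for the whole segment
  although it may fail at \<open>s\<close>.\<close>

lemma emeasure_initial_segment_le:
  fixes \<mu> :: "real measure" and I :: "real set"
  assumes sets: "sets \<mu> = sets borel" and bounded: "I \<subseteq> {0<..t}"
    and initial: "\<And>x y. y \<in> I \<Longrightarrow> 0 < x \<Longrightarrow> x < y \<Longrightarrow> x \<in> I"
    and le: "\<And>y. y \<in> I \<Longrightarrow> emeasure \<mu> {0<..y} \<le> c"
  shows "emeasure \<mu> I \<le> c"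
proof (cases "I = {}")
  case False
  have bdd: "bdd_above I" using bounded by (intro bdd_aboveI[of _ t]) auto
  define s where "s = Sup I"
  have s: "y \<le> s" if "y \<in> I" for y using that bdd by (simp add: s_def cSup_upper)
  have lt: "y \<in> I" if y: "0 < y" "y < s" for y
  proof -
    obtain z where "z \<in> I" "y < z" using less_cSup_iff[OF False bdd, of y] y by (auto simp: s_def)
    then show ?thesis using initial[of z y] y by simp
  qed
  have "0 < s" using False s bounded by force
  show ?thesis
  proof (cases "s \<in> I")
    case True
    have "x \<in> I \<longleftrightarrow> x \<in> {0<..s}" for x
      using s[of x] lt[of x] True bounded by (cases "x = s") auto
    then have "I = {0<..s}" by blast
    then show ?thesis using le True by simp
  next
    case False
    \<comment> \<open>The divisor starts at 2: with \<open>Suc n\<close> the first end point would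
      be 0, which is not in \<open>I\<close>.\<close>
    define y where "y n = s - s / real (Suc (Suc n))" for n
    have "0 < s / real (Suc (Suc n))" "s / real (Suc (Suc n)) < s" for n
      using \<open>0 < s\<close> by (auto simp: divide_less_eq)
    then have y: "0 < y n" "y n < s" for n unfolding y_def by (simp_all only: diff_gt_0_iff_gt) (simp add: less_diff_eq)
    have "I = (\<Union>n. {0<..y n})"
    proof safe
      fix x assume x: "x \<in> I"
      then have "x < s" using s[OF x] False by (cases "x = s") auto
      have "y \<longlonglongrightarrow> s - 0" unfolding y_def by (intro tendsto_intros LIMSEQ_Suc lim_const_over_n)
      then have "\<forall>\<^sub>F n in sequentially. x < y n" using \<open>x < s\<close> by (intro order_tendstoD(1)) auto
      then obtain n where "x < y n" by (auto simp: eventually_sequentially)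
      then show "x \<in> (\<Union>n. {0<..y n})" using x bounded by (auto intro!: exI[of _ n])
    next
      fix x n assume "x \<in> {0<..y n}"
      then show "x \<in> I" using y[of n] by (intro lt) auto
    qed
    moreover have "emeasure \<mu> (\<Union>n. {0<..y n}) = (SUP n. emeasure \<mu> {0<..y n})"
    proof (rule SUP_emeasure_incseq[symmetric])
      have "y m \<le> y n" if "m \<le> n" for m n
        unfolding y_def using that \<open>0 < s\<close> by (intro diff_left_mono divide_left_mono) auto
      then show "incseq (\<lambda>n. {0<..y n})" by (fastforce simp: incseq_def)
      show "range (\<lambda>n. {0<..y n}) \<subseteq> sets \<mu>" by (simp add: sets image_subset_iff)
    qed
    ultimately have "emeasure \<mu> I = (SUP n. emeasure \<mu> {0<..y n})" by simp
    also have "\<dots> \<le> c" by (intro SUP_least le lt y)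
    finally show ?thesis .
  qed
qed simp

lemma abs_integral_le_nn_integral:
  fixes f :: "'b \<Rightarrow> real"
  shows "ennreal \<bar>integral\<^sup>L K f\<bar> \<le> (\<integral>\<^sup>+x. ennreal \<bar>f x\<bar> \<partial>K)"
proof (cases "integrable K f")
  case True
  then show ?thesis using integral_norm_bound_ennreal[OF True] by simp
qed (simp add: not_integrable_integral_eq)

lemma ls_integral_cong:
  assumes "\<And>x. 0 < x \<Longrightarrow> x \<le> b \<Longrightarrow> f x = g x"
  shows "ls_integral w b f = ls_integral w b g"
proof -
  have "indicator {0<..b} x *\<^sub>R f x = indicator {0<..b} x *\<^sub>R g x" for x
    using assms[of x] by (cases "x \<in> {0<..b}") auto
  then show ?thesis unfolding ls_integral_def set_lebesgue_integral_def by (simp only:)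
qed

section \<open>Measurability of the inner and of the double integral\<close>

context filtered_space begin

lemma predictable_inner_lebesgue_integral:
  fixes f :: "(real \<times> real) \<times> 'a \<Rightarrow> real"
  assumes U: "inc_process U" and f [measurable]: "f \<in> borel_measurable (bi_predictable_sigma F)"
  shows "(\<lambda>(y, \<omega>). LINT x:{0<..<y}|path_measure (\<lambda>s. U s \<omega>). f ((x, y), \<omega>)) \<in> borel_measurable (predictable_sigma F)"
proof -
  have [measurable]: "inner_integral U (\<lambda>z. ennreal \<bar>f z\<bar>) \<in> borel_measurable (predictable_sigma F)"
    "inner_integral U (\<lambda>z. ennreal (f z)) \<in> borel_measurable (predictable_sigma F)"
    "inner_integral U (\<lambda>z. ennreal (- f z)) \<in> borel_measurable (predictable_sigma F)"
    by (rule predictable_inner_integral[OF U]; measurable)+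
  have "(\<lambda>z. if inner_integral U (\<lambda>z. ennreal \<bar>f z\<bar>) z < \<infinity> then enn2real (inner_integral U (\<lambda>z. ennreal (f z)) z) -
      enn2real (inner_integral U (\<lambda>z. ennreal (- f z)) z) else 0) \<in> borel_measurable (predictable_sigma F)"
    by measurable
  also have "?this \<longleftrightarrow> ?thesis"
  proof (rule measurable_cong)
    fix z assume "z \<in> space (predictable_sigma F)"
    then obtain y \<omega> where z: "z = (y, \<omega>)" "\<omega> \<in> space M" by (auto simp: space_predictable)
    define k where "k x = indicator {0<..<y} x * f ((x, y), \<omega>)" for x
    have [measurable_cong]: "sets (path_measure (\<lambda>s. U s \<omega>)) = sets borel" by (simp add: path_measure_def)
    \<comment> \<open>The real section is recovered from its two nonnegative parts, since
      \<open>bi_section\<close> provides measurability for values in [0,\<infinity>].\<close>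
    have "(\<lambda>x. enn2real (ennreal (f ((x, y), \<omega>)) * indicator {0<..<y} x) - enn2real (ennreal (- f ((x, y), \<omega>)) * indicator {0<..<y} x)) \<in> borel_measurable borel"
    proof -
      have [measurable]: "(\<lambda>x. ennreal (f ((x, y), \<omega>)) * indicator {0<..<y} x) \<in> borel_measurable borel"
        "(\<lambda>x. ennreal (- f ((x, y), \<omega>)) * indicator {0<..<y} x) \<in> borel_measurable borel"
        by (rule bi_section[OF _ z(2)]; measurable)+
      show ?thesis by measurable
    qed
    also have "(\<lambda>x. enn2real (ennreal (f ((x, y), \<omega>)) * indicator {0<..<y} x) - enn2real (ennreal (- f ((x, y), \<omega>)) * indicator {0<..<y} x)) = k"
    proof -
      have "enn2real (ennreal r) - enn2real (ennreal (- r)) = r" for r :: real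
        by (cases "0 \<le> r") (auto simp: ennreal_neg)
      then show ?thesis by (auto simp: fun_eq_iff k_def split: split_indicator)
    qed
    finally have k [measurable]: "k \<in> borel_measurable borel" .
    have nn: "inner_integral U (\<lambda>z. ennreal (c * f z)) z = (\<integral>\<^sup>+x. ennreal (c * k x) \<partial>path_measure (\<lambda>s. U s \<omega>))"
      "inner_integral U (\<lambda>z. ennreal \<bar>f z\<bar>) z = (\<integral>\<^sup>+x. ennreal \<bar>k x\<bar> \<partial>path_measure (\<lambda>s. U s \<omega>))" for c
      unfolding inner_integral_def z prod.case by (intro nn_integral_cong; simp add: k_def split: split_indicator)+
    have lint: "(LINT x:{0<..<y}|path_measure (\<lambda>s. U s \<omega>). f ((x, y), \<omega>)) = (\<integral>x. k x \<partial>path_measure (\<lambda>s. U s \<omega>))"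
      by (simp add: set_lebesgue_integral_def k_def)
    show "(if inner_integral U (\<lambda>z. ennreal \<bar>f z\<bar>) z < \<infinity> then enn2real (inner_integral U (\<lambda>z. ennreal (f z)) z) -
      enn2real (inner_integral U (\<lambda>z. ennreal (- f z)) z) else 0) = (case z of (y, \<omega>) \<Rightarrow> LINT x:{0<..<y}|path_measure (\<lambda>s. U s \<omega>). f ((x, y), \<omega>))"
      using nn(1)[of 1] nn(1)[of "-1"] nn(2) unfolding z prod.case lint
      by (auto simp: integrable_iff_bounded real_lebesgue_integral_def not_integrable_integral_eq)
  qed
  finally show ?thesis .
qed

lemma pos_def_kernelD:
  assumes "predictable_pos_def F h"
  shows "\<And>\<omega> x y. \<omega> \<in> space M \<Longrightarrow> 0 \<le> x \<Longrightarrow> 0 \<le> y \<Longrightarrow> h x y \<omega> = h y x \<omega>"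
    "\<And>\<omega> (m::nat) a z. \<omega> \<in> space M \<Longrightarrow> (\<And>k. k < m \<Longrightarrow> 0 \<le> z k) \<Longrightarrow> 0 \<le> (\<Sum>k<m. \<Sum>l<m. a k * a l * h (z k) (z l) \<omega>)"
    "(\<lambda>((x, y), \<omega>). h x y \<omega>) \<in> borel_measurable (bi_predictable_sigma F)"
    "(\<lambda>(y, \<omega>). h y y \<omega>) \<in> borel_measurable (predictable_sigma F)"
proof -
  note * = assms[unfolded predictable_pos_def_def predictable_def space_F]
  show "h x y \<omega> = h y x \<omega>" if "\<omega> \<in> space M" "0 \<le> x" "0 \<le> y" for \<omega> x y
    using conjunct1[OF *] that by simp
  show "0 \<le> (\<Sum>k<m. \<Sum>l<m. a k * a l * h (z k) (z l) \<omega>)" if "\<omega> \<in> space M" "\<And>k. k < m \<Longrightarrow> 0 \<le> z k" for \<omega> and m :: nat and a z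
    using conjunct1[OF conjunct2[OF *]] that by simp
  show "(\<lambda>((x, y), \<omega>). h x y \<omega>) \<in> borel_measurable (bi_predictable_sigma F)"
    using * by (elim conjE)
  show "(\<lambda>(y, \<omega>). h y y \<omega>) \<in> borel_measurable (predictable_sigma F)"
    using * by (elim conjE)
qed

text \<open>Predictability gives measurability on x < y and, separately, on the diagonal. Reflection
  in the diagonal and the symmetry of \<open>h\<close> supply x > y.\<close>

lemma pos_def_kernel_measurable:
  assumes h: "predictable_pos_def F h"
  shows "(\<lambda>((\<omega>, y), x). if 0 < x \<and> 0 < y then h x y \<omega> else 0) \<in> borel_measurable ((M \<Otimes>\<^sub>M borel) \<Otimes>\<^sub>M borel)"
proof -
  let ?MM = "(M \<Otimes>\<^sub>M (borel :: real measure)) \<Otimes>\<^sub>M (borel :: real measure)"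
  define b where "b = (\<lambda>((\<omega>, y), x). if 0 < x \<and> x < y then h x y \<omega> else 0)"
  define d where "d = (\<lambda>(\<omega>, y). if 0 < y then h y y \<omega> else 0)"
  have [measurable]: "b \<in> borel_measurable ?MM"
    using bi_predictable_imp_product[OF pos_def_kernelD(3)[OF h]] by (simp add: b_def split_beta' cong: if_cong)
  have [measurable]: "d \<in> borel_measurable (M \<Otimes>\<^sub>M borel)"
    using predictable_imp_product[OF pos_def_kernelD(4)[OF h]] by (simp add: d_def split_beta' cong: if_cong)
  have [measurable]: "{z \<in> space ?MM. snd z = snd (fst z)} \<in> sets ?MM" by measurable
  have "(\<lambda>z. b z + b ((fst (fst z), snd z), snd (fst z)) + indicator {z \<in> space ?MM. snd z = snd (fst z)} z * d (fst z)) \<in> borel_measurable ?MM"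
    by measurable
  also have "?this \<longleftrightarrow> ?thesis"
  proof (rule measurable_cong)
    fix z assume z: "z \<in> space ?MM"
    obtain \<omega> y x where z_eq: "z = ((\<omega>, y), x)" by (cases z) auto
    then have \<omega>: "\<omega> \<in> space M" using z by (simp add: space_pair_measure)
    show "b z + b ((fst (fst z), snd z), snd (fst z)) + indicator {z \<in> space ?MM. snd z = snd (fst z)} z * d (fst z) =
      (case z of (x, xa) \<Rightarrow> (case x of (\<omega>, y) \<Rightarrow> \<lambda>x. if 0 < x \<and> 0 < y then h x y \<omega> else 0) xa)"
      using z pos_def_kernelD(1)[OF h \<omega>, of x y] unfolding z_eq
      by (cases x y rule: linorder_cases) (auto simp: b_def d_def)
  qed
  finally show ?thesis .
qed

text \<open>The random upper limit is moved into the integrand as an indicator. Measurability in a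
  parameter then applies twice, first with (\<omega>, y) and then with \<omega> as
  parameter.\<close>

lemma double_ls_integral_measurable:
  assumes W: "fv_martingale W" and h: "predictable_pos_def F h" and \<tau> [measurable]: "\<tau> \<in> borel_measurable M"
  shows "(\<lambda>\<omega>. ls_integral (\<lambda>s. W s \<omega>) (\<tau> \<omega>) (\<lambda>y. ls_integral (\<lambda>s. W s \<omega>) (\<tau> \<omega>) (\<lambda>x. h x y \<omega>))) \<in> borel_measurable M"
proof -
  define k where "k = (\<lambda>((\<omega>, y), x). if 0 < x \<and> 0 < y then h x y \<omega> else 0)"
  have [measurable]: "k \<in> borel_measurable ((M \<Otimes>\<^sub>M borel) \<Otimes>\<^sub>M borel)"
    unfolding k_def by (rule pos_def_kernel_measurable[OF h])
  have ind: "(\<lambda>z. indicator {0<..\<tau> (f z)} (g z) :: real) \<in> borel_measurable N"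
    if [measurable]: "f \<in> measurable N M" "g \<in> borel_measurable N" for f g and N :: "'b measure"
  proof -
    have "(\<lambda>z. if 0 < g z \<and> g z \<le> \<tau> (f z) then 1 else 0 :: real) \<in> borel_measurable N" by measurable
    then show ?thesis by (simp add: indicator_def of_bool_def)
  qed
  define J where "J b = ls_integral (\<lambda>s. W s (fst b)) (\<tau> (fst b)) (\<lambda>x. k (b, x))" for b
  have inner: "(\<lambda>b. LINT x:{0<..\<tau> (fst b)}|path_measure (\<lambda>s. U s (fst b)). k (b, x)) \<in> borel_measurable (M \<Otimes>\<^sub>M borel)"
    if U: "inc_process U" for U
  proof -
    have [measurable]: "(\<lambda>z. indicator {0<..\<tau> (fst (fst z))} (snd z) * k z) \<in> borel_measurable ((M \<Otimes>\<^sub>M borel) \<Otimes>\<^sub>M borel)"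
      by (intro borel_measurable_times ind) measurable
    have "(\<lambda>b. \<integral>x. (\<lambda>z. indicator {0<..\<tau> (fst (fst z))} (snd z) * k z) (b, x) \<partial>path_measure (\<lambda>s. U s (fst b))) \<in> borel_measurable (M \<Otimes>\<^sub>M borel)"
      by (rule measurable_integral_path_measure)
        (use inc_process_path[OF U] inc_process_measurable[OF U] in \<open>auto simp: space_pair_measure intro: measurable_compose[OF measurable_fst]\<close>)
    then show ?thesis by (simp add: set_lebesgue_integral_def)
  qed
  have J: "J \<in> borel_measurable (M \<Otimes>\<^sub>M borel)"
  proof -
    have "(\<lambda>b. (LINT x:{0<..\<tau> (fst b)}|path_measure (\<lambda>s. pos_process W s (fst b)). k (b, x)) -
      (LINT x:{0<..\<tau> (fst b)}|path_measure (\<lambda>s. neg_process W s (fst b)). k (b, x))) \<in> borel_measurable (M \<Otimes>\<^sub>M borel)"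
      by (intro borel_measurable_diff inner inc_pos[OF W] inc_neg[OF W])
    also have "?this \<longleftrightarrow> ?thesis"
      by (rule measurable_cong) (auto simp: J_def ls_integral_def process_measures[OF W] space_pair_measure)
    finally show ?thesis .
  qed
  have outer: "(\<lambda>\<omega>. LINT y:{0<..\<tau> \<omega>}|path_measure (\<lambda>s. U s \<omega>). J (\<omega>, y)) \<in> borel_measurable M" if U: "inc_process U" for U
  proof -
    have [measurable]: "(\<lambda>z. indicator {0<..\<tau> (fst z)} (snd z) * J z) \<in> borel_measurable (M \<Otimes>\<^sub>M borel)"
      by (intro borel_measurable_times ind J) measurable
    have "(\<lambda>\<omega>. \<integral>y. (\<lambda>z. indicator {0<..\<tau> (fst z)} (snd z) * J z) (\<omega>, y) \<partial>path_measure (\<lambda>s. U s \<omega>)) \<in> borel_measurable M"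
      by (rule measurable_integral_path_measure) (use inc_process_path[OF U] inc_process_measurable[OF U] in auto)
    then show ?thesis by (simp add: set_lebesgue_integral_def)
  qed
  have "(\<lambda>\<omega>. (LINT y:{0<..\<tau> \<omega>}|path_measure (\<lambda>s. pos_process W s \<omega>). J (\<omega>, y)) - (LINT y:{0<..\<tau> \<omega>}|path_measure (\<lambda>s. neg_process W s \<omega>). J (\<omega>, y))) \<in> borel_measurable M"
    by (intro borel_measurable_diff outer inc_pos[OF W] inc_neg[OF W])
  also have "?this \<longleftrightarrow> ?thesis"
  proof (rule measurable_cong)
    fix \<omega> assume \<omega>: "\<omega> \<in> space M"
    have "(LINT y:{0<..\<tau> \<omega>}|path_measure (\<lambda>s. pos_process W s \<omega>). J (\<omega>, y)) - (LINT y:{0<..\<tau> \<omega>}|path_measure (\<lambda>s. neg_process W s \<omega>). J (\<omega>, y))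
      = ls_integral (\<lambda>s. W s \<omega>) (\<tau> \<omega>) (\<lambda>y. J (\<omega>, y))"
      by (simp add: ls_integral_def process_measures[OF W \<omega>])
    also have "\<dots> = ls_integral (\<lambda>s. W s \<omega>) (\<tau> \<omega>) (\<lambda>y. ls_integral (\<lambda>s. W s \<omega>) (\<tau> \<omega>) (\<lambda>x. h x y \<omega>))"
      unfolding J_def fst_conv by (intro ls_integral_cong) (auto simp: k_def)
    finally show "(LINT y:{0<..\<tau> \<omega>}|path_measure (\<lambda>s. pos_process W s \<omega>). J (\<omega>, y)) - (LINT y:{0<..\<tau> \<omega>}|path_measure (\<lambda>s. neg_process W s \<omega>). J (\<omega>, y))
      = ls_integral (\<lambda>s. W s \<omega>) (\<tau> \<omega>) (\<lambda>y. ls_integral (\<lambda>s. W s \<omega>) (\<tau> \<omega>) (\<lambda>x. h x y \<omega>))" .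
  qed
  finally show ?thesis .
qed



section \<open>The domination inequality\<close>

definition double_variation :: "(real \<Rightarrow> 'a \<Rightarrow> real) \<Rightarrow> real \<Rightarrow> (real \<Rightarrow> real \<Rightarrow> 'a \<Rightarrow> real) \<Rightarrow> 'a \<Rightarrow> ennreal" where
  "double_variation W t h \<omega> = (\<integral>\<^sup>+y\<in>{0<..t}. (\<integral>\<^sup>+x\<in>{0<..t}. ennreal \<bar>h x y \<omega>\<bar>
     \<partial>variation_measure (\<lambda>s. W s \<omega>)) \<partial>variation_measure (\<lambda>s. W s \<omega>))"

lemma double_variation_measurable:
  assumes W: "fv_martingale W" and h: "predictable_pos_def F h"
  shows "double_variation W t h \<in> borel_measurable M"
proof -
  note V = inc_var[OF W]
  define k where "k = (\<lambda>((\<omega>, y), x). if 0 < x \<and> 0 < y then h x y \<omega> else 0)"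
  have [measurable]: "k \<in> borel_measurable ((M \<Otimes>\<^sub>M borel) \<Otimes>\<^sub>M borel)"
    unfolding k_def by (rule pos_def_kernel_measurable[OF h])
  define J where "J b = (\<integral>\<^sup>+x. ennreal \<bar>k (b, x)\<bar> * indicator {0<..t} x \<partial>path_measure (\<lambda>s. var_process W s (fst b)))" for b
  have J [measurable]: "J \<in> borel_measurable (M \<Otimes>\<^sub>M borel)"
  proof -
    have "(\<lambda>b. \<integral>\<^sup>+x. (\<lambda>z. ennreal \<bar>k z\<bar> * indicator {0<..t} (snd z)) (b, x) \<partial>path_measure (\<lambda>s. var_process W s (fst b))) \<in> borel_measurable (M \<Otimes>\<^sub>M borel)"
      by (rule measurable_nn_integral_path_measure)
        (use inc_process_path[OF V] inc_process_measurable[OF V] in \<open>auto simp: space_pair_measure intro: measurable_compose[OF measurable_fst]\<close>)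
    then show ?thesis by (simp add: J_def[abs_def])
  qed
  have "(\<lambda>\<omega>. \<integral>\<^sup>+y. (\<lambda>z. J z * indicator {0<..t} (snd z)) (\<omega>, y) \<partial>path_measure (\<lambda>s. var_process W s \<omega>)) \<in> borel_measurable M"
    by (rule measurable_nn_integral_path_measure) (use inc_process_path[OF V] inc_process_measurable[OF V] in auto)
  also have "?this \<longleftrightarrow> ?thesis"
  proof (rule measurable_cong)
    fix \<omega> assume \<omega>: "\<omega> \<in> space M"
    have "J (\<omega>, y) * indicator {0<..t} y = (\<integral>\<^sup>+x\<in>{0<..t}. ennreal \<bar>h x y \<omega>\<bar> \<partial>variation_measure (\<lambda>s. W s \<omega>)) * indicator {0<..t} y" for y
    proof (cases "y \<in> {0<..t}")
      case True
      then have "ennreal \<bar>k ((\<omega>, y), x)\<bar> * indicator {0<..t} x = ennreal \<bar>h x y \<omega>\<bar> * indicator {0<..t} x" for x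
        by (auto simp: k_def split: split_indicator)
      then show ?thesis by (simp add: J_def process_measures[OF W \<omega>])
    qed simp
    then show "(\<integral>\<^sup>+y. (\<lambda>z. J z * indicator {0<..t} (snd z)) (\<omega>, y) \<partial>path_measure (\<lambda>s. var_process W s \<omega>)) = double_variation W t h \<omega>"
      by (simp add: double_variation_def process_measures[OF W \<omega>])
  qed
  finally show ?thesis .
qed

text \<open>Restricting the inner integral to the single point x = y leaves |h(y,y)| times the mass
  of that point. In this way a finite mean of the double integral also controls the
  diagonal.\<close>

lemma bracket_integral_le_double_variation:
  assumes W: "fv_martingale W" and \<omega>: "\<omega> \<in> space M"
  shows "bracket_integral W t (\<lambda>(y, \<omega>). ennreal (h y y \<omega>)) \<omega> \<le> double_variation W t h \<omega>"
proof -
  interpret fv_path "\<lambda>s. W s \<omega>" using W_path[OF W \<omega>] .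
  let ?V = "variation_measure (\<lambda>s. W s \<omega>)"
  have "ennreal (h y y \<omega>) * emeasure ?V {y} * indicator {0<..t} y \<le> (\<integral>\<^sup>+x\<in>{0<..t}. ennreal \<bar>h x y \<omega>\<bar> \<partial>?V) * indicator {0<..t} y" for y
  proof (cases "y \<in> {0<..t}")
    case True
    have "ennreal (h y y \<omega>) * emeasure ?V {y} = (\<integral>\<^sup>+x. ennreal (h y y \<omega>) * indicator {y} x \<partial>?V)"
      by (rule nn_integral_cmult_indicator[symmetric]) simp
    also have "\<dots> \<le> (\<integral>\<^sup>+x\<in>{0<..t}. ennreal \<bar>h x y \<omega>\<bar> \<partial>?V)"
      using True by (intro nn_integral_mono) (auto intro!: ennreal_leI split: split_indicator)
    finally show ?thesis using True by simp
  qed simp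
  then show ?thesis unfolding bracket_integral_def double_variation_def prod.case by (intro nn_integral_mono)
qed

text \<open>
  Lenglart's domination inequality. The kernel is cut off at the predictable set where the
  compensator \<open>\<integral>h(x,x)dA\<close> is at most \<open>\<delta>\<close>. As this set is an initial interval of time, on
  \<open>x < y\<close> the cut-off of the kernel only involves \<open>y\<close>.
\<close>

theorem domination_inequality:
  assumes W: "fv_martingale W" and A: "inc_process A" and A_pred: "predictable F A"
    and local: "local_martingale M F (\<lambda>t \<omega>. (W t \<omega>)\<^sup>2 - A t \<omega>)"
    and h: "predictable_pos_def F h"
    and \<tau>: "\<And>q. 0 \<le> q \<Longrightarrow> {\<omega> \<in> space M. \<tau> \<omega> \<le> q} \<in> sets (F q)" and \<tau>_meas: "\<tau> \<in> borel_measurable M"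
    and t: "0 < t" and fin: "(\<integral>\<^sup>+\<omega>. double_variation W t h \<omega> \<partial>M) < \<infinity>"
    and \<delta>: "0 < \<delta>" and \<epsilon>: "0 < \<epsilon>"
    and Y_meas: "Y \<in> borel_measurable M"
    and Y: "\<And>\<omega>. \<omega> \<in> space M \<Longrightarrow> path_integral A (\<tau> \<omega>) (\<lambda>(y, \<omega>). ennreal (h y y \<omega>)) \<omega> < \<infinity> \<Longrightarrow>
      Y \<omega> = enn2real (path_integral A (\<tau> \<omega>) (\<lambda>(y, \<omega>). ennreal (h y y \<omega>)) \<omega>)"
  defines "Z \<equiv> \<lambda>\<omega>. ls_integral (\<lambda>s. W s \<omega>) (\<tau> \<omega>) (\<lambda>y. ls_integral (\<lambda>s. W s \<omega>) (\<tau> \<omega>) (\<lambda>x. h x y \<omega>))"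
  shows "measure M {\<omega> \<in> space M. \<epsilon> < \<bar>Z \<omega>\<bar>} \<le> \<delta> / \<epsilon> + measure M {\<omega> \<in> space M. t < \<tau> \<omega>} + measure M {\<omega> \<in> space M. \<delta> < \<bar>Y \<omega>\<bar>}"
proof -
  note hD = pos_def_kernelD[OF h]
  define H where "H = (\<lambda>(y, \<omega>). ennreal (h y y \<omega>))"
  have H [measurable]: "H \<in> borel_measurable (predictable_sigma F)"
    using measurable_compose[OF hD(4) measurable_ennreal] by (simp add: H_def split_beta')
  define R where "R = (\<lambda>(y, \<omega>). path_integral A y H \<omega>)"
  have [measurable]: "R \<in> borel_measurable (predictable_sigma F)"
    unfolding R_def by (rule predictable_running_integral[OF A A_pred H])
  \<comment> \<open>\<open>R\<close> at \<open>y\<close> includes the jump of \<open>A\<close> at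
    \<open>y\<close>, and it is predictable because \<open>A\<close> is. Thus the integral over
    \<open>K\<close> stays at most \<open>\<delta>\<close>, without overshooting.\<close>
  define K where "K = {(y, \<omega>). 0 \<le> y \<and> \<omega> \<in> space M \<and> y \<le> max 0 (\<tau> \<omega>)} \<inter> {z \<in> space (predictable_sigma F). R z \<le> ennreal \<delta>}"
  have K [measurable]: "K \<in> sets (predictable_sigma F)"
  proof -
    have "{(y, \<omega>). 0 \<le> y \<and> \<omega> \<in> space M \<and> y \<le> max 0 (\<tau> \<omega>)} \<in> sets (predictable_sigma F)"
      using \<tau> by (rule predictable_until)
    moreover have "{z \<in> space (predictable_sigma F). R z \<le> ennreal \<delta>} \<in> sets (predictable_sigma F)" by measurable
    ultimately show ?thesis unfolding K_def by (rule sets.Int)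
  qed
  have R_mono: "R (x, \<omega>) \<le> R (y, \<omega>)" if "x \<le> y" for x y \<omega>
    unfolding R_def path_integral_def prod.case using that by (intro nn_integral_mono) (auto split: split_indicator)
  have K_iff: "(y, \<omega>) \<in> K \<longleftrightarrow> y \<le> \<tau> \<omega> \<and> R (y, \<omega>) \<le> ennreal \<delta>" if "0 < y" "\<omega> \<in> space M" for y \<omega>
    using that by (auto simp: K_def space_predictable)
  have K_initial: "(x, \<omega>) \<in> K" if "(y, \<omega>) \<in> K" "0 < x" "x < y" "\<omega> \<in> space M" for x y \<omega>
    using that R_mono[of x y \<omega>] by (auto simp: K_iff intro: order_trans)
  define HK where "HK z = H z * indicator K z" for z
  have HK [measurable]: "HK \<in> borel_measurable (predictable_sigma F)" unfolding HK_def[abs_def] by measurable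
  \<comment> \<open>The section of \<open>K\<close> may lack its right end point, so the bound is
    taken from the segments \<open>{0<..y}\<close> that end inside it.\<close>
  have HK_le: "path_integral A t HK \<omega> \<le> ennreal \<delta>" if \<omega>: "\<omega> \<in> space M" for \<omega>
  proof -
    have [measurable_cong]: "sets (path_measure (\<lambda>s. A s \<omega>)) = sets borel" by (simp add: path_measure_def)
    define \<mu> where "\<mu> = density (path_measure (\<lambda>s. A s \<omega>)) (\<lambda>y. H (y, \<omega>) * indicator {0<..t} y)"
    have [measurable]: "(\<lambda>y. H (y, \<omega>) * indicator {0<..t} y) \<in> borel_measurable borel"
      by (rule predictable_path_section_indicator[OF H \<omega>])
    define I where "I = {y \<in> {0<..t}. (y, \<omega>) \<in> K}"
    have I: "I \<in> sets borel"
    proof -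
      have "(\<lambda>y. indicator K (y, \<omega>) * indicator {0<..t} y :: ennreal) \<in> borel_measurable borel"
        by (rule predictable_path_section_indicator[OF _ \<omega>]) measurable
      also have "(\<lambda>y. indicator K (y, \<omega>) * indicator {0<..t} y :: ennreal) = indicator I"
        by (auto simp: I_def fun_eq_iff split: split_indicator)
      finally show ?thesis by (simp add: borel_measurable_indicator_iff)
    qed
    have "path_integral A t HK \<omega> = emeasure \<mu> I"
      unfolding \<mu>_def path_integral_def using I
      by (subst emeasure_density) (auto simp: HK_def I_def intro!: nn_integral_cong split: split_indicator)
    also have "\<dots> \<le> ennreal \<delta>"
    proof (rule emeasure_initial_segment_le)
      show "I \<subseteq> {0<..t}" by (auto simp: I_def)
      show "x \<in> I" if "y \<in> I" "0 < x" "x < y" for x y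
        using that K_initial[OF _ _ _ \<omega>] by (auto simp: I_def)
      fix y assume y: "y \<in> I"
      have "emeasure \<mu> {0<..y} = R (y, \<omega>)"
        unfolding \<mu>_def R_def path_integral_def prod.case using y
        by (subst emeasure_density) (auto simp: I_def intro!: nn_integral_cong split: split_indicator)
      then show "emeasure \<mu> {0<..y} \<le> ennreal \<delta>" using y K_iff[of y \<omega>] \<omega> by (auto simp: I_def)
    qed (simp add: \<mu>_def path_measure_def)
    finally show ?thesis .
  qed
  have t0: "0 \<le> t" using t by simp
  note [measurable] = double_variation_measurable[OF W h] bracket_integral_measurable[OF W HK]
    bracket_integral_measurable[OF W H] path_integral_measurable[OF A H]
  have bracket: "(\<integral>\<^sup>+\<omega>. bracket_integral W t HK \<omega> \<partial>M) \<le> ennreal \<delta>"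
  proof -
    have "(\<integral>\<^sup>+\<omega>. bracket_integral W t HK \<omega> \<partial>M) = mean_integral A t HK"
      by (rule mean_bracket[OF W A t0 local HK])
    also have "\<dots> \<le> (\<integral>\<^sup>+\<omega>. ennreal \<delta> \<partial>M)" unfolding mean_integral_def by (intro nn_integral_mono HK_le)
    finally show ?thesis by (simp add: emeasure_space_1)
  qed
  have AE_dv: "AE \<omega> in M. double_variation W t h \<omega> \<noteq> \<infinity>"
    using fin by (intro nn_integral_PInf_AE) auto
  \<comment> \<open>Finiteness up to \<open>t\<close> makes \<open>Y\<close> the true value of the
    compensator when \<open>\<tau> \<omega> \<le> t\<close>; an infinite value would not be
    controlled by \<open>Y\<close>.\<close>
  have AE_A: "AE \<omega> in M. path_integral A t H \<omega> \<noteq> \<infinity>"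
  proof (rule nn_integral_PInf_AE)
    have "(\<integral>\<^sup>+\<omega>. path_integral A t H \<omega> \<partial>M) = (\<integral>\<^sup>+\<omega>. bracket_integral W t H \<omega> \<partial>M)"
      using mean_bracket[OF W A t0 local H] by (simp add: mean_integral_def)
    also have "\<dots> \<le> (\<integral>\<^sup>+\<omega>. double_variation W t h \<omega> \<partial>M)"
      unfolding H_def by (intro nn_integral_mono bracket_integral_le_double_variation[OF W])
    finally show "(\<integral>\<^sup>+\<omega>. path_integral A t H \<omega> \<partial>M) \<noteq> \<infinity>" using fin by auto
  qed measurable
  let ?f = "\<lambda>((x, y), \<omega>). h x y \<omega>"
  define g where "g = (\<lambda>(y, \<omega>). indicator K (y, \<omega>) * ((LINT x:{0<..<y}|path_measure (\<lambda>s. pos_process W s \<omega>). h x y \<omega>) -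
     (LINT x:{0<..<y}|path_measure (\<lambda>s. neg_process W s \<omega>). h x y \<omega>)))"
  have g [measurable]: "g \<in> borel_measurable (predictable_sigma F)"
  proof -
    have [measurable]: "(\<lambda>(y, \<omega>). LINT x:{0<..<y}|path_measure (\<lambda>s. pos_process W s \<omega>). h x y \<omega>) \<in> borel_measurable (predictable_sigma F)"
      "(\<lambda>(y, \<omega>). LINT x:{0<..<y}|path_measure (\<lambda>s. neg_process W s \<omega>). h x y \<omega>) \<in> borel_measurable (predictable_sigma F)"
      using predictable_inner_lebesgue_integral[OF inc_pos[OF W] hD(3)] predictable_inner_lebesgue_integral[OF inc_neg[OF W] hD(3)] by simp_all
    have "(\<lambda>z. indicator K z * ((\<lambda>(y, \<omega>). LINT x:{0<..<y}|path_measure (\<lambda>s. pos_process W s \<omega>). h x y \<omega>) z -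
      (\<lambda>(y, \<omega>). LINT x:{0<..<y}|path_measure (\<lambda>s. neg_process W s \<omega>). h x y \<omega>) z)) \<in> borel_measurable (predictable_sigma F)"
      by measurable
    then show ?thesis by (simp add: g_def split_beta')
  qed
  have g_le: "ennreal \<bar>g (y, \<omega>)\<bar> \<le> (\<integral>\<^sup>+x\<in>{0<..t}. ennreal \<bar>h x y \<omega>\<bar> \<partial>variation_measure (\<lambda>s. W s \<omega>))"
    if y: "0 < y" "y \<le> t" and \<omega>: "\<omega> \<in> space M" for y \<omega>
  proof -
    interpret fv_path "\<lambda>s. W s \<omega>" using W_path[OF W \<omega>] .
    define k where "k x = indicator {0<..<y} x * h x y \<omega>" for x
    have k: "(\<lambda>x. ennreal \<bar>k x\<bar>) \<in> borel_measurable borel"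
    proof -
      have "(\<lambda>z. ennreal \<bar>?f z\<bar>) \<in> borel_measurable (bi_predictable_sigma F)"
        by (intro measurable_compose[OF _ measurable_ennreal] borel_measurable_abs hD(3))
      from bi_section[OF this \<omega>, of y]
      have "(\<lambda>x. ennreal \<bar>h x y \<omega>\<bar> * indicator {0<..<y} x) \<in> borel_measurable borel" by simp
      also have "(\<lambda>x. ennreal \<bar>h x y \<omega>\<bar> * indicator {0<..<y} x) = (\<lambda>x. ennreal \<bar>k x\<bar>)"
        by (auto simp: k_def fun_eq_iff split: split_indicator)
      finally show ?thesis .
    qed
    let ?P = "\<integral>x. k x \<partial>positive_measure (\<lambda>s. W s \<omega>)" and ?N = "\<integral>x. k x \<partial>negative_measure (\<lambda>s. W s \<omega>)"
    have "\<bar>g (y, \<omega>)\<bar> \<le> \<bar>?P\<bar> + \<bar>?N\<bar>"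
      unfolding g_def prod.case process_measures[OF W \<omega>] set_lebesgue_integral_def
      by (auto simp: k_def split: split_indicator)
    then have "ennreal \<bar>g (y, \<omega>)\<bar> \<le> ennreal \<bar>?P\<bar> + ennreal \<bar>?N\<bar>"
      by (simp add: ennreal_plus[symmetric] ennreal_leI del: ennreal_plus)
    also have "\<dots> \<le> (\<integral>\<^sup>+x. ennreal \<bar>k x\<bar> \<partial>positive_measure (\<lambda>s. W s \<omega>)) + (\<integral>\<^sup>+x. ennreal \<bar>k x\<bar> \<partial>negative_measure (\<lambda>s. W s \<omega>))"
      by (intro add_mono abs_integral_le_nn_integral)
    also have "\<dots> = (\<integral>\<^sup>+x. ennreal \<bar>k x\<bar> \<partial>variation_measure (\<lambda>s. W s \<omega>))" by (rule nn_integral_variation[OF k, symmetric])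
    also have "\<dots> \<le> (\<integral>\<^sup>+x\<in>{0<..t}. ennreal \<bar>h x y \<omega>\<bar> \<partial>variation_measure (\<lambda>s. W s \<omega>))"
      using y by (intro nn_integral_mono) (auto simp: k_def split: split_indicator)
    finally show ?thesis .
  qed
  have g_fin: "mean_integral (var_process W) t (\<lambda>z. ennreal \<bar>g z\<bar>) < \<infinity>"
  proof -
    have "mean_integral (var_process W) t (\<lambda>z. ennreal \<bar>g z\<bar>) \<le> (\<integral>\<^sup>+\<omega>. double_variation W t h \<omega> \<partial>M)"
      unfolding mean_integral_def path_integral_def double_variation_def
    proof (rule nn_integral_mono)
      fix \<omega> assume \<omega>: "\<omega> \<in> space M"
      show "(\<integral>\<^sup>+y\<in>{0<..t}. ennreal \<bar>g (y, \<omega>)\<bar> \<partial>path_measure (\<lambda>s. var_process W s \<omega>)) \<le>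
        (\<integral>\<^sup>+y\<in>{0<..t}. (\<integral>\<^sup>+x\<in>{0<..t}. ennreal \<bar>h x y \<omega>\<bar> \<partial>variation_measure (\<lambda>s. W s \<omega>)) \<partial>variation_measure (\<lambda>s. W s \<omega>))"
        unfolding process_measures[OF W \<omega>] using g_le[OF _ _ \<omega>] by (intro nn_integral_mono) (auto split: split_indicator)
    qed
    then show ?thesis using fin by (rule le_less_trans)
  qed
  define X where "X \<omega> = (LINT y:{0<..t}|positive_measure (\<lambda>s. W s \<omega>). g (y, \<omega>)) - (LINT y:{0<..t}|negative_measure (\<lambda>s. W s \<omega>). g (y, \<omega>))" for \<omega>
  have X: "integrable M X" "(\<integral>\<omega>. X \<omega> \<partial>M) = 0"
    unfolding X_def using fv_martingale_integral_zero[OF W t0 g g_fin] by auto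
  \<comment> \<open>The double integral of the cut-off kernel: \<open>X\<close> is its part over x <
    y and has mean zero, the bracket is the diagonal and has mean at most
    \<open>\<delta>\<close>.\<close>
  define S where "S \<omega> = 2 * X \<omega> + enn2real (bracket_integral W t HK \<omega>)" for \<omega>
  have br_int: "integrable M (\<lambda>\<omega>. enn2real (bracket_integral W t HK \<omega>))" "(\<integral>\<omega>. enn2real (bracket_integral W t HK \<omega>) \<partial>M) \<le> \<delta>"
  proof -
    have "AE \<omega> in M. bracket_integral W t HK \<omega> \<noteq> \<infinity>"
      using bracket by (intro nn_integral_PInf_AE) (auto simp: top_unique)
    then have eq: "(\<integral>\<^sup>+\<omega>. ennreal (enn2real (bracket_integral W t HK \<omega>)) \<partial>M) = (\<integral>\<^sup>+\<omega>. bracket_integral W t HK \<omega> \<partial>M)"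
      by (intro nn_integral_cong_AE) (auto simp: less_top)
    then show int: "integrable M (\<lambda>\<omega>. enn2real (bracket_integral W t HK \<omega>))"
      using bracket by (intro integrableI_nonneg) (auto intro: le_less_trans)
    have "ennreal (\<integral>\<omega>. enn2real (bracket_integral W t HK \<omega>) \<partial>M) \<le> ennreal \<delta>"
      using bracket unfolding eq[symmetric] by (subst nn_integral_eq_integral[OF int, symmetric]) auto
    then show "(\<integral>\<omega>. enn2real (bracket_integral W t HK \<omega>) \<partial>M) \<le> \<delta>" using \<delta> by (simp add: ennreal_le_iff)
  qed
  have S_int: "integrable M S" "(\<integral>\<omega>. S \<omega> \<partial>M) \<le> \<delta>"
    unfolding S_def using X br_int by simp_all
  \<comment> \<open>Nonnegativity is claimed whether or not the cut-off is active, since Markov's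
    inequality will require it almost everywhere. Agreement with \<open>Z\<close> is claimed where
    \<open>\<tau> \<omega> \<le> t\<close> and the cut-off removes nothing from
    \<open>{0<..\<tau> \<omega>}\<close>.\<close>
  have path: "0 \<le> S \<omega> \<and> (\<tau> \<omega> \<le> t \<longrightarrow> R (\<tau> \<omega>, \<omega>) \<le> ennreal \<delta> \<longrightarrow> Z \<omega> = S \<omega>)"
    if \<omega>: "\<omega> \<in> space M" and dv: "double_variation W t h \<omega> \<noteq> \<infinity>" for \<omega>
  proof -
    interpret fv_path "\<lambda>s. W s \<omega>" using W_path[OF W \<omega>] .
    \<comment> \<open>The decomposition takes a symmetric Borel kernel on the whole plane, while
      \<open>h\<close> is controlled at nonnegative times only.\<close>
    define h' where "h' x y = (if 0 < x \<and> 0 < y then h x y \<omega> else 0)" for x y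
    define I where "I = {y \<in> {0<..t}. (y, \<omega>) \<in> K}"
    have I: "I \<in> sets borel"
    proof -
      have "(\<lambda>y. indicator K (y, \<omega>) * indicator {0<..t} y :: ennreal) \<in> borel_measurable borel"
        by (rule predictable_path_section_indicator[OF _ \<omega>]) measurable
      also have "(\<lambda>y. indicator K (y, \<omega>) * indicator {0<..t} y :: ennreal) = indicator I"
        by (auto simp: I_def fun_eq_iff split: split_indicator)
      finally show ?thesis by (simp add: borel_measurable_indicator_iff)
    qed
    have h'_meas: "(\<lambda>(x, y). h' x y) \<in> borel_measurable (borel \<Otimes>\<^sub>M borel)"
    proof -
      have "(\<lambda>p :: real \<times> real. ((\<omega>, snd p), fst p)) \<in> measurable (borel \<Otimes>\<^sub>M borel) ((M \<Otimes>\<^sub>M borel) \<Otimes>\<^sub>M borel)"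
        using \<omega> by measurable
      from measurable_compose[OF this pos_def_kernel_measurable[OF h]]
      show ?thesis by (simp add: h'_def[abs_def] split_beta' cong: if_cong)
    qed
    have h'_sym: "h' x y = h' y x" for x y using hD(1)[OF \<omega>, of x y] by (simp add: h'_def)
    have h'_pos: "0 \<le> (\<Sum>k<m. \<Sum>l<m. a k * a l * h' (z k) (z l))" if z: "\<And>k. k < m \<Longrightarrow> 0 < z k" for m :: nat and a z
    proof -
      have "0 \<le> (\<Sum>k<m. \<Sum>l<m. a k * a l * h (z k) (z l) \<omega>)" by (rule hD(2)[OF \<omega>]) (use z less_imp_le in blast)
      also have "\<dots> = (\<Sum>k<m. \<Sum>l<m. a k * a l * h' (z k) (z l))" using z by (intro sum.cong refl) (auto simp: h'_def)
      finally show ?thesis .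
    qed
    have I_initial: "x \<in> I" if "y \<in> I" "0 < x" "x < y" for x y
      using that K_initial[OF _ _ _ \<omega>] by (auto simp: I_def)
    have fin': "(\<integral>\<^sup>+y\<in>I. (\<integral>\<^sup>+x\<in>I. ennreal \<bar>h' x y\<bar> \<partial>variation_measure (\<lambda>s. W s \<omega>)) \<partial>variation_measure (\<lambda>s. W s \<omega>)) < \<infinity>"
    proof -
      have "(\<integral>\<^sup>+x\<in>I. ennreal \<bar>h' x y\<bar> \<partial>variation_measure (\<lambda>s. W s \<omega>)) * indicator I y \<le> (\<integral>\<^sup>+x\<in>{0<..t}. ennreal \<bar>h x y \<omega>\<bar> \<partial>variation_measure (\<lambda>s. W s \<omega>)) * indicator {0<..t} y" for y
        by (intro mult_mono nn_integral_mono) (auto simp: I_def h'_def split: split_indicator)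
      then have "(\<integral>\<^sup>+y\<in>I. (\<integral>\<^sup>+x\<in>I. ennreal \<bar>h' x y\<bar> \<partial>variation_measure (\<lambda>s. W s \<omega>)) \<partial>variation_measure (\<lambda>s. W s \<omega>)) \<le> double_variation W t h \<omega>"
        unfolding double_variation_def by (intro nn_integral_mono)
      then show ?thesis using dv by (auto simp: less_top top_unique)
    qed
    define g' where "g' y = indicator I y * ((LINT x:{0<..<y}|positive_measure (\<lambda>s. W s \<omega>). h' x y) - (LINT x:{0<..<y}|negative_measure (\<lambda>s. W s \<omega>). h' x y))" for y
    have g'_eq: "g' y = indicator {0<..t} y * g (y, \<omega>)" for y
    proof (cases "y \<in> {0<..t}")
      case True
      then have "indicator {0<..<y} x *\<^sub>R h' x y = indicator {0<..<y} x *\<^sub>R h x y \<omega>" for x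
        by (auto simp: h'_def split: split_indicator)
      then have "(LINT x:{0<..<y}|N. h' x y) = (LINT x:{0<..<y}|N. h x y \<omega>)" for N
        unfolding set_lebesgue_integral_def by (simp only:)
      then show ?thesis using True
        by (simp add: g'_def g_def I_def process_measures[OF W \<omega>] split: split_indicator)
    qed (auto simp: g'_def I_def indicator_def)
    have br_eq: "(\<integral>\<^sup>+y\<in>I. ennreal (h' y y) * emeasure (variation_measure (\<lambda>s. W s \<omega>)) {y} \<partial>variation_measure (\<lambda>s. W s \<omega>)) = bracket_integral W t HK \<omega>"
      unfolding bracket_integral_def by (intro nn_integral_cong) (auto simp: I_def h'_def HK_def H_def split: split_indicator)
    have "\<exists>s\<ge>0. 2 * ((LINT y|positive_measure (\<lambda>s. W s \<omega>). g' y) - (LINT y|negative_measure (\<lambda>s. W s \<omega>). g' y)) + enn2real (bracket_integral W t HK \<omega>) = s \<and>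
      (\<forall>b. I = {0<..b} \<longrightarrow> ls_integral (\<lambda>s. W s \<omega>) b (\<lambda>y. ls_integral (\<lambda>s. W s \<omega>) b (\<lambda>x. h' x y)) = s)"
      unfolding g'_def br_eq[symmetric]
    proof (rule double_integral_decomposition)
      show "I \<subseteq> {0<..t}" by (auto simp: I_def)
    qed (fact h'_meas h'_sym I fin' | rule h'_pos I_initial; assumption)+
    then obtain s where s: "0 \<le> s"
      "2 * ((LINT y|positive_measure (\<lambda>s. W s \<omega>). g' y) - (LINT y|negative_measure (\<lambda>s. W s \<omega>). g' y)) + enn2real (bracket_integral W t HK \<omega>) = s"
      "\<And>b. I = {0<..b} \<Longrightarrow> ls_integral (\<lambda>s. W s \<omega>) b (\<lambda>y. ls_integral (\<lambda>s. W s \<omega>) b (\<lambda>x. h' x y)) = s"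
      by (elim exE conjE) blast
    have "S \<omega> = s" using s(2) unfolding S_def X_def set_lebesgue_integral_def g'_eq by simp
    moreover have "Z \<omega> = s" if le: "\<tau> \<omega> \<le> t" "R (\<tau> \<omega>, \<omega>) \<le> ennreal \<delta>"
    proof -
      have "R (x, \<omega>) \<le> ennreal \<delta>" if "x \<le> \<tau> \<omega>" for x
        using R_mono[OF that, of \<omega>] le(2) by (rule order_trans)
      then have "I = {0<..\<tau> \<omega>}"
        using le K_iff[OF _ \<omega>] by (auto simp: I_def)
      then have "ls_integral (\<lambda>s. W s \<omega>) (\<tau> \<omega>) (\<lambda>y. ls_integral (\<lambda>s. W s \<omega>) (\<tau> \<omega>) (\<lambda>x. h' x y)) = s" by (rule s(3))
      also have "ls_integral (\<lambda>s. W s \<omega>) (\<tau> \<omega>) (\<lambda>y. ls_integral (\<lambda>s. W s \<omega>) (\<tau> \<omega>) (\<lambda>x. h' x y)) = Z \<omega>"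
        unfolding Z_def by (intro ls_integral_cong) (simp add: h'_def)
      finally show ?thesis .
    qed
    ultimately show ?thesis using s(1) by simp
  qed
  have AE_path: "AE \<omega> in M. 0 \<le> S \<omega> \<and> (\<epsilon> < \<bar>Z \<omega>\<bar> \<longrightarrow> t < \<tau> \<omega> \<or> \<delta> < \<bar>Y \<omega>\<bar> \<or> \<epsilon> \<le> S \<omega>)"
    using AE_dv AE_A AE_space
  proof eventually_elim
    case (elim \<omega>)
    note * = path[OF elim(3,1)]
    have "R (\<tau> \<omega>, \<omega>) \<le> ennreal \<delta>" if "\<tau> \<omega> \<le> t" "\<bar>Y \<omega>\<bar> \<le> \<delta>"
    proof -
      have "R (\<tau> \<omega>, \<omega>) < \<infinity>" using R_mono[OF that(1), of \<omega>] elim(2) by (auto simp: R_def less_top top_unique)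
      then have "Y \<omega> = enn2real (R (\<tau> \<omega>, \<omega>))" "ennreal (enn2real (R (\<tau> \<omega>, \<omega>))) = R (\<tau> \<omega>, \<omega>)"
        using Y[OF elim(3)] by (auto simp: R_def H_def)
      then show ?thesis using that(2) by (metis abs_of_nonneg enn2real_nonneg ennreal_leI)
    qed
    then show ?case using * by force
  qed
  have Z_meas: "Z \<in> borel_measurable M" unfolding Z_def by (rule double_ls_integral_measurable[OF W h \<tau>_meas])
  note [measurable] = Z_meas Y_meas \<tau>_meas borel_measurable_integrable[OF S_int(1)]
  have "measure M {\<omega> \<in> space M. \<epsilon> < \<bar>Z \<omega>\<bar>} \<le> measure M ({\<omega> \<in> space M. \<epsilon> \<le> S \<omega>} \<union> {\<omega> \<in> space M. t < \<tau> \<omega>} \<union> {\<omega> \<in> space M. \<delta> < \<bar>Y \<omega>\<bar>})"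
    using AE_path by (intro finite_measure_mono_AE) auto
  also have "\<dots> \<le> measure M {\<omega> \<in> space M. \<epsilon> \<le> S \<omega>} + measure M {\<omega> \<in> space M. t < \<tau> \<omega>} + measure M {\<omega> \<in> space M. \<delta> < \<bar>Y \<omega>\<bar>}"
    by (intro order_trans[OF measure_Un_le] add_mono order_refl) measurable
  also have "measure M {\<omega> \<in> space M. \<epsilon> \<le> S \<omega>} \<le> \<delta> / \<epsilon>"
  proof -
    have "measure M {\<omega> \<in> space M. \<epsilon> \<le> S \<omega>} \<le> (\<integral>\<omega>. S \<omega> \<partial>M) / \<epsilon>"
      by (rule integral_Markov_inequality_measure[where A = "{}"]) (use S_int(1) AE_path \<epsilon> in auto)
    also have "\<dots> \<le> \<delta> / \<epsilon>" using S_int(2) \<epsilon> by (simp add: divide_right_mono)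
    finally show ?thesis .
  qed
  finally show ?thesis by simp
qed

end

section \<open>Path integrals against an increasing path\<close>

context inc_path begin

lemma variation_sum_le:
  assumes "mono p" "range p \<subseteq> {0..t}"
  shows "(\<Sum>i<m. \<bar>U (p (Suc i)) - U (p i)\<bar>) \<le> U t - U 0"
proof -
  have p: "0 \<le> p i" "p i \<le> t" "p i \<le> p (Suc i)" for i
    using assms(2) monoD[OF assms(1), of i "Suc i"] by (auto simp: image_subset_iff)
  have "U (p i) \<le> U (p (Suc i))" for i using mono_onD[OF inc] p by simp
  then have "(\<Sum>i<m. \<bar>U (p (Suc i)) - U (p i)\<bar>) = (\<Sum>i<m. U (p (Suc i)) - U (p i))" by simp
  also have "\<dots> = U (p m) - U (p 0)" by (rule sum_lessThan_telescope)
  also have "\<dots> \<le> U t - U 0"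
    using mono_onD[OF inc, of "p m" t] mono_onD[OF inc, of 0 "p 0"] p[of m] p[of 0] by simp
  finally show ?thesis .
qed

lemma fv_path: "fv_path U"
proof (rule fv_path.intro)
  show "locally_finite_variation U"
    unfolding locally_finite_variation_def variation_sums_def
    using variation_sum_le by (auto intro!: bdd_aboveI)
qed (rule inc_right_cont)

lemma total_variation_eq: "0 \<le> t \<Longrightarrow> total_variation U t = U t - U 0"
proof (rule antisym)
  assume t: "0 \<le> t"
  show "total_variation U t \<le> U t - U 0" using t variation_sum_le by (rule fv_path.total_variation_least[OF fv_path])
  show "U t - U 0 \<le> total_variation U t" using fv_path.abs_diff_le_V[OF fv_path t] by simp
qed

text \<open>An increasing path has no negative part, and its positive part is the path itself when
  it starts at 0. This links the integral against the predictable variation to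
  \<open>path_measure\<close>.\<close>

lemma ls_integral_eq:
  assumes "U 0 = 0"
  shows "ls_integral U b f = (LINT x:{0<..b}|path_measure U. f x)"
proof -
  have "inc_path (\<lambda>_. 0)" by standard (auto simp: mono_on_def right_continuous_path_def)
  then have "null_measure borel = path_measure (\<lambda>_. 0)"
    by (rule inc_path.path_measure_eqI) simp_all
  moreover have "negative_measure U = path_measure (\<lambda>_. 0)"
    by (simp add: negative_measure_def path_measure_def total_variation_eq)
  ultimately have neg: "(LINT x:{0<..b}|negative_measure U. f x) = 0"
    by (simp add: set_lebesgue_integral_def flip: \<open>null_measure borel = path_measure (\<lambda>_. 0)\<close>)
  have pos: "positive_measure U = path_measure U"
    by (simp add: positive_measure_def path_measure_def total_variation_eq assms)
  show ?thesis by (simp add: ls_integral_def neg pos)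
qed

end


section \<open>Censored data\<close>

lemma continuous_positive_cdfD:
  assumes "continuous_positive_cdf F"
  shows "continuous_on UNIV F" "F 0 = 0" "0 \<le> F x" "F x \<le> 1"
proof -
  obtain D where D: "real_distribution D" "measure D {0<..} = 1" "cdf D = F"
    and cont: "continuous_on UNIV F"
    using assms unfolding continuous_positive_cdf_def by blast
  interpret real_distribution D by fact
  show "continuous_on UNIV F" by fact
  have "measure D {..0} = measure D (space D - {0<..})" by (simp add: greaterThan_def atMost_def Compl_eq_Diff_UNIV[symmetric] Collect_neg_eq[symmetric] not_less)
  also have "\<dots> = 1 - measure D {0<..}" by (rule prob_compl) simp
  finally show "F 0 = 0" using D(2) by (simp add: D(3)[symmetric] cdf_def)
  show "0 \<le> F x" "F x \<le> 1" using cdf_bounded_prob[of x] by (simp_all add: D(3)[symmetric] cdf_def)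
qed

text \<open>A continuous distribution function leaves no atom at \<open>r\<close>, so the mass 1 of
  the points up to \<open>r\<close> already lies strictly below \<open>r\<close>.\<close>

lemma (in prob_space) AE_less_of_cdf:
  assumes X [measurable]: "X \<in> borel_measurable M" and F: "cdf (distr M borel X) = F"
    and cont: "continuous_on UNIV F" and r: "F r = 1"
  shows "AE \<omega> in M. X \<omega> < r"
proof -
  interpret D: real_distribution "distr M borel X"
    by (intro real_distribution_distr) simp
  have "(cdf (distr M borel X) \<longlongrightarrow> measure (distr M borel X) {..<r}) (at_left r)" by (rule D.cdf_at_left)
  moreover have "(F \<longlongrightarrow> F r) (at_left r)"
    using cont unfolding continuous_on_def by (meson UNIV_I tendsto_within_subset top_greatest)
  ultimately have "measure (distr M borel X) {..<r} = 1"
    using r F by (metis tendsto_unique trivial_limit_at_left_real)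
  then have "prob {\<omega> \<in> space M. X \<omega> < r} = 1"
    by (subst (asm) measure_distr) (auto simp: vimage_def Int_def conj_commute)
  then show ?thesis by (subst (asm) prob_Collect_eq_1) auto
qed

context censored_two_sample begin

abbreviation "Filt n \<equiv> obs_filtration (M n) n (T n) (C n)"

lemma obs_time_measurable: "i \<in> {1..n} \<Longrightarrow> obs_time (T n) (C n) i \<in> borel_measurable (M n)"
  unfolding obs_time_def[abs_def] using T_meas C_meas by measurable

lemma obs_status_measurable: "i \<in> {1..n} \<Longrightarrow> {\<omega> \<in> space (M n). obs_status (T n) (C n) i \<omega> = d} \<in> sets (M n)"
proof -
  assume i: "i \<in> {1..n}"
  note [measurable] = T_meas[OF i] obs_time_measurable[OF i]
  have E: "{\<omega> \<in> space (M n). obs_time (T n) (C n) i \<omega> = T n i \<omega>} \<in> sets (M n)" by measurable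
  have "{\<omega> \<in> space (M n). obs_status (T n) (C n) i \<omega> = d} =
    (if d = 1 then {\<omega> \<in> space (M n). obs_time (T n) (C n) i \<omega> = T n i \<omega>}
     else if d = 0 then space (M n) - {\<omega> \<in> space (M n). obs_time (T n) (C n) i \<omega> = T n i \<omega>} else {})"
    by (auto simp: obs_status_def)
  then show ?thesis using E by auto
qed

definition "filt_gen n x = {{\<omega> \<in> space (M n). obs_time (T n) (C n) i \<omega> \<le> s \<and> obs_status (T n) (C n) i \<omega> = d} | i s d.
         i \<in> {1..n} \<and> 0 \<le> s \<and> s \<le> x \<and> d \<in> {0, 1}} \<union> null_sets (M n)"

lemma filt_gen_sets: "filt_gen n x \<subseteq> sets (M n)"
proof -
  have "{\<omega> \<in> space (M n). obs_time (T n) (C n) i \<omega> \<le> s \<and> obs_status (T n) (C n) i \<omega> = d} \<in> sets (M n)" if i: "i \<in> {1..n}" for i s d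
  proof -
    note [measurable] = obs_time_measurable[OF i]
    have "{\<omega> \<in> space (M n). obs_time (T n) (C n) i \<omega> \<le> s} \<inter> {\<omega> \<in> space (M n). obs_status (T n) (C n) i \<omega> = d} \<in> sets (M n)"
    proof (rule sets.Int)
      show "{\<omega> \<in> space (M n). obs_time (T n) (C n) i \<omega> \<le> s} \<in> sets (M n)" by measurable
    qed (rule obs_status_measurable[OF i])
    also have "{\<omega> \<in> space (M n). obs_time (T n) (C n) i \<omega> \<le> s} \<inter> {\<omega> \<in> space (M n). obs_status (T n) (C n) i \<omega> = d} =
      {\<omega> \<in> space (M n). obs_time (T n) (C n) i \<omega> \<le> s \<and> obs_status (T n) (C n) i \<omega> = d}" by auto
    finally show ?thesis .
  qed
  then show ?thesis by (auto simp: filt_gen_def)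
qed

lemma filt_gen_Pow: "filt_gen n x \<subseteq> Pow (space (M n))"
  using filt_gen_sets sets.sets_into_space by blast

lemma sets_Filt: "sets (Filt n x) = sigma_sets (space (M n)) (filt_gen n x)"
  unfolding obs_filtration_def filt_gen_def[symmetric] using filt_gen_Pow by (rule sets_measure_of)

lemma space_Filt: "space (Filt n x) = space (M n)"
  unfolding obs_filtration_def filt_gen_def[symmetric] using filt_gen_Pow by (rule space_measure_of)

lemma filtered: "n \<ge> 1 \<Longrightarrow> filtered_space (M n) (Filt n)"
proof (intro filtered_space.intro filtered_space_axioms.intro)
  show "sets (Filt n t) \<subseteq> sets (M n)" for t
    unfolding sets_Filt using filt_gen_sets by (rule sets.sigma_sets_subset)
  show "sets (Filt n s) \<subseteq> sets (Filt n t)" if "s \<le> t" for s t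
    unfolding sets_Filt
  proof (rule sigma_sets_mono')
    show "filt_gen n s \<subseteq> filt_gen n t" using that unfolding filt_gen_def by (auto intro: order_trans)
  qed
qed (auto simp: space_Filt intro: prob)

lemma max_obs_time_le_iff: "n \<ge> 1 \<Longrightarrow> max_obs_time n (T n) (C n) \<omega> \<le> q \<longleftrightarrow> (\<forall>i\<in>{1..n}. obs_time (T n) (C n) i \<omega> \<le> q)"
  unfolding max_obs_time_def by (subst Max_le_iff) auto

lemma max_obs_time_less_iff: "n \<ge> 1 \<Longrightarrow> max_obs_time n (T n) (C n) \<omega> < q \<longleftrightarrow> (\<forall>i\<in>{1..n}. obs_time (T n) (C n) i \<omega> < q)"
  unfolding max_obs_time_def by (subst Max_less_iff) auto

lemma max_obs_time_stopping:
  assumes n: "n \<ge> 1" and q: "0 \<le> q"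
  shows "{\<omega> \<in> space (M n). max_obs_time n (T n) (C n) \<omega> \<le> q} \<in> sets (Filt n q)"
proof -
  have "{\<omega> \<in> space (M n). obs_time (T n) (C n) i \<omega> \<le> q} \<in> sets (Filt n q)" if i: "i \<in> {1..n}" for i
  proof -
    let ?E = "\<lambda>d. {\<omega> \<in> space (M n). obs_time (T n) (C n) i \<omega> \<le> q \<and> obs_status (T n) (C n) i \<omega> = d}"
    have "?E d \<in> sets (Filt n q)" if "d \<in> {0, 1}" for d
    proof -
      have "?E d \<in> filt_gen n q"
        unfolding filt_gen_def using i q that by blast
      then show ?thesis unfolding sets_Filt by (rule sigma_sets.Basic)
    qed
    \<comment> \<open>The filtration records a time only together with the status. As the status
      takes no values other than 0 and 1, the union forgets it.\<close>
    then have "?E 0 \<union> ?E 1 \<in> sets (Filt n q)" by (intro sets.Un) auto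
    also have "?E 0 \<union> ?E 1 = {\<omega> \<in> space (M n). obs_time (T n) (C n) i \<omega> \<le> q}" by (auto simp: obs_status_def)
    finally show ?thesis .
  qed
  then have "(\<Inter>i\<in>{1..n}. {\<omega> \<in> space (M n). obs_time (T n) (C n) i \<omega> \<le> q}) \<in> sets (Filt n q)"
    using n by (intro sets.finite_INT) auto
  also have "(\<Inter>i\<in>{1..n}. {\<omega> \<in> space (M n). obs_time (T n) (C n) i \<omega> \<le> q}) = {\<omega> \<in> space (M n). max_obs_time n (T n) (C n) \<omega> \<le> q}"
    using n by (auto simp: max_obs_time_le_iff)
  finally show ?thesis .
qed

lemma max_obs_time_measurable: "n \<ge> 1 \<Longrightarrow> max_obs_time n (T n) (C n) \<in> borel_measurable (M n)"
proof (rule borel_measurableI_le)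
  fix q assume n: "n \<ge> 1"
  have "(\<Inter>i\<in>{1..n}. {\<omega> \<in> space (M n). obs_time (T n) (C n) i \<omega> \<le> q}) \<in> sets (M n)"
  proof (intro sets.finite_INT)
    fix i assume "i \<in> {1..n}"
    note [measurable] = obs_time_measurable[OF this]
    show "{\<omega> \<in> space (M n). obs_time (T n) (C n) i \<omega> \<le> q} \<in> sets (M n)" by measurable
  qed (use n in auto)
  also have "(\<Inter>i\<in>{1..n}. {\<omega> \<in> space (M n). obs_time (T n) (C n) i \<omega> \<le> q}) = {\<omega> \<in> space (M n). max_obs_time n (T n) (C n) \<omega> \<le> q}"
    using n by (auto simp: max_obs_time_le_iff)
  finally show "{\<omega> \<in> space (M n). max_obs_time n (T n) (C n) \<omega> \<le> q} \<in> sets (M n)" .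
qed

abbreviation "survival x \<equiv> 1 - mixed_obs_cdf F G \<eta> x"

lemma survival_eq: "survival x = \<eta> * ((1 - F 0 x) * (1 - G 0 x)) + (1 - \<eta>) * ((1 - F 1 x) * (1 - G 1 x))"
  by (simp add: mixed_obs_cdf_def obs_cdf_def algebra_simps)

lemma cdf_facts:
  assumes "j \<in> {0, 1}"
  shows "continuous_on UNIV (F j)" "continuous_on UNIV (G j)" "F j 0 = 0" "G j 0 = 0" "F j x \<le> 1" "G j x \<le> 1"
  using cdfs[OF assms] continuous_positive_cdfD by auto

lemma survival_pos_right:
  assumes "0 < survival x"
  shows "\<exists>y>x. 0 < survival y"
proof -
  have "continuous_on UNIV (\<lambda>x. survival x)"
    unfolding survival_eq using cdf_facts by (intro continuous_intros) auto
  then have "(survival \<longlongrightarrow> survival x) (at_right x)"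
    unfolding continuous_on_def by (meson UNIV_I tendsto_within_subset top_greatest)
  then have "\<forall>\<^sub>F y in at_right x. 0 < survival y" using assms by (rule order_tendstoD)
  moreover have "\<forall>\<^sub>F y in at_right x. x < y" by (rule eventually_at_right_less)
  ultimately have "\<forall>\<^sub>F y in at_right x. x < y \<and> 0 < survival y" by eventually_elim auto
  then have "\<exists>y. x < y \<and> 0 < survival y" by (intro eventually_happens'[of "at_right x"]) simp_all
  then show ?thesis by blast
qed

text \<open>Survival is continuous, so a point with positive survival has further such points to its
  right and cannot be the supremum. Hence survival vanishes at a finite horizon.\<close>

lemma horizon_upper: "0 < survival x \<Longrightarrow> ereal x < obs_horizon F G \<eta>"
proof -
  assume "0 < survival x"
  then obtain y where "x < y" "0 < survival y" using survival_pos_right by blast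
  then have "ereal y \<le> obs_horizon F G \<eta>" unfolding obs_horizon_def by (intro Sup_upper) blast
  then show ?thesis using \<open>x < y\<close> by (meson less_ereal.simps(1) less_le_trans)
qed

lemma horizon_pos: "0 < obs_horizon F G \<eta>"
proof -
  have "survival 0 = 1" unfolding survival_eq using cdf_facts by simp
  then show ?thesis using horizon_upper[of 0] by (simp add: zero_ereal_def)
qed

text \<open>At a finite horizon the mixed survival function vanishes, and since both weights are
  positive so does that of each group. So in each group the event time or the censoring time lies
  below the horizon almost surely, and the observation is the smaller of the two.\<close>

lemma AE_less_horizon:
  assumes n: "n \<ge> 1"
  shows "AE \<omega> in M n. ereal (max_obs_time n (T n) (C n) \<omega>) < obs_horizon F G \<eta>"
proof (cases "obs_horizon F G \<eta>")
  case (real r)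
  interpret prob_space "M n" by (rule prob[OF n])
  have "survival r \<le> 0" using horizon_upper[of r] real by (auto simp: not_less[symmetric])
  moreover have "0 \<le> (1 - F 0 r) * (1 - G 0 r)" "0 \<le> (1 - F 1 r) * (1 - G 1 r)"
    using cdf_facts by (auto intro!: mult_nonneg_nonneg)
  ultimately have zero: "(1 - F 0 r) * (1 - G 0 r) = 0" "(1 - F 1 r) * (1 - G 1 r) = 0"
    using eta unfolding survival_eq
    by (smt (verit, best) mult_nonneg_nonneg mult_pos_pos)+
  have "AE \<omega> in M n. obs_time (T n) (C n) i \<omega> < r" if i: "i \<in> {1..n}" for i
  proof -
    have j: "c n i \<in> {0, 1}" by (rule labels[OF i])
    have "F (c n i) r = 1 \<or> G (c n i) r = 1" using zero j by auto
    then have "(AE \<omega> in M n. T n i \<omega> < r) \<or> (AE \<omega> in M n. C n i \<omega> < r)"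
      using AE_less_of_cdf[OF T_meas[OF i] T_dist[OF i] cdf_facts(1)[OF j]] AE_less_of_cdf[OF C_meas[OF i] C_dist[OF i] cdf_facts(2)[OF j]] by blast
    then show ?thesis
    proof
      assume "AE \<omega> in M n. T n i \<omega> < r"
      then show ?thesis by eventually_elim (simp add: obs_time_def)
    next
      assume "AE \<omega> in M n. C n i \<omega> < r"
      then show ?thesis by eventually_elim (simp add: obs_time_def)
    qed
  qed
  then have "AE \<omega> in M n. \<forall>i\<in>{1..n}. obs_time (T n) (C n) i \<omega> < r" by (intro AE_finite_allI) auto
  then show ?thesis unfolding real by eventually_elim (simp add: max_obs_time_less_iff[OF n])
qed (use horizon_pos in auto)

lemma ex_horizon_sequence:
  "\<exists>t :: nat \<Rightarrow> real. incseq t \<and> (\<forall>k. 0 < t k \<and> ereal (t k) < obs_horizon F G \<eta>) \<and>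
    (\<forall>x. ereal x < obs_horizon F G \<eta> \<longrightarrow> (\<exists>k. x \<le> t k))"
proof (cases "obs_horizon F G \<eta>")
  case (real r)
  then have r: "0 < r" using horizon_pos by simp
  \<comment> \<open>The divisor is at least 2, which keeps all \<open>t k\<close> positive.\<close>
  define t where "t k = r - r / real (Suc (Suc k))" for k
  have "t m \<le> t k" if "m \<le> k" for m k
    unfolding t_def using that r by (intro diff_left_mono divide_left_mono) auto
  moreover have "0 < r / real (Suc (Suc k))" "r / real (Suc (Suc k)) < r" for k
    using r by (auto simp: divide_less_eq)
  then have "0 < t k \<and> t k < r" for k unfolding t_def by (metis diff_gt_0_iff_gt less_add_same_cancel1 diff_less_eq)
  moreover have "\<exists>k. x \<le> t k" if "x < r" for x
  proof -
    have "t \<longlonglongrightarrow> r - 0" unfolding t_def by (intro tendsto_intros LIMSEQ_Suc lim_const_over_n)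
    then have "\<forall>\<^sub>F k in sequentially. x < t k" using that by (intro order_tendstoD(1)) auto
    then show ?thesis by (auto simp: eventually_sequentially intro: less_imp_le)
  qed
  ultimately show ?thesis unfolding real by (intro exI[of _ t]) (auto simp: incseq_def)
next
  case PInf
  have "\<exists>k. x \<le> real (Suc k)" for x
  proof -
    obtain k where "x \<le> real k" using real_arch_simple[of x] by blast
    then show ?thesis by (intro exI[of _ k]) simp
  qed
  then show ?thesis
    unfolding PInf by (intro exI[of _ "\<lambda>k. real (Suc k)"]) (auto simp: incseq_def)
qed (use horizon_pos in auto)

end

section \<open>The tail bound for a fixed sample size\<close>

lemma (in filtered_space) inc_process_of_predictable:
  assumes "predictable F A" "\<And>\<omega>. \<omega> \<in> space M \<Longrightarrow> increasing_path (\<lambda>t. A t \<omega>)"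
  shows "inc_process A"
proof -
  have "A u \<in> borel_measurable (F u)" if "0 \<le> u" for u
    using predictable_section[OF assms(1)[unfolded predictable_def] that] by simp
  moreover have "inc_path (\<lambda>t. A t \<omega>)" if "\<omega> \<in> space M" for \<omega>
    using assms(2)[OF that] by (intro inc_path.intro) (simp_all add: increasing_path_def)
  ultimately show ?thesis by (simp add: inc_process_def adapted_def)
qed

lemma (in filtered_space) pos_def_diagonal_nonneg:
  assumes "predictable_pos_def F h" "\<omega> \<in> space M" "0 \<le> y"
  shows "0 \<le> h y y \<omega>"
  using pos_def_kernelD(2)[OF assms(1,2), of 1 "\<lambda>_. y" "\<lambda>_. 1"] assms(3) by simp

text \<open>The diagonal of a positive-definite kernel is nonnegative, so the real integral is the
  real value of the integral in [0,\<infinity>]; an infinite integral gives 0 on both sides.\<close>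

lemma (in filtered_space) ls_integral_diagonal_eq:
  assumes A: "inc_process A" and A0: "\<And>\<omega>. \<omega> \<in> space M \<Longrightarrow> A 0 \<omega> = 0"
    and h: "predictable_pos_def F h" and \<omega>: "\<omega> \<in> space M"
  shows "ls_integral (\<lambda>s. A s \<omega>) b (\<lambda>x. h x x \<omega>) = enn2real (path_integral A b (\<lambda>(y, \<omega>). ennreal (h y y \<omega>)) \<omega>)"
proof -
  interpret A: inc_path "\<lambda>s. A s \<omega>" using A \<omega> by (simp add: inc_process_def)
  have eq: "indicator {0<..b} y *\<^sub>R h y y \<omega> = indicator {0<..b} y * (if 0 < y then h y y \<omega> else 0)" for y
    by (simp split: split_indicator)
  have m: "(\<lambda>y. if 0 < y then h y y \<omega> else 0) \<in> borel_measurable borel"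
    using predictable_path_section[OF pos_def_kernelD(4)[OF h] \<omega>] by (simp cong: if_cong)
  have "(\<lambda>y. indicator {0<..b} y *\<^sub>R h y y \<omega>) \<in> borel_measurable (path_measure (\<lambda>s. A s \<omega>))"
    unfolding eq measurable_cong_sets[OF A.sets_path_measure refl]
    by (rule borel_measurable_times[OF borel_measurable_indicator m]) simp
  then have "(LINT y|path_measure (\<lambda>s. A s \<omega>). indicator {0<..b} y *\<^sub>R h y y \<omega>) =
      enn2real (\<integral>\<^sup>+y. ennreal (indicator {0<..b} y *\<^sub>R h y y \<omega>) \<partial>path_measure (\<lambda>s. A s \<omega>))"
    using pos_def_diagonal_nonneg[OF h \<omega>] by (intro integral_eq_nn_integral) (auto intro!: AE_I2 split: split_indicator)
  also have "(\<integral>\<^sup>+y. ennreal (indicator {0<..b} y *\<^sub>R h y y \<omega>) \<partial>path_measure (\<lambda>s. A s \<omega>)) = path_integral A b (\<lambda>(y, \<omega>). ennreal (h y y \<omega>)) \<omega>"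
    unfolding path_integral_def by (intro nn_integral_cong) (simp split: split_indicator)
  finally show ?thesis using A.ls_integral_eq[OF A0[OF \<omega>]] by (simp add: set_lebesgue_integral_def)
qed

context censored_two_sample begin

text \<open>The sample size stays fixed while \<open>t k\<close> increases to the horizon. As the
  largest observation lies below the horizon almost surely, the probability that it exceeds
  \<open>t k\<close> disappears in the limit. The expectations up to \<open>t k\<close> may grow
  without bound on the way, as they do not enter the estimate quantitatively.\<close>

lemma tail_bound:
  fixes W A :: "real \<Rightarrow> 'a \<Rightarrow> real" and h :: "real \<Rightarrow> real \<Rightarrow> 'a \<Rightarrow> real"
  defines "\<tau> n \<equiv> max_obs_time n (T n) (C n)"
  defines "Y n \<equiv> \<lambda>\<omega>. ls_integral (\<lambda>s. A s \<omega>) (\<tau> n \<omega>) (\<lambda>x. h x x \<omega>)"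
    and "Z n \<equiv> \<lambda>\<omega>. ls_integral (\<lambda>s. W s \<omega>) (\<tau> n \<omega>) (\<lambda>y. ls_integral (\<lambda>s. W s \<omega>) (\<tau> n \<omega>) (\<lambda>x. h x y \<omega>))"
  assumes n: "n \<ge> 1"
    and h: "predictable_pos_def (Filt n) h" and W: "martingale (M n) (Filt n) W"
    and fvp: "\<And>\<omega>. \<omega> \<in> space (M n) \<Longrightarrow> fv_path (\<lambda>t. W t \<omega>)"
    and A: "predictable_variation (M n) (Filt n) W A"
    and fin: "\<And>t. 0 < t \<Longrightarrow> ereal t < obs_horizon F G \<eta> \<Longrightarrow> (\<integral>\<^sup>+\<omega>. filtered_space.double_variation W t h \<omega> \<partial>M n) < \<infinity>"
    and Y_meas: "Y n \<in> borel_measurable (M n)"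
  shows "Z n \<in> borel_measurable (M n)"
    and "0 < \<delta> \<Longrightarrow> 0 < \<epsilon> \<Longrightarrow> measure (M n) {\<omega> \<in> space (M n). \<bar>Z n \<omega>\<bar> > \<epsilon>} \<le> \<delta> / \<epsilon> + measure (M n) {\<omega> \<in> space (M n). \<bar>Y n \<omega>\<bar> > \<delta>}"
proof -
  interpret filtered_space "M n" "Filt n" by (rule filtered[OF n])
  have fvW: "fv_martingale W" unfolding fv_martingale_def using W fvp by blast
  note AD = A[unfolded predictable_variation_def]
  have A': "inc_process A" using AD by (intro inc_process_of_predictable) auto
  have \<tau> [measurable]: "\<tau> n \<in> borel_measurable (M n)" unfolding \<tau>_def by (rule max_obs_time_measurable[OF n])
  show "Z n \<in> borel_measurable (M n)"
    unfolding Z_def by (rule double_ls_integral_measurable[OF fvW h \<tau>])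
  assume \<delta>: "0 < \<delta>" and \<epsilon>: "0 < \<epsilon>"
  obtain t :: "nat \<Rightarrow> real" where t': "incseq t \<and> (\<forall>k. 0 < t k \<and> ereal (t k) < obs_horizon F G \<eta>) \<and>
      (\<forall>x. ereal x < obs_horizon F G \<eta> \<longrightarrow> (\<exists>k. x \<le> t k))"
    using ex_horizon_sequence by (rule exE)
  have t: "incseq t" "\<And>k. 0 < t k" "\<And>k. ereal (t k) < obs_horizon F G \<eta>"
    and t_ex: "\<And>x. ereal x < obs_horizon F G \<eta> \<Longrightarrow> \<exists>k. x \<le> t k"
    using conjunct1[OF t'] conjunct1[OF conjunct2[OF t']] conjunct2[OF conjunct2[OF t']] by simp_all
  let ?N = "\<lambda>k. {\<omega> \<in> space (M n). t k < \<tau> n \<omega>}"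
  have bound: "measure (M n) {\<omega> \<in> space (M n). \<bar>Z n \<omega>\<bar> > \<epsilon>} \<le>
      \<delta> / \<epsilon> + measure (M n) (?N k) + measure (M n) {\<omega> \<in> space (M n). \<bar>Y n \<omega>\<bar> > \<delta>}" for k
  proof -
    have fin_k: "(\<integral>\<^sup>+\<omega>. double_variation W (t k) h \<omega> \<partial>M n) < \<infinity>" by (rule fin[OF t(2) t(3)])
    note dom = domination_inequality[where W = W and A = A and h = h and \<tau> = "\<tau> n" and t = "t k" and Y = "Y n" and \<delta> = \<delta> and \<epsilon> = \<epsilon>]
    show ?thesis unfolding Z_def
    proof (rule dom)
    show "predictable (Filt n) A" "local_martingale (M n) (Filt n) (\<lambda>t \<omega>. (W t \<omega>)\<^sup>2 - A t \<omega>)"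
      using AD by auto
    show "{\<omega> \<in> space (M n). \<tau> n \<omega> \<le> q} \<in> sets (Filt n q)" if "0 \<le> q" for q
      unfolding \<tau>_def by (rule max_obs_time_stopping[OF n that])
    show "Y n \<omega> = enn2real (path_integral A (\<tau> n \<omega>) (\<lambda>(y, \<omega>). ennreal (h y y \<omega>)) \<omega>)" if "\<omega> \<in> space (M n)" for \<omega>
      unfolding Y_def using AD by (intro ls_integral_diagonal_eq A' h that) (auto simp: increasing_path_def)
    qed (fact fvW A' h \<tau> t(2) fin_k \<delta> \<epsilon> Y_meas)+
  qed
  have "(\<lambda>k. measure (M n) (?N k)) \<longlonglongrightarrow> measure (M n) (\<Inter>k. ?N k)"
  proof (rule finite_Lim_measure_decseq)
    show "range ?N \<subseteq> sets (M n)" by auto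
    show "decseq ?N" using t(1) by (auto simp: decseq_def incseq_def intro: le_less_trans)
  qed
  moreover have "measure (M n) (\<Inter>k. ?N k) = 0"
  proof -
    have "AE \<omega> in M n. \<omega> \<notin> (\<Inter>k. ?N k)"
      using AE_less_horizon[OF n] unfolding \<tau>_def[symmetric]
    proof eventually_elim
      fix \<omega> assume "ereal (\<tau> n \<omega>) < obs_horizon F G \<eta>"
      then obtain k where "\<tau> n \<omega> \<le> t k" using t_ex by blast
      then have "\<omega> \<notin> ?N k" by simp
      then show "\<omega> \<notin> (\<Inter>k. ?N k)" by blast
    qed
    then show ?thesis by (subst prob_eq_0) auto
  qed
  ultimately have "(\<lambda>k. \<delta> / \<epsilon> + measure (M n) (?N k) + measure (M n) {\<omega> \<in> space (M n). \<bar>Y n \<omega>\<bar> > \<delta>}) \<longlonglongrightarrow>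
    \<delta> / \<epsilon> + 0 + measure (M n) {\<omega> \<in> space (M n). \<bar>Y n \<omega>\<bar> > \<delta>}" by (intro tendsto_intros) simp
  then show "measure (M n) {\<omega> \<in> space (M n). \<bar>Z n \<omega>\<bar> > \<epsilon>} \<le> \<delta> / \<epsilon> + measure (M n) {\<omega> \<in> space (M n). \<bar>Y n \<omega>\<bar> > \<delta>}"
    using LIMSEQ_le_const[of _ "\<delta> / \<epsilon> + 0 + measure (M n) {\<omega> \<in> space (M n). \<bar>Y n \<omega>\<bar> > \<delta>}"] bound by auto
qed

end

section \<open>From tail bounds to stochastic order symbols\<close>

lemma small_op_one_of_tail_bound:
  assumes meas: "\<forall>\<^sub>F n in sequentially. Y n \<in> borel_measurable (M n) \<longrightarrow> Z n \<in> borel_measurable (M n)"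
    and bound: "\<forall>\<^sub>F n in sequentially. Y n \<in> borel_measurable (M n) \<longrightarrow> (\<forall>\<delta>>0. \<forall>\<epsilon>>0.
      measure (M n) {\<omega> \<in> space (M n). \<bar>Z n \<omega>\<bar> > \<epsilon>} \<le> \<delta> / \<epsilon> + measure (M n) {\<omega> \<in> space (M n). \<bar>Y n \<omega>\<bar> > \<delta>})"
    and Y: "small_op_one M Y"
  shows "small_op_one M Z"
proof -
  have Ym: "\<forall>\<^sub>F n in sequentially. Y n \<in> borel_measurable (M n)" using Y by (simp add: small_op_one_def)
  have "(\<lambda>n. measure (M n) {\<omega> \<in> space (M n). \<bar>Z n \<omega>\<bar> > \<epsilon>}) \<longlonglongrightarrow> 0" if \<epsilon>: "0 < \<epsilon>" for \<epsilon>
  proof (rule tendstoI)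
    fix r :: real assume r: "0 < r"
    \<comment> \<open>Chosen so that \<open>\<delta> / \<epsilon>\<close> is half of the tolerance
      \<open>r\<close>; the level \<open>\<epsilon>\<close> is given, so \<open>\<delta>\<close> has
      to be small.\<close>
    define \<delta> where "\<delta> = r * \<epsilon> / 2"
    have \<delta>: "0 < \<delta>" "\<delta> / \<epsilon> = r / 2" using r \<epsilon> by (simp_all add: \<delta>_def)
    have "(\<lambda>n. measure (M n) {\<omega> \<in> space (M n). \<bar>Y n \<omega>\<bar> > \<delta>}) \<longlonglongrightarrow> 0"
      using Y \<delta>(1) by (simp add: small_op_one_def)
    then have "\<forall>\<^sub>F n in sequentially. measure (M n) {\<omega> \<in> space (M n). \<bar>Y n \<omega>\<bar> > \<delta>} < r / 2"
      using r by (intro order_tendstoD) auto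
    then show "\<forall>\<^sub>F n in sequentially. dist (measure (M n) {\<omega> \<in> space (M n). \<bar>Z n \<omega>\<bar> > \<epsilon>}) 0 < r"
      using bound Ym
    proof eventually_elim
      case (elim n)
      then have "measure (M n) {\<omega> \<in> space (M n). \<bar>Z n \<omega>\<bar> > \<epsilon>} \<le> \<delta> / \<epsilon> + measure (M n) {\<omega> \<in> space (M n). \<bar>Y n \<omega>\<bar> > \<delta>}"
        using \<delta>(1) \<epsilon> by blast
      then show ?case using elim(1) \<delta>(2) by (simp add: dist_real_def)
    qed
  qed
  moreover have "\<forall>\<^sub>F n in sequentially. Z n \<in> borel_measurable (M n)" using meas Ym by eventually_elim simp
  ultimately show ?thesis by (simp add: small_op_one_def)
qed

lemma big_op_one_of_tail_bound:
  assumes meas: "\<forall>\<^sub>F n in sequentially. Y n \<in> borel_measurable (M n) \<longrightarrow> Z n \<in> borel_measurable (M n)"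
    and bound: "\<forall>\<^sub>F n in sequentially. Y n \<in> borel_measurable (M n) \<longrightarrow> (\<forall>\<delta>>0. \<forall>\<epsilon>>0.
      measure (M n) {\<omega> \<in> space (M n). \<bar>Z n \<omega>\<bar> > \<epsilon>} \<le> \<delta> / \<epsilon> + measure (M n) {\<omega> \<in> space (M n). \<bar>Y n \<omega>\<bar> > \<delta>})"
    and prob: "\<forall>\<^sub>F n in sequentially. prob_space (M n)"
    and Y: "big_op_one M Y"
  shows "big_op_one M Z"
proof -
  have Ym: "\<forall>\<^sub>F n in sequentially. Y n \<in> borel_measurable (M n)" using Y by (simp add: big_op_one_def)
  have "\<exists>K. \<forall>\<^sub>F n in sequentially. measure (M n) {\<omega> \<in> space (M n). \<bar>Z n \<omega>\<bar> > K} \<le> r" if r: "0 < r" for r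
  proof -
    have "\<exists>K. \<forall>\<^sub>F n in sequentially. measure (M n) {\<omega> \<in> space (M n). \<bar>Y n \<omega>\<bar> > K} \<le> r / 2"
      using Y r unfolding big_op_one_def by (meson half_gt_zero)
    then obtain K where K: "\<forall>\<^sub>F n in sequentially. measure (M n) {\<omega> \<in> space (M n). \<bar>Y n \<omega>\<bar> > K} \<le> r / 2" by blast
    \<comment> \<open>The roles are reversed: \<open>\<delta>\<close> is fixed by the tightness of
      \<open>Y\<close>, made positive by \<open>max K 1\<close>, and \<open>\<epsilon>\<close> is
      taken so large that \<open>\<delta> / \<epsilon>\<close> is half of \<open>r\<close>.\<close>
    define \<delta> where "\<delta> = max K 1"
    define \<epsilon> where "\<epsilon> = 2 * \<delta> / r"
    have \<delta>: "0 < \<delta>" "K \<le> \<delta>" by (auto simp: \<delta>_def)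
    have \<epsilon>: "0 < \<epsilon>" "\<delta> / \<epsilon> = r / 2" using r \<delta>(1) by (simp_all add: \<epsilon>_def)
    have "\<forall>\<^sub>F n in sequentially. measure (M n) {\<omega> \<in> space (M n). \<bar>Z n \<omega>\<bar> > \<epsilon>} \<le> r"
      using K bound Ym prob
    proof eventually_elim
      case (elim n)
      interpret prob_space "M n" by fact
      note [measurable] = elim(3)
      have "measure (M n) {\<omega> \<in> space (M n). \<bar>Y n \<omega>\<bar> > \<delta>} \<le> measure (M n) {\<omega> \<in> space (M n). \<bar>Y n \<omega>\<bar> > K}"
        using \<delta>(2) by (intro finite_measure_mono) auto
      moreover have "measure (M n) {\<omega> \<in> space (M n). \<bar>Z n \<omega>\<bar> > \<epsilon>} \<le> \<delta> / \<epsilon> + measure (M n) {\<omega> \<in> space (M n). \<bar>Y n \<omega>\<bar> > \<delta>}"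
        using elim(2,3) \<delta>(1) \<epsilon>(1) by blast
      ultimately show ?case using elim(1) \<epsilon>(2) by simp
    qed
    then show ?thesis by blast
  qed
  moreover have "\<forall>\<^sub>F n in sequentially. Z n \<in> borel_measurable (M n)" using meas Ym by eventually_elim simp
  ultimately show ?thesis by (simp add: big_op_one_def)
qed

theorem theorem17:
  fixes M :: "nat \<Rightarrow> 'a measure"
    and T C :: "nat \<Rightarrow> nat \<Rightarrow> 'a \<Rightarrow> real"
    and c :: "nat \<Rightarrow> nat \<Rightarrow> nat"
    and F G :: "nat \<Rightarrow> real \<Rightarrow> real"
    and \<eta> :: real
    and h :: "nat \<Rightarrow> real \<Rightarrow> real \<Rightarrow> 'a \<Rightarrow> real"
    and W pvar qvar :: "nat \<Rightarrow> real \<Rightarrow> 'a \<Rightarrow> real"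
  assumes data: "censored_two_sample M T C c F G \<eta>"
    and h: "\<And>n. n \<ge> 1 \<Longrightarrow> predictable_pos_def (obs_filtration (M n) n (T n) (C n)) (h n)"
    and W_martingale: "\<And>n. n \<ge> 1 \<Longrightarrow> martingale (M n) (obs_filtration (M n) n (T n) (C n)) (W n)"
    and W_right_continuous: "\<And>n \<omega>. n \<ge> 1 \<Longrightarrow> \<omega> \<in> space (M n) \<Longrightarrow>
          right_continuous_path (\<lambda>t. W n t \<omega>)"
    and W_finite_variation: "\<And>n \<omega>. n \<ge> 1 \<Longrightarrow> \<omega> \<in> space (M n) \<Longrightarrow>
          locally_finite_variation (\<lambda>t. W n t \<omega>)"
    and pvar: "\<And>n. n \<ge> 1 \<Longrightarrow>
          predictable_variation (M n) (obs_filtration (M n) n (T n) (C n)) (W n) (pvar n)"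
    and qvar: "\<And>n. n \<ge> 1 \<Longrightarrow>
          quadratic_variation (M n) (obs_filtration (M n) n (T n) (C n)) (W n) (qvar n)"
    and finite_expectation: "\<forall>\<^sub>F n in sequentially. \<forall>t. 0 < t \<and> ereal t < obs_horizon F G \<eta> \<longrightarrow>
          (\<integral>\<^sup>+\<omega>. (\<integral>\<^sup>+y\<in>{0<..t}. (\<integral>\<^sup>+x\<in>{0<..t}. ennreal \<bar>h n x y \<omega>\<bar>
              \<partial>variation_measure (\<lambda>s. W n s \<omega>)) \<partial>variation_measure (\<lambda>s. W n s \<omega>)) \<partial>M n) < \<infinity>"
  shows "(small_op_one M (\<lambda>n \<omega>.
            ls_integral (\<lambda>s. pvar n s \<omega>) (max_obs_time n (T n) (C n) \<omega>) (\<lambda>x. h n x x \<omega>)) \<longrightarrow>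
          small_op_one M (\<lambda>n \<omega>.
            ls_integral (\<lambda>s. W n s \<omega>) (max_obs_time n (T n) (C n) \<omega>) (\<lambda>y.
              ls_integral (\<lambda>s. W n s \<omega>) (max_obs_time n (T n) (C n) \<omega>) (\<lambda>x. h n x y \<omega>)))) \<and>
         (big_op_one M (\<lambda>n \<omega>.
            ls_integral (\<lambda>s. pvar n s \<omega>) (max_obs_time n (T n) (C n) \<omega>) (\<lambda>x. h n x x \<omega>)) \<longrightarrow>
          big_op_one M (\<lambda>n \<omega>.
            ls_integral (\<lambda>s. W n s \<omega>) (max_obs_time n (T n) (C n) \<omega>) (\<lambda>y.
              ls_integral (\<lambda>s. W n s \<omega>) (max_obs_time n (T n) (C n) \<omega>) (\<lambda>x. h n x y \<omega>))))"
proof -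
  interpret censored_two_sample M T C c F G \<eta> by (rule data)
  define Y where "Y n \<omega> = ls_integral (\<lambda>s. pvar n s \<omega>) (max_obs_time n (T n) (C n) \<omega>) (\<lambda>x. h n x x \<omega>)" for n \<omega>
  define Z where "Z n \<omega> = ls_integral (\<lambda>s. W n s \<omega>) (max_obs_time n (T n) (C n) \<omega>) (\<lambda>y.
      ls_integral (\<lambda>s. W n s \<omega>) (max_obs_time n (T n) (C n) \<omega>) (\<lambda>x. h n x y \<omega>))" for n \<omega>
  have ev: "\<forall>\<^sub>F n in sequentially. Y n \<in> borel_measurable (M n) \<longrightarrow> Z n \<in> borel_measurable (M n) \<and> (\<forall>\<delta>>0. \<forall>\<epsilon>>0.
      measure (M n) {\<omega> \<in> space (M n). \<bar>Z n \<omega>\<bar> > \<epsilon>} \<le> \<delta> / \<epsilon> + measure (M n) {\<omega> \<in> space (M n). \<bar>Y n \<omega>\<bar> > \<delta>})"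
    using finite_expectation eventually_ge_at_top[of "1::nat"]
  proof eventually_elim
    case (elim n)
    note n = elim(2)
    have path: "fv_path (\<lambda>t. W n t \<omega>)" if "\<omega> \<in> space (M n)" for \<omega>
      by (rule fv_path.intro[OF W_finite_variation[OF n that] W_right_continuous[OF n that]])
    have fin: "(\<integral>\<^sup>+\<omega>. filtered_space.double_variation (W n) t (h n) \<omega> \<partial>M n) < \<infinity>" if "0 < t" "ereal t < obs_horizon F G \<eta>" for t
      unfolding filtered_space.double_variation_def[OF filtered[OF n]] using elim(1) that by blast
    show ?case
      using tail_bound[OF n h[OF n] W_martingale[OF n] path pvar[OF n] fin] unfolding Y_def[abs_def] Z_def[abs_def] by blast
  qed
  have meas: "\<forall>\<^sub>F n in sequentially. Y n \<in> borel_measurable (M n) \<longrightarrow> Z n \<in> borel_measurable (M n)"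
    using ev by (rule eventually_mono) blast
  have bound: "\<forall>\<^sub>F n in sequentially. Y n \<in> borel_measurable (M n) \<longrightarrow> (\<forall>\<delta>>0. \<forall>\<epsilon>>0.
      measure (M n) {\<omega> \<in> space (M n). \<bar>Z n \<omega>\<bar> > \<epsilon>} \<le> \<delta> / \<epsilon> + measure (M n) {\<omega> \<in> space (M n). \<bar>Y n \<omega>\<bar> > \<delta>})"
    using ev by (rule eventually_mono) blast
  have "\<forall>\<^sub>F n in sequentially. prob_space (M n)"
    using eventually_ge_at_top[of "1::nat"] prob by (rule eventually_mono)
  then show ?thesis
    unfolding Y_def[abs_def, symmetric] Z_def[abs_def, symmetric]
    using small_op_one_of_tail_bound[OF meas bound] big_op_one_of_tail_bound[OF meas bound] by blast
qed

end
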